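(* Fix $T>0$. Assume that each flux function $f^k:\mathbb{R}\to\mathbb{R}$, $k\in\mathcal{I}$, is locally Lipschitz continuous and strictly monotone. Let $\mathcal{G}^0_{\mathrm{disc}}\subset\mathbb{R}^{N+1}$ be a set of discrete stationary solutions for the upwind method. Let $\mathbf{u}_{\Delta t}$ be computed by the upwind method with initial data $\bar{\mathbf{u}}\in L^\infty_{\mathrm{oco}}(\mathcal{G}^0_{\mathrm{disc}})\cap L^1(\Omega;\lambda)$, and assume that $\mathrm{TV}(\bar{\mathbf{u}})<\infty$. Then, as $\Delta t\to0$, the numerical solution $\{\mathbf{u}_{\Delta t}\}_{\Delta t>0}$ converges in $C([0,T],L^1_{\mathrm{loc}}(\Omega;\lambda))$ to a weak solution $\mathbf{u}$ of $u^k_t+f^k(u^k)_x=0$ ($x\in D^k$, $k\in\mathcal{I}$) with initial data $\bar{\mathbf{u}}$.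
   Context: **Network.** Fix integers $N_{\mathrm{in}},N_{\mathrm{out}}\geq1$, $N=N_{\mathrm{in}}+N_{\mathrm{out}}$, $\mathcal{I}_{\mathrm{in}}=\{-N_{\mathrm{in}},\dots,-1\}$, $\mathcal{I}_{\mathrm{out}}=\{1,\dots,N_{\mathrm{out}}\}$, $\mathcal{I}=\mathcal{I}_{\mathrm{in}}\cup\mathcal{I}_{\mathrm{out}}$. $D^k=(-\infty,0)$ for $k\in\mathcal{I}_{\mathrm{in}}$, $D^k=(0,\infty)$ for $k\in\mathcal{I}_{\mathrm{out}}$. $\Omega=\bigcup_{k\in\mathcal{I}}D^k\times\{k\}$, $\lambda=$ (Lebesgue)$\times$(counting measure), so $\int_\Omega\mathbf{u}\,d\lambda=\sum_k\int_{D^k}u^k\,dx$ for $\mathbf{u}=(u^k)_{k\in\mathcal{I}}$. $\mathrm{TV}(\mathbf{u})=\sum_{k\in\mathcal{I}}\mathrm{TV}(u^k;D^k)$, the sum of the total variations on the edges. **Weak solution (on $[0,T)$).** $\mathbf{u}\in L^\infty$ with $$\sum_{k\in\mathcal{I}}\int_0^T\!\!\int_{D^k}u^k\varphi^k_t+f^k(u^k)\varphi^k_x\,dx\,dt+\sum_{k\in\mathcal{I}}\int_{D^k}\bar u^k(x)\varphi^k(x,0)\,dx=0$$ for all $\varphi^k\in C_c^\infty(\overline{D^k}\times[0,T))$ with $\varphi^k(0,t)=\varphi^1(0,t)$ for all $k\in\mathcal{I}$. **Convergence in $C([0,T],L^1_{\mathrm{loc}})$.** Since $\mathbf{u}_{\Delta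 t}$ is piecewise constant in time, this means: $\mathbf{u}\in C([0,T];L^1_{\mathrm{loc}}(\Omega;\lambda))$ and $\sup_{t\in[0,T]}\sum_k\int_{D^k\cap[-R,R]}|u^k_{\Delta t}(x,t)-u^k(x,t)|\,dx\to0$ for every $R>0$. **Finite volume method.** Let $\Delta t,\Delta x>0$, $t^n=n\Delta t$, $x_{i+1/2}=(i+\tfrac12)\Delta x$, cells $\mathcal{C}^k_i=D^k\cap(x_{i-1/2},x_{i+1/2})$, $\Delta x_0=N\Delta x/2$, $D^k_{\mathrm{disc}}=\{1,2,\dots\}$ for $k\in\mathcal{I}_{\mathrm{out}}$, $D^k_{\mathrm{disc}}=\{-1,-2,\dots\}$ for $k\in\mathcal{I}_{\mathrm{in}}$. Given numerical fluxes $F^k(u,v)$, the method is $$u_i^{k,n+1}=u_i^{k,n}-\tfrac{\Delta t}{\Delta x}\big(F^k(u_i^{k,n},u_{i+1}^{k,n})-F^k(u_{i-1}^{k,n},u_i^{k,n})\big)\quad(i\in D^k_{\mathrm{disc}},\ k\in\mathcal{I}),$$ $$u_0^{n+1}=u_0^n-\tfrac{\Delta t}{\Delta x_0}\Big(\sum_{k\in\mathcal{I}_{\mathrm{out}}}F^k(u_0^n,u_1^{k,n})-\sum_{k\in\mathcal{I}_{\mathrm{in}}}F^k(u_{-1}^{k,n},u_0^n)\Big),$$ with the convention $u_0^{k,n}=u_0^n$ for all $k$. Set $\mathbf{u}_{\Delta t}(x,k,t)=u_i^{k,n}$ for $x\in\mathcal{C}_i^k$, $t\in[t^n,t^{n+1})$.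 The **upwind method** uses $F^k(u,v)=f^k(u)$ if $f^k$ is increasing and $F^k(u,v)=f^k(v)$ if $f^k$ is decreasing. **Discrete stationary solution.** A vector $\mathbf{c}=(c^{-N_{\mathrm{in}}},\dots,c^{-1},c^0,c^1,\dots,c^{N_{\mathrm{out}}})\in\mathbb{R}^{N+1}$ with $\sum_{k\in\mathcal{I}_{\mathrm{in}}}f^k(c^k)=\sum_{k\in\mathcal{I}_{\mathrm{out}}}f^k(c^k)$, $F^k(c^k,c^0)=f^k(c^k)$ for $k\in\mathcal{I}_{\mathrm{in}}$ and $F^k(c^0,c^k)=f^k(c^k)$ for $k\in\mathcal{I}_{\mathrm{out}}$. **Initial data class.** $L^\infty_{\mathrm{oco}}(\mathcal{G}^0_{\mathrm{disc}})$ is the set of $\mathbf{u}\in L^\infty(\Omega;\lambda)$ for which there are $\mathbf{c},\mathbf{d}\in\mathcal{G}^0_{\mathrm{disc}}$ such that, for all $k,l\in\mathcal{I}$ (the vertex index $0$ is ignored): every $\alpha\in[c^k,d^k]$ is the $k$-th component of some element of $\mathcal{G}^0_{\mathrm{disc}}$; $c^k\leq u^k(x)\leq d^k$ for (a.e.) $x\in D^k$; and $c^k\leq d^l$. **Initialization.** Choose $\mathbf{c},\mathbf{d}$ for $\bar{\mathbf{u}}$ as in that definition, their vertex values being modified if necessary so that both remain discrete stationary solutions and $c^0\leq d^0$ (this is always possible). Set $u_i^{k,0}=\frac1{\Delta x}\int_{\mathcal{C}_i^k}\bar u^k\,dx$ for $i\in D^k_{\mathrm{disc}}$, $k\in\mathcal{I}$,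 and $u_0^0=c^0$. The choice of $\mathbf c,\mathbf d$ does not depend on $\Delta t,\Delta x$. **Standing assumption (CFL).** $\Delta t$ and $\Delta x$ are linked by a fixed ratio $\Delta t/\Delta x$ satisfying $\Delta t\max_{k,u,v}|\partial F^k/\partial u|\leq\Delta x/2$ and $\Delta t\max_{k,u,v}|\partial F^k/\partial v|\leq\Delta x/2$ (for Lipschitz $F^k$ read as bounds on Lipschitz constants over the relevant range of values), which makes the method monotone. *)

theory Defs
  imports "HOL-Analysis.Analysis"
begin

section \<open>The network\<close>

definition I_in :: "nat \<Rightarrow> int set" where
  "I_in Nin = {- int Nin .. -1}"

definition I_out :: "nat \<Rightarrow> int set" where
  "I_out Nout = {1 .. int Nout}"

definition edges :: "nat \<Rightarrow> nat \<Rightarrow> int set" where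
  "edges Nin Nout = I_in Nin \<union> I_out Nout"

definition edge :: "int \<Rightarrow> real set" where
  "edge k = (if k < 0 then {..<0} else {0<..})"

definition edge_disc :: "int \<Rightarrow> int set" where
  "edge_disc k = (if k < 0 then {..-1} else {1..})"

section \<open>Function spaces on the network\<close>

text \<open>A function on the disjoint union of the edges is a family \<open>u k x\<close>, a function on
  network times time is a family \<open>u k (x, t)\<close>.  Only indices in \<open>edges Nin Nout\<close> and points
  \<open>x\<close> in \<open>edge k\<close> matter.  Measurability and integrals with respect to Lebesgue measure times
  counting measure are spelled out edge by edge.\<close>

definition Linf_network :: "nat \<Rightarrow> nat \<Rightarrow> (int \<Rightarrow> real \<Rightarrow> real) \<Rightarrow> bool" where
  "Linf_network Nin Nout u \<longleftrightarrow>
     (\<forall>k\<in>edges Nin Nout. u k \<in> borel_measurable (lebesgue_on (edge k)) \<and>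
        (\<exists>M. AE x in lebesgue_on (edge k). \<bar>u k x\<bar> \<le> M))"

definition L1_network :: "nat \<Rightarrow> nat \<Rightarrow> (int \<Rightarrow> real \<Rightarrow> real) \<Rightarrow> bool" where
  "L1_network Nin Nout u \<longleftrightarrow> (\<forall>k\<in>edges Nin Nout. integrable (lebesgue_on (edge k)) (u k))"

definition Linf_spacetime :: "nat \<Rightarrow> nat \<Rightarrow> real \<Rightarrow> (int \<Rightarrow> real \<times> real \<Rightarrow> real) \<Rightarrow> bool" where
  "Linf_spacetime Nin Nout T u \<longleftrightarrow>
     (\<forall>k\<in>edges Nin Nout. u k \<in> borel_measurable (lebesgue_on (edge k \<times> {0<..<T})) \<and>
        (\<exists>M. AE p in lebesgue_on (edge k \<times> {0<..<T}). \<bar>u k p\<bar> \<le> M))"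

definition pointwise_variation :: "real set \<Rightarrow> (real \<Rightarrow> real) \<Rightarrow> ennreal" where
  "pointwise_variation A v =
     (SUP (n, p) \<in> {(n :: nat, p :: nat \<Rightarrow> real). mono p \<and> range p \<subseteq> A}.
        \<Sum>i<n. ennreal \<bar>v (p (Suc i)) - v (p i)\<bar>)"

text \<open>Elements of \<open>L\<^sup>\<infinity>\<close> are classes of almost everywhere equal functions, so their total variation
  is the infimum of the pointwise variation over all representatives.\<close>

definition total_variation :: "real set \<Rightarrow> (real \<Rightarrow> real) \<Rightarrow> ennreal" where
  "total_variation A v =
     (INF w \<in> {w. AE x in lebesgue_on A. w x = v x}. pointwise_variation A w)"

definition TV_network :: "nat \<Rightarrow> nat \<Rightarrow> (int \<Rightarrow> real \<Rightarrow> real) \<Rightarrow> ennreal" where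
  "TV_network Nin Nout u = (\<Sum>k\<in>edges Nin Nout. total_variation (edge k) (u k))"

text \<open>Membership in \<open>C([0,T]; L\<^sup>1\<^sub>l\<^sub>o\<^sub>c)\<close>; here \<open>u k (\<cdot>, t)\<close> is relevant for every \<open>t\<close>
  in \<open>[0,T]\<close>, not just for almost every \<open>t\<close>.\<close>

definition C_L1loc :: "nat \<Rightarrow> nat \<Rightarrow> real \<Rightarrow> (int \<Rightarrow> real \<times> real \<Rightarrow> real) \<Rightarrow> bool" where
  "C_L1loc Nin Nout T u \<longleftrightarrow>
     (\<forall>k\<in>edges Nin Nout. \<forall>R>0.
        (\<forall>t\<in>{0..T}. integrable (lebesgue_on (edge k \<inter> {-R..R})) (\<lambda>x. u k (x, t))) \<and>
        (\<forall>s\<in>{0..T}.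
           ((\<lambda>t. LINT x|lebesgue_on (edge k \<inter> {-R..R}). \<bar>u k (x, t) - u k (x, s)\<bar>) \<longlongrightarrow> 0)
             (at s within {0..T})))"

definition converges_C_L1loc ::
  "nat \<Rightarrow> nat \<Rightarrow> real \<Rightarrow> (real \<Rightarrow> int \<Rightarrow> real \<times> real \<Rightarrow> real) \<Rightarrow> (int \<Rightarrow> real \<times> real \<Rightarrow> real) \<Rightarrow> bool" where
  "converges_C_L1loc Nin Nout T U u \<longleftrightarrow>
     C_L1loc Nin Nout T u \<and>
     (\<forall>R>0. uniform_limit {0..T}
        (\<lambda>dt t. \<Sum>k\<in>edges Nin Nout.
           LINT x|lebesgue_on (edge k \<inter> {-R..R}). \<bar>U dt k (x, t) - u k (x, t)\<bar>)
        (\<lambda>t. 0) (at_right 0))"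

section \<open>Weak solutions\<close>

text \<open>\<open>C\<^sup>\<infinity>\<close> functions on a set \<open>S\<close> of the plane (used for convex \<open>S\<close> with nonempty interior, on which
  derivatives within \<open>S\<close> are unique): \<open>D i j\<close> is the partial derivative of order \<open>i\<close> in the first
  and \<open>j\<close> in the second variable, one-sided at boundary points.\<close>

definition smooth_within :: "(real \<times> real) set \<Rightarrow> (real \<times> real \<Rightarrow> real) \<Rightarrow> bool" where
  "smooth_within S \<phi> \<longleftrightarrow>
     (\<exists>D :: nat \<Rightarrow> nat \<Rightarrow> real \<times> real \<Rightarrow> real. (\<forall>p\<in>S. D 0 0 p = \<phi> p) \<and>
        (\<forall>i j. \<forall>p\<in>S.
           (D i j has_derivative (\<lambda>h. fst h * D (Suc i) j p + snd h * D i (Suc j) p))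
             (at p within S)))"

definition test_function_on :: "(real \<times> real) set \<Rightarrow> (real \<times> real \<Rightarrow> real) \<Rightarrow> bool" where
  "test_function_on S \<phi> \<longleftrightarrow>
     smooth_within S \<phi> \<and> (\<exists>K. compact K \<and> K \<subseteq> S \<and> (\<forall>p\<in>S - K. \<phi> p = 0))"

definition test_family :: "nat \<Rightarrow> nat \<Rightarrow> real \<Rightarrow> (int \<Rightarrow> real \<times> real \<Rightarrow> real) \<Rightarrow> bool" where
  "test_family Nin Nout T \<phi> \<longleftrightarrow>
     (\<forall>k\<in>edges Nin Nout. test_function_on (closure (edge k) \<times> {0..<T}) (\<phi> k) \<and>
        (\<forall>t\<in>{0..<T}. \<phi> k (0, t) = \<phi> 1 (0, t)))"

definition weak_solution ::
  "nat \<Rightarrow> nat \<Rightarrow> (int \<Rightarrow> real \<Rightarrow> real) \<Rightarrow> real \<Rightarrow> (int \<Rightarrow> real \<Rightarrow> real) \<Rightarrow> (int \<Rightarrow> real \<times> real \<Rightarrow> real) \<Rightarrow> bool" where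
  "weak_solution Nin Nout f T ubar u \<longleftrightarrow>
     Linf_spacetime Nin Nout T u \<and>
     (\<forall>\<phi>. test_family Nin Nout T \<phi> \<longrightarrow>
        (\<Sum>k\<in>edges Nin Nout. LINT t|lebesgue_on {0<..<T}. LINT x|lebesgue_on (edge k).
            u k (x, t) * deriv (\<lambda>s. \<phi> k (x, s)) t
            + f k (u k (x, t)) * deriv (\<lambda>y. \<phi> k (y, t)) x)
        + (\<Sum>k\<in>edges Nin Nout. LINT x|lebesgue_on (edge k). ubar k x * \<phi> k (x, 0)) = 0)"

section \<open>The finite volume method\<close>

definition upwind_flux :: "(int \<Rightarrow> real \<Rightarrow> real) \<Rightarrow> int \<Rightarrow> real \<Rightarrow> real \<Rightarrow> real" where
  "upwind_flux f k u v = (if mono (f k) then f k u else f k v)"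

text \<open>A vector indexed by \<open>- Nin, \<dots>, Nout\<close> is a function on \<open>int\<close>, index \<open>0\<close> being the vertex;
  values at other indices are irrelevant.\<close>

definition discrete_stationary ::
  "nat \<Rightarrow> nat \<Rightarrow> (int \<Rightarrow> real \<Rightarrow> real) \<Rightarrow> (int \<Rightarrow> real \<Rightarrow> real \<Rightarrow> real) \<Rightarrow> (int \<Rightarrow> real) \<Rightarrow> bool" where
  "discrete_stationary Nin Nout f F c \<longleftrightarrow>
     (\<Sum>k\<in>I_in Nin. f k (c k)) = (\<Sum>k\<in>I_out Nout. f k (c k)) \<and>
     (\<forall>k\<in>I_in Nin. F k (c k) (c 0) = f k (c k)) \<and>
     (\<forall>k\<in>I_out Nout. F k (c 0) (c k) = f k (c k))"

definition oco_bounds ::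
  "nat \<Rightarrow> nat \<Rightarrow> (int \<Rightarrow> real) set \<Rightarrow> (int \<Rightarrow> real \<Rightarrow> real) \<Rightarrow> (int \<Rightarrow> real) \<Rightarrow> (int \<Rightarrow> real) \<Rightarrow> bool" where
  "oco_bounds Nin Nout G u c d \<longleftrightarrow>
     c \<in> G \<and> d \<in> G \<and>
     (\<forall>k\<in>edges Nin Nout. \<forall>l\<in>edges Nin Nout.
        (\<forall>\<alpha>\<in>{c k..d k}. \<exists>e\<in>G. e k = \<alpha>) \<and>
        (AE x in lebesgue_on (edge k). c k \<le> u k x \<and> u k x \<le> d k) \<and>
        c k \<le> d l)"

definition Linf_oco :: "nat \<Rightarrow> nat \<Rightarrow> (int \<Rightarrow> real) set \<Rightarrow> (int \<Rightarrow> real \<Rightarrow> real) set" where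
  "Linf_oco Nin Nout G = {u. Linf_network Nin Nout u \<and> (\<exists>c d. oco_bounds Nin Nout G u c d)}"

text \<open>Admissible \<open>c, d\<close> for the initialization: bounds from \<open>G\<close> whose vertex values may have been
  modified (possibly leaving \<open>G\<close>) so that both are discrete stationary and \<open>c 0 \<le> d 0\<close>.\<close>

definition init_bounds ::
  "nat \<Rightarrow> nat \<Rightarrow> (int \<Rightarrow> real \<Rightarrow> real) \<Rightarrow> (int \<Rightarrow> real \<Rightarrow> real \<Rightarrow> real) \<Rightarrow> (int \<Rightarrow> real) set \<Rightarrow>
   (int \<Rightarrow> real \<Rightarrow> real) \<Rightarrow> (int \<Rightarrow> real) \<Rightarrow> (int \<Rightarrow> real) \<Rightarrow> bool" where
  "init_bounds Nin Nout f F G u c d \<longleftrightarrow>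
     (\<exists>c' d'. oco_bounds Nin Nout G u c' d' \<and>
        (\<forall>k\<in>edges Nin Nout. c k = c' k \<and> d k = d' k)) \<and>
     discrete_stationary Nin Nout f F c \<and> discrete_stationary Nin Nout f F d \<and> c 0 \<le> d 0"

definition cell :: "real \<Rightarrow> int \<Rightarrow> int \<Rightarrow> real set" where
  "cell dx k i = edge k \<inter> {(of_int i - 1/2) * dx <..< (of_int i + 1/2) * dx}"

text \<open>A grid function is \<open>v k i\<close> with \<open>i\<close> in \<open>edge_disc k\<close> or \<open>i = 0\<close>.  The vertex value is stored
  as \<open>v k 0\<close> for every edge \<open>k\<close>; it is independent of \<open>k\<close> initially, and \<open>fv_step\<close> preserves this.\<close>

definition fv_init :: "(int \<Rightarrow> real \<Rightarrow> real) \<Rightarrow> real \<Rightarrow> real \<Rightarrow> int \<Rightarrow> int \<Rightarrow> real" where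
  "fv_init ubar c0 dx k i =
     (if i \<in> edge_disc k then 1 / dx * (LINT x|lebesgue_on (cell dx k i). ubar k x)
      else if i = 0 then c0
      else 0)"

definition fv_step ::
  "nat \<Rightarrow> nat \<Rightarrow> (int \<Rightarrow> real \<Rightarrow> real \<Rightarrow> real) \<Rightarrow> real \<Rightarrow> real \<Rightarrow> (int \<Rightarrow> int \<Rightarrow> real) \<Rightarrow> int \<Rightarrow> int \<Rightarrow> real" where
  "fv_step Nin Nout F dt dx v k i =
     (if i \<in> edge_disc k then
        v k i - dt / dx * (F k (v k i) (v k (i + 1)) - F k (v k (i - 1)) (v k i))
      else if i = 0 then
        v k 0 - dt / (real (Nin + Nout) * dx / 2) *
          ((\<Sum>j\<in>I_out Nout. F j (v j 0) (v j 1)) - (\<Sum>j\<in>I_in Nin. F j (v j (-1)) (v j 0)))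
      else 0)"

definition fv_grid ::
  "nat \<Rightarrow> nat \<Rightarrow> (int \<Rightarrow> real \<Rightarrow> real \<Rightarrow> real) \<Rightarrow> (int \<Rightarrow> real \<Rightarrow> real) \<Rightarrow> real \<Rightarrow> real \<Rightarrow> real \<Rightarrow>
   nat \<Rightarrow> int \<Rightarrow> int \<Rightarrow> real" where
  "fv_grid Nin Nout F ubar c0 dt dx n = (fv_step Nin Nout F dt dx ^^ n) (fv_init ubar c0 dx)"

text \<open>\<open>x \<in> cell dx k i\<close> implies \<open>round (x / dx) = i\<close>; cell interfaces are a null set.\<close>

definition fv_solution ::
  "nat \<Rightarrow> nat \<Rightarrow> (int \<Rightarrow> real \<Rightarrow> real \<Rightarrow> real) \<Rightarrow> (int \<Rightarrow> real \<Rightarrow> real) \<Rightarrow> real \<Rightarrow> real \<Rightarrow> real \<Rightarrow>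
   int \<Rightarrow> real \<times> real \<Rightarrow> real" where
  "fv_solution Nin Nout F ubar c0 dt dx k =
     (\<lambda>(x, t). fv_grid Nin Nout F ubar c0 dt dx (nat \<lfloor>t / dt\<rfloor>) k (round (x / dx)))"

text \<open>CFL condition for the ratio \<open>\<mu> = dt / dx\<close>.  On edge \<open>k\<close> and at the vertex the method takes
  values in \<open>[c k, d k]\<close> and \<open>[c 0, d 0]\<close>, so \<open>F k\<close> is only considered on the interval they span.\<close>

definition CFL ::
  "nat \<Rightarrow> nat \<Rightarrow> (int \<Rightarrow> real \<Rightarrow> real \<Rightarrow> real) \<Rightarrow> (int \<Rightarrow> real) \<Rightarrow> (int \<Rightarrow> real) \<Rightarrow> real \<Rightarrow> bool" where
  "CFL Nin Nout F c d \<mu> \<longleftrightarrow>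
     (\<exists>L. \<mu> * L \<le> 1 / 2 \<and>
        (\<forall>k\<in>edges Nin Nout. let S = {min (c k) (c 0)..max (d k) (d 0)} in
           (\<forall>v\<in>S. L-lipschitz_on S (\<lambda>u. F k u v)) \<and> (\<forall>u\<in>S. L-lipschitz_on S (\<lambda>v. F k u v))))"

end

theory Submission
  imports Defs
begin

text \<open>The discrete potentials, whose space differences are the cell values and whose time differences
  are the numerical fluxes, solve monotone schemes for a Hamilton--Jacobi equation.  Doubling of
  variables shows that the potentials for two meshes are uniformly close on every edge along which
  information enters the vertex.  The fluxes have bounded variation, because under the CFL condition they
  are advected by convex combinations.  A difference with a small primitive tested against a function of
  bounded variation is small; by strict monotonicity of the fluxes, this turns uniform closeness of
  potentials into closeness in \<open>L\<^sup>1\<close>.  The balance at the vertex expresses the total outgoing flux through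
  the incoming potentials up to \<open>O(\<Delta>x)\<close>, so the same argument in time shows that the vertex fluxes are
  Cauchy, and doubling of variables with these boundary data handles the remaining edges.  Hence the
  approximations are Cauchy for all \<open>\<Delta>t \<rightarrow> 0\<close>, and neither compactness nor uniqueness of entropy
  solutions is needed.  The weak formulation follows by integrating by parts twice and inserting the
  discrete conservation law.\<close>

section \<open>Comparison of monotone schemes on different grids\<close>

text \<open>Strict monotonicity gives no lower bound on the slopes of the fluxes, so bounded
  variation of the fluxes says nothing about the variation of the cell values or of the vertex
  value. Closeness is therefore first proved for integrated quantities and only then carried over to
  values through products with the flux. The potentials are Lipschitz uniformly in the mesh width,
  so two grids can be compared at nearby points without interpolation. In the doubling the errors
  \<open>K\<^sup>2 * \<epsilon>\<close> and \<open>(h + h') / \<epsilon>\<close> balance at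
  \<open>\<epsilon> = sqrt (h + h')\<close>, the source of all square roots. The order of the edges
  is forced by the characteristics: an edge whose information runs into the vertex needs no boundary
  value there, so its potential is controlled before anything is known about the vertex. With all
  edges reflected to the positive half line and all fluxes counted away from the vertex, the fluxes
  at the vertex sum to zero up to the change of content of a cell of length
  \<open>N * h / 2\<close>; this change is of order \<open>h\<close> merely because the vertex value
  is bounded.\<close>

lemma upwind_step_mono:
  fixes \<phi> :: "real \<Rightarrow> real"
  assumes sig: "\<sigma> = 1 \<or> \<sigma> = -1"
    and mono: "\<And>a b. a \<le> b \<Longrightarrow> \<sigma> * \<phi> a \<le> \<sigma> * \<phi> b"
    and lip: "\<And>a b. \<bar>\<phi> a - \<phi> b\<bar> \<le> L * \<bar>a - b\<bar>"
    and "L \<ge> 0" "\<mu> > 0" "\<mu> * L \<le> 1" "h > 0"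
    and ab: "a \<le> a'" "b \<le> b'"
  shows "a - \<mu> * h * \<phi> (\<sigma> * (a - b) / h) \<le> a' - \<mu> * h * \<phi> (\<sigma> * (a' - b') / h)"
proof -
  define z where "z = \<sigma> * (a - b) / h"
  define z' where "z' = \<sigma> * (a' - b') / h"
  \<comment> \<open>Only an increase of \<open>\<phi>\<close> can break the claim. By the sign of
    \<open>\<sigma>\<close> it forces \<open>\<sigma> * (z' - z) \<ge> 0\<close>, and this quantity
    is at most \<open>(a' - a) / h\<close>, since a larger \<open>b\<close> only lowers it. The CFL
    number then absorbs the factor \<open>L\<close>.\<close>
  have key: "\<phi> z' - \<phi> z \<le> L * ((a' - a) / h)"
  proof (cases "\<phi> z' \<le> \<phi> z")
    case True
    have "0 \<le> L * ((a' - a) / h)" using assms by simp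
    with True show ?thesis by linarith
  next
    case False
    have "\<sigma> * (z' - z) \<ge> 0"
    proof (rule ccontr)
      assume "\<not> ?thesis"
      hence "\<sigma> * z' < \<sigma> * z" by (simp add: algebra_simps)
      with sig mono[of z' z] mono[of z z'] False show False by auto
    qed
    hence "\<bar>z' - z\<bar> = \<sigma> * (z' - z)" using sig by auto
    also have "\<dots> = ((a' - b') - (a - b)) / h"
      using sig by (auto simp: z_def z'_def diff_divide_distrib)
    also have "\<dots> \<le> (a' - a) / h"
      using ab assms(7) by (simp add: divide_right_mono)
    finally have "\<bar>z' - z\<bar> \<le> (a' - a) / h" .
    then have "L * \<bar>z' - z\<bar> \<le> L * ((a' - a) / h)" using assms(4) by (rule mult_left_mono)
    with lip[of z' z] show ?thesis by linarith
  qed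
  have "\<mu> * h * (\<phi> z' - \<phi> z) \<le> \<mu> * h * (L * ((a' - a) / h))"
    using key assms by (intro mult_left_mono) auto
  also have "\<dots> = (\<mu> * L) * (a' - a)" using \<open>h > 0\<close> by simp
  also have "\<dots> \<le> 1 * (a' - a)" using assms by (intro mult_right_mono) auto
  finally show ?thesis unfolding z_def[symmetric] z'_def[symmetric] by (simp add: algebra_simps)
qed

text \<open>Doubling of variables: at an interior maximum of \<open>U - V\<close> minus the quadratic penalty, the
  monotonicity of the two schemes allows the penalty to be inserted in their place.\<close>

lemma doubling_of_variables:
  fixes \<phi> :: "real \<Rightarrow> real" and \<sigma> L \<mu> T h h' K E \<epsilon> :: real
    and U V :: "nat \<Rightarrow> nat \<Rightarrow> real" and nb :: "nat \<Rightarrow> nat" and bd :: "nat \<Rightarrow> bool"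
  defines "x \<equiv> \<lambda>i. (real i + 1/2) * h" and "y \<equiv> \<lambda>i. (real i + 1/2) * h'"
    and "t \<equiv> \<lambda>n. real n * (\<mu> * h)" and "s \<equiv> \<lambda>n. real n * (\<mu> * h')"
  assumes sig: "\<sigma> = 1 \<or> \<sigma> = -1"
    and mono: "\<And>a b. a \<le> b \<Longrightarrow> \<sigma> * \<phi> a \<le> \<sigma> * \<phi> b"
    and lip: "\<And>a b. \<bar>\<phi> a - \<phi> b\<bar> \<le> L * \<bar>a - b\<bar>"
    and L: "L \<ge> 0" "\<mu> > 0" "\<mu> * L \<le> 1" and h: "h > 0" "h' > 0" and eps: "\<epsilon> > 0" and K: "K \<ge> 0"
    and nb: "\<And>j. \<not> bd j \<Longrightarrow> real (nb j) = real j - \<sigma>"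
    and U: "\<And>n j. \<not> bd j \<Longrightarrow> U (Suc n) j = U n j - \<mu> * h * \<phi> (\<sigma> * (U n j - U n (nb j)) / h)"
    and V: "\<And>n j. \<not> bd j \<Longrightarrow> V (Suc n) j = V n j - \<mu> * h' * \<phi> (\<sigma> * (V n j - V n (nb j)) / h')"
    and bnd: "\<And>n m i j. t n \<le> T \<Longrightarrow> s m \<le> T \<Longrightarrow> n = 0 \<or> m = 0 \<or> bd i \<or> bd j \<Longrightarrow>
      U n i - V m j \<le> E + K * \<bar>x i - y j\<bar> + K * \<bar>t n - s m\<bar>"
    and NT: "t n0 \<le> T" "s m0 \<le> T"
  shows "U n0 i0 - V m0 j0 \<le> E + ((x i0 - y j0)\<^sup>2 + (t n0 - s m0)\<^sup>2) / (2 * \<epsilon>) + K\<^sup>2 * \<epsilon>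
    + (\<mu> + L) * (h + h') / \<epsilon> * T"
proof -
  \<comment> \<open>Twice the error that the schemes make on the quadratic penalty. Subtracting
    \<open>S * t n\<close> thus leaves a strict gap at an interior maximum, and costs
    \<open>S * T\<close> in the end.\<close>
  define S where "S = (\<mu> + L) * (h + h') / \<epsilon>"
  have Spos: "S > 0" unfolding S_def using L h eps by (simp add: add_pos_nonneg)
  define p where "p = (\<lambda>n i m j. ((x i - y j)\<^sup>2 + (t n - s m)\<^sup>2) / (2 * \<epsilon>))"
  define \<Psi> where "\<Psi> = (\<lambda>((n, i), (m, j)). U n i - V m j - p n i m j - S * t n)"
  \<comment> \<open>A discrete cone of dependence: one step back in time moves at most one cell
    outwards, so \<open>i + n\<close> does not grow. The cone is finite, hence a maximum exists
    without any decay at infinity.\<close>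
  define A where "A = {(n, i). t n \<le> T \<and> i + n \<le> i0 + n0}"
  define B where "B = {(m, j). s m \<le> T \<and> j + m \<le> j0 + m0}"
  have "A \<subseteq> {..i0+n0} \<times> {..i0+n0}" "B \<subseteq> {..j0+m0} \<times> {..j0+m0}" by (auto simp: A_def B_def)
  hence fin: "finite (A \<times> B)" by (meson finite_SigmaI finite_atMost finite_subset)
  have mem0: "((n0, i0), (m0, j0)) \<in> A \<times> B" using NT by (auto simp: A_def B_def)
  have "Max (\<Psi> ` (A \<times> B)) \<in> \<Psi> ` (A \<times> B)" using fin mem0 by (intro Max_in) auto
  then obtain n i m j where mem: "((n, i), (m, j)) \<in> A \<times> B"
    and mx: "\<Psi> ((n, i), (m, j)) = Max (\<Psi> ` (A \<times> B))" by auto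
  have max: "\<Psi> q \<le> \<Psi> ((n, i), (m, j))" if "q \<in> A \<times> B" for q
    using that fin by (simp add: mx)
  have tnn: "0 \<le> t n" for n using L h by (simp add: t_def)
  \<comment> \<open>Completing the square. It is used once in space and once in time, which gives
    \<open>K\<^sup>2 * \<epsilon>\<close> in total.\<close>
  have pen: "K * \<bar>a\<bar> - a\<^sup>2 / (2 * \<epsilon>) \<le> K\<^sup>2 * \<epsilon> / 2" for a
  proof -
    have "0 \<le> (\<bar>a\<bar> - K * \<epsilon>)\<^sup>2 / (2 * \<epsilon>)" using eps by simp
    also have "\<dots> = a\<^sup>2 / (2 * \<epsilon>) - K * \<bar>a\<bar> + K\<^sup>2 * \<epsilon> / 2"
      using eps by (simp add: power2_diff field_simps power2_eq_square)
    finally show ?thesis by simp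
  qed
  have "n = 0 \<or> m = 0 \<or> bd i \<or> bd j"
  proof (rule ccontr)
    assume "\<not> ?thesis"
    then obtain n' m' where nm: "n = Suc n'" "m = Suc m'" and nbd: "\<not> bd i" "\<not> bd j"
      by (metis not0_implies_Suc)
    have nbi: "nb i \<le> Suc i" "nb j \<le> Suc j" using nb[OF nbd(1)] nb[OF nbd(2)] sig by auto
    have tm: "t n' \<le> t n" "s m' \<le> s m" using L h by (auto simp: nm t_def s_def algebra_simps)
    have A1: "(n', i) \<in> A" "(n', nb i) \<in> A" "(n, i) \<in> A"
      using mem tm nbi by (auto simp: A_def nm)
    have B1: "(m', j) \<in> B" "(m', nb j) \<in> B" "(m, j) \<in> B"
      using mem tm nbi by (auto simp: B_def nm)
    define X where "X = x i - y j"
    define Tt where "Tt = t n - s m"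
    have tn': "t n' = t n - \<mu> * h" "s m' = s m - \<mu> * h'" by (auto simp: nm t_def s_def algebra_simps)
    have xn: "x (nb i) = x i - \<sigma> * h" "y (nb j) = y j - \<sigma> * h'"
      unfolding x_def y_def nb[OF nbd(1)] nb[OF nbd(2)] by (auto simp: algebra_simps)
    have ss: "\<sigma> * \<sigma> = 1" using sig by auto
    \<comment> \<open>\<open>da\<close> and \<open>db\<close> are the changes of the penalty from
      the maximum point to the two points that feed the scheme. By monotonicity \<open>U\<close> may
      be replaced there by \<open>U n i\<close> plus these changes; then \<open>U\<close> cancels
      and an inequality for the penalty alone remains. \<open>ea\<close> and \<open>eb\<close> do
      the same for \<open>V\<close>.\<close>
    define da where "da = p n' i m j + S * t n' - (p n i m j + S * t n)"
    define db where "db = p n' (nb i) m j + S * t n' - (p n i m j + S * t n)"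
    have "U n' i \<le> U n i + da" "U n' (nb i) \<le> U n i + db"
      using max[of "((n', i), (m, j))"] max[of "((n', nb i), (m, j))"] A1 B1
      by (auto simp: \<Psi>_def da_def db_def)
    then have "U (Suc n') i \<le> U n i + da - \<mu> * h * \<phi> (\<sigma> * ((U n i + da) - (U n i + db)) / h)"
      unfolding U[OF nbd(1)] by (intro upwind_step_mono[where L = L] sig mono lip L h) auto
    then have 1: "0 \<le> da - \<mu> * h * \<phi> (\<sigma> * (da - db) / h)" by (simp add: nm)
    have e1: "\<sigma> * (da - db) / h = X / \<epsilon> - \<sigma> * h / (2 * \<epsilon>)"
    proof -
      have "da - db = (X\<^sup>2 - (X - \<sigma> * h)\<^sup>2) / (2 * \<epsilon>)"
        by (simp add: da_def db_def p_def xn X_def diff_divide_distrib[symmetric] algebra_simps)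
      also have "X\<^sup>2 - (X - \<sigma> * h)\<^sup>2 = 2 * \<sigma> * h * X - (\<sigma> * \<sigma>) * h * h"
        by (simp add: power2_eq_square algebra_simps)
      finally have e: "da - db = (2 * \<sigma> * h * X - h * h) / (2 * \<epsilon>)" unfolding ss by simp
      show ?thesis using h eps unfolding e by (simp add: field_simps ss)
    qed
    have e2: "da = \<mu> * h * (- Tt / \<epsilon> + \<mu> * h / (2 * \<epsilon>) - S)"
      using eps by (simp add: da_def p_def tn' Tt_def power2_eq_square field_simps)
    have 2: "0 \<le> - Tt / \<epsilon> + \<mu> * h / (2 * \<epsilon>) - S - \<phi> (X / \<epsilon> - \<sigma> * h / (2 * \<epsilon>))"
    proof -
      have "0 \<le> \<mu> * h * (- Tt / \<epsilon> + \<mu> * h / (2 * \<epsilon>) - S - \<phi> (X / \<epsilon> - \<sigma> * h / (2 * \<epsilon>)))"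
        using 1 unfolding e1 unfolding e2 by (simp add: algebra_simps)
      then show ?thesis using mult_pos_pos[OF L(2) h(1)] by (simp add: zero_le_mult_iff)
    qed
    define ea where "ea = p n i m j - p n i m' j"
    define eb where "eb = p n i m j - p n i m' (nb j)"
    have "V m j + ea \<le> V m' j" "V m j + eb \<le> V m' (nb j)"
      using max[of "((n, i), (m', j))"] max[of "((n, i), (m', nb j))"] A1 B1
      by (auto simp: \<Psi>_def ea_def eb_def)
    then have "V m j + ea - \<mu> * h' * \<phi> (\<sigma> * ((V m j + ea) - (V m j + eb)) / h') \<le> V (Suc m') j"
      unfolding V[OF nbd(2)] by (intro upwind_step_mono[where L = L] sig mono lip L h) auto
    then have 3: "ea - \<mu> * h' * \<phi> (\<sigma> * (ea - eb) / h') \<le> 0" by (simp add: nm)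
    have e3: "\<sigma> * (ea - eb) / h' = X / \<epsilon> + \<sigma> * h' / (2 * \<epsilon>)"
    proof -
      have "ea - eb = ((X + \<sigma> * h')\<^sup>2 - X\<^sup>2) / (2 * \<epsilon>)"
        by (simp add: ea_def eb_def p_def xn X_def diff_divide_distrib[symmetric] algebra_simps)
      also have "(X + \<sigma> * h')\<^sup>2 - X\<^sup>2 = 2 * \<sigma> * h' * X + (\<sigma> * \<sigma>) * h' * h'"
        by (simp add: power2_eq_square algebra_simps)
      finally have e: "ea - eb = (2 * \<sigma> * h' * X + h' * h') / (2 * \<epsilon>)" unfolding ss by simp
      show ?thesis using h eps unfolding e by (simp add: field_simps ss)
    qed
    have e4: "ea = \<mu> * h' * (- Tt / \<epsilon> - \<mu> * h' / (2 * \<epsilon>))"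
      using eps by (simp add: ea_def p_def tn' Tt_def power2_eq_square field_simps)
    have 4: "0 \<ge> - Tt / \<epsilon> - \<mu> * h' / (2 * \<epsilon>) - \<phi> (X / \<epsilon> + \<sigma> * h' / (2 * \<epsilon>))"
    proof -
      have "0 \<ge> \<mu> * h' * (- Tt / \<epsilon> - \<mu> * h' / (2 * \<epsilon>) - \<phi> (X / \<epsilon> + \<sigma> * h' / (2 * \<epsilon>)))"
        using 3 unfolding e3 unfolding e4 by (simp add: algebra_simps)
      then show ?thesis using L(2) h(2) by (simp add: mult_le_0_iff)
    qed
    have "\<phi> (X / \<epsilon> + \<sigma> * h' / (2 * \<epsilon>)) - \<phi> (X / \<epsilon> - \<sigma> * h / (2 * \<epsilon>))
      \<le> L * \<bar>(X / \<epsilon> + \<sigma> * h' / (2 * \<epsilon>)) - (X / \<epsilon> - \<sigma> * h / (2 * \<epsilon>))\<bar>"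
      using lip by (meson abs_le_D1)
    also have "(X / \<epsilon> + \<sigma> * h' / (2 * \<epsilon>)) - (X / \<epsilon> - \<sigma> * h / (2 * \<epsilon>)) = \<sigma> * ((h + h') / (2 * \<epsilon>))"
      by (simp add: add_divide_distrib algebra_simps)
    also have "\<bar>\<sigma> * ((h + h') / (2 * \<epsilon>))\<bar> = (h + h') / (2 * \<epsilon>)"
      using sig h eps by (auto simp: abs_mult)
    finally have "S \<le> \<mu> * h / (2 * \<epsilon>) + \<mu> * h' / (2 * \<epsilon>) + L * ((h + h') / (2 * \<epsilon>))"
      using 2 4 by linarith
    also have "\<dots> = S / 2" by (simp add: S_def add_divide_distrib algebra_simps)
    finally show False using Spos by linarith
  qed
  then have "U n i - V m j \<le> E + K * \<bar>x i - y j\<bar> + K * \<bar>t n - s m\<bar>"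
    using mem by (intro bnd) (auto simp: A_def B_def)
  moreover have "0 \<le> S * t n" using Spos tnn by simp
  ultimately have "\<Psi> ((n, i), (m, j)) \<le> E + K\<^sup>2 * \<epsilon>"
    using pen[of "x i - y j"] pen[of "t n - s m"] by (simp add: \<Psi>_def p_def add_divide_distrib)
  with max[OF mem0] have "U n0 i0 - V m0 j0 \<le> E + K\<^sup>2 * \<epsilon> + p n0 i0 m0 j0 + S * t n0"
    by (simp add: \<Psi>_def)
  moreover have "S * t n0 \<le> S * T" using NT Spos by simp
  ultimately show ?thesis by (simp add: p_def S_def)
qed

section \<open>Variation bounds\<close>

text \<open>The values \<open>p n l\<close> of the flux are advected by convex combinations; \<open>l\<close> counts cells from the
  boundary \<open>l = 0\<close>.\<close>

lemma flux_variation_outgoing: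
  fixes p \<theta> :: "nat \<Rightarrow> nat \<Rightarrow> real"
  assumes step: "\<And>n l. p (Suc n) (Suc l) = p n (Suc l) + \<theta> n l * (p n l - p n (Suc l))"
    and lam: "\<And>n l. 0 \<le> \<theta> n l" "\<And>n l. \<theta> n l \<le> 1"
  shows "(\<Sum>l<M. \<bar>p n (Suc l) - p n l\<bar>) \<le>
    (\<Sum>l<M. \<bar>p 0 (Suc l) - p 0 l\<bar>) + (\<Sum>m<n. \<bar>p (Suc m) 0 - p m 0\<bar>)"
proof (induction n)
  case (Suc n)
  define D where "D = (\<lambda>l. \<bar>p n (Suc l) - p n l\<bar>)"
  have one: "\<bar>p (Suc n) (Suc 0) - p (Suc n) 0\<bar> \<le> (1 - \<theta> n 0) * D 0 + \<bar>p (Suc n) 0 - p n 0\<bar>"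
  proof -
    have "p (Suc n) (Suc 0) - p (Suc n) 0
        = (1 - \<theta> n 0) * (p n (Suc 0) - p n 0) - (p (Suc n) 0 - p n 0)"
      by (simp add: step algebra_simps)
    then have "\<bar>p (Suc n) (Suc 0) - p (Suc n) 0\<bar>
        \<le> \<bar>(1 - \<theta> n 0) * (p n (Suc 0) - p n 0)\<bar> + \<bar>p (Suc n) 0 - p n 0\<bar>" by linarith
    also have "\<bar>(1 - \<theta> n 0) * (p n (Suc 0) - p n 0)\<bar> = (1 - \<theta> n 0) * D 0"
      using lam by (simp add: D_def abs_mult)
    finally show ?thesis .
  qed
  have two: "\<bar>p (Suc n) (Suc (Suc l)) - p (Suc n) (Suc l)\<bar>
      \<le> (1 - \<theta> n (Suc l)) * D (Suc l) + \<theta> n l * D l" for l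
  proof -
    have "p (Suc n) (Suc (Suc l)) - p (Suc n) (Suc l)
        = (1 - \<theta> n (Suc l)) * (p n (Suc (Suc l)) - p n (Suc l)) + \<theta> n l * (p n (Suc l) - p n l)"
      by (simp add: step algebra_simps)
    then have "\<bar>p (Suc n) (Suc (Suc l)) - p (Suc n) (Suc l)\<bar>
        \<le> \<bar>(1 - \<theta> n (Suc l)) * (p n (Suc (Suc l)) - p n (Suc l))\<bar> + \<bar>\<theta> n l * (p n (Suc l) - p n l)\<bar>"
      by linarith
    then show ?thesis using lam by (simp add: D_def abs_mult)
  qed
  \<comment> \<open>The extra term is what the difference number \<open>M - 1\<close> hands on to
    the next one; carrying it along makes the induction over \<open>M\<close> close.\<close>
  have "(\<Sum>l<M. \<bar>p (Suc n) (Suc l) - p (Suc n) l\<bar>) + (if M = 0 then 0 else \<theta> n (M - 1) * D (M - 1))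
    \<le> (\<Sum>l<M. D l) + \<bar>p (Suc n) 0 - p n 0\<bar>" for M
  proof (induction M)
    case (Suc M)
    show ?case
    proof (cases M)
      case 0
      then show ?thesis using one by (simp add: algebra_simps)
    next
      case (Suc M')
      then show ?thesis using Suc.IH two[of M'] by (simp add: algebra_simps)
    qed
  qed auto
  from this[of M] lam have "(\<Sum>l<M. \<bar>p (Suc n) (Suc l) - p (Suc n) l\<bar>)
    \<le> (\<Sum>l<M. D l) + \<bar>p (Suc n) 0 - p n 0\<bar>"
    by (smt (verit, best) D_def abs_ge_zero mult_nonneg_nonneg)
  with Suc.IH show ?case by (simp add: D_def)
qed simp

text \<open>Variation that leaves through \<open>l = 0\<close> turns into variation in time of the
  boundary value, so both sums draw on one budget. The initial range is \<open>M + n\<close> because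
  each step looks one cell further out.\<close>

lemma flux_variation_incoming:
  fixes p \<theta> :: "nat \<Rightarrow> nat \<Rightarrow> real"
  assumes step: "\<And>n l. p (Suc n) l = p n l + \<theta> n l * (p n (Suc l) - p n l)"
    and lam: "\<And>n l. 0 \<le> \<theta> n l" "\<And>n l. \<theta> n l \<le> 1"
  shows "(\<Sum>l<M. \<bar>p n (Suc l) - p n l\<bar>) + (\<Sum>m<n. \<bar>p (Suc m) 0 - p m 0\<bar>)
    \<le> (\<Sum>l<M+n. \<bar>p 0 (Suc l) - p 0 l\<bar>)"
proof (induction n arbitrary: M)
  case (Suc n)
  define D where "D = (\<lambda>l. \<bar>p n (Suc l) - p n l\<bar>)"
  have two: "\<bar>p (Suc n) (Suc l) - p (Suc n) l\<bar>
      \<le> (1 - \<theta> n l) * D l + \<theta> n (Suc l) * D (Suc l)" for l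
  proof -
    have "p (Suc n) (Suc l) - p (Suc n) l
        = (1 - \<theta> n l) * (p n (Suc l) - p n l) + \<theta> n (Suc l) * (p n (Suc (Suc l)) - p n (Suc l))"
      by (simp add: step algebra_simps)
    then have "\<bar>p (Suc n) (Suc l) - p (Suc n) l\<bar>
        \<le> \<bar>(1 - \<theta> n l) * (p n (Suc l) - p n l)\<bar> + \<bar>\<theta> n (Suc l) * (p n (Suc (Suc l)) - p n (Suc l))\<bar>"
      by linarith
    then show ?thesis using lam by (simp add: D_def abs_mult)
  qed
  \<comment> \<open>The last term is the variation that enters from the right, of which at most all
    of \<open>D M\<close> arrives; hence the range grows to \<open>Suc M\<close>.\<close>
  have "(\<Sum>l<M. \<bar>p (Suc n) (Suc l) - p (Suc n) l\<bar>) + \<bar>p (Suc n) 0 - p n 0\<bar>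
    \<le> (\<Sum>l<M. D l) + \<theta> n M * D M" for M
  proof (induction M)
    case 0
    then show ?case using lam by (simp add: step D_def abs_mult)
  next
    case (Suc M)
    then show ?case using two[of M] by (simp add: algebra_simps)
  qed
  moreover have "\<theta> n M * D M \<le> D M" using lam by (simp add: D_def mult_left_le_one_le)
  ultimately have "(\<Sum>l<M. \<bar>p (Suc n) (Suc l) - p (Suc n) l\<bar>) + \<bar>p (Suc n) 0 - p n 0\<bar>
    \<le> (\<Sum>l<Suc M. D l)"
    by (smt (verit) sum.lessThan_Suc)
  with Suc.IH[of "Suc M"] show ?case by (simp add: D_def)
qed simp

section \<open>Integrals of step functions\<close>

lemma bounded_borel_set_integrable:
  fixes f :: "real \<Rightarrow> real"
  assumes "f \<in> borel_measurable borel" "\<And>x. \<bar>f x\<bar> \<le> M"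
  shows "set_integrable lborel {a..b} f"
  unfolding set_integrable_def
proof (rule integrableI_bounded_set_indicator[where B = M])
  show "emeasure lborel {a..b} < \<infinity>" by (simp add: emeasure_lborel_Icc_eq)
  show "f \<in> borel_measurable lborel" using assms(1) by simp
  show "AE x in lborel. x \<in> {a..b} \<longrightarrow> norm (f x) \<le> M" using assms(2) by simp
qed simp

lemma bounded_borel_integrable_on:
  fixes f :: "real \<Rightarrow> real"
  assumes "f \<in> borel_measurable borel" "\<And>x. \<bar>f x\<bar> \<le> M"
  shows "f integrable_on {a..b}"
  using set_borel_integral_eq_integral(1)[OF bounded_borel_set_integrable[OF assms]] .

lemma has_integral_const_on_interior:
  fixes f :: "real \<Rightarrow> real"
  assumes "a \<le> b" "\<And>x. a \<le> x \<Longrightarrow> x < b \<Longrightarrow> f x = c"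
  shows "(f has_integral (b - a) * c) {a..b}"
proof -
  have "((\<lambda>x. c) has_integral (b - a) * c) {a..b}"
    using has_integral_const_real[of c a b] assms by simp
  then show ?thesis
    by (rule has_integral_spike_finite[where S = "{b}", rotated 2]) (use assms in auto)
qed

text \<open>A grid on the half line: \<open>idx\<close> counts the grid points \<open>z 0 < z 1 < \<dots>\<close> to the left of a point.\<close>

locale step_grid =
  fixes idx :: "real \<Rightarrow> nat" and z :: "nat \<Rightarrow> real"
  assumes idx: "\<And>l x. 0 \<le> x \<Longrightarrow> l < idx x \<longleftrightarrow> z l \<le> x"
    and z_nonneg: "\<And>l. 0 \<le> z l" and z_mono: "\<And>l. z l \<le> z (Suc l)"
begin

lemma idx_eq_Suc:
  assumes "z l \<le> x" "x < z (Suc l)"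
  shows "idx x = Suc l"
proof -
  have "0 \<le> x" using assms z_nonneg[of l] by linarith
  with assms idx[of x l] idx[of x "Suc l"] show ?thesis by auto
qed

lemma idx_eq_0: "0 \<le> x \<Longrightarrow> x < z 0 \<Longrightarrow> idx x = 0"
  using idx[of x 0] by auto

lemma step_has_integral:
  fixes f :: "nat \<Rightarrow> real"
  shows "((\<lambda>x. f (idx x)) has_integral z 0 * f 0 + (\<Sum>l<j. (z (Suc l) - z l) * f (Suc l))) {0..z j}"
proof (induction j)
  case 0
  have "((\<lambda>x. f (idx x)) has_integral (z 0 - 0) * f 0) {0..z 0}"
    using z_nonneg by (intro has_integral_const_on_interior) (auto simp: idx_eq_0)
  then show ?case by simp
next
  case (Suc j)
  have "((\<lambda>x. f (idx x)) has_integral (z (Suc j) - z j) * f (Suc j)) {z j..z (Suc j)}"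
    using z_mono by (intro has_integral_const_on_interior) (auto simp: idx_eq_Suc)
  from has_integral_combine[OF z_nonneg z_mono Suc.IH this] show ?case by (simp add: algebra_simps)
qed

lemma step_integral:
  fixes f :: "nat \<Rightarrow> real"
  shows "integral {0..z j} (\<lambda>x. f (idx x)) = z 0 * f 0 + (\<Sum>l<j. (z (Suc l) - z l) * f (Suc l))"
  using step_has_integral by (rule integral_unique)

text \<open>Abel summation over the jumps of the step function leaves only tail integrals of \<open>w\<close>.\<close>

lemma step_pairing_bound:
  fixes p :: "nat \<Rightarrow> real" and w :: "real \<Rightarrow> real"
  assumes w: "w integrable_on {0..R}"
    and S: "\<And>x. 0 \<le> x \<Longrightarrow> x \<le> R \<Longrightarrow> \<bar>integral {x..R} w\<bar> \<le> S" and "0 \<le> S" "0 \<le> R"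
    and V: "\<And>J. (\<Sum>l<J. \<bar>p (Suc l) - p l\<bar>) \<le> V"
  shows "\<bar>integral {0..R} (\<lambda>x. w x * p (idx x))\<bar> \<le> S * (\<bar>p 0\<bar> + V)"
proof -
  define J where "J = idx R"
  define \<omega> where "\<omega> = (\<lambda>l x. if x \<in> {z l..} then w x else 0)"
  \<comment> \<open>\<open>p (idx x)\<close> is \<open>p 0\<close> plus the jumps at the grid points
    to the left of \<open>x\<close>. Grid points beyond \<open>R\<close> are never met, so
    \<open>J = idx R\<close> jumps suffice.\<close>
  have rep: "w x * p (idx x) = p 0 * w x + (\<Sum>l<J. (p (Suc l) - p l) * \<omega> l x)" if x: "x \<in> {0..R}" for x
  proof -
    have le: "idx x \<le> J"
    proof (rule ccontr)
      assume "\<not> ?thesis"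
      hence "z J \<le> x" using idx[of x J] x by auto
      hence "J < idx R" using idx[of R J] x by auto
      thus False by (simp add: J_def)
    qed
    have "(\<Sum>l<J. (p (Suc l) - p l) * \<omega> l x) = (\<Sum>l<J. if l < idx x then (p (Suc l) - p l) * w x else 0)"
      using x by (intro sum.cong) (auto simp: \<omega>_def idx)
    also have "\<dots> = (\<Sum>l\<in>{..<J} \<inter> {l. l < idx x}. (p (Suc l) - p l) * w x)"
      by (subst sum.inter_restrict) auto
    also have "{..<J} \<inter> {l. l < idx x} = {..<idx x}" using le by auto
    also have "(\<Sum>l<idx x. (p (Suc l) - p l) * w x) = (p (idx x) - p 0) * w x"
      by (simp add: sum_distrib_right[symmetric] sum_lessThan_telescope)
    finally show ?thesis by (simp add: algebra_simps)
  qed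
  have \<omega>: "\<omega> l integrable_on {0..R}" "\<bar>integral {0..R} (\<omega> l)\<bar> \<le> S" for l
  proof -
    have "w integrable_on {z l..R}"
      using w by (rule integrable_on_subinterval) (use z_nonneg[of l] in auto)
    then show "\<omega> l integrable_on {0..R}"
      unfolding \<omega>_def by (subst integrable_restrict_Int) (simp_all add: max_absorb1[OF z_nonneg])
    have "integral {0..R} (\<omega> l) = integral {z l..R} w"
      unfolding \<omega>_def by (subst integral_restrict_Int) (simp_all add: max_absorb1[OF z_nonneg])
    then show "\<bar>integral {0..R} (\<omega> l)\<bar> \<le> S"
      using S[of "z l"] z_nonneg[of l] \<open>0 \<le> S\<close> by (cases "z l \<le> R") auto
  qed
  have "integral {0..R} (\<lambda>x. w x * p (idx x))
      = integral {0..R} (\<lambda>x. p 0 * w x + (\<Sum>l<J. (p (Suc l) - p l) * \<omega> l x))"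
    using rep by (intro integral_cong) auto
  also have "\<dots> = p 0 * integral {0..R} w + (\<Sum>l<J. (p (Suc l) - p l) * integral {0..R} (\<omega> l))"
  proof (subst integral_add)
    show "(\<lambda>x. p 0 * w x) integrable_on {0..R}" using w by (rule integrable_on_mult_right)
    show "(\<lambda>x. \<Sum>l<J. (p (Suc l) - p l) * \<omega> l x) integrable_on {0..R}"
      using \<omega> by (intro integrable_sum integrable_on_mult_right) auto
    show "integral {0..R} (\<lambda>x. p 0 * w x) + integral {0..R} (\<lambda>x. \<Sum>l<J. (p (Suc l) - p l) * \<omega> l x)
        = p 0 * integral {0..R} w + (\<Sum>l<J. (p (Suc l) - p l) * integral {0..R} (\<omega> l))"
      using \<omega> by (subst integral_sum) (auto intro: integrable_on_mult_right)
  qed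
  also have "\<bar>\<dots>\<bar> \<le> \<bar>p 0 * integral {0..R} w\<bar> + (\<Sum>l<J. \<bar>(p (Suc l) - p l) * integral {0..R} (\<omega> l)\<bar>)"
    by (rule order_trans[OF abs_triangle_ineq add_left_mono[OF sum_abs]])
  also have "\<dots> = \<bar>p 0\<bar> * \<bar>integral {0..R} w\<bar> + (\<Sum>l<J. \<bar>p (Suc l) - p l\<bar> * \<bar>integral {0..R} (\<omega> l)\<bar>)"
    by (simp add: abs_mult)
  also have "\<dots> \<le> \<bar>p 0\<bar> * S + (\<Sum>l<J. \<bar>p (Suc l) - p l\<bar> * S)"
    using S[of 0] \<open>0 \<le> R\<close> \<omega> by (intro add_mono mult_left_mono sum_mono) auto
  also have "\<dots> = S * (\<bar>p 0\<bar> + (\<Sum>l<J. \<bar>p (Suc l) - p l\<bar>))"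
    by (simp add: sum_distrib_left algebra_simps)
  also have "\<dots> \<le> S * (\<bar>p 0\<bar> + V)" using V \<open>0 \<le> S\<close> by (intro mult_left_mono add_left_mono) auto
  finally show ?thesis .
qed

end

lemma step_grid_time:
  assumes "\<delta> > 0"
  shows "step_grid (\<lambda>t. nat \<lfloor>t / \<delta>\<rfloor>) (\<lambda>l. (real l + 1) * \<delta>)"
proof
  fix l and x :: real assume "0 \<le> x"
  have "l < nat \<lfloor>x / \<delta>\<rfloor> \<longleftrightarrow> int l + 1 \<le> \<lfloor>x / \<delta>\<rfloor>" by linarith
  also have "\<dots> \<longleftrightarrow> real l + 1 \<le> x / \<delta>" by (simp add: le_floor_iff)
  finally show "l < nat \<lfloor>x / \<delta>\<rfloor> \<longleftrightarrow> (real l + 1) * \<delta> \<le> x" using assms by (simp add: field_simps)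
qed (use assms in \<open>auto simp: algebra_simps\<close>)

text \<open>\<open>round\<close> jumps at the odd multiples of \<open>h / 2\<close>; the first piece
  \<open>[0, h/2)\<close> is the share of the vertex cell on this edge.\<close>

lemma step_grid_space:
  assumes "h > 0"
  shows "step_grid (\<lambda>x. nat (round (x / h))) (\<lambda>l. (real l + 1/2) * h)"
proof
  fix l and x :: real assume "0 \<le> x"
  have "l < nat (round (x / h)) \<longleftrightarrow> int l + 1 \<le> \<lfloor>x / h + 1/2\<rfloor>" unfolding round_def by linarith
  also have "\<dots> \<longleftrightarrow> real l + 1/2 \<le> x / h" unfolding le_floor_iff by auto
  finally show "l < nat (round (x / h)) \<longleftrightarrow> (real l + 1/2) * h \<le> x" using assms by (simp add: field_simps)
qed (use assms in \<open>auto simp: algebra_simps\<close>)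

lemma nat_round_bounds:
  assumes "h > 0" "0 \<le> x"
  shows "x < (real (nat (round (x / h))) + 1/2) * h" "(real (nat (round (x / h))) + 1/2) * h \<le> x + h"
proof -
  define k where "k = round (x / h)"
  have "x / h - 1/2 < of_int k" "of_int k \<le> x / h + 1/2"
    unfolding k_def round_def by linarith+
  moreover have "0 \<le> k" using assms by (simp add: k_def round_def)
  ultimately show "x < (real (nat (round (x / h))) + 1/2) * h" "(real (nat (round (x / h))) + 1/2) * h \<le> x + h"
    unfolding k_def[symmetric] using assms by (simp_all add: field_simps)
qed

lemma nat_floor_bounds:
  assumes "\<delta> > 0" "0 \<le> t"
  shows "real (nat \<lfloor>t / \<delta>\<rfloor>) * \<delta> \<le> t" "t < real (nat \<lfloor>t / \<delta>\<rfloor>) * \<delta> + \<delta>"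
proof -
  have "of_int \<lfloor>t / \<delta>\<rfloor> * \<delta> \<le> t" "t / \<delta> < of_int \<lfloor>t / \<delta>\<rfloor> + 1"
    by (rule pos_le_divide_eq[THEN iffD1, OF assms(1) of_int_floor_le]) linarith
  moreover have "0 \<le> \<lfloor>t / \<delta>\<rfloor>" using assms by simp
  ultimately show "real (nat \<lfloor>t / \<delta>\<rfloor>) * \<delta> \<le> t" "t < real (nat \<lfloor>t / \<delta>\<rfloor>) * \<delta> + \<delta>"
    using assms by (simp_all add: field_simps)
qed

lemma time_step_integral:
  fixes f :: "nat \<Rightarrow> real"
  assumes "\<delta> > 0"
  shows "integral {0..real n * \<delta>} (\<lambda>t. f (nat \<lfloor>t / \<delta>\<rfloor>)) = \<delta> * (\<Sum>m<n. f m)"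
proof (cases n)
  case (Suc j)
  interpret step_grid "\<lambda>t. nat \<lfloor>t / \<delta>\<rfloor>" "\<lambda>l. (real l + 1) * \<delta>"
    using assms by (rule step_grid_time)
  have "integral {0..real n * \<delta>} (\<lambda>t. f (nat \<lfloor>t / \<delta>\<rfloor>)) = \<delta> * f 0 + (\<Sum>l<j. \<delta> * f (Suc l))"
    using step_integral[of j f] by (simp add: Suc algebra_simps)
  also have "\<dots> = \<delta> * (\<Sum>m<n. f m)"
    by (simp add: Suc sum.lessThan_Suc_shift sum_distrib_left algebra_simps del: sum.lessThan_Suc)
  finally show ?thesis .
qed simp

lemma step_borel_measurable [measurable]:
  "(\<lambda>x::real. f (nat (round (x / h))) :: real) \<in> borel_measurable borel"
  "(\<lambda>t::real. f (nat \<lfloor>t / \<delta>\<rfloor>) :: real) \<in> borel_measurable borel"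
  unfolding round_def by measurable

lemma abs_integral_bound:
  fixes f :: "real \<Rightarrow> real"
  assumes "a \<le> b" "f integrable_on {a..b}" "\<And>x. x \<in> {a..b} \<Longrightarrow> \<bar>f x\<bar> \<le> M"
  shows "\<bar>integral {a..b} f\<bar> \<le> M * (b - a)"
proof -
  have "norm (integral {a..b} f) \<le> integral {a..b} (\<lambda>x. M)"
    using assms by (intro integral_norm_bound_integral) auto
  then show ?thesis using assms(1) by (simp add: mult.commute)
qed

text \<open>Replaces the missing lower bound on the slope. On the compact set
  \<open>|x - y| \<ge> \<eta>\<close> the product is continuous and positive, so it has a positive
  minimum, and \<open>C\<close> is the diameter of the interval over this minimum. Nearer to the
  diagonal \<open>\<eta>\<close> alone suffices.\<close>

lemma strict_mono_gap:
  fixes \<phi> :: "real \<Rightarrow> real"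
  assumes cont: "continuous_on {lo..hi} \<phi>"
    and strict: "\<And>x y. lo \<le> x \<Longrightarrow> x < y \<Longrightarrow> y \<le> hi \<Longrightarrow> \<sigma> * \<phi> x < \<sigma> * \<phi> y" and "\<eta> > 0"
  obtains C where "C \<ge> 0"
    "\<And>x y. x \<in> {lo..hi} \<Longrightarrow> y \<in> {lo..hi} \<Longrightarrow> \<bar>x - y\<bar> \<le> \<eta> + C * ((x - y) * (\<sigma> * \<phi> x - \<sigma> * \<phi> y))"
proof -
  define S where "S = ({lo..hi} \<times> {lo..hi}) \<inter> {p. \<eta> \<le> \<bar>fst p - snd p\<bar>}"
  define g where "g = (\<lambda>p. (fst p - snd p) * (\<sigma> * \<phi> (fst p) - \<sigma> * \<phi> (snd p)))"
  have pos: "0 < (x - y) * (\<sigma> * \<phi> x - \<sigma> * \<phi> y)" if "x \<in> {lo..hi}" "y \<in> {lo..hi}" "x \<noteq> y" for x y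
    using that strict[of x y] strict[of y x] by (cases "x < y") (auto simp: zero_less_mult_iff)
  have nn: "0 \<le> (x - y) * (\<sigma> * \<phi> x - \<sigma> * \<phi> y)" if "x \<in> {lo..hi}" "y \<in> {lo..hi}" for x y
    using pos[of x y] that by (cases "x = y") auto
  have "compact S" unfolding S_def
    by (intro compact_Int_closed compact_Times compact_Icc closed_Collect_le continuous_intros)
  have contg: "continuous_on S g" unfolding g_def
    by (intro continuous_intros continuous_on_compose2[OF cont]) (auto simp: S_def)
  show thesis
  proof (cases "S = {}")
    case True
    show thesis
    proof (rule that[of 0])
      fix x y assume "x \<in> {lo..hi}" "y \<in> {lo..hi}"
      then have "(x, y) \<notin> S \<longrightarrow> \<bar>x - y\<bar> < \<eta>" by (auto simp: S_def)
      with True show "\<bar>x - y\<bar> \<le> \<eta> + 0 * ((x - y) * (\<sigma> * \<phi> x - \<sigma> * \<phi> y))" by auto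
    qed simp
  next
    case False
    then obtain p where p: "p \<in> S" "\<And>q. q \<in> S \<Longrightarrow> g p \<le> g q"
      using continuous_attains_inf[OF \<open>compact S\<close> False contg] by blast
    have gp: "g p > 0" unfolding g_def using p(1) \<open>\<eta> > 0\<close> by (intro pos) (auto simp: S_def)
    have lh: "lo \<le> hi" using p(1) by (auto simp: S_def)
    show thesis
    proof (rule that[of "(hi - lo) / g p"])
      show "(hi - lo) / g p \<ge> 0" using gp lh by simp
      fix x y assume xy: "x \<in> {lo..hi}" "y \<in> {lo..hi}"
      show "\<bar>x - y\<bar> \<le> \<eta> + (hi - lo) / g p * ((x - y) * (\<sigma> * \<phi> x - \<sigma> * \<phi> y))"
      proof (cases "\<bar>x - y\<bar> \<le> \<eta>")
        case True
        have "0 \<le> (hi - lo) / g p * ((x - y) * (\<sigma> * \<phi> x - \<sigma> * \<phi> y))"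
          using gp lh by (intro mult_nonneg_nonneg[OF divide_nonneg_pos nn[OF xy]]) simp_all
        with True show ?thesis by linarith
      next
        case False
        then have "g p \<le> (x - y) * (\<sigma> * \<phi> x - \<sigma> * \<phi> y)"
          using p(2)[of "(x, y)"] xy by (auto simp: S_def g_def)
        then have "(hi - lo) / g p * g p \<le> (hi - lo) / g p * ((x - y) * (\<sigma> * \<phi> x - \<sigma> * \<phi> y))"
          using gp lh by (intro mult_left_mono) auto
        moreover have "\<bar>x - y\<bar> \<le> hi - lo" using xy by auto
        ultimately show ?thesis using gp \<open>\<eta> > 0\<close> by simp
      qed
    qed
  qed
qed

section \<open>The upwind scheme on one edge\<close>

text \<open>After reflecting the edges on the negative half line, every edge is the positive half line with the
  vertex at \<open>0\<close>.  The flux is increasing (\<open>\<sigma> = 1\<close>) if information leaves the vertex and decreasing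
  (\<open>\<sigma> = -1\<close>) if it enters the vertex.  \<open>P\<close> is a primitive of the initial datum.\<close>

locale upwind_edge =
  fixes \<phi> :: "real \<Rightarrow> real" and \<sigma> lo hi L \<mu> M :: real and P :: "real \<Rightarrow> real"
  assumes sig: "\<sigma> = 1 \<or> \<sigma> = -1" and lohi: "lo \<le> hi"
    and strict: "\<And>x y. lo \<le> x \<Longrightarrow> x < y \<Longrightarrow> y \<le> hi \<Longrightarrow> \<sigma> * \<phi> x < \<sigma> * \<phi> y"
    and lip: "\<And>x y. x \<in> {lo..hi} \<Longrightarrow> y \<in> {lo..hi} \<Longrightarrow> \<bar>\<phi> x - \<phi> y\<bar> \<le> L * \<bar>x - y\<bar>"
    and L_nonneg: "L \<ge> 0" and mu_pos: "\<mu> > 0" and cfl: "\<mu> * L \<le> 1"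
    and M_bound: "\<And>x. x \<in> {lo..hi} \<Longrightarrow> \<bar>x\<bar> \<le> M" "\<And>x. x \<in> {lo..hi} \<Longrightarrow> \<bar>\<phi> x\<bar> \<le> M"
    and P_lip: "\<And>x y. 0 \<le> x \<Longrightarrow> 0 \<le> y \<Longrightarrow> \<bar>P x - P y\<bar> \<le> M * \<bar>x - y\<bar>" and P_0: "P 0 = 0"
begin

definition flux :: "real \<Rightarrow> real \<Rightarrow> real" where
  "flux a b = (if \<sigma> = 1 then \<phi> a else \<phi> b)"

lemma flux_out: "\<sigma> = 1 \<Longrightarrow> flux a b = \<phi> a" and flux_in: "\<sigma> \<noteq> 1 \<Longrightarrow> flux a b = \<phi> b"
  unfolding flux_def by simp_all

text \<open>The time step is \<open>\<mu> * h\<close>. No update is prescribed in cell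
  \<open>0\<close>: its values are boundary data, which the vertex supplies. The initial values
  enter as differences of \<open>P\<close>, which is what makes the potential exact at time
  \<open>0\<close>.\<close>

definition scheme :: "real \<Rightarrow> (nat \<Rightarrow> nat \<Rightarrow> real) \<Rightarrow> bool" where
  "scheme h u \<longleftrightarrow> h > 0 \<and> (\<forall>n l. u n l \<in> {lo..hi}) \<and>
     (\<forall>n l. u (Suc n) (Suc l) = u n (Suc l)
        - \<mu> * (flux (u n (Suc l)) (u n (Suc (Suc l))) - flux (u n l) (u n (Suc l)))) \<and>
     (\<forall>l. h * u 0 (Suc l) = P ((real l + 3/2) * h) - P ((real l + 1/2) * h))"

text \<open>The discrete potential at the interface between the cells \<open>j\<close> and \<open>Suc j\<close>; it solves a monotone
  scheme for a Hamilton--Jacobi equation.\<close>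

definition pot :: "real \<Rightarrow> (nat \<Rightarrow> nat \<Rightarrow> real) \<Rightarrow> nat \<Rightarrow> nat \<Rightarrow> real" where
  "pot h u n j = P ((real j + 1/2) * h) - \<mu> * h * (\<Sum>m<n. flux (u m j) (u m (Suc j)))"

lemma M_nonneg: "M \<ge> 0"
  using M_bound(1)[of lo] lohi by force

lemma sig_sq [simp]: "\<sigma> * \<sigma> = 1" "\<sigma> * (\<sigma> * a) = a"
  using sig by auto

lemma mono: "lo \<le> x \<Longrightarrow> x \<le> y \<Longrightarrow> y \<le> hi \<Longrightarrow> \<sigma> * \<phi> x \<le> \<sigma> * \<phi> y"
  using strict[of x y] by (cases "x = y") auto

lemma scheme_h: "scheme h u \<Longrightarrow> h > 0"
  by (simp add: scheme_def)

lemma scheme_range: "scheme h u \<Longrightarrow> u n l \<in> {lo..hi}"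
  unfolding scheme_def by blast

lemma scheme_bound: "scheme h u \<Longrightarrow> \<bar>u n l\<bar> \<le> M" "scheme h u \<Longrightarrow> \<bar>\<phi> (u n l)\<bar> \<le> M"
  using M_bound scheme_range by blast+

lemma scheme_flux_bound: "scheme h u \<Longrightarrow> \<bar>flux (u n l) (u n' l')\<bar> \<le> M"
  unfolding flux_def using scheme_bound(2) by auto

lemma scheme_step: "scheme h u \<Longrightarrow> u (Suc n) (Suc l) = u n (Suc l)
    - \<mu> * (flux (u n (Suc l)) (u n (Suc (Suc l))) - flux (u n l) (u n (Suc l)))"
  unfolding scheme_def by blast

lemma scheme_init: "scheme h u \<Longrightarrow> h * u 0 (Suc l) = P ((real l + 3/2) * h) - P ((real l + 1/2) * h)"
  unfolding scheme_def by blast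

lemma pot_0: "pot h u 0 j = P ((real j + 1/2) * h)"
  by (simp add: pot_def)

lemma pot_Suc: "pot h u (Suc n) j = pot h u n j - \<mu> * h * flux (u n j) (u n (Suc j))"
  by (simp add: pot_def algebra_simps)

lemma pot_diff:
  assumes "scheme h u"
  shows "pot h u n (Suc j) - pot h u n j = h * u n (Suc j)"
proof (induction n)
  case 0
  have "real (Suc j) + 1/2 = real j + 3/2" by simp
  then show ?case using scheme_init[OF assms, of j] by (simp only: pot_0)
next
  case (Suc n)
  then show ?case by (simp add: pot_Suc scheme_step[OF assms] algebra_simps)
qed

lemma pot_lip_space:
  assumes "scheme h u"
  shows "\<bar>pot h u n i - pot h u n j\<bar> \<le> M * \<bar>(real i - real j) * h\<bar>"
proof -
  have *: "\<bar>pot h u n (i + k) - pot h u n i\<bar> \<le> M * (real k * h)" for i k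
  proof (induction k)
    case (Suc k)
    have "\<bar>h * u n (Suc (i + k))\<bar> \<le> h * M"
      using scheme_bound(1)[OF assms] scheme_h[OF assms] by (simp add: abs_mult)
    with Suc pot_diff[OF assms, of n "i + k"] show ?case by (simp add: algebra_simps)
  qed simp
  have "h > 0" using scheme_h[OF assms] .
  show ?thesis
  proof (cases "i \<le> j")
    case True
    then obtain k where "j = i + k" using le_Suc_ex by blast
    then show ?thesis using *[of i k] \<open>h > 0\<close> by (simp add: abs_minus_commute abs_mult)
  next
    case False
    then obtain k where "i = j + k" using le_Suc_ex by (metis nat_le_linear)
    then show ?thesis using *[of j k] \<open>h > 0\<close> by (simp add: abs_mult)
  qed
qed

lemma pot_lip_time:
  assumes "scheme h u"
  shows "\<bar>pot h u n i - pot h u m i\<bar> \<le> M * \<bar>real n * (\<mu> * h) - real m * (\<mu> * h)\<bar>"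
proof -
  have h: "h > 0" "\<mu> * h > 0" using scheme_h[OF assms] mu_pos by auto
  have *: "\<bar>pot h u (n + k) i - pot h u n i\<bar> \<le> M * (real k * (\<mu> * h))" for n k
  proof (induction k)
    case (Suc k)
    have "\<bar>\<mu> * h * flux (u (n + k) i) (u (n + k) (Suc i))\<bar> \<le> \<mu> * h * M"
      using scheme_flux_bound[OF assms] h mu_pos by (simp add: abs_mult)
    with Suc show ?case by (simp add: pot_Suc algebra_simps)
  qed simp
  show ?thesis
  proof (cases "n \<le> m")
    case True
    then obtain k where k: "m = n + k" using le_Suc_ex by blast
    have "\<bar>real n * (\<mu> * h) - real m * (\<mu> * h)\<bar> = real k * (\<mu> * h)"
      using h mu_pos by (simp add: k algebra_simps abs_mult)
    then show ?thesis using *[of n k] by (simp add: k abs_minus_commute)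
  next
    case False
    then obtain k where k: "n = m + k" using le_Suc_ex by (metis nat_le_linear)
    have "\<bar>real n * (\<mu> * h) - real m * (\<mu> * h)\<bar> = real k * (\<mu> * h)"
      using h mu_pos by (simp add: k algebra_simps abs_mult)
    then show ?thesis using *[of m k] by (simp add: k)
  qed
qed

text \<open>In the doubling the scheme is evaluated at difference quotients of the penalty, which
  need not lie in \<open>[lo, hi]\<close>. Clamping extends the flux to the line with the same
  monotonicity and Lipschitz constant.\<close>

definition clamp_flux :: "real \<Rightarrow> real" where
  "clamp_flux a = \<phi> (max lo (min hi a))"

lemma clamp_flux_eq: "a \<in> {lo..hi} \<Longrightarrow> clamp_flux a = \<phi> a"
  by (simp add: clamp_flux_def)

lemma clamp_flux_mono: "a \<le> b \<Longrightarrow> \<sigma> * clamp_flux a \<le> \<sigma> * clamp_flux b"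
  unfolding clamp_flux_def using lohi by (intro mono) auto

lemma clamp_flux_lip: "\<bar>clamp_flux a - clamp_flux b\<bar> \<le> L * \<bar>a - b\<bar>"
proof -
  have "\<bar>clamp_flux a - clamp_flux b\<bar> \<le> L * \<bar>max lo (min hi a) - max lo (min hi b)\<bar>"
    unfolding clamp_flux_def using lohi by (intro lip) auto
  also have "\<dots> \<le> L * \<bar>a - b\<bar>" using L_nonneg by (intro mult_left_mono) auto
  finally show ?thesis .
qed

definition nb :: "nat \<Rightarrow> nat" where
  "nb j = (if \<sigma> = 1 then j - 1 else Suc j)"

lemma nb: "\<not> (\<sigma> = 1 \<and> j = 0) \<Longrightarrow> real (nb j) = real j - \<sigma>"
  unfolding nb_def using sig by auto

text \<open>The upwind neighbour is chosen such that the potential difference to it recovers exactly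
  the cell value that the flux at interface \<open>j\<close> uses: cell \<open>j\<close> for
  \<open>\<sigma> = 1\<close>, cell \<open>Suc j\<close> for \<open>\<sigma> = -1\<close>. For
  \<open>\<sigma> = 1\<close> and \<open>j = 0\<close> this is the vertex value, which no potential
  difference gives.\<close>

lemma pot_hamilton_jacobi:
  assumes "scheme h u" "\<not> (\<sigma> = 1 \<and> j = 0)"
  shows "pot h u (Suc n) j = pot h u n j
    - \<mu> * h * clamp_flux (\<sigma> * (pot h u n j - pot h u n (nb j)) / h)"
proof (cases "\<sigma> = 1")
  case True
  then obtain i where j: "j = Suc i" using assms(2) not0_implies_Suc by auto
  have nbj: "nb j = i" unfolding nb_def using True by (simp add: j)
  have e: "pot h u n j - pot h u n (nb j) = h * u n j"
    unfolding nbj unfolding j by (rule pot_diff[OF assms(1)])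
  have "\<sigma> * (pot h u n j - pot h u n (nb j)) / h = u n j"
    unfolding e using scheme_h[OF assms(1)] True by simp
  then show ?thesis
    unfolding pot_Suc flux_out[OF True] by (simp only: clamp_flux_eq[OF scheme_range[OF assms(1)]])
next
  case False
  then have s: "\<sigma> = -1" using sig by auto
  have nbj: "nb j = Suc j" unfolding nb_def using False by simp
  have e: "pot h u n j - pot h u n (nb j) = - (h * u n (Suc j))"
    using pot_diff[OF assms(1), of n j] unfolding nbj by linarith
  have "\<sigma> * (pot h u n j - pot h u n (nb j)) / h = u n (Suc j)"
    unfolding e using scheme_h[OF assms(1)] s by simp
  then show ?thesis
    unfolding pot_Suc flux_in[OF False] by (simp only: clamp_flux_eq[OF scheme_range[OF assms(1)]])
qed

text \<open>Collects the errors of \<open>doubling_of_variables\<close> for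
  \<open>\<epsilon> = sqrt (h + h')\<close>: \<open>2 * M\<close> covers the offset of the grids at
  the boundary, \<open>1 + \<mu>\<^sup>2\<close> the penalty between neighbouring points,
  \<open>M\<^sup>2\<close> the term \<open>K\<^sup>2 * \<epsilon>\<close>, and the last summand the
  correction \<open>S * T\<close>.\<close>

definition rate :: "real \<Rightarrow> real" where
  "rate T = 2 * M + 1 + \<mu>\<^sup>2 + M\<^sup>2 + (\<mu> + L) * T"

lemma rate_nonneg: "T \<ge> 0 \<Longrightarrow> rate T \<ge> 0"
  unfolding rate_def using M_nonneg mu_pos L_nonneg by (simp add: add_nonneg_nonneg)

text \<open>Closeness at the vertex is demanded only for \<open>\<sigma> = 1\<close>. For
  \<open>\<sigma> = -1\<close> the neighbour lies further out, so there is no spatial boundary and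
  the common initial primitive alone determines the potential.\<close>

lemma pot_compare_one_sided:
  fixes h h' T E
  defines "x \<equiv> \<lambda>i. (real i + 1/2) * h" and "y \<equiv> \<lambda>i. (real i + 1/2) * h'"
    and "t \<equiv> \<lambda>n. real n * (\<mu> * h)" and "s \<equiv> \<lambda>n. real n * (\<mu> * h')"
  assumes sch: "scheme h u" "scheme h' u'" and T: "T \<ge> 0" and E: "E \<ge> 0" and small: "h + h' \<le> 1"
    and bdry: "\<And>n m. \<sigma> = 1 \<Longrightarrow> t n \<le> T \<Longrightarrow> s m \<le> T \<Longrightarrow>
      \<bar>pot h u n 0 - pot h' u' m 0\<bar> \<le> E + M * \<bar>t n - s m\<bar>"
    and tn: "t n \<le> T" "s m \<le> T"
    and close: "\<bar>x i - y j\<bar> \<le> h + h'" "\<bar>t n - s m\<bar> \<le> \<mu> * (h + h')"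
  shows "pot h u n i - pot h' u' m j \<le> E + rate T * sqrt (h + h')"
proof -
  define H where "H = h + h'"
  have h: "h > 0" "h' > 0" "H > 0"
    using scheme_h[OF sch(1)] scheme_h[OF sch(2)] by (simp_all add: H_def)
  define r where "r = sqrt H"
  have r: "r > 0" "r * r = H" "r \<le> 1" "H \<le> r"
  proof -
    show "r > 0" "r * r = H" "r \<le> 1" using h small by (auto simp: r_def H_def)
    then show "H \<le> r" by (metis mult_left_le less_imp_le)
  qed
  have lip_y: "\<bar>pot h' u' m i - pot h' u' m j\<bar> \<le> M * \<bar>y i - y j\<bar>" for m i j
    using pot_lip_space[OF sch(2), of m i j] by (simp add: y_def algebra_simps)
  have lip_x: "\<bar>pot h u m i - pot h u m j\<bar> \<le> M * \<bar>x i - x j\<bar>" for m i j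
    using pot_lip_space[OF sch(1), of m i j] by (simp add: x_def algebra_simps)
  \<comment> \<open>At time \<open>0\<close> both potentials are values of the same
    \<open>P\<close>; at the boundary \<open>bdry\<close> applies. The rest is Lipschitz continuity,
    and \<open>M * H\<close> pays for the first interfaces \<open>h / 2\<close> and
    \<open>h' / 2\<close> not coinciding.\<close>
  have bnd: "pot h u n i - pot h' u' m j \<le> (E + M * H) + M * \<bar>x i - y j\<bar> + M * \<bar>t n - s m\<bar>"
    if nm: "t n \<le> T" "s m \<le> T" "n = 0 \<or> m = 0 \<or> (\<sigma> = 1 \<and> i = 0) \<or> (\<sigma> = 1 \<and> j = 0)" for n m i j
  proof -
    have MH: "0 \<le> M * H" using M_nonneg h by simp
    have PP: "P (x i) - P (y j) \<le> M * \<bar>x i - y j\<bar>"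
      using P_lip[of "x i" "y j"] h by (simp add: x_def y_def)
    consider "n = 0" | "m = 0" | "\<sigma> = 1" "i = 0" | "\<sigma> = 1" "j = 0" using nm(3) by blast
    then show ?thesis
    proof cases
      case 1
      have "\<bar>pot h' u' 0 j - pot h' u' m j\<bar> \<le> M * \<bar>t n - s m\<bar>"
        using pot_lip_time[OF sch(2), of 0 j m] by (simp add: 1 t_def s_def)
      then show ?thesis using 1 PP MH E by (simp add: pot_0 x_def y_def)
    next
      case 2
      have "\<bar>pot h u n i - pot h u 0 i\<bar> \<le> M * \<bar>t n - s m\<bar>"
        using pot_lip_time[OF sch(1), of n i 0] by (simp add: 2 t_def s_def)
      then show ?thesis using 2 PP MH E by (simp add: pot_0 x_def y_def)
    next
      case 3
      have "\<bar>y 0 - y j\<bar> \<le> \<bar>x i - y j\<bar> + H" using h unfolding 3(2) by (simp add: x_def y_def H_def)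
      then have "M * \<bar>y 0 - y j\<bar> \<le> M * (\<bar>x i - y j\<bar> + H)" using M_nonneg by (rule mult_left_mono)
      then show ?thesis using bdry[OF 3(1) nm(1,2)] lip_y[of m 0 j] unfolding 3(2) by (simp add: algebra_simps)
    next
      case 4
      have "\<bar>x i - x 0\<bar> \<le> \<bar>x i - y j\<bar> + H" using h unfolding 4(2) by (simp add: x_def y_def H_def)
      then have "M * \<bar>x i - x 0\<bar> \<le> M * (\<bar>x i - y j\<bar> + H)" using M_nonneg by (rule mult_left_mono)
      then show ?thesis using bdry[OF 4(1) nm(1,2)] lip_x[of n i 0] unfolding 4(2) by (simp add: algebra_simps)
    qed
  qed
  have "pot h u n i - pot h' u' m j \<le> (E + M * H) + ((x i - y j)\<^sup>2 + (t n - s m)\<^sup>2) / (2 * r) + M\<^sup>2 * r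
      + (\<mu> + L) * (h + h') / r * T"
    unfolding x_def y_def t_def s_def
  proof (rule doubling_of_variables[where \<phi> = clamp_flux and \<sigma> = \<sigma> and nb = nb
          and bd = "\<lambda>j. \<sigma> = 1 \<and> j = 0" and L = L and K = M])
    show "pot h u (Suc n) j = pot h u n j
        - \<mu> * h * clamp_flux (\<sigma> * (pot h u n j - pot h u n (nb j)) / h)"
      if "\<not> (\<sigma> = 1 \<and> j = 0)" for n j
      by (rule pot_hamilton_jacobi[OF sch(1) that])
    show "pot h' u' (Suc n) j = pot h' u' n j
        - \<mu> * h' * clamp_flux (\<sigma> * (pot h' u' n j - pot h' u' n (nb j)) / h')"
      if "\<not> (\<sigma> = 1 \<and> j = 0)" for n j
      by (rule pot_hamilton_jacobi[OF sch(2) that])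
    show "real (nb j) = real j - \<sigma>" if "\<not> (\<sigma> = 1 \<and> j = 0)" for j using that by (rule nb)
    show "real n * (\<mu> * h) \<le> T" "real m * (\<mu> * h') \<le> T" using tn by (simp_all add: t_def s_def)
  qed (use sig clamp_flux_mono clamp_flux_lip L_nonneg mu_pos cfl h r(1) M_nonneg
      bnd[unfolded x_def y_def t_def s_def] in blast)+
  also have "(\<mu> + L) * (h + h') / r * T = (\<mu> + L) * T * r"
    using r by (simp add: H_def[symmetric] r(2)[symmetric])
  also have "((x i - y j)\<^sup>2 + (t n - s m)\<^sup>2) / (2 * r) \<le> (1 + \<mu>\<^sup>2) * r"
  proof -
    have "(x i - y j)\<^sup>2 \<le> H\<^sup>2" "(t n - s m)\<^sup>2 \<le> (\<mu> * H)\<^sup>2"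
      using close h mu_pos by (auto simp: H_def abs_le_square_iff[symmetric])
    then have "(x i - y j)\<^sup>2 + (t n - s m)\<^sup>2 \<le> (1 + \<mu>\<^sup>2) * H * H"
      by (simp add: power2_eq_square algebra_simps)
    also have "\<dots> \<le> (1 + \<mu>\<^sup>2) * H * 1"
      using h small by (intro mult_left_mono) (auto simp: H_def add_pos_nonneg)
    also have "\<dots> = (1 + \<mu>\<^sup>2) * r * r" by (simp add: r(2)[symmetric])
    finally have "((x i - y j)\<^sup>2 + (t n - s m)\<^sup>2) / r \<le> (1 + \<mu>\<^sup>2) * r"
      using r by (simp add: pos_divide_le_eq)
    moreover have "((x i - y j)\<^sup>2 + (t n - s m)\<^sup>2) / (2 * r) \<le> ((x i - y j)\<^sup>2 + (t n - s m)\<^sup>2) / r"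
      using r by (intro divide_left_mono) auto
    ultimately show ?thesis by linarith
  qed
  also have "M * H \<le> M * r" using r M_nonneg by (intro mult_left_mono) auto
  also have "E + M * r + (1 + \<mu>\<^sup>2) * r + M\<^sup>2 * r + (\<mu> + L) * T * r \<le> E + rate T * r"
    using M_nonneg r by (simp add: rate_def algebra_simps)
  finally show ?thesis by (simp add: r_def H_def)
qed

lemma pot_compare:
  fixes h h' T E
  assumes sch: "scheme h u" "scheme h' u'" and T: "T \<ge> 0" and E: "E \<ge> 0" and small: "h + h' \<le> 1"
    and bdry: "\<And>n m. \<sigma> = 1 \<Longrightarrow> real n * (\<mu> * h) \<le> T \<Longrightarrow> real m * (\<mu> * h') \<le> T \<Longrightarrow>
      \<bar>pot h u n 0 - pot h' u' m 0\<bar> \<le> E + M * \<bar>real n * (\<mu> * h) - real m * (\<mu> * h')\<bar>"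
    and tn: "real n * (\<mu> * h) \<le> T" "real m * (\<mu> * h') \<le> T"
    and close: "\<bar>(real i + 1/2) * h - (real j + 1/2) * h'\<bar> \<le> h + h'"
      "\<bar>real n * (\<mu> * h) - real m * (\<mu> * h')\<bar> \<le> \<mu> * (h + h')"
  shows "\<bar>pot h u n i - pot h' u' m j\<bar> \<le> E + rate T * sqrt (h + h')"
proof -
  have "pot h u n i - pot h' u' m j \<le> E + rate T * sqrt (h + h')"
    by (rule pot_compare_one_sided[OF sch T E small bdry tn close])
  moreover have "pot h' u' m j - pot h u n i \<le> E + rate T * sqrt (h' + h)"
  proof (rule pot_compare_one_sided[OF sch(2,1) T E _ _ tn(2,1)])
    fix n m assume "\<sigma> = 1" "real n * (\<mu> * h') \<le> T" "real m * (\<mu> * h) \<le> T"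
    then show "\<bar>pot h' u' n 0 - pot h u m 0\<bar> \<le> E + M * \<bar>real n * (\<mu> * h') - real m * (\<mu> * h)\<bar>"
      by (metis abs_minus_commute bdry)
  qed (use small close in \<open>simp_all only: abs_minus_commute add.commute\<close>)
  ultimately show ?thesis by (simp add: add.commute abs_le_iff)
qed

lemma continuous_flux: "continuous_on {lo..hi} \<phi>"
proof -
  have "L-lipschitz_on {lo..hi} \<phi>"
    using lip L_nonneg by (intro lipschitz_onI) (auto simp: dist_real_def)
  then show ?thesis by (rule lipschitz_on_continuous_on)
qed

text \<open>There are two errors of size at most \<open>M * h\<close>: the half cell next to the
  vertex, which the potential does not count, and the piece between \<open>\<rho>\<close> and the
  next interface.\<close>

lemma space_integral_pot:
  assumes sch: "scheme h u" and "\<rho> \<ge> 0"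
  shows "\<bar>integral {0..\<rho>} (\<lambda>x. u n (nat (round (x / h))))
    - (pot h u n (nat (round (\<rho> / h))) - pot h u n 0)\<bar> \<le> 2 * M * h"
proof -
  have h: "h > 0" using sch by (rule scheme_h)
  interpret step_grid "\<lambda>x. nat (round (x / h))" "\<lambda>l. (real l + 1/2) * h"
    using h by (rule step_grid_space)
  define j where "j = nat (round (\<rho> / h))"
  define X where "X = (real j + 1/2) * h"
  define w where "w = (\<lambda>x. u n (nat (round (x / h))))"
  have wb: "\<bar>w x\<bar> \<le> M" for x unfolding w_def by (rule scheme_bound[OF sch])
  have wi: "w integrable_on {a..b}" for a b
    using wb by (intro bounded_borel_integrable_on) (auto simp: w_def)
  have X: "\<rho> \<le> X" "X \<le> \<rho> + h"
    unfolding X_def j_def using nat_round_bounds[OF h assms(2)] by auto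
  have "integral {0..X} w = h / 2 * u n 0 + (\<Sum>l<j. h * u n (Suc l))"
    unfolding w_def X_def using step_integral[of j "u n"] by (simp add: algebra_simps)
  also have "(\<Sum>l<j. h * u n (Suc l)) = pot h u n j - pot h u n 0"
    by (simp add: pot_diff[OF sch, symmetric] sum_lessThan_telescope)
  finally have 1: "integral {0..X} w = h / 2 * u n 0 + (pot h u n j - pot h u n 0)" .
  have 2: "integral {0..\<rho>} w + integral {\<rho>..X} w = integral {0..X} w"
    using X assms(2) wi by (intro Henstock_Kurzweil_Integration.integral_combine) auto
  have "\<bar>integral {\<rho>..X} w\<bar> \<le> M * (X - \<rho>)"
    using X wi wb by (intro abs_integral_bound) auto
  also have "\<dots> \<le> M * h" using X M_nonneg by (intro mult_left_mono) auto
  finally have 3: "\<bar>integral {\<rho>..X} w\<bar> \<le> M * h" .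
  have "\<bar>h / 2 * u n 0\<bar> \<le> h / 2 * M"
    using scheme_bound(1)[OF sch, of n 0] h by (simp add: abs_mult)
  then have "\<bar>h / 2 * u n 0\<bar> \<le> M * h" using h M_nonneg by (simp add: field_simps)
  with 1 2 3 show ?thesis unfolding w_def j_def by linarith
qed

text \<open>The product of the differences of the values and of the fluxes is small in mean, because the
  former has a small primitive and the latter has bounded variation.\<close>

lemma L1_distance:
  assumes sch: "scheme h u" "scheme h' u'" and R: "R \<ge> 0" and S: "S \<ge> 0"
    and pot: "\<And>i j. \<bar>(real i + 1/2) * h - (real j + 1/2) * h'\<bar> \<le> h + h' \<Longrightarrow>
      \<bar>pot h u n i - pot h' u' m j\<bar> \<le> S"
    and W: "\<And>J. (\<Sum>l<J. \<bar>\<phi> (u n (Suc l)) - \<phi> (u n l)\<bar>) \<le> W"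
      "\<And>J. (\<Sum>l<J. \<bar>\<phi> (u' m (Suc l)) - \<phi> (u' m l)\<bar>) \<le> W"
    and C: "C \<ge> 0"
      "\<And>x y. x \<in> {lo..hi} \<Longrightarrow> y \<in> {lo..hi} \<Longrightarrow> \<bar>x - y\<bar> \<le> \<eta> + C * ((x - y) * (\<sigma> * \<phi> x - \<sigma> * \<phi> y))"
  shows "integral {0..R} (\<lambda>x. \<bar>u n (nat (round (x / h))) - u' m (nat (round (x / h')))\<bar>)
    \<le> R * \<eta> + C * (8 * (S + M * (h + h')) * (M + W))"
proof -
  have h: "h > 0" "h' > 0" using sch by (auto intro: scheme_h)
  define a where "a = (\<lambda>x. u n (nat (round (x / h))))"
  define b where "b = (\<lambda>x. u' m (nat (round (x / h'))))"
  define w where "w = (\<lambda>x. a x - b x)"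
  have rng: "a x \<in> {lo..hi}" "b x \<in> {lo..hi}" for x
    unfolding a_def b_def by (auto intro!: scheme_range[OF sch(1)] scheme_range[OF sch(2)] simp del: atLeastAtMost_iff)
  have mb [measurable]: "a \<in> borel_measurable borel" "b \<in> borel_measurable borel"
    "(\<lambda>x. \<phi> (a x)) \<in> borel_measurable borel" "(\<lambda>x. \<phi> (b x)) \<in> borel_measurable borel"
    unfolding a_def b_def
    using step_borel_measurable(1)[of "\<lambda>l. \<phi> (u n l)" h] step_borel_measurable(1)[of "\<lambda>l. \<phi> (u' m l)" h'] by auto
  have bnd: "\<bar>a x\<bar> \<le> M" "\<bar>b x\<bar> \<le> M" "\<bar>\<phi> (a x)\<bar> \<le> M" "\<bar>\<phi> (b x)\<bar> \<le> M" for x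
    using M_bound rng by blast+
  have wb: "\<bar>w x\<bar> \<le> 2 * M" for x using bnd(1,2)[of x] by (simp add: w_def)
  have ai: "a integrable_on {s..t}" and bi: "b integrable_on {s..t}" for s t
    by (rule bounded_borel_integrable_on; use bnd in auto)+
  have wi: "w integrable_on {s..t}" for s t
    unfolding w_def using ai bi by (rule integrable_diff)
  \<comment> \<open>One \<open>S\<close> for the potentials at each end of
    \<open>[0, \<rho>]\<close>, and the error of \<open>space_integral_pot\<close> for each
    mesh.\<close>
  define S' where "S' = 2 * S + 2 * M * (h + h')"
  have prim: "\<bar>integral {0..\<rho>} w\<bar> \<le> S'" if "\<rho> \<ge> 0" for \<rho>
  proof -
    define i where "i = nat (round (\<rho> / h))"
    define j where "j = nat (round (\<rho> / h'))"
    have "integral {0..\<rho>} w = integral {0..\<rho>} a - integral {0..\<rho>} b"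
      unfolding w_def using ai bi by (rule Henstock_Kurzweil_Integration.integral_diff)
    moreover have "\<bar>integral {0..\<rho>} a - (pot h u n i - pot h u n 0)\<bar> \<le> 2 * M * h"
      unfolding a_def i_def by (rule space_integral_pot[OF sch(1) that])
    moreover have "\<bar>integral {0..\<rho>} b - (pot h' u' m j - pot h' u' m 0)\<bar> \<le> 2 * M * h'"
      unfolding b_def j_def by (rule space_integral_pot[OF sch(2) that])
    moreover have "\<bar>pot h u n i - pot h' u' m j\<bar> \<le> S"
      using nat_round_bounds[OF h(1) that] nat_round_bounds[OF h(2) that] h
      by (intro pot) (auto simp: i_def j_def)
    moreover have "\<bar>pot h u n 0 - pot h' u' m 0\<bar> \<le> S" using h by (intro pot) auto
    ultimately show ?thesis unfolding S'_def by (simp add: algebra_simps)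
  qed
  have tail: "\<bar>integral {x..R} w\<bar> \<le> 2 * S'" if "0 \<le> x" "x \<le> R" for x
  proof -
    have "integral {0..x} w + integral {x..R} w = integral {0..R} w"
      using that wi by (intro Henstock_Kurzweil_Integration.integral_combine) auto
    then show ?thesis using prim[of x] prim[of R] that by linarith
  qed
  have S': "0 \<le> S'" using S M_nonneg h by (simp add: S'_def)
  have W0: "W \<ge> 0" using W(1)[of 0] by simp
  interpret g: step_grid "\<lambda>x. nat (round (x / h))" "\<lambda>l. (real l + 1/2) * h"
    using h(1) by (rule step_grid_space)
  interpret g': step_grid "\<lambda>x. nat (round (x / h'))" "\<lambda>l. (real l + 1/2) * h'"
    using h(2) by (rule step_grid_space)
  \<comment> \<open>The two fluxes jump on different grids, so \<open>w\<close> is paired with each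
    of them separately, each time on the grid of that flux.\<close>
  have "\<bar>integral {0..R} (\<lambda>x. w x * \<phi> (a x))\<bar> \<le> 2 * S' * (\<bar>\<phi> (u n 0)\<bar> + W)"
    unfolding a_def using wi tail S' R W(1) by (intro g.step_pairing_bound) auto
  also have "\<dots> \<le> 2 * S' * (M + W)"
    using S' scheme_bound(2)[OF sch(1)] by (intro mult_left_mono add_mono) auto
  finally have A: "\<bar>integral {0..R} (\<lambda>x. w x * \<phi> (a x))\<bar> \<le> 2 * S' * (M + W)" .
  have "\<bar>integral {0..R} (\<lambda>x. w x * \<phi> (b x))\<bar> \<le> 2 * S' * (\<bar>\<phi> (u' m 0)\<bar> + W)"
    unfolding b_def using wi tail S' R W(2) by (intro g'.step_pairing_bound) auto
  also have "\<dots> \<le> 2 * S' * (M + W)"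
    using S' scheme_bound(2)[OF sch(2)] by (intro mult_left_mono add_mono) auto
  finally have B: "\<bar>integral {0..R} (\<lambda>x. w x * \<phi> (b x))\<bar> \<le> 2 * S' * (M + W)" .
  have [measurable]: "w \<in> borel_measurable borel" unfolding w_def by measurable
  have prodb: "\<bar>w x * \<phi> (a x)\<bar> \<le> 2 * M * M" "\<bar>w x * \<phi> (b x)\<bar> \<le> 2 * M * M" for x
    unfolding abs_mult using wb[of x] bnd[of x] M_nonneg by (auto intro!: mult_mono)
  have pi: "(\<lambda>x. w x * \<phi> (a x)) integrable_on {0..R}" "(\<lambda>x. w x * \<phi> (b x)) integrable_on {0..R}"
    using prodb by (auto intro!: bounded_borel_integrable_on)
  define q where "q = (\<lambda>x. \<eta> + C * \<sigma> * (w x * \<phi> (a x) - w x * \<phi> (b x)))"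
  have qi: "(\<lambda>x. C * \<sigma> * (w x * \<phi> (a x) - w x * \<phi> (b x))) integrable_on {0..R}"
    using pi by (intro integrable_on_mult_right integrable_diff)
  have "integral {0..R} (\<lambda>x. \<bar>w x\<bar>) \<le> integral {0..R} q"
  proof (rule integral_le)
    show "(\<lambda>x. \<bar>w x\<bar>) integrable_on {0..R}"
      using wb by (intro bounded_borel_integrable_on) auto
    show "q integrable_on {0..R}" unfolding q_def using qi by (intro integrable_add) auto
    show "\<bar>w x\<bar> \<le> q x" for x
      using C(2)[OF rng[of x]] by (simp add: q_def w_def algebra_simps)
  qed
  also have "integral {0..R} q = R * \<eta> + C * \<sigma> * (integral {0..R} (\<lambda>x. w x * \<phi> (a x)) - integral {0..R} (\<lambda>x. w x * \<phi> (b x)))"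
    unfolding q_def using qi pi R
    by (subst Henstock_Kurzweil_Integration.integral_add)
      (auto simp: Henstock_Kurzweil_Integration.integral_diff)
  also have "\<dots> \<le> R * \<eta> + C * (4 * S' * (M + W))"
  proof -
    define D where "D = integral {0..R} (\<lambda>x. w x * \<phi> (a x)) - integral {0..R} (\<lambda>x. w x * \<phi> (b x))"
    have "\<sigma> * D \<le> \<bar>D\<bar>" using sig by auto
    also have "\<bar>D\<bar> \<le> 4 * S' * (M + W)" using A B unfolding D_def by linarith
    finally have "C * (\<sigma> * D) \<le> C * (4 * S' * (M + W))" using C(1) by (rule mult_left_mono)
    then show ?thesis by (simp add: D_def[symmetric])
  qed
  also have "4 * S' * (M + W) = 8 * (S + M * (h + h')) * (M + W)" by (simp add: S'_def algebra_simps)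
  finally show ?thesis by (simp add: w_def a_def b_def)
qed

end

section \<open>Variation of the flux and discrete conservation on one edge\<close>

lemma sum_first:
  fixes a :: "nat \<Rightarrow> real"
  assumes "a 0 \<le> A" "0 \<le> A" "(\<Sum>l<J. a (Suc l)) \<le> B" "\<And>l. 0 \<le> a l"
  shows "(\<Sum>l<J. a l) \<le> A + B"
proof -
  have "(\<Sum>l<J. a l) \<le> (\<Sum>l<Suc J. a l)" using assms(4) by simp
  also have "\<dots> = a 0 + (\<Sum>l<J. a (Suc l))" by (rule sum.lessThan_Suc_shift)
  finally show ?thesis using assms by linarith
qed

context upwind_edge
begin

text \<open>A secant slope takes the place of the derivative, which a Lipschitz flux need not
  have.\<close>

lemma slope:
  assumes "x \<in> {lo..hi}" "y \<in> {lo..hi}"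
  shows "\<exists>q\<ge>0. q \<le> L \<and> \<phi> y - \<phi> x = \<sigma> * q * (y - x)"
proof (cases "x = y")
  case False
  have "0 \<le> (\<sigma> * \<phi> y - \<sigma> * \<phi> x) / (y - x)"
    using strict[of x y] strict[of y x] assms False by (cases "x < y") (auto simp: zero_le_divide_iff)
  moreover have "(\<sigma> * \<phi> y - \<sigma> * \<phi> x) / (y - x) \<le> L"
  proof -
    have "\<bar>\<sigma> * \<phi> y - \<sigma> * \<phi> x\<bar> = \<bar>\<phi> y - \<phi> x\<bar>" using sig by auto
    also have "\<dots> \<le> L * \<bar>y - x\<bar>" using lip assms by blast
    finally have "\<bar>(\<sigma> * \<phi> y - \<sigma> * \<phi> x) / (y - x)\<bar> \<le> L"
      using False by (simp add: pos_divide_le_eq)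
    then show ?thesis by linarith
  qed
  moreover have "\<phi> y - \<phi> x = \<sigma> * ((\<sigma> * \<phi> y - \<sigma> * \<phi> x) / (y - x)) * (y - x)"
  proof -
    have "\<sigma> * ((\<sigma> * \<phi> y - \<sigma> * \<phi> x) / (y - x)) * (y - x) = \<sigma> * (\<sigma> * \<phi> y - \<sigma> * \<phi> x)"
      using False by simp
    also have "\<dots> = \<phi> y - \<phi> x" by (simp add: right_diff_distrib)
    finally show ?thesis by simp
  qed
  ultimately show ?thesis by blast
qed (use L_nonneg in auto)

text \<open>Multiply the update by the secant slope \<open>q\<close> of \<open>\<phi>\<close>
  between the old and the new value: both sides become flux differences, and
  \<open>\<theta> = \<mu> * q\<close> is at most \<open>1\<close> by the CFL condition.\<close>

lemma flux_advection:
  assumes sch: "scheme h u"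
  shows "\<exists>\<theta>\<ge>0. \<theta> \<le> 1 \<and> \<phi> (u (Suc n) (Suc l)) = \<phi> (u n (Suc l))
    + \<theta> * (\<phi> (u n (if \<sigma> = 1 then l else Suc (Suc l))) - \<phi> (u n (Suc l)))"
proof -
  obtain q where q: "q \<ge> 0" "q \<le> L"
    "\<phi> (u (Suc n) (Suc l)) - \<phi> (u n (Suc l)) = \<sigma> * q * (u (Suc n) (Suc l) - u n (Suc l))"
    using slope[OF scheme_range[OF sch] scheme_range[OF sch]] by blast
  have "\<mu> * q \<le> \<mu> * L" using q mu_pos by simp
  then have "\<mu> * q \<le> 1" using cfl by linarith
  moreover have "0 \<le> \<mu> * q" using q mu_pos by simp
  moreover have "\<phi> (u (Suc n) (Suc l)) = \<phi> (u n (Suc l))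
      + \<mu> * q * (\<phi> (u n (if \<sigma> = 1 then l else Suc (Suc l))) - \<phi> (u n (Suc l)))"
  proof (cases "\<sigma> = 1")
    case True
    then show ?thesis using q(3) unfolding scheme_step[OF sch] flux_out[OF True]
      by (simp add: algebra_simps)
  next
    case False
    then have "\<sigma> = -1" using sig by auto
    with False show ?thesis using q(3) unfolding scheme_step[OF sch] flux_in[OF False]
      by (simp add: algebra_simps)
  qed
  ultimately show ?thesis by blast
qed

lemma flux_variation_init:
  assumes sch: "scheme h u"
    and V: "\<And>J. (\<Sum>l<J. \<bar>u 0 (Suc (Suc l)) - u 0 (Suc l)\<bar>) \<le> V"
  shows "(\<Sum>l<J. \<bar>\<phi> (u 0 (Suc (Suc l))) - \<phi> (u 0 (Suc l))\<bar>) \<le> L * V"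
proof -
  have "(\<Sum>l<J. \<bar>\<phi> (u 0 (Suc (Suc l))) - \<phi> (u 0 (Suc l))\<bar>)
      \<le> (\<Sum>l<J. L * \<bar>u 0 (Suc (Suc l)) - u 0 (Suc l)\<bar>)"
    by (intro sum_mono lip scheme_range[OF sch])
  also have "\<dots> \<le> L * V" using V L_nonneg by (simp add: sum_distrib_left[symmetric] mult_left_mono)
  finally show ?thesis .
qed

lemma flux_jump_bound: "scheme h u \<Longrightarrow> \<bar>\<phi> (u n l) - \<phi> (u n' l')\<bar> \<le> 2 * M"
  using scheme_bound(2)[of h u n l] scheme_bound(2)[of h u n' l'] by linarith

lemma flux_variation_out:
  assumes sch: "scheme h u" and s: "\<sigma> = 1"
    and V: "\<And>J. (\<Sum>l<J. \<bar>u 0 (Suc (Suc l)) - u 0 (Suc l)\<bar>) \<le> V"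
    and B: "(\<Sum>m<n. \<bar>\<phi> (u (Suc m) 0) - \<phi> (u m 0)\<bar>) \<le> B"
  shows "(\<Sum>l<J. \<bar>\<phi> (u n (Suc l)) - \<phi> (u n l)\<bar>) \<le> 2 * M + L * V + B"
proof -
  define \<theta> where "\<theta> = (\<lambda>n l. SOME \<theta>. 0 \<le> \<theta> \<and> \<theta> \<le> 1 \<and> \<phi> (u (Suc n) (Suc l)) = \<phi> (u n (Suc l))
      + \<theta> * (\<phi> (u n l) - \<phi> (u n (Suc l))))"
  have "0 \<le> \<theta> n l \<and> \<theta> n l \<le> 1 \<and> \<phi> (u (Suc n) (Suc l)) = \<phi> (u n (Suc l))
      + \<theta> n l * (\<phi> (u n l) - \<phi> (u n (Suc l)))" for n l
    unfolding \<theta>_def by (rule someI_ex) (use flux_advection[OF sch, of n l] s in auto)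
  then have \<theta>: "\<And>n l. 0 \<le> \<theta> n l" "\<And>n l. \<theta> n l \<le> 1" "\<And>n l. \<phi> (u (Suc n) (Suc l)) = \<phi> (u n (Suc l))
      + \<theta> n l * (\<phi> (u n l) - \<phi> (u n (Suc l)))" by blast+
  have "(\<Sum>l<J. \<bar>\<phi> (u n (Suc l)) - \<phi> (u n l)\<bar>)
      \<le> (\<Sum>l<J. \<bar>\<phi> (u 0 (Suc l)) - \<phi> (u 0 l)\<bar>) + (\<Sum>m<n. \<bar>\<phi> (u (Suc m) 0) - \<phi> (u m 0)\<bar>)"
    by (rule flux_variation_outgoing[where p = "\<lambda>n l. \<phi> (u n l)", OF \<theta>(3,1,2)])
  \<comment> \<open>\<open>2 * M\<close> pays for the initial jump between cell \<open>0\<close> and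
    cell \<open>1\<close>, which \<open>V\<close> does not see.\<close>
  moreover have "(\<Sum>l<J. \<bar>\<phi> (u 0 (Suc l)) - \<phi> (u 0 l)\<bar>) \<le> 2 * M + L * V"
    using flux_variation_init[OF sch V] flux_jump_bound[OF sch] M_nonneg by (intro sum_first) auto
  ultimately show ?thesis using B by linarith
qed

text \<open>The second bound concerns the flux that reaches the vertex; it is the only information
  about incoming edges that the variation estimate at the vertex uses.\<close>

lemma flux_variation_in:
  assumes sch: "scheme h u" and s: "\<sigma> \<noteq> 1"
    and V: "\<And>J. (\<Sum>l<J. \<bar>u 0 (Suc (Suc l)) - u 0 (Suc l)\<bar>) \<le> V"
  shows "(\<Sum>l<J. \<bar>\<phi> (u n (Suc l)) - \<phi> (u n l)\<bar>) \<le> 2 * M + L * V"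
    and "(\<Sum>m<n. \<bar>\<phi> (u (Suc m) (Suc 0)) - \<phi> (u m (Suc 0))\<bar>) \<le> L * V"
proof -
  define \<theta> where "\<theta> = (\<lambda>n l. SOME \<theta>. 0 \<le> \<theta> \<and> \<theta> \<le> 1 \<and> \<phi> (u (Suc n) (Suc l)) = \<phi> (u n (Suc l))
      + \<theta> * (\<phi> (u n (Suc (Suc l))) - \<phi> (u n (Suc l))))"
  have "0 \<le> \<theta> n l \<and> \<theta> n l \<le> 1 \<and> \<phi> (u (Suc n) (Suc l)) = \<phi> (u n (Suc l))
      + \<theta> n l * (\<phi> (u n (Suc (Suc l))) - \<phi> (u n (Suc l)))" for n l
    unfolding \<theta>_def by (rule someI_ex) (use flux_advection[OF sch, of n l] s in auto)
  then have \<theta>: "\<And>n l. 0 \<le> \<theta> n l" "\<And>n l. \<theta> n l \<le> 1" "\<And>n l. \<phi> (u (Suc n) (Suc l)) = \<phi> (u n (Suc l))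
      + \<theta> n l * (\<phi> (u n (Suc (Suc l))) - \<phi> (u n (Suc l)))" by blast+
  \<comment> \<open>Applied with indices shifted by one: cell \<open>0\<close> is not updated by the
    edge, so the advected sequence begins with cell \<open>1\<close>.\<close>
  have *: "(\<Sum>l<J. \<bar>\<phi> (u n (Suc (Suc l))) - \<phi> (u n (Suc l))\<bar>)
      + (\<Sum>m<n. \<bar>\<phi> (u (Suc m) (Suc 0)) - \<phi> (u m (Suc 0))\<bar>)
      \<le> (\<Sum>l<J+n. \<bar>\<phi> (u 0 (Suc (Suc l))) - \<phi> (u 0 (Suc l))\<bar>)" for J
    by (rule flux_variation_incoming[where p = "\<lambda>n l. \<phi> (u n (Suc l))", OF \<theta>(3,1,2)])
  have **: "(\<Sum>l<J. \<bar>\<phi> (u 0 (Suc (Suc l))) - \<phi> (u 0 (Suc l))\<bar>) \<le> L * V" for J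
    by (rule flux_variation_init[OF sch V])
  show "(\<Sum>m<n. \<bar>\<phi> (u (Suc m) (Suc 0)) - \<phi> (u m (Suc 0))\<bar>) \<le> L * V"
    using *[of 0] **[of n] by simp
  have "0 \<le> (\<Sum>m<n. \<bar>\<phi> (u (Suc m) (Suc 0)) - \<phi> (u m (Suc 0))\<bar>)" by (rule sum_nonneg) simp
  then have "(\<Sum>l<J. \<bar>\<phi> (u n (Suc (Suc l))) - \<phi> (u n (Suc l))\<bar>) \<le> L * V"
    using *[of J] **[of "J + n"] by linarith
  then show "(\<Sum>l<J. \<bar>\<phi> (u n (Suc l)) - \<phi> (u n l)\<bar>) \<le> 2 * M + L * V"
    using flux_jump_bound[OF sch] M_nonneg by (intro sum_first) auto
qed

text \<open>The discrete conservation law on \<open>[0, \<rho>] \<times> [0, t]\<close>.  For an incoming edge the flux through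
  \<open>\<rho>\<close> inside the vertex cell is unrelated to the numerical fluxes of the edge, whence the restriction
  on \<open>\<rho>\<close>.\<close>

lemma conservation_defect:
  assumes sch: "scheme h u" and \<rho>: "h / 2 \<le> \<rho>" and t: "0 \<le> t"
  defines "n \<equiv> nat \<lfloor>t / (\<mu> * h)\<rfloor>"
  shows "\<bar>integral {0..\<rho>} (\<lambda>x. u n (nat (round (x / h))))
    + integral {0..t} (\<lambda>\<tau>. \<phi> (u (nat \<lfloor>\<tau> / (\<mu> * h)\<rfloor>) (nat (round (\<rho> / h)))))
    - P \<rho> - \<mu> * h * (\<Sum>m<n. flux (u m 0) (u m (Suc 0)))\<bar> \<le> (5 + \<mu>) * M * h"
proof -
  have h: "h > 0" "\<mu> * h > 0" using scheme_h[OF sch] mu_pos by auto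
  have \<rho>0: "\<rho> \<ge> 0" using \<rho> h by linarith
  define j where "j = nat (round (\<rho> / h))"
  interpret step_grid "\<lambda>x. nat (round (x / h))" "\<lambda>l. (real l + 1/2) * h"
    using h(1) by (rule step_grid_space)
  have "0 < j" using idx[of \<rho> 0] \<rho> \<rho>0 by (simp add: j_def)
  then obtain i where j: "j = Suc i" using not0_implies_Suc by auto
  have xj: "\<rho> < (real j + 1/2) * h" "(real j + 1/2) * h \<le> \<rho> + h"
    unfolding j_def using nat_round_bounds[OF h(1) \<rho>0] by auto
  have MP: "M * \<bar>a\<bar> \<le> M * h" if "\<bar>a\<bar> \<le> h" for a using that M_nonneg by (rule mult_left_mono)
  have pP: "\<bar>P ((real j + 1/2) * h) - P \<rho>\<bar> \<le> M * h"
    using P_lip[of "(real j + 1/2) * h" \<rho>] MP[of "(real j + 1/2) * h - \<rho>"] xj \<rho>0 by linarith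
  have "\<bar>((real i + 1/2) * h - \<rho>)\<bar> \<le> h" using xj by (simp add: j algebra_simps abs_le_iff)
  then have pPi: "\<bar>P ((real i + 1/2) * h) - P \<rho>\<bar> \<le> M * h"
    using P_lip[of "(real i + 1/2) * h" \<rho>] MP[of "(real i + 1/2) * h - \<rho>"] h \<rho>0 by force
  have pP0: "\<bar>P ((real 0 + 1/2) * h)\<bar> \<le> M * h"
    using P_lip[of "h/2" 0] P_0 MP[of "h/2"] h by simp
  have A: "\<bar>integral {0..\<rho>} (\<lambda>x. u n (nat (round (x / h)))) - (pot h u n j - pot h u n 0)\<bar> \<le> 2 * M * h"
    unfolding j_def by (rule space_integral_pot[OF sch \<rho>0])
  define g where "g = (\<lambda>\<tau>. \<phi> (u (nat \<lfloor>\<tau> / (\<mu> * h)\<rfloor>) j))"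
  define s where "s = real n * (\<mu> * h)"
  have s: "0 \<le> s" "s \<le> t" "t < s + \<mu> * h"
    using nat_floor_bounds[OF h(2) t] h by (auto simp: s_def n_def)
  have gb: "\<bar>g \<tau>\<bar> \<le> M" for \<tau> unfolding g_def by (rule scheme_bound(2)[OF sch])
  have "g \<in> borel_measurable borel"
    unfolding g_def using step_borel_measurable(2)[of "\<lambda>m. \<phi> (u m j)" "\<mu> * h"] by simp
  then have gi: "g integrable_on {a..b}" for a b using gb by (rule bounded_borel_integrable_on)
  have "integral {0..s} g = \<mu> * h * (\<Sum>m<n. \<phi> (u m j))"
    unfolding g_def s_def by (rule time_step_integral[OF h(2)])
  moreover have "integral {0..s} g + integral {s..t} g = integral {0..t} g"
    using s gi by (intro Henstock_Kurzweil_Integration.integral_combine) auto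
  moreover have "\<bar>integral {s..t} g\<bar> \<le> M * (\<mu> * h)"
  proof -
    have "\<bar>integral {s..t} g\<bar> \<le> M * (t - s)" using s gi gb by (intro abs_integral_bound) auto
    also have "\<dots> \<le> M * (\<mu> * h)" using s M_nonneg by (intro mult_left_mono) auto
    finally show ?thesis .
  qed
  ultimately have B: "\<bar>integral {0..t} g - \<mu> * h * (\<Sum>m<n. \<phi> (u m j))\<bar> \<le> M * (\<mu> * h)" by linarith
  have H: "\<mu> * h * (\<Sum>m<n. flux (u m 0) (u m (Suc 0))) = P ((real 0 + 1/2) * h) - pot h u n 0"
    by (simp add: pot_def)
  \<comment> \<open>The values in cell \<open>j\<close> are the fluxes through interface
    \<open>j\<close> if \<open>\<sigma> = 1\<close>, but through interface \<open>j - 1\<close>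
    otherwise. In the second case the argument runs at the interface one cell nearer to the vertex,
    at the price of \<open>h * u n j\<close>.\<close>
  have C: "\<bar>pot h u n j + \<mu> * h * (\<Sum>m<n. \<phi> (u m j)) - P \<rho>\<bar> \<le> 2 * (M * h)"
  proof (cases "\<sigma> = 1")
    case True
    have "pot h u n j + \<mu> * h * (\<Sum>m<n. \<phi> (u m j)) = P ((real j + 1/2) * h)"
      unfolding pot_def flux_out[OF True] by simp
    moreover have "0 \<le> M * h" using M_nonneg h by simp
    ultimately show ?thesis using pP by linarith
  next
    case False
    have "pot h u n i + \<mu> * h * (\<Sum>m<n. \<phi> (u m j)) = P ((real i + 1/2) * h)"
      unfolding pot_def flux_in[OF False] by (simp add: j)
    moreover have "pot h u n j - pot h u n i = h * u n j" unfolding j by (rule pot_diff[OF sch])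
    moreover have "\<bar>h * u n j\<bar> \<le> M * h" using scheme_bound(1)[OF sch, of n j] h by (simp add: abs_mult)
    ultimately show ?thesis using pPi by linarith
  qed
  have "\<bar>integral {0..\<rho>} (\<lambda>x. u n (nat (round (x / h)))) + integral {0..t} g
    - P \<rho> - \<mu> * h * (\<Sum>m<n. flux (u m 0) (u m (Suc 0)))\<bar> \<le> 2 * M * h + M * (\<mu> * h) + 2 * (M * h) + M * h"
    using A B C H pP0 by linarith
  also have "\<dots> = (5 + \<mu>) * M * h" by (simp add: algebra_simps)
  finally show ?thesis by (simp add: g_def j_def)
qed

end

lemma le_sqrt:
  fixes a :: real
  assumes "0 \<le> a" "a \<le> 1"
  shows "a \<le> sqrt a"
  using assms by (intro real_le_rsqrt) (simp add: power2_eq_square mult_left_le)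

section \<open>The upwind scheme on a star of half lines\<close>

text \<open>\<open>u h k n l\<close> is the value on edge \<open>k\<close>, in cell \<open>l\<close> after \<open>n\<close> steps, for the mesh width \<open>h\<close>;
  \<open>v h n\<close> is the value at the vertex.\<close>

locale upwind_star =
  fixes K :: "'k set" and \<phi> :: "'k \<Rightarrow> real \<Rightarrow> real" and \<sigma> lo hi :: "'k \<Rightarrow> real" and L \<mu> M V T :: real
    and P :: "'k \<Rightarrow> real \<Rightarrow> real" and u :: "real \<Rightarrow> 'k \<Rightarrow> nat \<Rightarrow> nat \<Rightarrow> real" and v :: "real \<Rightarrow> nat \<Rightarrow> real"
  assumes fin: "finite K" and ne: "K \<noteq> {}"
    and edge: "\<And>k. k \<in> K \<Longrightarrow> upwind_edge (\<phi> k) (\<sigma> k) (lo k) (hi k) L \<mu> M (P k)"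
    and sch: "\<And>k h. k \<in> K \<Longrightarrow> h > 0 \<Longrightarrow>
      upwind_edge.scheme (\<phi> k) (\<sigma> k) (lo k) (hi k) \<mu> (P k) h (u h k)"
    and vertex: "\<And>k h n. k \<in> K \<Longrightarrow> h > 0 \<Longrightarrow> u h k n 0 = v h n"
    and vertex_step: "\<And>h n. h > 0 \<Longrightarrow> v h (Suc n) = v h n - 2 * \<mu> / real (card K) *
      (\<Sum>k\<in>K. upwind_edge.flux (\<phi> k) (\<sigma> k) (u h k n 0) (u h k n (Suc 0)))"
    and cfl2: "\<mu> * L \<le> 1 / 2"
    and var: "\<And>k h J. k \<in> K \<Longrightarrow> h > 0 \<Longrightarrow> (\<Sum>l<J. \<bar>u h k 0 (Suc (Suc l)) - u h k 0 (Suc l)\<bar>) \<le> V"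
    and T_pos: "T > 0"
begin

abbreviation "N \<equiv> real (card K)"
abbreviation "fl k \<equiv> upwind_edge.flux (\<phi> k) (\<sigma> k)"
abbreviation "Pot h k \<equiv> upwind_edge.pot (\<phi> k) (\<sigma> k) \<mu> (P k) h (u h k)"

definition outg :: "'k set" where "outg = {k \<in> K. \<sigma> k = 1}"
definition g :: "real \<Rightarrow> real" where "g a = (\<Sum>k\<in>outg. \<phi> k a)"
text \<open>Fluxes are oriented away from the vertex, so what arrives there carries a minus
  sign.\<close>

definition inflow :: "real \<Rightarrow> nat \<Rightarrow> real" where "inflow h n = - (\<Sum>k\<in>K - outg. \<phi> k (u h k n (Suc 0)))"
text \<open>The time step \<open>\<mu> * h\<close> over the length \<open>N * h / 2\<close> of the
  vertex cell.\<close>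

definition vrate :: real where "vrate = 2 * \<mu> / N"
definition sol :: "real \<Rightarrow> 'k \<Rightarrow> real \<times> real \<Rightarrow> real" where
  "sol h k = (\<lambda>(x, t). u h k (nat \<lfloor>t / (\<mu> * h)\<rfloor>) (nat (round (x / h))))"

lemma outg: "outg \<subseteq> K" "finite outg" "finite (K - outg)"
  using fin by (auto simp: outg_def)

lemma N_pos: "N > 0"
  using fin ne by (simp add: card_gt_0_iff)

lemma some_edge:
  obtains k where "k \<in> K"
  using ne by blast

lemma params: "L \<ge> 0" "\<mu> > 0" "M \<ge> 0" "V \<ge> 0" "vrate > 0"
proof -
  obtain k where k: "k \<in> K" by (rule some_edge)
  interpret e: upwind_edge "\<phi> k" "\<sigma> k" "lo k" "hi k" L \<mu> M "P k" by (rule edge[OF k])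
  show "L \<ge> 0" "\<mu> > 0" "M \<ge> 0" by (rule e.L_nonneg e.mu_pos e.M_nonneg)+
  then show "vrate > 0" unfolding vrate_def using N_pos by simp
  show "V \<ge> 0" using var[OF k, of 1 0] by simp
qed

lemma v_range: "k \<in> K \<Longrightarrow> h > 0 \<Longrightarrow> v h n \<in> {lo k..hi k}"
  using upwind_edge.scheme_range[OF edge sch] vertex by metis

lemma v_bound: "h > 0 \<Longrightarrow> \<bar>v h n\<bar> \<le> M"
  by (metis some_edge upwind_edge.M_bound(1) edge v_range)

lemma g_bound: "h > 0 \<Longrightarrow> \<bar>g (v h n)\<bar> \<le> N * M"
proof -
  assume h: "h > 0"
  have "\<bar>g (v h n)\<bar> \<le> (\<Sum>k\<in>outg. \<bar>\<phi> k (v h n)\<bar>)" unfolding g_def by (rule sum_abs)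
  also have "\<dots> \<le> (\<Sum>k\<in>outg. M)"
    using outg(1) by (intro sum_mono upwind_edge.M_bound(2)[OF edge] v_range h) auto
  also have "\<dots> \<le> N * M" using outg fin params by (auto simp: card_mono mult_right_mono)
  finally show ?thesis .
qed

text \<open>Up to \<open>N\<close> secant slopes of size \<open>L\<close> add up, and
  \<open>vrate\<close> contributes \<open>2 * \<mu> / N\<close>. Hence the vertex needs
  \<open>2 * \<mu> * L \<le> 1\<close>, twice as strict as the condition on an edge.\<close>

lemma g_slope:
  assumes "h > 0" "h' > 0"
  shows "\<exists>q\<ge>0. vrate * q \<le> 1 \<and> g (v h n) - g (v h' m) = q * (v h n - v h' m)"
proof -
  have "\<forall>k\<in>outg. \<exists>q\<ge>0. q \<le> L \<and> \<phi> k (v h n) - \<phi> k (v h' m) = q * (v h n - v h' m)"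
  proof
    fix k assume "k \<in> outg"
    then have k: "k \<in> K" "\<sigma> k = 1" by (auto simp: outg_def)
    show "\<exists>q\<ge>0. q \<le> L \<and> \<phi> k (v h n) - \<phi> k (v h' m) = q * (v h n - v h' m)"
      using upwind_edge.slope[OF edge[OF k(1)] v_range[OF k(1) assms(2)] v_range[OF k(1) assms(1)]]
      by (simp add: k(2))
  qed
  then obtain q where q: "\<And>k. k \<in> outg \<Longrightarrow> 0 \<le> q k" "\<And>k. k \<in> outg \<Longrightarrow> q k \<le> L"
    "\<And>k. k \<in> outg \<Longrightarrow> \<phi> k (v h n) - \<phi> k (v h' m) = q k * (v h n - v h' m)" by metis
  have "(\<Sum>k\<in>outg. q k) \<le> (\<Sum>k\<in>outg. L)" using q by (intro sum_mono)
  also have "\<dots> \<le> N * L" using outg fin params by (auto simp: card_mono mult_right_mono)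
  finally have "vrate * (\<Sum>k\<in>outg. q k) \<le> vrate * (N * L)" using params by simp
  also have "\<dots> = 2 * (\<mu> * L)" using N_pos by (simp add: vrate_def)
  finally have "vrate * (\<Sum>k\<in>outg. q k) \<le> 1" using cfl2 by linarith
  moreover have "g (v h n) - g (v h' m) = (\<Sum>k\<in>outg. q k) * (v h n - v h' m)"
    by (simp add: g_def sum_subtractf[symmetric] q(3) sum_distrib_right)
  moreover have "0 \<le> (\<Sum>k\<in>outg. q k)" using q by (intro sum_nonneg)
  ultimately show ?thesis by blast
qed

text \<open>All outgoing fluxes are increasing, so their differences have the same sign and nothing
  cancels in \<open>g\<close>. Control of the sum therefore controls every summand.\<close>

lemma outgoing_flux_le_g:
  assumes "k \<in> outg" "h > 0" "h' > 0"
  shows "\<bar>\<phi> k (v h n) - \<phi> k (v h' m)\<bar> \<le> \<bar>g (v h n) - g (v h' m)\<bar>"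
proof -
  have *: "\<phi> k b - \<phi> k a \<le> g b - g a" "\<phi> k a \<le> \<phi> k b"
    if ab: "a \<le> b" "\<And>j. j \<in> K \<Longrightarrow> a \<in> {lo j..hi j}" "\<And>j. j \<in> K \<Longrightarrow> b \<in> {lo j..hi j}" for a b
  proof -
    have nn: "0 \<le> \<phi> j b - \<phi> j a" if "j \<in> outg" for j
      using upwind_edge.mono[OF edge, of j a b] that ab by (auto simp: outg_def)
    have "\<phi> k b - \<phi> k a \<le> (\<Sum>j\<in>outg. \<phi> j b - \<phi> j a)"
      using nn outg(2) assms(1) by (intro member_le_sum) auto
    then show "\<phi> k b - \<phi> k a \<le> g b - g a" by (simp add: g_def sum_subtractf)
    show "\<phi> k a \<le> \<phi> k b" using nn[OF assms(1)] by simp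
  qed
  show ?thesis
    using *(1,2)[of "v h n" "v h' m"] *(1,2)[of "v h' m" "v h n"] v_range assms
    by (cases "v h n \<le> v h' m") auto
qed

lemma flux_sum_split: "h > 0 \<Longrightarrow>
  (\<Sum>k\<in>K. fl k (u h k n 0) (u h k n (Suc 0))) = g (v h n) - inflow h n"
proof -
  assume h: "h > 0"
  have "fl k (u h k n 0) (u h k n (Suc 0)) = \<phi> k (v h n)" if "k \<in> outg" for k
  proof -
    have k: "k \<in> K" "\<sigma> k = 1" using that by (auto simp: outg_def)
    show ?thesis unfolding upwind_edge.flux_out[OF edge[OF k(1)] k(2)] using vertex k h by simp
  qed
  moreover have "fl k (u h k n 0) (u h k n (Suc 0)) = \<phi> k (u h k n (Suc 0))" if "k \<in> K - outg" for k
  proof -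
    have k: "k \<in> K" "\<sigma> k \<noteq> 1" using that by (auto simp: outg_def)
    show ?thesis by (rule upwind_edge.flux_in[OF edge[OF k(1)] k(2)])
  qed
  ultimately show ?thesis
    using sum.subset_diff[OF outg(1) fin, of "\<lambda>k. fl k (u h k n 0) (u h k n (Suc 0))"]
    by (simp add: g_def inflow_def)
qed

lemma v_step: "h > 0 \<Longrightarrow> v h (Suc n) = v h n - vrate * (g (v h n) - inflow h n)"
  by (simp add: vertex_step flux_sum_split vrate_def)

lemma v_sum: "h > 0 \<Longrightarrow> v h n = v h 0 - vrate * (\<Sum>m<n. g (v h m) - inflow h m)"
  by (induction n) (simp_all add: v_step algebra_simps)

lemma inflow_variation:
  assumes "h > 0"
  shows "(\<Sum>m<n. \<bar>inflow h (Suc m) - inflow h m\<bar>) \<le> N * (L * V)"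
proof -
  have "(\<Sum>m<n. \<bar>inflow h (Suc m) - inflow h m\<bar>)
      \<le> (\<Sum>m<n. \<Sum>k\<in>K - outg. \<bar>\<phi> k (u h k (Suc m) (Suc 0)) - \<phi> k (u h k m (Suc 0))\<bar>)"
  proof (rule sum_mono)
    fix m
    have "inflow h (Suc m) - inflow h m = - (\<Sum>k\<in>K - outg. \<phi> k (u h k (Suc m) (Suc 0)) - \<phi> k (u h k m (Suc 0)))"
      by (simp add: inflow_def sum_subtractf)
    then show "\<bar>inflow h (Suc m) - inflow h m\<bar>
        \<le> (\<Sum>k\<in>K - outg. \<bar>\<phi> k (u h k (Suc m) (Suc 0)) - \<phi> k (u h k m (Suc 0))\<bar>)"
      by (simp add: sum_abs)
  qed
  also have "\<dots> = (\<Sum>k\<in>K - outg. \<Sum>m<n. \<bar>\<phi> k (u h k (Suc m) (Suc 0)) - \<phi> k (u h k m (Suc 0))\<bar>)"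
    by (rule sum.swap)
  also have "\<dots> \<le> (\<Sum>k\<in>K - outg. L * V)"
  proof (rule sum_mono)
    fix k assume "k \<in> K - outg"
    then have k: "k \<in> K" "\<sigma> k \<noteq> 1" by (auto simp: outg_def)
    show "(\<Sum>m<n. \<bar>\<phi> k (u h k (Suc m) (Suc 0)) - \<phi> k (u h k m (Suc 0))\<bar>) \<le> L * V"
      by (rule upwind_edge.flux_variation_in(2)[OF edge[OF k(1)] sch[OF k(1) assms] k(2) var[OF k(1) assms]])
  qed
  also have "\<dots> \<le> N * (L * V)" using outg fin params by (auto simp: card_mono intro!: mult_right_mono)
  finally show ?thesis .
qed

text \<open>The vertex value itself need not have bounded variation, but \<open>g\<close> of it does.\<close>

definition G :: real where "G = 2 * M / vrate + N * (L * V)"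

lemma g_variation:
  assumes h: "h > 0"
  shows "(\<Sum>m<n. \<bar>g (v h (Suc m)) - g (v h m)\<bar>) \<le> G"
proof -
  define w where "w = (\<lambda>n. v h (Suc n) - v h n)"
  define dg where "dg = (\<lambda>n. g (v h (Suc n)) - g (v h n))"
  define di where "di = (\<lambda>n. inflow h (Suc n) - inflow h n)"
  \<comment> \<open>The increment of the vertex value is damped by the factor
    \<open>1 - vrate * q\<close>, and the amount lost is exactly \<open>vrate * |dg n|\<close>.
    Summing up, the variation of \<open>g\<close> is paid for by the first increment, at most
    \<open>2 * M\<close>, and by the variation of the inflow.\<close>
  have step: "\<bar>w (Suc n)\<bar> + vrate * \<bar>dg n\<bar> \<le> \<bar>w n\<bar> + vrate * \<bar>di n\<bar>" for n
  proof -
    obtain q where q: "q \<ge> 0" "vrate * q \<le> 1" "dg n = q * w n"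
      using g_slope[OF h h, of "Suc n" n] by (auto simp: dg_def w_def)
    have "w (Suc n) = w n - vrate * dg n + vrate * di n"
      using v_step[OF h, of "Suc n"] v_step[OF h, of n]
      unfolding w_def dg_def di_def right_diff_distrib by linarith
    then have "w (Suc n) = (1 - vrate * q) * w n + vrate * di n"
      unfolding q(3) by (simp add: algebra_simps)
    then have "\<bar>w (Suc n)\<bar> \<le> \<bar>(1 - vrate * q) * w n\<bar> + \<bar>vrate * di n\<bar>" by linarith
    also have "\<dots> = (1 - vrate * q) * \<bar>w n\<bar> + vrate * \<bar>di n\<bar>"
      using q params by (simp add: abs_mult)
    finally show ?thesis using q by (simp add: abs_mult algebra_simps)
  qed
  have "\<bar>w n\<bar> + vrate * (\<Sum>m<n. \<bar>dg m\<bar>) \<le> \<bar>w 0\<bar> + vrate * (\<Sum>m<n. \<bar>di m\<bar>)" for n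
  proof (induction n)
    case (Suc n)
    then show ?case using step[of n] by (simp add: distrib_left)
  qed simp
  moreover have "(\<Sum>m<n. \<bar>di m\<bar>) \<le> N * (L * V)" unfolding di_def by (rule inflow_variation[OF h])
  then have "vrate * (\<Sum>m<n. \<bar>di m\<bar>) \<le> vrate * (N * (L * V))" using params by simp
  moreover have "\<bar>w 0\<bar> \<le> 2 * M" using v_bound[OF h, of 0] v_bound[OF h, of "Suc 0"] by (simp add: w_def)
  ultimately have "vrate * (\<Sum>m<n. \<bar>dg m\<bar>) \<le> 2 * M + vrate * (N * (L * V))"
    by (smt (verit) abs_ge_zero)
  also have "\<dots> = vrate * G" using params by (simp add: G_def algebra_simps)
  finally show ?thesis using params by (simp add: dg_def)
qed

definition W :: real where "W = 2 * M + L * V + G"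

lemma G_nonneg: "G \<ge> 0"
  using g_variation[of 1 0] by simp

lemma flux_variation:
  assumes k: "k \<in> K" and h: "h > 0"
  shows "(\<Sum>l<J. \<bar>\<phi> k (u h k n (Suc l)) - \<phi> k (u h k n l)\<bar>) \<le> W"
proof (cases "\<sigma> k = 1")
  case True
  then have ko: "k \<in> outg" using k by (simp add: outg_def)
  have "(\<Sum>m<n. \<bar>\<phi> k (u h k (Suc m) 0) - \<phi> k (u h k m 0)\<bar>) \<le> (\<Sum>m<n. \<bar>g (v h (Suc m)) - g (v h m)\<bar>)"
    unfolding vertex[OF k h] by (intro sum_mono outgoing_flux_le_g ko h)
  also have "\<dots> \<le> G" by (rule g_variation[OF h])
  finally show ?thesis unfolding W_def
    by (rule upwind_edge.flux_variation_out[OF edge[OF k] sch[OF k h] True var[OF k h]])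
next
  case False
  have "(\<Sum>l<J. \<bar>\<phi> k (u h k n (Suc l)) - \<phi> k (u h k n l)\<bar>) \<le> 2 * M + L * V"
    by (rule upwind_edge.flux_variation_in(1)[OF edge[OF k] sch[OF k h] False var[OF k h]])
  then show ?thesis using G_nonneg by (simp add: W_def)
qed

abbreviation "rt \<equiv> upwind_edge.rate L \<mu> M T"

lemma rt_nonneg: "rt \<ge> 0"
proof -
  obtain k where k: "k \<in> K" by (rule some_edge)
  show ?thesis using T_pos by (intro upwind_edge.rate_nonneg[OF edge[OF k]]) simp
qed

definition vflux :: "real \<Rightarrow> real \<Rightarrow> real" where
  "vflux h t = g (v h (nat \<lfloor>t / (\<mu> * h)\<rfloor>))"

lemma vflux_props:
  assumes "h > 0"
  shows "vflux h \<in> borel_measurable borel" "\<bar>vflux h t\<bar> \<le> N * M" "vflux h integrable_on {a..b}"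
proof -
  show 1: "vflux h \<in> borel_measurable borel"
    unfolding vflux_def using step_borel_measurable(2)[of "\<lambda>m. g (v h m)" "\<mu> * h"] by simp
  have 2: "\<bar>vflux h t\<bar> \<le> N * M" for t unfolding vflux_def by (rule g_bound[OF assms])
  then show "\<bar>vflux h t\<bar> \<le> N * M" .
  show "vflux h integrable_on {a..b}" by (rule bounded_borel_integrable_on[OF 1 2])
qed

text \<open>Summing the vertex updates trades \<open>g\<close> for the inflow plus the change of
  content of the vertex cell, and the summed inflow is the change of the incoming potentials at
  interface \<open>0\<close>. In the bound, \<open>\<mu>\<close> accounts for the unfinished last
  time step and \<open>1\<close> for the content of the vertex cell.\<close>

lemma vflux_primitive:
  assumes h: "h > 0" and t: "t \<ge> 0"
  defines "n \<equiv> nat \<lfloor>t / (\<mu> * h)\<rfloor>"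
  shows "\<bar>integral {0..t} (vflux h) - (\<Sum>k\<in>K - outg. Pot h k n 0 - P k (h / 2))\<bar>
    \<le> N * M * (\<mu> + 1) * h"
proof -
  have mh: "\<mu> * h > 0" using h params by simp
  define s where "s = real n * (\<mu> * h)"
  have s: "0 \<le> s" "s \<le> t" "t < s + \<mu> * h"
    using nat_floor_bounds[OF mh t] mh by (auto simp: s_def n_def)
  have "integral {0..s} (vflux h) = \<mu> * h * (\<Sum>m<n. g (v h m))"
    unfolding vflux_def s_def by (rule time_step_integral[OF mh])
  moreover have "integral {0..s} (vflux h) + integral {s..t} (vflux h) = integral {0..t} (vflux h)"
    using s vflux_props(3)[OF h] by (intro Henstock_Kurzweil_Integration.integral_combine) auto
  moreover have "\<bar>integral {s..t} (vflux h)\<bar> \<le> N * M * (\<mu> * h)"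
  proof -
    have "\<bar>integral {s..t} (vflux h)\<bar> \<le> N * M * (t - s)"
      using s vflux_props[OF h] by (intro abs_integral_bound) auto
    also have "\<dots> \<le> N * M * (\<mu> * h)" using s params N_pos by (intro mult_left_mono) auto
    finally show ?thesis .
  qed
  moreover have "\<mu> * h * (\<Sum>m<n. g (v h m)) = \<mu> * h * (\<Sum>m<n. inflow h m) - N * h / 2 * (v h n - v h 0)"
  proof -
    have "vrate * (\<Sum>m<n. g (v h m)) = vrate * (\<Sum>m<n. inflow h m) - (v h n - v h 0)"
      using v_sum[OF h, of n] by (simp add: sum_subtractf algebra_simps)
    then have "N * h / 2 * (vrate * (\<Sum>m<n. g (v h m))) = N * h / 2 * (vrate * (\<Sum>m<n. inflow h m) - (v h n - v h 0))"
      by simp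
    then show ?thesis using N_pos by (simp add: vrate_def right_diff_distrib mult.commute mult.left_commute)
  qed
  moreover have "\<mu> * h * (\<Sum>m<n. inflow h m) = (\<Sum>k\<in>K - outg. Pot h k n 0 - P k (h / 2))"
  proof -
    have "Pot h k n 0 - P k (h / 2) = - (\<mu> * h * (\<Sum>m<n. \<phi> k (u h k m (Suc 0))))" if "k \<in> K - outg" for k
    proof -
      have k: "k \<in> K" "\<sigma> k \<noteq> 1" using that by (auto simp: outg_def)
      show ?thesis
        unfolding upwind_edge.pot_def[OF edge[OF k(1)]] upwind_edge.flux_in[OF edge[OF k(1)] k(2)] by simp
    qed
    then have "(\<Sum>k\<in>K - outg. Pot h k n 0 - P k (h / 2))
        = - (\<Sum>k\<in>K - outg. \<Sum>m<n. \<mu> * h * \<phi> k (u h k m (Suc 0)))"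
      by (simp add: sum_distrib_left sum_negf)
    also have "(\<Sum>k\<in>K - outg. \<Sum>m<n. \<mu> * h * \<phi> k (u h k m (Suc 0))) = (\<Sum>m<n. \<Sum>k\<in>K - outg. \<mu> * h * \<phi> k (u h k m (Suc 0)))"
      by (rule sum.swap)
    finally show ?thesis by (simp add: inflow_def sum_distrib_left sum_negf)
  qed
  moreover have "\<bar>N * h / 2 * (v h n - v h 0)\<bar> \<le> N * M * h"
  proof -
    have "\<bar>v h n - v h 0\<bar> \<le> 2 * M" using v_bound[OF h, of n] v_bound[OF h, of 0] by linarith
    then have "N * h / 2 * \<bar>v h n - v h 0\<bar> \<le> N * h / 2 * (2 * M)" using h N_pos by (intro mult_left_mono) auto
    moreover have "\<bar>N * h / 2 * (v h n - v h 0)\<bar> = N * h / 2 * \<bar>v h n - v h 0\<bar>"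
      unfolding abs_mult using h N_pos by simp
    moreover have "N * h / 2 * (2 * M) = N * M * h" by simp
    ultimately show ?thesis by linarith
  qed
  ultimately have "\<bar>integral {0..t} (vflux h) - (\<Sum>k\<in>K - outg. Pot h k n 0 - P k (h / 2))\<bar>
    \<le> N * M * (\<mu> * h) + N * M * h" by linarith
  then show ?thesis by (simp add: algebra_simps)
qed

lemma time_index_close:
  assumes "h > 0" "h' > 0" "t \<ge> 0"
  shows "real (nat \<lfloor>t / (\<mu> * h)\<rfloor>) * (\<mu> * h) \<le> t"
    "\<bar>real (nat \<lfloor>t / (\<mu> * h)\<rfloor>) * (\<mu> * h) - real (nat \<lfloor>t / (\<mu> * h')\<rfloor>) * (\<mu> * h')\<bar> \<le> \<mu> * (h + h')"
proof -
  have mh: "\<mu> * h > 0" "\<mu> * h' > 0" using assms params by auto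
  show "real (nat \<lfloor>t / (\<mu> * h)\<rfloor>) * (\<mu> * h) \<le> t" by (rule nat_floor_bounds(1)[OF mh(1) assms(3)])
  show "\<bar>real (nat \<lfloor>t / (\<mu> * h)\<rfloor>) * (\<mu> * h) - real (nat \<lfloor>t / (\<mu> * h')\<rfloor>) * (\<mu> * h')\<bar> \<le> \<mu> * (h + h')"
    using nat_floor_bounds[OF mh(1) assms(3)] nat_floor_bounds[OF mh(2) assms(3)] mh
    by (simp add: distrib_left)
qed

definition C1 :: real where "C1 = N * (rt + M + M * (\<mu> + 1))"

lemma C1_nonneg: "C1 \<ge> 0"
  unfolding C1_def using params N_pos rt_nonneg by (simp add: add_nonneg_nonneg)

lemma vflux_primitive_close:
  assumes h: "h > 0" "h' > 0" "h + h' \<le> 1" and t: "0 \<le> t" "t \<le> T"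
  shows "\<bar>integral {0..t} (vflux h) - integral {0..t} (vflux h')\<bar> \<le> C1 * sqrt (h + h')"
proof -
  define n where "n = nat \<lfloor>t / (\<mu> * h)\<rfloor>"
  define m where "m = nat \<lfloor>t / (\<mu> * h')\<rfloor>"
  define r where "r = sqrt (h + h')"
  have r: "h + h' \<le> r" "0 \<le> r" unfolding r_def using h by (auto intro: le_sqrt)
  have nm: "real n * (\<mu> * h) \<le> T" "real m * (\<mu> * h') \<le> T"
    "\<bar>real n * (\<mu> * h) - real m * (\<mu> * h')\<bar> \<le> \<mu> * (h + h')"
    unfolding n_def m_def using time_index_close[OF h(1,2) t(1)] time_index_close(1)[OF h(2,1) t(1)] t by auto
  have each: "\<bar>(Pot h k n 0 - P k (h / 2)) - (Pot h' k m 0 - P k (h' / 2))\<bar> \<le> rt * r + M * r"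
    if "k \<in> K - outg" for k
  proof -
    have k: "k \<in> K" "\<sigma> k \<noteq> 1" using that by (auto simp: outg_def)
    have "\<bar>Pot h k n 0 - Pot h' k m 0\<bar> \<le> 0 + rt * sqrt (h + h')"
      using upwind_edge.pot_compare[OF edge[OF k(1)] sch[OF k(1) h(1)] sch[OF k(1) h(2)], of T 0 n m 0 0]
        T_pos k(2) h nm by simp
    moreover have "\<bar>P k (h / 2) - P k (h' / 2)\<bar> \<le> M * \<bar>h / 2 - h' / 2\<bar>"
      using h by (intro upwind_edge.P_lip[OF edge[OF k(1)]]) auto
    moreover have "M * \<bar>h / 2 - h' / 2\<bar> \<le> M * r" using h r params by (intro mult_left_mono) auto
    ultimately show ?thesis unfolding r_def by linarith
  qed
  have "\<bar>(\<Sum>k\<in>K - outg. Pot h k n 0 - P k (h / 2)) - (\<Sum>k\<in>K - outg. Pot h' k m 0 - P k (h' / 2))\<bar>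
      \<le> (\<Sum>k\<in>K - outg. \<bar>(Pot h k n 0 - P k (h / 2)) - (Pot h' k m 0 - P k (h' / 2))\<bar>)"
    unfolding sum_subtractf[symmetric] by (rule sum_abs)
  also have "\<dots> \<le> (\<Sum>k\<in>K - outg. rt * r + M * r)" by (rule sum_mono[OF each])
  also have "\<dots> \<le> N * (rt * r + M * r)"
    using outg fin params r rt_nonneg by (auto simp: card_mono intro!: mult_right_mono)
  finally have A: "\<bar>(\<Sum>k\<in>K - outg. Pot h k n 0 - P k (h / 2)) - (\<Sum>k\<in>K - outg. Pot h' k m 0 - P k (h' / 2))\<bar>
      \<le> N * (rt * r + M * r)" .
  have B: "N * M * (\<mu> + 1) * (h + h') \<le> N * M * (\<mu> + 1) * r"
    using r params N_pos by (intro mult_left_mono) auto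
  have "\<bar>integral {0..t} (vflux h) - integral {0..t} (vflux h')\<bar>
      \<le> N * (rt * r + M * r) + N * M * (\<mu> + 1) * (h + h')"
    using A vflux_primitive[OF h(1) t(1)] vflux_primitive[OF h(2) t(1)]
    unfolding n_def[symmetric] m_def[symmetric] by (simp add: distrib_left)
  also have "\<dots> \<le> C1 * r" using B by (simp add: C1_def algebra_simps)
  finally show ?thesis by (simp add: r_def)
qed

definition vdist :: "real \<Rightarrow> real \<Rightarrow> real" where
  "vdist h h' = integral {0..T} (\<lambda>t. \<bar>vflux h t - vflux h' t\<bar>)"

text \<open>The pairing argument in time. Here the difference \<open>w\<close> is tested against
  itself, so \<open>strict_mono_gap\<close> is replaced by
  \<open>|w| \<le> \<eta> + w\<^sup>2 / \<eta>\<close>; one factor \<open>w\<close> has a small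
  primitive, the other is a difference of two functions of bounded variation.\<close>

lemma vdist_bound:
  assumes h: "h > 0" "h' > 0" "h + h' \<le> 1" and \<eta>: "\<eta> > 0"
  shows "vdist h h' \<le> T * \<eta> + 4 * C1 * sqrt (h + h') * (N * M + G) / \<eta>"
proof -
  \<comment> \<open>A tail integral over \<open>[t, T]\<close> is the difference of two integrals
    from \<open>0\<close>, whence the factor \<open>2\<close>.\<close>
  define S where "S = 2 * (C1 * sqrt (h + h'))"
  have S: "S \<ge> 0" using C1_nonneg h by (simp add: S_def)
  define w where "w = (\<lambda>t. vflux h t - vflux h' t)"
  have mh: "\<mu> * h > 0" "\<mu> * h' > 0" using h params by auto
  have [measurable]: "vflux h \<in> borel_measurable borel" "vflux h' \<in> borel_measurable borel"
    using vflux_props(1) h by auto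
  have wm [measurable]: "w \<in> borel_measurable borel" unfolding w_def by measurable
  have NM: "0 \<le> N * M" using params N_pos by simp
  have vb: "\<bar>vflux h t\<bar> \<le> N * M" "\<bar>vflux h' t\<bar> \<le> N * M" for t using vflux_props(2) h by auto
  have wb: "\<bar>w t\<bar> \<le> 2 * (N * M)" for t using vb[of t] by (simp add: w_def)
  have wi: "w integrable_on {a..b}" for a b using wm wb by (rule bounded_borel_integrable_on)
  have prim: "\<bar>integral {0..t} w\<bar> \<le> C1 * sqrt (h + h')" if "0 \<le> t" "t \<le> T" for t
    using vflux_primitive_close[OF h that] unfolding w_def
    by (subst Henstock_Kurzweil_Integration.integral_diff) (auto intro: vflux_props(3) h)
  have tail: "\<bar>integral {t..T} w\<bar> \<le> S" if "0 \<le> t" "t \<le> T" for t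
  proof -
    have "integral {0..t} w + integral {t..T} w = integral {0..T} w"
      using that wi by (intro Henstock_Kurzweil_Integration.integral_combine) auto
    then show ?thesis using prim[of t] prim[of T] that T_pos by (simp add: S_def)
  qed
  have pair: "\<bar>integral {0..T} (\<lambda>t. w t * vflux h0 t)\<bar> \<le> S * (N * M + G)" if h0: "h0 > 0" for h0
  proof -
    have mh0: "\<mu> * h0 > 0" using h0 params by simp
    interpret step_grid "\<lambda>t. nat \<lfloor>t / (\<mu> * h0)\<rfloor>" "\<lambda>l. (real l + 1) * (\<mu> * h0)"
      using mh0 by (rule step_grid_time)
    have "\<bar>integral {0..T} (\<lambda>t. w t * vflux h0 t)\<bar> \<le> S * (\<bar>g (v h0 0)\<bar> + G)"
      unfolding vflux_def using wi tail S T_pos g_variation[OF h0] by (intro step_pairing_bound) auto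
    also have "\<dots> \<le> S * (N * M + G)" using S g_bound[OF h0] by (intro mult_left_mono add_mono) auto
    finally show ?thesis .
  qed
  have pb: "\<bar>w t * vflux h t\<bar> \<le> 2 * (N * M) * (N * M)" "\<bar>w t * vflux h' t\<bar> \<le> 2 * (N * M) * (N * M)" for t
    unfolding abs_mult using wb[of t] vb[of t] NM by (auto intro!: mult_mono)
  have pi: "(\<lambda>t. w t * vflux h t) integrable_on {0..T}" "(\<lambda>t. w t * vflux h' t) integrable_on {0..T}"
    using pb by (auto intro!: bounded_borel_integrable_on)
  have "integral {0..T} (\<lambda>t. \<bar>w t\<bar>) \<le> integral {0..T} (\<lambda>t. \<eta> + (w t * vflux h t - w t * vflux h' t) / \<eta>)"
  proof (rule integral_le)
    show "(\<lambda>t. \<bar>w t\<bar>) integrable_on {0..T}" using wb by (intro bounded_borel_integrable_on) auto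
    show "(\<lambda>t. \<eta> + (w t * vflux h t - w t * vflux h' t) / \<eta>) integrable_on {0..T}"
      using pi by (intro integrable_add integrable_on_divide integrable_diff) auto
    show "\<bar>w t\<bar> \<le> \<eta> + (w t * vflux h t - w t * vflux h' t) / \<eta>" for t
    proof -
      have "\<bar>w t\<bar> * \<eta> \<le> \<eta> * \<eta> + w t * w t"
      proof (cases "\<bar>w t\<bar> \<le> \<eta>")
        case True
        then have "\<bar>w t\<bar> * \<eta> \<le> \<eta> * \<eta>" using \<eta> by (intro mult_right_mono) auto
        then show ?thesis by (smt (verit) zero_le_square)
      next
        case False
        then have "\<bar>w t\<bar> * \<eta> \<le> \<bar>w t\<bar> * \<bar>w t\<bar>" using \<eta> by (intro mult_left_mono) auto
        then show ?thesis using \<eta> by (simp add: add_increasing)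
      qed
      moreover have "w t * w t = w t * vflux h t - w t * vflux h' t" by (simp add: w_def algebra_simps)
      ultimately show ?thesis using \<eta> by (simp add: field_simps)
    qed
  qed
  also have "\<dots> = T * \<eta> + (integral {0..T} (\<lambda>t. w t * vflux h t) - integral {0..T} (\<lambda>t. w t * vflux h' t)) / \<eta>"
    using pi T_pos
    by (subst Henstock_Kurzweil_Integration.integral_add)
      (auto intro!: integrable_on_divide integrable_diff simp: Henstock_Kurzweil_Integration.integral_diff)
  also have "\<dots> \<le> T * \<eta> + (2 * (S * (N * M + G))) / \<eta>"
    using pair[OF h(1)] pair[OF h(2)] \<eta> by (intro add_left_mono divide_right_mono) auto
  finally show ?thesis by (simp add: w_def vdist_def S_def algebra_simps)
qed

text \<open>Supplies the boundary hypothesis of \<open>pot_compare\<close> on outgoing edges. At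
  interface \<open>0\<close> their potential is \<open>P k (h / 2)\<close> minus a time integral of
  the flux of the vertex value, and by \<open>outgoing_flux_le_g\<close> these integrands differ by
  no more than those of \<open>vdist\<close>.\<close>

lemma vertex_pot_close:
  assumes k: "k \<in> outg" and h: "h > 0" "h' > 0"
    and nm: "real n * (\<mu> * h) \<le> T" "real m * (\<mu> * h') \<le> T"
  shows "\<bar>Pot h k n 0 - Pot h' k m 0\<bar> \<le> M * (h + h') + vdist h h' + M * \<bar>real n * (\<mu> * h) - real m * (\<mu> * h')\<bar>"
proof -
  have kK: "k \<in> K" "\<sigma> k = 1" using k by (auto simp: outg_def)
  define r where "r = (\<lambda>h t. \<phi> k (v h (nat \<lfloor>t / (\<mu> * h)\<rfloor>)))"
  have rm: "r h \<in> borel_measurable borel" for h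
    unfolding r_def using step_borel_measurable(2)[of "\<lambda>m. \<phi> k (v h m)" "\<mu> * h"] by simp
  have rb: "\<bar>r h t\<bar> \<le> M" if "h > 0" for h t
    unfolding r_def using upwind_edge.M_bound(2)[OF edge[OF kK(1)] v_range[OF kK(1) that]] .
  have ri: "r h integrable_on {a..b}" if "h > 0" for h a b
    using rm rb[OF that] by (rule bounded_borel_integrable_on)
  have pot: "Pot h k n 0 = P k (h / 2) - integral {0..real n * (\<mu> * h)} (r h)" if "h > 0" for h n
  proof -
    have "\<mu> * h > 0" using that params by simp
    then have "integral {0..real n * (\<mu> * h)} (r h) = \<mu> * h * (\<Sum>m<n. \<phi> k (v h m))"
      unfolding r_def by (rule time_step_integral)
    then show ?thesis
      unfolding upwind_edge.pot_def[OF edge[OF kK(1)]] upwind_edge.flux_out[OF edge[OF kK(1)] kK(2)]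
      using vertex[OF kK(1) that] by simp
  qed
  have lipint: "\<bar>integral {0..a} (r h) - integral {0..b} (r h)\<bar> \<le> M * \<bar>a - b\<bar>"
    if "h > 0" "0 \<le> a" "0 \<le> b" for h a b
  proof -
    have *: "\<bar>integral {0..b} (r h) - integral {0..a} (r h)\<bar> \<le> M * (b - a)" if "0 \<le> a" "a \<le> b" for a b
    proof -
      have "integral {0..a} (r h) + integral {a..b} (r h) = integral {0..b} (r h)"
        using that ri[OF \<open>h > 0\<close>] by (intro Henstock_Kurzweil_Integration.integral_combine) auto
      moreover have "\<bar>integral {a..b} (r h)\<bar> \<le> M * (b - a)"
        using that ri[OF \<open>h > 0\<close>] rb[OF \<open>h > 0\<close>] by (intro abs_integral_bound) auto
      ultimately show ?thesis by linarith
    qed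
    show ?thesis using *[of a b] *[of b a] that by (cases "a \<le> b") auto
  qed
  define a where "a = real n * (\<mu> * h)"
  define b where "b = real m * (\<mu> * h')"
  have ab: "0 \<le> a" "0 \<le> b" "a \<le> T" "b \<le> T" using nm h params by (auto simp: a_def b_def)
  have "\<bar>integral {0..a} (r h) - integral {0..a} (r h')\<bar> \<le> vdist h h'"
  proof -
    have "\<bar>integral {0..a} (r h) - integral {0..a} (r h')\<bar> = norm (integral {0..a} (\<lambda>t. r h t - r h' t))"
      using ri h by (subst Henstock_Kurzweil_Integration.integral_diff) auto
    also have "\<dots> \<le> integral {0..a} (\<lambda>t. \<bar>vflux h t - vflux h' t\<bar>)"
    proof (rule integral_norm_bound_integral)
      show "(\<lambda>t. r h t - r h' t) integrable_on {0..a}" using ri h by (intro integrable_diff) auto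
      show "(\<lambda>t. \<bar>vflux h t - vflux h' t\<bar>) integrable_on {0..a}"
      proof (rule bounded_borel_integrable_on)
        show "(\<lambda>t. \<bar>vflux h t - vflux h' t\<bar>) \<in> borel_measurable borel"
          using vflux_props(1)[OF h(1)] vflux_props(1)[OF h(2)] by measurable
        show "\<bar>\<bar>vflux h t - vflux h' t\<bar>\<bar> \<le> 2 * (N * M)" for t
          using vflux_props(2)[OF h(1), of t] vflux_props(2)[OF h(2), of t] by linarith
      qed
      show "norm (r h t - r h' t) \<le> \<bar>vflux h t - vflux h' t\<bar>" for t
        unfolding r_def vflux_def real_norm_def by (rule outgoing_flux_le_g[OF k h])
    qed
    also have "\<dots> \<le> vdist h h'"
      unfolding vdist_def
    proof (rule integral_subset_le)
      have "(\<lambda>t. \<bar>vflux h t - vflux h' t\<bar>) integrable_on {a..b}" for a b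
      proof (rule bounded_borel_integrable_on)
        show "(\<lambda>t. \<bar>vflux h t - vflux h' t\<bar>) \<in> borel_measurable borel"
          using vflux_props(1)[OF h(1)] vflux_props(1)[OF h(2)] by measurable
        show "\<bar>\<bar>vflux h t - vflux h' t\<bar>\<bar> \<le> 2 * (N * M)" for t
          using vflux_props(2)[OF h(1), of t] vflux_props(2)[OF h(2), of t] by linarith
      qed
      then show "(\<lambda>t. \<bar>vflux h t - vflux h' t\<bar>) integrable_on {0..a}"
        "(\<lambda>t. \<bar>vflux h t - vflux h' t\<bar>) integrable_on {0..T}" by auto
    qed (use ab in auto)
    finally show ?thesis .
  qed
  moreover have "\<bar>integral {0..a} (r h') - integral {0..b} (r h')\<bar> \<le> M * \<bar>a - b\<bar>"
    using ab h by (intro lipint) auto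
  moreover have "\<bar>P k (h / 2) - P k (h' / 2)\<bar> \<le> M * (h + h')"
  proof -
    have "\<bar>P k (h / 2) - P k (h' / 2)\<bar> \<le> M * \<bar>h / 2 - h' / 2\<bar>"
      using h by (intro upwind_edge.P_lip[OF edge[OF kK(1)]]) auto
    also have "\<dots> \<le> M * (h + h')" using h params by (intro mult_left_mono) auto
    finally show ?thesis .
  qed
  ultimately show ?thesis
    unfolding pot[OF h(1)] pot[OF h(2)] a_def[symmetric] b_def[symmetric] by linarith
qed

definition pdist :: "real \<Rightarrow> real \<Rightarrow> real" where
  "pdist h h' = M * (h + h') + vdist h h' + rt * sqrt (h + h')"

lemma vdist_nonneg: "0 \<le> vdist h h'"
  unfolding vdist_def
  by (cases "(\<lambda>t. \<bar>vflux h t - vflux h' t\<bar>) integrable_on {0..T}")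
    (auto simp: not_integrable_integral intro!: Henstock_Kurzweil_Integration.integral_nonneg)

lemma Pot_close:
  assumes k: "k \<in> K" and h: "h > 0" "h' > 0" "h + h' \<le> 1"
    and nm: "real n * (\<mu> * h) \<le> T" "real m * (\<mu> * h') \<le> T"
    and close: "\<bar>(real i + 1/2) * h - (real j + 1/2) * h'\<bar> \<le> h + h'"
      "\<bar>real n * (\<mu> * h) - real m * (\<mu> * h')\<bar> \<le> \<mu> * (h + h')"
  shows "\<bar>Pot h k n i - Pot h' k m j\<bar> \<le> pdist h h'"
proof -
  have E: "0 \<le> M * (h + h') + vdist h h'" using params h vdist_nonneg by (simp add: add_nonneg_nonneg)
  show ?thesis unfolding pdist_def
  proof (rule upwind_edge.pot_compare[OF edge[OF k] sch[OF k h(1)] sch[OF k h(2)] _ E h(3) _ nm close])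
    show "0 \<le> T" using T_pos by simp
    fix n m assume "\<sigma> k = 1" and nm: "real n * (\<mu> * h) \<le> T" "real m * (\<mu> * h') \<le> T"
    then have "k \<in> outg" using k by (simp add: outg_def)
    then show "\<bar>Pot h k n 0 - Pot h' k m 0\<bar>
        \<le> M * (h + h') + vdist h h' + M * \<bar>real n * (\<mu> * h) - real m * (\<mu> * h')\<bar>"
      using h(1,2) nm by (rule vertex_pot_close)
  qed
qed

end

section \<open>Cauchy property in \<open>L\<^sup>1\<close> and equicontinuity in time\<close>

lemma eventually_small_pair:
  fixes C \<epsilon> :: real
  assumes "C \<ge> 0" "\<epsilon> > 0"
  shows "\<forall>\<^sub>F p in at_right 0 \<times>\<^sub>F at_right 0.
    0 < fst p \<and> 0 < snd p \<and> fst p + snd p \<le> (1::real) \<and> C * sqrt (fst p + snd p) \<le> \<epsilon>"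
proof -
  define \<delta> where "\<delta> = min (1/2) ((\<epsilon> / (C + 1))\<^sup>2 / 2)"
  have \<delta>: "\<delta> > 0" using assms by (simp add: \<delta>_def)
  have ev: "\<forall>\<^sub>F h in at_right (0::real). 0 < h \<and> h < \<delta>"
    using eventually_at_right_less[of 0] order_tendstoD(2)[OF tendsto_ident_at \<delta>]
    by (auto intro: eventually_conj)
  show ?thesis
  proof (rule eventually_mono[OF eventually_prodI[OF ev ev]])
    fix p :: "real \<times> real" assume p: "(0 < fst p \<and> fst p < \<delta>) \<and> 0 < snd p \<and> snd p < \<delta>"
    have "sqrt (fst p + snd p) \<le> sqrt ((\<epsilon> / (C + 1))\<^sup>2)"
      using p by (intro real_sqrt_le_mono) (simp add: \<delta>_def)
    then have "sqrt (fst p + snd p) \<le> \<epsilon> / (C + 1)" using assms by simp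
    then have "(C + 1) * sqrt (fst p + snd p) \<le> \<epsilon>" using assms by (simp add: field_simps)
    moreover have "C * sqrt (fst p + snd p) \<le> (C + 1) * sqrt (fst p + snd p)"
      using p by (intro mult_right_mono) auto
    ultimately have "C * sqrt (fst p + snd p) \<le> \<epsilon>" by linarith
    then show "0 < fst p \<and> 0 < snd p \<and> fst p + snd p \<le> 1 \<and> C * sqrt (fst p + snd p) \<le> \<epsilon>"
      using p by (auto simp: \<delta>_def)
  qed
qed

context upwind_star
begin

text \<open>\<open>\<eta>\<close> is fixed first, so that \<open>T * \<eta>\<close> is half of
  \<open>\<epsilon>\<close>; the remaining terms are a fixed multiple of
  \<open>sqrt (h + h')\<close>, although the multiple contains \<open>1 / \<eta>\<close>.\<close>

lemma eventually_pdist_le: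
  assumes "\<epsilon> > 0"
  shows "\<forall>\<^sub>F p in at_right 0 \<times>\<^sub>F at_right 0. 0 < fst p \<and> 0 < snd p \<and> fst p + snd p \<le> 1
    \<and> pdist (fst p) (snd p) \<le> \<epsilon> \<and> M * (fst p + snd p) \<le> \<epsilon>"
proof -
  define \<eta> where "\<eta> = \<epsilon> / (2 * T)"
  have \<eta>: "\<eta> > 0" "T * \<eta> = \<epsilon> / 2" using assms T_pos by (auto simp: \<eta>_def)
  define C where "C = M + 4 * C1 * (N * M + G) / \<eta> + rt"
  have nn: "0 \<le> 4 * C1 * (N * M + G) / \<eta>" "0 \<le> M" "0 \<le> rt"
    using C1_nonneg params G_nonneg N_pos \<eta> rt_nonneg by (auto simp: zero_le_mult_iff add_nonneg_nonneg)
  then have "C \<ge> 0" by (simp add: C_def)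
  then show ?thesis
  proof (rule eventually_mono[OF eventually_small_pair[of C "\<epsilon> / 2"]])
    show "0 < \<epsilon> / 2" using assms by simp
    fix p assume p: "0 < fst p \<and> 0 < snd p \<and> fst p + snd p \<le> 1 \<and> C * sqrt (fst p + snd p) \<le> \<epsilon> / 2"
    define r where "r = sqrt (fst p + snd p)"
    have r: "fst p + snd p \<le> r" "0 \<le> r" using p by (auto simp: r_def intro: le_sqrt)
    have "M * (fst p + snd p) \<le> M * r" using r params by (intro mult_left_mono) auto
    moreover have "vdist (fst p) (snd p) \<le> \<epsilon> / 2 + 4 * C1 * (N * M + G) / \<eta> * r"
      using vdist_bound[of "fst p" "snd p" \<eta>] p \<eta> by (simp add: r_def algebra_simps)
    ultimately have "pdist (fst p) (snd p) \<le> \<epsilon> / 2 + C * r"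
      unfolding pdist_def r_def[symmetric] C_def by (simp add: algebra_simps)
    moreover have "M * r \<le> C * r" using nn r by (intro mult_right_mono) (auto simp: C_def)
    ultimately show "0 < fst p \<and> 0 < snd p \<and> fst p + snd p \<le> 1
      \<and> pdist (fst p) (snd p) \<le> \<epsilon> \<and> M * (fst p + snd p) \<le> \<epsilon>"
      using p assms \<open>M * (fst p + snd p) \<le> M * r\<close> unfolding r_def[symmetric] by linarith
  qed
qed

lemma MW_nonneg: "0 \<le> M + W"
  using params G_nonneg by (simp add: W_def)

text \<open>The constants depend on each other in one direction: \<open>\<epsilon>\<close> gives the
  threshold \<open>\<eta>\<close>, this gives the constant \<open>C\<close> of
  \<open>strict_mono_gap\<close>, and \<open>C\<close> decides how close the potentials must be.
  None of them depends on \<open>t\<close>.\<close>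

lemma sol_cauchy:
  assumes k: "k \<in> K" and R: "R \<ge> 0" and \<epsilon>: "\<epsilon> > 0"
  shows "\<forall>\<^sub>F p in at_right 0 \<times>\<^sub>F at_right 0. \<forall>t\<in>{0..T}.
    integral {0..R} (\<lambda>x. \<bar>sol (fst p) k (x, t) - sol (snd p) k (x, t)\<bar>) \<le> \<epsilon>"
proof -
  interpret e: upwind_edge "\<phi> k" "\<sigma> k" "lo k" "hi k" L \<mu> M "P k" by (rule edge[OF k])
  define \<eta> where "\<eta> = \<epsilon> / (2 * (R + 1))"
  have \<eta>: "\<eta> > 0" "R * \<eta> \<le> \<epsilon> / 2" using R \<epsilon> by (auto simp: \<eta>_def field_simps)
  obtain C where C: "C \<ge> 0" "\<And>x y. x \<in> {lo k..hi k} \<Longrightarrow> y \<in> {lo k..hi k} \<Longrightarrow>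
      \<bar>x - y\<bar> \<le> \<eta> + C * ((x - y) * (\<sigma> k * \<phi> k x - \<sigma> k * \<phi> k y))"
    using strict_mono_gap[OF e.continuous_flux, of "\<sigma> k" \<eta>] e.strict \<eta>(1) by metis
  define A where "A = C * (8 * (M + W))"
  have A: "A \<ge> 0" using C(1) MW_nonneg by (simp add: A_def)
  define \<epsilon>' where "\<epsilon>' = \<epsilon> / 4 / (A + 1)"
  have \<epsilon>': "\<epsilon>' > 0" "A * (\<epsilon>' + \<epsilon>') \<le> \<epsilon> / 2" 
  proof -
    show "\<epsilon>' > 0" using \<epsilon> A by (simp add: \<epsilon>'_def)
    then have "A * (\<epsilon>' + \<epsilon>') \<le> (A + 1) * (\<epsilon>' + \<epsilon>')" by (intro mult_right_mono) auto
    also have "\<dots> = \<epsilon> / 2"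
    proof -
      have "A + 1 \<noteq> 0" using A by simp
      from nonzero_eq_divide_eq[OF this, THEN iffD1, OF \<epsilon>'_def] have "(A + 1) * \<epsilon>' = \<epsilon> / 4"
        by (simp only: mult.commute)
      then show ?thesis by (simp add: distrib_left)
    qed
    finally show "A * (\<epsilon>' + \<epsilon>') \<le> \<epsilon> / 2" .
  qed
  show ?thesis
  proof (rule eventually_mono[OF eventually_pdist_le[OF \<epsilon>'(1)]], intro ballI)
    fix p :: "real \<times> real" and t
    assume p: "0 < fst p \<and> 0 < snd p \<and> fst p + snd p \<le> 1
      \<and> pdist (fst p) (snd p) \<le> \<epsilon>' \<and> M * (fst p + snd p) \<le> \<epsilon>'" and t: "t \<in> {0..T}"
    define h where "h = fst p"
    define h' where "h' = snd p"
    have h: "h > 0" "h' > 0" "h + h' \<le> 1" "pdist h h' \<le> \<epsilon>'" "M * (h + h') \<le> \<epsilon>'"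
      using p by (auto simp: h_def h'_def)
    define n where "n = nat \<lfloor>t / (\<mu> * h)\<rfloor>"
    define m where "m = nat \<lfloor>t / (\<mu> * h')\<rfloor>"
    have nm: "real n * (\<mu> * h) \<le> T" "real m * (\<mu> * h') \<le> T"
      "\<bar>real n * (\<mu> * h) - real m * (\<mu> * h')\<bar> \<le> \<mu> * (h + h')"
      unfolding n_def m_def using time_index_close[OF h(1,2), of t] time_index_close(1)[OF h(2,1), of t] t by auto
    have "integral {0..R} (\<lambda>x. \<bar>u h k n (nat (round (x / h))) - u h' k m (nat (round (x / h')))\<bar>)
        \<le> R * \<eta> + C * (8 * (pdist h h' + M * (h + h')) * (M + W))"
    proof (rule e.L1_distance[OF sch[OF k h(1)] sch[OF k h(2)] R])
      show "0 \<le> pdist h h'"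
        using h vdist_nonneg params rt_nonneg by (simp add: pdist_def add_nonneg_nonneg)
      show "\<bar>e.pot h (u h k) n i - e.pot h' (u h' k) m j\<bar> \<le> pdist h h'"
        if "\<bar>(real i + 1/2) * h - (real j + 1/2) * h'\<bar> \<le> h + h'" for i j
        by (rule Pot_close[OF k h(1-3) nm(1,2) that nm(3)])
    qed (use flux_variation[OF k] h C in auto)
    also have "C * (8 * (pdist h h' + M * (h + h')) * (M + W)) = A * (pdist h h' + M * (h + h'))"
      unfolding A_def by (simp only: mult.commute mult.left_commute mult.assoc)
    also have "A * (pdist h h' + M * (h + h')) \<le> A * (\<epsilon>' + \<epsilon>')" using h A by (intro mult_left_mono add_mono) auto
    finally show "integral {0..R} (\<lambda>x. \<bar>sol (fst p) k (x, t) - sol (snd p) k (x, t)\<bar>) \<le> \<epsilon>"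
      using \<eta> \<epsilon>' by (simp add: sol_def h_def[symmetric] h'_def[symmetric] n_def m_def)
  qed
qed

text \<open>\<open>L1_distance\<close> is applied to one mesh at two times. The closeness of the
  potentials is then plain Lipschitz continuity in time, with no doubling.\<close>

lemma sol_time_continuity:
  assumes k: "k \<in> K" and R: "R \<ge> 0" and \<epsilon>: "\<epsilon> > 0"
  shows "\<exists>\<delta>>0. \<forall>\<^sub>F h in at_right 0. \<forall>s\<in>{0..T}. \<forall>t\<in>{0..T}. \<bar>t - s\<bar> \<le> \<delta> \<longrightarrow>
    integral {0..R} (\<lambda>x. \<bar>sol h k (x, t) - sol h k (x, s)\<bar>) \<le> \<epsilon>"
proof -
  interpret e: upwind_edge "\<phi> k" "\<sigma> k" "lo k" "hi k" L \<mu> M "P k" by (rule edge[OF k])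
  define \<eta> where "\<eta> = \<epsilon> / (2 * (R + 1))"
  have \<eta>: "\<eta> > 0" "R * \<eta> \<le> \<epsilon> / 2" using R \<epsilon> by (auto simp: \<eta>_def field_simps)
  obtain C where C: "C \<ge> 0" "\<And>x y. x \<in> {lo k..hi k} \<Longrightarrow> y \<in> {lo k..hi k} \<Longrightarrow>
      \<bar>x - y\<bar> \<le> \<eta> + C * ((x - y) * (\<sigma> k * \<phi> k x - \<sigma> k * \<phi> k y))"
    using strict_mono_gap[OF e.continuous_flux, of "\<sigma> k" \<eta>] e.strict \<eta>(1) by metis
  define A where "A = C * (8 * (M + W)) * M"
  have A: "A \<ge> 0" using C(1) MW_nonneg params by (simp add: A_def)
  define \<delta> where "\<delta> = \<epsilon> / 4 / (A + 1)"
  have \<delta>: "\<delta> > 0" "A * (\<delta> + \<delta>) \<le> \<epsilon> / 2" 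
  proof -
    show "\<delta> > 0" using \<epsilon> A by (simp add: \<delta>_def)
    then have "A * (\<delta> + \<delta>) \<le> (A + 1) * (\<delta> + \<delta>)" by (intro mult_right_mono) auto
    also have "\<dots> = \<epsilon> / 2"
    proof -
      have "A + 1 \<noteq> 0" using A by simp
      from nonzero_eq_divide_eq[OF this, THEN iffD1, OF \<delta>_def] have "(A + 1) * \<delta> = \<epsilon> / 4"
        by (simp only: mult.commute)
      then show ?thesis by (simp add: distrib_left)
    qed
    finally show "A * (\<delta> + \<delta>) \<le> \<epsilon> / 2" .
  qed
  \<comment> \<open>The total potential error is \<open>M * (\<delta> + (4 + \<mu>) * h)\<close>:
    \<open>2 * h\<close> each from the offset of the indices and from \<open>L1_distance\<close>,
    and \<open>\<mu> * h\<close> from rounding the times. This threshold makes the mesh part at most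
    \<open>\<delta>\<close>.\<close>
  have d4: "0 < \<delta> / (4 + \<mu>)" using \<delta> params by simp
  have "\<forall>\<^sub>F h in at_right (0::real). 0 < h \<and> h < \<delta> / (4 + \<mu>)"
    using eventually_at_right_less[of 0] order_tendstoD(2)[OF tendsto_ident_at d4]
    by (auto intro: eventually_conj)
  then have "\<forall>\<^sub>F h in at_right 0. \<forall>s\<in>{0..T}. \<forall>t\<in>{0..T}. \<bar>t - s\<bar> \<le> \<delta> \<longrightarrow>
    integral {0..R} (\<lambda>x. \<bar>sol h k (x, t) - sol h k (x, s)\<bar>) \<le> \<epsilon>"
  proof (rule eventually_mono, intro ballI impI)
    fix h s t assume "0 < h \<and> h < \<delta> / (4 + \<mu>)" and st: "s \<in> {0..T}" "t \<in> {0..T}" "\<bar>t - s\<bar> \<le> \<delta>"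
    then have h: "h > 0" "(4 + \<mu>) * h \<le> \<delta>" using params by (auto simp: field_simps)
    define n where "n = nat \<lfloor>t / (\<mu> * h)\<rfloor>"
    define m where "m = nat \<lfloor>s / (\<mu> * h)\<rfloor>"
    have mh: "\<mu> * h > 0" using h params by simp
    define S where "S = M * (h + h) + M * (\<delta> + \<mu> * h)"
    have nm: "\<bar>real n * (\<mu> * h) - real m * (\<mu> * h)\<bar> \<le> \<delta> + \<mu> * h"
      using nat_floor_bounds[OF mh, of t] nat_floor_bounds[OF mh, of s] st
      unfolding n_def m_def by (simp add: abs_le_iff)
    have "integral {0..R} (\<lambda>x. \<bar>u h k n (nat (round (x / h))) - u h k m (nat (round (x / h)))\<bar>)
        \<le> R * \<eta> + C * (8 * (S + M * (h + h)) * (M + W))"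
    proof (rule e.L1_distance[OF sch[OF k h(1)] sch[OF k h(1)] R])
      show "0 \<le> S" using h mh \<delta> params by (simp add: S_def add_nonneg_nonneg)
      show "\<bar>e.pot h (u h k) n i - e.pot h (u h k) m j\<bar> \<le> S"
        if "\<bar>(real i + 1/2) * h - (real j + 1/2) * h\<bar> \<le> h + h" for i j
      proof -
        have "\<bar>(real i - real j) * h\<bar> \<le> h + h" using that by (simp add: algebra_simps)
        then have "M * \<bar>(real i - real j) * h\<bar> \<le> M * (h + h)" using params by (intro mult_left_mono) auto
        moreover have "M * \<bar>real n * (\<mu> * h) - real m * (\<mu> * h)\<bar> \<le> M * (\<delta> + \<mu> * h)"
          using nm params by (intro mult_left_mono) auto
        ultimately show ?thesis
          using e.pot_lip_space[OF sch[OF k h(1)], of n i j] e.pot_lip_time[OF sch[OF k h(1)], of n j m]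
          unfolding S_def by linarith
      qed
    qed (use flux_variation[OF k] h C in auto)
    also have "C * (8 * (S + M * (h + h)) * (M + W)) = A * (\<delta> + (4 + \<mu>) * h)"
      by (simp add: A_def S_def algebra_simps)
    also have "\<dots> \<le> A * (\<delta> + \<delta>)" using h A by (intro mult_left_mono add_mono) auto
    finally show "integral {0..R} (\<lambda>x. \<bar>sol h k (x, t) - sol h k (x, s)\<bar>) \<le> \<epsilon>"
      using \<eta> \<delta> by (simp add: sol_def n_def m_def)
  qed
  with \<delta>(1) show ?thesis by blast
qed

text \<open>The total flux out of the vertex up to step \<open>n\<close> is the loss of content of
  the vertex cell, that is \<open>N * h / 2\<close> times a difference of two bounded
  values.\<close>

lemma flux_balance:
  assumes h: "h > 0"
  shows "\<bar>\<Sum>k\<in>K. \<mu> * h * (\<Sum>m<n. fl k (u h k m 0) (u h k m (Suc 0)))\<bar> \<le> N * M * h"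
proof -
  have "(\<Sum>k\<in>K. \<mu> * h * (\<Sum>m<n. fl k (u h k m 0) (u h k m (Suc 0))))
      = \<mu> * h * (\<Sum>k\<in>K. \<Sum>m<n. fl k (u h k m 0) (u h k m (Suc 0)))"
    by (rule sum_distrib_left[symmetric])
  also have "(\<Sum>k\<in>K. \<Sum>m<n. fl k (u h k m 0) (u h k m (Suc 0)))
      = (\<Sum>m<n. \<Sum>k\<in>K. fl k (u h k m 0) (u h k m (Suc 0)))"
    by (rule sum.swap)
  also have "\<dots> = (\<Sum>m<n. g (v h m) - inflow h m)" by (simp add: flux_sum_split[OF h])
  also have "\<mu> * h * (\<Sum>m<n. g (v h m) - inflow h m) = N * h / 2 * (v h 0 - v h n)"
  proof -
    have "v h 0 - v h n = vrate * (\<Sum>m<n. g (v h m) - inflow h m)" using v_sum[OF h, of n] by simp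
    then show ?thesis using N_pos by (simp add: vrate_def)
  qed
  finally have e: "(\<Sum>k\<in>K. \<mu> * h * (\<Sum>m<n. fl k (u h k m 0) (u h k m (Suc 0)))) = N * h / 2 * (v h 0 - v h n)" .
  have "\<bar>v h 0 - v h n\<bar> \<le> 2 * M" using v_bound[OF h, of n] v_bound[OF h, of 0] by linarith
  then have "N * h / 2 * \<bar>v h 0 - v h n\<bar> \<le> N * h / 2 * (2 * M)" using h N_pos by (intro mult_left_mono) auto
  moreover have "\<bar>N * h / 2 * (v h 0 - v h n)\<bar> = N * h / 2 * \<bar>v h 0 - v h n\<bar>"
    unfolding abs_mult using h N_pos by simp
  moreover have "N * h / 2 * (2 * M) = N * M * h" by simp
  ultimately show ?thesis unfolding e by linarith
qed

end

section \<open>Limits of families that are Cauchy uniformly in time\<close>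

text \<open>A sequence converging fast enough converges almost everywhere at every time, which makes the limit
  jointly measurable.\<close>

lemma bounded_L1_fast_convergence:
  fixes a :: "nat \<Rightarrow> real \<Rightarrow> real"
  assumes m: "\<And>n. a n \<in> borel_measurable borel" and b: "\<And>n x. \<bar>a n x\<bar> \<le> B"
    and I: "\<And>n. n \<ge> k \<Longrightarrow> integral {0..R} (\<lambda>x. \<bar>a (Suc n) x - a n x\<bar>) \<le> (1/2) ^ n"
  shows "AE x in lborel. x \<in> {0..R} \<longrightarrow> convergent (\<lambda>n. a n x)"
proof -
  note [measurable] = m
  define f where "f = (\<lambda>n x. ennreal (indicator {0..R} x * \<bar>a (Suc (n + k)) x - a (n + k) x\<bar>))"
  have fm [measurable]: "f n \<in> borel_measurable lborel" for n unfolding f_def by measurable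
  have f_int: "integral\<^sup>N lborel (f n) \<le> ennreal ((1/2) ^ n)" for n
  proof -
    define d where "d = (\<lambda>x. \<bar>a (Suc (n + k)) x - a (n + k) x\<bar>)"
    have db: "\<bar>d x\<bar> \<le> 2 * B" for x using b[of "Suc (n + k)" x] b[of "n + k" x] by (simp add: d_def)
    have dm: "d \<in> borel_measurable borel" unfolding d_def by measurable
    have si: "set_integrable lborel {0..R} d" by (rule bounded_borel_set_integrable[OF dm db])
    have "integral\<^sup>N lborel (f n) = ennreal (LINT x:{0..R}|lborel. d x)"
      unfolding f_def d_def[symmetric] set_lebesgue_integral_def
      using si by (subst nn_integral_eq_integral) (auto simp: set_integrable_def d_def)
    also have "(LINT x:{0..R}|lborel. d x) = integral {0..R} d"
      by (rule set_borel_integral_eq_integral(2)[OF si])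
    also have "\<dots> \<le> (1/2) ^ (n + k)" unfolding d_def by (rule I) simp
    also have "\<dots> \<le> (1/2) ^ n" by (intro power_decreasing) auto
    finally show ?thesis by (simp add: ennreal_leI)
  qed
  have "(\<integral>\<^sup>+x. (\<Sum>n. f n x) \<partial>lborel) = (\<Sum>n. integral\<^sup>N lborel (f n))"
    by (rule nn_integral_suminf) measurable
  also have "\<dots> \<le> (\<Sum>n. ennreal ((1/2) ^ n))" by (intro suminf_le f_int) auto
  also have "\<dots> = ennreal (\<Sum>n. (1/2) ^ n)" by (rule suminf_ennreal2) (auto intro: summable_geometric)
  also have "\<dots> < \<infinity>" by simp
  finally have "AE x in lborel. (\<Sum>n. f n x) \<noteq> \<infinity>" by (intro nn_integral_PInf_AE) auto
  then show ?thesis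
  proof (rule AE_mp, intro AE_I2 impI)
    fix x assume fin: "(\<Sum>n. f n x) \<noteq> \<infinity>" and x: "x \<in> {0..R}"
    have "summable (\<lambda>n. \<bar>a (Suc (n + k)) x - a (n + k) x\<bar>)"
      using fin x unfolding f_def by (intro summable_suminf_not_top) auto
    then have "summable (\<lambda>n. a (Suc (n + k)) x - a (n + k) x)" by (rule summable_rabs_cancel)
    then have "convergent (\<lambda>n. \<Sum>i<n. a (Suc i + k) x - a (i + k) x)"
      by (simp add: summable_iff_convergent)
    then have "convergent (\<lambda>n. a (n + k) x - a k x)"
      using sum_lessThan_telescope[of "\<lambda>i. a (i + k) x"] by simp
    then have "convergent (\<lambda>n. a k x + (a (n + k) x - a k x))" by (intro convergent_add convergent_const)
    then have "convergent (\<lambda>n. a (n + k) x)" by simp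
    then show "convergent (\<lambda>n. a n x)" by (auto simp: convergent_def dest: LIMSEQ_offset)
  qed
qed

text \<open>A single sequence of mesh widths serves all times, so its pointwise limit is Borel in
  \<open>(x, t)\<close> jointly. Convergence of the whole family, uniform in \<open>t\<close>,
  follows by comparing an arbitrary \<open>h\<close> with the sequence in the Cauchy estimate and
  letting the sequence converge.\<close>

lemma L1_limit_exists:
  fixes U :: "real \<Rightarrow> real \<times> real \<Rightarrow> real"
  assumes m: "\<And>h. h > 0 \<Longrightarrow> U h \<in> borel_measurable borel"
    and rng: "\<And>h p. h > 0 \<Longrightarrow> U h p \<in> {lo..hi}"
    and cauchy: "\<And>R \<epsilon>. R \<ge> 0 \<Longrightarrow> \<epsilon> > 0 \<Longrightarrow> \<forall>\<^sub>F p in at_right 0 \<times>\<^sub>F at_right 0. \<forall>t\<in>{0..T}.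
      integral {0..R} (\<lambda>x. \<bar>U (fst p) (x, t) - U (snd p) (x, t)\<bar>) \<le> \<epsilon>"
  obtains w where "w \<in> borel_measurable borel" "\<And>p. w p \<in> {lo..hi}"
    "\<And>R \<epsilon>. R \<ge> 0 \<Longrightarrow> \<epsilon> > 0 \<Longrightarrow> \<forall>\<^sub>F h in at_right 0. \<forall>t\<in>{0..T}.
      integral {0..R} (\<lambda>x. \<bar>U h (x, t) - w (x, t)\<bar>) \<le> \<epsilon>"
proof -
  have lohi: "lo \<le> hi" using rng[of 1 "(0,0)"] by simp
  define B where "B = \<bar>lo\<bar> + \<bar>hi\<bar>"
  have bd: "\<bar>z\<bar> \<le> B" if "z \<in> {lo..hi}" for z using that by (auto simp: B_def)
  have close: "\<exists>\<delta>>0. \<forall>h h'. 0 < h \<longrightarrow> h < \<delta> \<longrightarrow> 0 < h' \<longrightarrow> h' < \<delta> \<longrightarrow> (\<forall>t\<in>{0..T}.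
      integral {0..R} (\<lambda>x. \<bar>U h (x, t) - U h' (x, t)\<bar>) \<le> \<epsilon>)" if R: "R \<ge> 0" "\<epsilon> > 0" for R \<epsilon>
  proof -
    obtain Q where Q: "eventually Q (at_right (0::real))" "\<And>h h'. Q h \<Longrightarrow> Q h' \<Longrightarrow> (\<forall>t\<in>{0..T}.
      integral {0..R} (\<lambda>x. \<bar>U h (x, t) - U h' (x, t)\<bar>) \<le> \<epsilon>)"
      using cauchy[OF R] unfolding eventually_prod_same by auto
    then show ?thesis unfolding eventually_at_right_field by (metis)
  qed
  define good where "good = (\<lambda>n \<delta>. 0 < \<delta> \<and> (\<forall>h h'. 0 < h \<longrightarrow> h < \<delta> \<longrightarrow> 0 < h' \<longrightarrow> h' < \<delta> \<longrightarrow> (\<forall>t\<in>{0..T}.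
      integral {0..real n} (\<lambda>x. \<bar>U h (x, t) - U h' (x, t)\<bar>) \<le> (1/2) ^ n)))"
  have "\<exists>\<delta>. good n \<delta>" for n using close[of "real n" "(1/2)^n"] by (auto simp: good_def)
  then obtain \<delta> where \<delta>: "\<And>n. good n (\<delta> n)" by metis
  \<comment> \<open>Half of the minimum puts \<open>H n\<close> below every
    \<open>\<delta> i\<close> with \<open>i \<le> n\<close>, so consecutive members are within
    \<open>(1/2) ^ n\<close> on \<open>[0, n]\<close>; the bound \<open>1 / real (Suc n)\<close>
    makes the sequence tend to \<open>0\<close>.\<close>
  define H where "H = (\<lambda>n. min (Min (\<delta> ` {..n}) / 2) (1 / real (Suc n)))"
  have \<delta>pos: "\<delta> n > 0" for n using \<delta>[of n] by (simp add: good_def)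
  have Hpos: "H n > 0" for n
    using \<delta>pos by (simp add: H_def)
  have H\<delta>: "H n < \<delta> i" if "i \<le> n" for n i
  proof -
    have "Min (\<delta> ` {..n}) \<le> \<delta> i" using that by (intro Min_le) auto
    then have "H n \<le> \<delta> i / 2" by (simp add: H_def min.coboundedI1)
    then show ?thesis using \<delta>pos[of i] by linarith
  qed
  have H0: "H \<longlonglongrightarrow> 0"
  proof (rule tendsto_sandwich[OF _ _ tendsto_const])
    show "(\<lambda>n. 1 / real (Suc n)) \<longlonglongrightarrow> 0" by (rule LIMSEQ_Suc[OF lim_1_over_n])
    show "\<forall>\<^sub>F n in sequentially. 0 \<le> H n" using Hpos by (simp add: less_imp_le)
    show "\<forall>\<^sub>F n in sequentially. H n \<le> 1 / real (Suc n)" by (simp add: H_def)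
  qed
  \<comment> \<open>Where the sequence diverges \<open>lim\<close> is an arbitrary value. The clamp
    keeps it in \<open>[lo, hi]\<close>, so that the range holds everywhere and not just almost
    everywhere; where the sequence converges the clamp changes nothing.\<close>
  define w where "w = (\<lambda>p. max lo (min hi (lim (\<lambda>n. U (H n) p))))"
  have Um [measurable]: "U (H n) \<in> borel_measurable borel" for n using m Hpos by blast
  have wm: "w \<in> borel_measurable borel" unfolding w_def by measurable
  have wr: "w p \<in> {lo..hi}" for p using lohi by (auto simp: w_def)
  have slice: "(\<lambda>x. f (x, t)) \<in> borel_measurable borel" if "f \<in> borel_measurable borel"
    for f :: "real \<times> real \<Rightarrow> real" and t
  proof -
    have "(\<lambda>x. (x, t)) \<in> borel_measurable (borel :: real measure)"
      by (intro borel_measurable_continuous_onI continuous_intros)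
    then show ?thesis using that by (rule measurable_compose)
  qed
  have lim0: "(\<lambda>n. integral {0..R} (\<lambda>x. \<bar>U (H n) (x, t) - w (x, t)\<bar>)) \<longlonglongrightarrow> 0"
    if R: "R \<ge> 0" and t: "t \<in> {0..T}" for R t
  proof -
    have am: "(\<lambda>x. U (H n) (x, t)) \<in> borel_measurable borel" for n using Um by (rule slice)
    have wmt: "(\<lambda>x. w (x, t)) \<in> borel_measurable borel" using wm by (rule slice)
    have "AE x in lborel. x \<in> {0..R} \<longrightarrow> convergent (\<lambda>n. U (H n) (x, t))"
    proof (rule bounded_L1_fast_convergence[where k = "nat \<lceil>R\<rceil>" and B = B])
      fix n assume n: "n \<ge> nat \<lceil>R\<rceil>"
      then have Rn: "R \<le> real n" by linarith
      have d: "(\<lambda>x. \<bar>U (H (Suc n)) (x, t) - U (H n) (x, t)\<bar>) integrable_on {0..b}" for b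
      proof (rule bounded_borel_integrable_on)
        show "(\<lambda>x. \<bar>U (H (Suc n)) (x, t) - U (H n) (x, t)\<bar>) \<in> borel_measurable borel"
          using am[of n] am[of "Suc n"] by measurable
        show "\<bar>\<bar>U (H (Suc n)) (x, t) - U (H n) (x, t)\<bar>\<bar> \<le> 2 * B" for x
          using bd[OF rng[OF Hpos, of "Suc n" "(x,t)"]] bd[OF rng[OF Hpos, of n "(x,t)"]] by linarith
      qed
      have "integral {0..R} (\<lambda>x. \<bar>U (H (Suc n)) (x, t) - U (H n) (x, t)\<bar>)
          \<le> integral {0..real n} (\<lambda>x. \<bar>U (H (Suc n)) (x, t) - U (H n) (x, t)\<bar>)"
        using d Rn by (intro integral_subset_le) auto
      also have "\<dots> \<le> (1/2) ^ n"
        using \<delta>[of n] H\<delta>[of n "Suc n"] H\<delta>[of n n] Hpos t by (auto simp: good_def)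
      finally show "integral {0..R} (\<lambda>x. \<bar>U (H (Suc n)) (x, t) - U (H n) (x, t)\<bar>) \<le> (1/2) ^ n" .
    qed (use am bd rng Hpos in auto)
    then have ae: "AE x in lborel. (\<lambda>n. indicator {0..R} x * \<bar>U (H n) (x, t) - w (x, t)\<bar>) \<longlonglongrightarrow> 0"
    proof (rule AE_mp, intro AE_I2 impI)
      fix x assume c: "x \<in> {0..R} \<longrightarrow> convergent (\<lambda>n. U (H n) (x, t))"
      show "(\<lambda>n. indicator {0..R} x * \<bar>U (H n) (x, t) - w (x, t)\<bar>) \<longlonglongrightarrow> 0"
      proof (cases "x \<in> {0..R}")
        case True
        define l where "l = lim (\<lambda>n. U (H n) (x, t))"
        have l: "(\<lambda>n. U (H n) (x, t)) \<longlonglongrightarrow> l"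
          using c True by (simp add: l_def convergent_LIMSEQ_iff)
        have "lo \<le> l" "l \<le> hi"
          using rng[OF Hpos] by (auto intro!: LIMSEQ_le_const[OF l] LIMSEQ_le_const2[OF l])
        then have "w (x, t) = l" by (simp add: w_def l_def)
        then have "(\<lambda>n. \<bar>U (H n) (x, t) - w (x, t)\<bar>) \<longlonglongrightarrow> 0"
          using tendsto_rabs_zero[OF LIM_zero[OF l]] by simp
        then show ?thesis by (rule tendsto_mult_right_zero)
      qed simp
    qed
    have d: "\<bar>\<bar>U (H n) (x, t) - w (x, t)\<bar>\<bar> \<le> 2 * B" for n x
      using bd[OF rng[OF Hpos, of n "(x,t)"]] bd[OF wr, of "(x,t)"] by linarith
    have dm: "(\<lambda>x. \<bar>U (H n) (x, t) - w (x, t)\<bar>) \<in> borel_measurable borel" for n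
      using am[of n] wmt by measurable
    have "(\<lambda>n. \<integral>x. indicator {0..R} x * \<bar>U (H n) (x, t) - w (x, t)\<bar> \<partial>lborel) \<longlonglongrightarrow> (\<integral>x. 0 \<partial>(lborel :: real measure))"
    proof (rule integral_dominated_convergence[where w = "\<lambda>x. indicator {0..R} x * (2 * B)"])
      show "integrable lborel (\<lambda>x. indicator {0..R} x * (2 * B))"
        using bounded_borel_set_integrable[of "\<lambda>x. 2 * B" "2 * B" 0 R] by (simp add: set_integrable_def B_def)
      show "(\<lambda>x. indicator {0..R} x * \<bar>U (H n) (x, t) - w (x, t)\<bar>) \<in> borel_measurable lborel" for n
      proof -
        have "(\<lambda>x. indicator {0..R} x * \<bar>U (H n) (x, t) - w (x, t)\<bar>) \<in> borel_measurable borel"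
          by (intro borel_measurable_times borel_measurable_indicator dm) simp
        then show ?thesis by (simp only: measurable_lborel2)
      qed
      show "AE x in lborel. norm (indicator {0..R} x * \<bar>U (H n) (x, t) - w (x, t)\<bar>) \<le> indicator {0..R} x * (2 * B)" for n
        using d[of n] by (intro AE_I2) (auto simp: indicator_def)
    qed (use ae in auto)
    moreover have e: "(\<integral>x. indicator {0..R} x * \<bar>U (H n) (x, t) - w (x, t)\<bar> \<partial>lborel)
        = integral {0..R} (\<lambda>x. \<bar>U (H n) (x, t) - w (x, t)\<bar>)" for n
      using set_borel_integral_eq_integral(2)[OF bounded_borel_set_integrable[OF dm d, of 0 R n]]
      unfolding set_lebesgue_integral_def real_scaleR_def .
    ultimately show ?thesis unfolding e by (simp only: Bochner_Integration.integral_zero)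
  qed
  show thesis
  proof (rule that[OF wm wr])
    fix R \<epsilon> :: real assume R: "R \<ge> 0" and \<epsilon>: "\<epsilon> > 0"
    obtain d where d: "d > 0" "\<And>h h' t. 0 < h \<Longrightarrow> h < d \<Longrightarrow> 0 < h' \<Longrightarrow> h' < d \<Longrightarrow> t \<in> {0..T} \<Longrightarrow>
      integral {0..R} (\<lambda>x. \<bar>U h (x, t) - U h' (x, t)\<bar>) \<le> \<epsilon>"
      using close[OF R \<epsilon>] by auto
    have "\<forall>t\<in>{0..T}. integral {0..R} (\<lambda>x. \<bar>U h (x, t) - w (x, t)\<bar>) \<le> \<epsilon>" if h: "0 < h" "h < d" for h
    proof
      fix t assume t: "t \<in> {0..T}"
      have gi: "(\<lambda>x. \<bar>f (x, t) - f' (x, t)\<bar>) integrable_on {0..R}"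
        if "f \<in> borel_measurable borel" "f' \<in> borel_measurable borel" "\<And>p. f p \<in> {lo..hi}" "\<And>p. f' p \<in> {lo..hi}"
        for f f' :: "real \<times> real \<Rightarrow> real"
      proof (rule bounded_borel_integrable_on)
        show "(\<lambda>x. \<bar>f (x, t) - f' (x, t)\<bar>) \<in> borel_measurable borel"
          using slice[OF that(1), of t] slice[OF that(2), of t] by measurable
        show "\<bar>\<bar>f (x, t) - f' (x, t)\<bar>\<bar> \<le> 2 * B" for x
          using bd[OF that(3), of "(x,t)"] bd[OF that(4), of "(x,t)"] by linarith
      qed
      have "\<forall>\<^sub>F n in sequentially. H n < d" using order_tendstoD(2)[OF H0 d(1)] .
      then have "\<forall>\<^sub>F n in sequentially. integral {0..R} (\<lambda>x. \<bar>U h (x, t) - w (x, t)\<bar>)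
          \<le> \<epsilon> + integral {0..R} (\<lambda>x. \<bar>U (H n) (x, t) - w (x, t)\<bar>)"
      proof (rule eventually_mono)
        fix n assume "H n < d"
        then have 1: "integral {0..R} (\<lambda>x. \<bar>U h (x, t) - U (H n) (x, t)\<bar>) \<le> \<epsilon>" using d(2) h Hpos t by auto
        have "integral {0..R} (\<lambda>x. \<bar>U h (x, t) - w (x, t)\<bar>)
            \<le> integral {0..R} (\<lambda>x. \<bar>U h (x, t) - U (H n) (x, t)\<bar> + \<bar>U (H n) (x, t) - w (x, t)\<bar>)"
          using gi m h Hpos wm rng wr by (intro integral_le integrable_add) auto
        also have "\<dots> = integral {0..R} (\<lambda>x. \<bar>U h (x, t) - U (H n) (x, t)\<bar>) + integral {0..R} (\<lambda>x. \<bar>U (H n) (x, t) - w (x, t)\<bar>)"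
          using gi m h Hpos wm rng wr by (intro Henstock_Kurzweil_Integration.integral_add) auto
        finally show "integral {0..R} (\<lambda>x. \<bar>U h (x, t) - w (x, t)\<bar>)
          \<le> \<epsilon> + integral {0..R} (\<lambda>x. \<bar>U (H n) (x, t) - w (x, t)\<bar>)" using 1 by linarith
      qed
      moreover have "(\<lambda>n. \<epsilon> + integral {0..R} (\<lambda>x. \<bar>U (H n) (x, t) - w (x, t)\<bar>)) \<longlonglongrightarrow> \<epsilon> + 0"
        by (intro tendsto_add tendsto_const lim0 R t)
      ultimately show "integral {0..R} (\<lambda>x. \<bar>U h (x, t) - w (x, t)\<bar>) \<le> \<epsilon>"
        using tendsto_lowerbound[of _ "\<epsilon> + 0" sequentially] by simp
    qed
    then show "\<forall>\<^sub>F h in at_right 0. \<forall>t\<in>{0..T}. integral {0..R} (\<lambda>x. \<bar>U h (x, t) - w (x, t)\<bar>) \<le> \<epsilon>"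
      unfolding eventually_at_right_field using d(1) by blast
  qed
qed

section \<open>The weak formulation by integration by parts\<close>

lemma borel_slice:
  fixes F :: "real \<times> real \<Rightarrow> real"
  assumes "F \<in> borel_measurable borel"
  shows "(\<lambda>x. F (x, t)) \<in> borel_measurable borel" "(\<lambda>t. F (x, t)) \<in> borel_measurable borel"
proof -
  have "(\<lambda>x. (x, t)) \<in> borel_measurable (borel :: real measure)"
    "(\<lambda>t. (x, t)) \<in> borel_measurable (borel :: real measure)"
    by (intro borel_measurable_continuous_onI continuous_intros)+
  then show "(\<lambda>x. F (x, t)) \<in> borel_measurable borel" "(\<lambda>t. F (x, t)) \<in> borel_measurable borel"
    using assms by (auto intro: measurable_compose)
qed

lemma borel_bounded_on_integrable_on:
  fixes f :: "real \<Rightarrow> real"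
  assumes "f \<in> borel_measurable borel" "\<And>x. x \<in> {a..b} \<Longrightarrow> \<bar>f x\<bar> \<le> M"
  shows "f integrable_on {a..b}"
proof -
  define f' where "f' = (\<lambda>x. indicator {a..b} x * f x)"
  have "f' integrable_on {a..b}"
  proof (rule bounded_borel_integrable_on)
    show "f' \<in> borel_measurable borel"
      unfolding f'_def by (intro borel_measurable_times borel_measurable_indicator assms) simp
    show "\<bar>f' x\<bar> \<le> max 0 M" for x using assms(2)[of x] by (cases "x \<in> {a..b}") (auto simp: f'_def)
  qed
  then show ?thesis by (rule integrable_cong[THEN iffD1, rotated]) (simp add: f'_def)
qed

lemma HK_integral_eq_lborel:
  fixes f :: "real \<Rightarrow> real"
  assumes "f \<in> borel_measurable borel" "\<And>x. x \<in> {a..b} \<Longrightarrow> \<bar>f x\<bar> \<le> M"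
  shows "integral {a..b} f = (\<integral>x. indicator {a..b} x * f x \<partial>lborel)"
proof -
  have "set_integrable lborel {a..b} f"
    unfolding set_integrable_def
  proof (rule integrableI_bounded_set_indicator[where B = M])
    show "emeasure lborel {a..b} < \<infinity>" by (simp add: emeasure_lborel_Icc_eq)
    show "f \<in> borel_measurable lborel" using assms(1) by (simp only: measurable_lborel2)
    show "AE x in lborel. x \<in> {a..b} \<longrightarrow> norm (f x) \<le> M" using assms(2) by simp
  qed simp
  from set_borel_integral_eq_integral(2)[OF this] show ?thesis
    unfolding set_lebesgue_integral_def real_scaleR_def by simp
qed

text \<open>A class closed under sums and products whose members are integrable on slices and admit
  Fubini on the rectangle; this keeps integrability conditions out of the double integrals
  below.\<close>

definition rect_bounded :: "real \<Rightarrow> real \<Rightarrow> (real \<times> real \<Rightarrow> real) \<Rightarrow> bool" where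
  "rect_bounded R T F \<longleftrightarrow> F \<in> borel_measurable borel \<and> (\<exists>B. \<forall>x\<in>{0..R}. \<forall>t\<in>{0..T}. \<bar>F (x, t)\<bar> \<le> B)"

lemma rect_boundedI:
  assumes "F \<in> borel_measurable borel" "\<And>x t. x \<in> {0..R} \<Longrightarrow> t \<in> {0..T} \<Longrightarrow> \<bar>F (x, t)\<bar> \<le> B"
  shows "rect_bounded R T F"
  using assms unfolding rect_bounded_def by blast

lemma rect_boundedE:
  assumes "rect_bounded R T F"
  obtains B where "B \<ge> 0" "\<And>x t. x \<in> {0..R} \<Longrightarrow> t \<in> {0..T} \<Longrightarrow> \<bar>F (x, t)\<bar> \<le> B"
proof -
  from assms obtain B where "\<forall>x\<in>{0..R}. \<forall>t\<in>{0..T}. \<bar>F (x, t)\<bar> \<le> B" by (auto simp: rect_bounded_def)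
  then show thesis by (intro that[of "max 0 B"]) (auto simp: le_max_iff_disj)
qed

lemma rect_bounded_add: "rect_bounded R T F \<Longrightarrow> rect_bounded R T G \<Longrightarrow> rect_bounded R T (\<lambda>p. F p + G p)"
  unfolding rect_bounded_def
  by (auto intro!: borel_measurable_add) (meson abs_triangle_ineq add_mono order_trans)

lemma rect_bounded_mult:
  assumes "rect_bounded R T F" "rect_bounded R T G"
  shows "rect_bounded R T (\<lambda>p. F p * G p)"
proof -
  obtain B where B: "B \<ge> 0" "\<And>x t. x \<in> {0..R} \<Longrightarrow> t \<in> {0..T} \<Longrightarrow> \<bar>F (x, t)\<bar> \<le> B"
    using assms(1) by (rule rect_boundedE) blast
  obtain C where C: "C \<ge> 0" "\<And>x t. x \<in> {0..R} \<Longrightarrow> t \<in> {0..T} \<Longrightarrow> \<bar>G (x, t)\<bar> \<le> C"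
    using assms(2) by (rule rect_boundedE) blast
  have "\<bar>F (x, t) * G (x, t)\<bar> \<le> B * C" if "x \<in> {0..R}" "t \<in> {0..T}" for x t
    unfolding abs_mult using B C that by (intro mult_mono) auto
  moreover have "(\<lambda>p. F p * G p) \<in> borel_measurable borel"
    using assms unfolding rect_bounded_def by (intro borel_measurable_times) auto
  ultimately show ?thesis by (intro rect_boundedI)
qed

lemma rect_bounded_minus: "rect_bounded R T F \<Longrightarrow> rect_bounded R T (\<lambda>p. - F p)"
  unfolding rect_bounded_def by (auto intro: borel_measurable_uminus)

lemma rect_bounded_diff:
  "rect_bounded R T F \<Longrightarrow> rect_bounded R T G \<Longrightarrow> rect_bounded R T (\<lambda>p. F p - G p)"
  using rect_bounded_add[OF _ rect_bounded_minus, of R T F G] by simp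

lemma rect_bounded_slice:
  assumes "rect_bounded R T F"
  shows "t \<in> {0..T} \<Longrightarrow> (\<lambda>x. F (x, t)) integrable_on {0..R}"
    and "x \<in> {0..R} \<Longrightarrow> (\<lambda>t. F (x, t)) integrable_on {0..T}"
proof -
  obtain B where B: "\<And>x t. x \<in> {0..R} \<Longrightarrow> t \<in> {0..T} \<Longrightarrow> \<bar>F (x, t)\<bar> \<le> B"
    using assms by (rule rect_boundedE) blast
  have "F \<in> borel_measurable borel" using assms by (simp add: rect_bounded_def)
  note m = borel_slice[OF this]
  show "(\<lambda>x. F (x, t)) integrable_on {0..R}" if "t \<in> {0..T}"
    by (rule borel_bounded_on_integrable_on[OF m(1)]) (use B that in auto)
  show "(\<lambda>t. F (x, t)) integrable_on {0..T}" if "x \<in> {0..R}"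
    by (rule borel_bounded_on_integrable_on[OF m(2)]) (use B that in auto)
qed

text \<open>The last two conclusions let the inner integral, cut off to \<open>[0, T]\<close>, be
  used as a bounded Borel function of time when the outer integral is a Lebesgue integral.\<close>

lemma rect_fubini:
  assumes F: "rect_bounded R T F"
  shows "(\<lambda>t. integral {0..R} (\<lambda>x. F (x, t))) integrable_on {0..T}"
    and "(\<lambda>x. integral {0..T} (\<lambda>t. F (x, t))) integrable_on {0..R}"
    and "integral {0..T} (\<lambda>t. integral {0..R} (\<lambda>x. F (x, t))) =
      integral {0..R} (\<lambda>x. integral {0..T} (\<lambda>t. F (x, t)))"
    and "(\<lambda>t. indicator {0..T} t * integral {0..R} (\<lambda>x. F (x, t))) \<in> borel_measurable borel"
    and "\<exists>C. \<forall>t. \<bar>indicator {0..T} t * integral {0..R} (\<lambda>x. F (x, t))\<bar> \<le> C"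
proof -
  obtain B where B: "B \<ge> 0" "\<And>x t. x \<in> {0..R} \<Longrightarrow> t \<in> {0..T} \<Longrightarrow> \<bar>F (x, t)\<bar> \<le> B"
    using assms by (rule rect_boundedE) blast
  have Fm: "F \<in> borel_measurable borel" using F by (simp add: rect_bounded_def)
  have Fm2 [measurable]: "F \<in> borel_measurable (borel \<Otimes>\<^sub>M borel)" using Fm by (simp only: borel_prod)
  define f where "f = (\<lambda>x t. indicator {0..R} x * (indicator {0..T} t * F (x, t)) :: real)"
  have fm: "(\<lambda>(x, t). f x t) \<in> borel_measurable (borel \<Otimes>\<^sub>M borel)"
    unfolding f_def by measurable
  have fb: "\<bar>f x t\<bar> \<le> B" for x t
    using B(1) B(2)[of x t] by (auto simp: f_def indicator_def)
  have fbx: "\<bar>f x t\<bar> \<le> indicator {0..R} x * (indicator {0..T} t * B)" for x t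
    using B(1) B(2)[of x t] by (auto simp: f_def indicator_def)
  have "integrable (lborel \<Otimes>\<^sub>M lborel) (\<lambda>p. indicator ({0..R} \<times> {0..T}) p *\<^sub>R (case p of (x, t) \<Rightarrow> f x t))"
  proof (rule integrableI_bounded_set_indicator[where B = B])
    show "{0..R} \<times> {0..T} \<in> sets (lborel \<Otimes>\<^sub>M lborel)" by (intro pair_measureI) auto
    show "emeasure (lborel \<Otimes>\<^sub>M lborel) ({0..R} \<times> {0..T}) < \<infinity>"
      by (subst lborel.emeasure_pair_measure_Times) (auto simp: emeasure_lborel_Icc_eq ennreal_mult_less_top)
    show "(\<lambda>(x, t). f x t) \<in> borel_measurable (lborel \<Otimes>\<^sub>M lborel)"
      using fm by (simp cong: measurable_cong_sets)
    show "AE p in lborel \<Otimes>\<^sub>M lborel. p \<in> {0..R} \<times> {0..T} \<longrightarrow> norm (case p of (x, t) \<Rightarrow> f x t) \<le> B"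
      using fb by (auto simp: split_beta)
  qed
  also have "(\<lambda>p. indicator ({0..R} \<times> {0..T}) p *\<^sub>R (case p of (x, t) \<Rightarrow> f x t)) = (\<lambda>(x, t). f x t)"
    by (auto simp: fun_eq_iff f_def indicator_def)
  finally have int: "integrable (lborel \<Otimes>\<^sub>M lborel) (\<lambda>(x, t). f x t)" .
  have inner_x: "indicator {0..T} t * integral {0..R} (\<lambda>x. F (x, t)) = (\<integral>x. f x t \<partial>lborel)" for t
  proof (cases "t \<in> {0..T}")
    case True
    then have "integral {0..R} (\<lambda>x. F (x, t)) = (\<integral>x. indicator {0..R} x * F (x, t) \<partial>lborel)"
      using B by (intro HK_integral_eq_lborel[OF borel_slice(1)[OF Fm]]) auto
    with True show ?thesis by (simp add: f_def)
  qed (simp add: f_def)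
  have inner_t: "indicator {0..R} x * integral {0..T} (\<lambda>t. F (x, t)) = (\<integral>t. f x t \<partial>lborel)" for x
  proof (cases "x \<in> {0..R}")
    case True
    then have "integral {0..T} (\<lambda>t. F (x, t)) = (\<integral>t. indicator {0..T} t * F (x, t) \<partial>lborel)"
      using B by (intro HK_integral_eq_lborel[OF borel_slice(2)[OF Fm]]) auto
    with True show ?thesis by (simp add: f_def)
  qed (simp add: f_def)
  have mx: "(\<lambda>t. \<integral>x. f x t \<partial>lborel) \<in> borel_measurable borel"
  proof -
    have "(\<lambda>(t, x). f x t) \<in> borel_measurable (borel \<Otimes>\<^sub>M lborel)"
      unfolding f_def by measurable
    then show ?thesis by (rule lborel.borel_measurable_lebesgue_integral)
  qed
  have mt: "(\<lambda>x. \<integral>t. f x t \<partial>lborel) \<in> borel_measurable borel"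
  proof -
    have "(\<lambda>(x, t). f x t) \<in> borel_measurable (borel \<Otimes>\<^sub>M lborel)"
      unfolding f_def by measurable
    then show ?thesis by (rule lborel.borel_measurable_lebesgue_integral)
  qed
  have bx: "\<bar>\<integral>x. f x t \<partial>lborel\<bar> \<le> \<bar>R\<bar> * B" for t
  proof (cases "t \<in> {0..T} \<and> 0 \<le> R")
    case True
    have "\<bar>integral {0..R} (\<lambda>x. F (x, t))\<bar> \<le> B * (R - 0)"
      using True B rect_bounded_slice(1)[OF F] by (intro abs_integral_bound) auto
    with True show ?thesis by (simp add: inner_x[symmetric] mult.commute)
  next
    case False
    then have "f x t = 0" for x by (auto simp: f_def)
    with B(1) show ?thesis by simp
  qed
  have bt: "\<bar>\<integral>t. f x t \<partial>lborel\<bar> \<le> \<bar>T\<bar> * B" for x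
  proof (cases "x \<in> {0..R} \<and> 0 \<le> T")
    case True
    have "\<bar>integral {0..T} (\<lambda>t. F (x, t))\<bar> \<le> B * (T - 0)"
      using True B rect_bounded_slice(2)[OF F] by (intro abs_integral_bound) auto
    with True show ?thesis by (simp add: inner_t[symmetric] mult.commute)
  next
    case False
    then have "f x t = 0" for t by (auto simp: f_def)
    with B(1) show ?thesis by simp
  qed
  have cx: "integral {0..R} (\<lambda>x. F (x, t)) = (\<integral>x. f x t \<partial>lborel)" if "t \<in> {0..T}" for t
    using inner_x[of t] that by simp
  have ct: "integral {0..T} (\<lambda>t. F (x, t)) = (\<integral>t. f x t \<partial>lborel)" if "x \<in> {0..R}" for x
    using inner_t[of x] that by simp
  show "(\<lambda>t. integral {0..R} (\<lambda>x. F (x, t))) integrable_on {0..T}"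
    using bounded_borel_integrable_on[OF mx bx]
    by (rule integrable_cong[THEN iffD1, rotated]) (simp add: cx)
  show "(\<lambda>x. integral {0..T} (\<lambda>t. F (x, t))) integrable_on {0..R}"
    using bounded_borel_integrable_on[OF mt bt]
    by (rule integrable_cong[THEN iffD1, rotated]) (simp add: ct)
  show "(\<lambda>t. indicator {0..T} t * integral {0..R} (\<lambda>x. F (x, t))) \<in> borel_measurable borel"
    using mx by (simp only: inner_x)
  show "\<exists>C. \<forall>t. \<bar>indicator {0..T} t * integral {0..R} (\<lambda>x. F (x, t))\<bar> \<le> C"
    using bx by (auto simp only: inner_x)
  have "integral {0..T} (\<lambda>t. integral {0..R} (\<lambda>x. F (x, t))) = integral {0..T} (\<lambda>t. \<integral>x. f x t \<partial>lborel)"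
    by (rule integral_cong) (rule cx)
  also have "\<dots> = (\<integral>t. indicator {0..T} t * (\<integral>x. f x t \<partial>lborel) \<partial>lborel)"
    by (rule HK_integral_eq_lborel[OF mx bx])
  also have "\<dots> = (\<integral>t. (\<integral>x. f x t \<partial>lborel) \<partial>lborel)"
    by (intro Bochner_Integration.integral_cong) (auto simp: f_def indicator_def)
  also have "\<dots> = (\<integral>x. (\<integral>t. f x t \<partial>lborel) \<partial>lborel)"
    by (rule lborel_pair.Fubini_integral[OF int])
  also have "\<dots> = (\<integral>x. indicator {0..R} x * (\<integral>t. f x t \<partial>lborel) \<partial>lborel)"
    by (intro Bochner_Integration.integral_cong) (auto simp: f_def indicator_def)
  also have "\<dots> = integral {0..R} (\<lambda>x. \<integral>t. f x t \<partial>lborel)"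
    by (rule HK_integral_eq_lborel[OF mt bt, symmetric])
  also have "\<dots> = integral {0..R} (\<lambda>x. integral {0..T} (\<lambda>t. F (x, t)))"
    by (rule integral_cong) (simp add: ct)
  finally show "integral {0..T} (\<lambda>t. integral {0..R} (\<lambda>x. F (x, t))) =
      integral {0..R} (\<lambda>x. integral {0..T} (\<lambda>t. F (x, t)))" .
qed

text \<open>\<open>a\<close> is only bounded and Borel, so its primitive need not be differentiable
  everywhere. Instead \<open>Q\<close> is written as minus the integral of \<open>q\<close> over
  \<open>[x, R]\<close>, and Fubini on the triangle \<open>x \<le> z\<close> moves the integration
  onto \<open>a\<close>.\<close>

lemma integration_by_parts_bounded:
  fixes a q Q :: "real \<Rightarrow> real"
  assumes a: "a \<in> borel_measurable borel" "\<And>x. x \<in> {0..R} \<Longrightarrow> \<bar>a x\<bar> \<le> A"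
    and q: "q \<in> borel_measurable borel" "\<And>x. x \<in> {0..R} \<Longrightarrow> \<bar>q x\<bar> \<le> B"
    and Q: "\<And>x. x \<in> {0..R} \<Longrightarrow> (Q has_real_derivative q x) (at x within {0..R})" "Q R = 0"
  shows "integral {0..R} (\<lambda>x. a x * Q x) = - integral {0..R} (\<lambda>x. integral {0..x} a * q x)"
proof -
  define F where "F = (\<lambda>(x, z). if x \<le> z then a x * q z else 0)"
  have F: "rect_bounded R R F"
  proof -
    have "F \<in> borel_measurable (borel \<Otimes>\<^sub>M borel)" unfolding F_def using a(1) q(1) by measurable
    then have "F \<in> borel_measurable borel" by (simp only: borel_prod)
    moreover have "\<bar>F (x, z)\<bar> \<le> A * B" if "x \<in> {0..R}" "z \<in> {0..R}" for x z
      using a(2)[OF that(1)] q(2)[OF that(2)] by (auto simp: F_def abs_mult intro!: mult_mono)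
    ultimately show ?thesis unfolding rect_bounded_def by blast
  qed
  have ai: "a integrable_on {s..t}" if "0 \<le> s" "t \<le> R" for s t
    using a that by (intro borel_bounded_on_integrable_on[where M = A]) auto
  have qi: "q integrable_on {s..t}" if "0 \<le> s" "t \<le> R" for s t
    using q that by (intro borel_bounded_on_integrable_on[where M = B]) auto
  have Qx: "Q x = - integral {x..R} q" if x: "x \<in> {0..R}" for x
  proof -
    have "(q has_integral Q R - Q x) {x..R}"
      using x by (intro fundamental_theorem_of_calculus)
        (auto simp: has_real_derivative_iff_has_vector_derivative[symmetric] intro: DERIV_subset[OF Q(1)])
    then show ?thesis using Q(2) by (simp add: integral_unique)
  qed
  have cut1: "{0..R} \<inter> {x..} = {x..R}" if "x \<in> {0..R}" for x using that by auto
  have cut2: "{0..R} \<inter> {..z} = {0..z}" if "z \<in> {0..R}" for z using that by auto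
  have 1: "integral {0..R} (\<lambda>z. F (x, z)) = - (a x * Q x)" if x: "x \<in> {0..R}" for x
  proof -
    have "integral {0..R} (\<lambda>z. F (x, z)) = integral {0..R} (\<lambda>z. if z \<in> {x..} then a x * q z else 0)"
      by (intro integral_cong) (simp add: F_def)
    also have "\<dots> = integral {x..R} (\<lambda>z. a x * q z)"
      by (simp only: integral_restrict_Int cut1[OF x] Int_commute[of "{x..}" "{0..R}"])
    also have "\<dots> = a x * integral {x..R} q" by simp
    finally show ?thesis by (simp add: Qx[OF x])
  qed
  have 2: "integral {0..R} (\<lambda>x. F (x, z)) = integral {0..z} a * q z" if z: "z \<in> {0..R}" for z
  proof -
    have "integral {0..R} (\<lambda>x. F (x, z)) = integral {0..R} (\<lambda>x. if x \<in> {..z} then a x * q z else 0)"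
      by (intro integral_cong) (simp add: F_def)
    also have "\<dots> = integral {0..z} (\<lambda>x. a x * q z)"
      by (simp only: integral_restrict_Int cut2[OF z] Int_commute[of "{..z}" "{0..R}"])
    finally show ?thesis by simp
  qed
  have "integral {0..R} (\<lambda>x. a x * Q x) = - integral {0..R} (\<lambda>x. - (a x * Q x))"
    by (simp add: integral_neg)
  also have "integral {0..R} (\<lambda>x. - (a x * Q x)) = integral {0..R} (\<lambda>x. integral {0..R} (\<lambda>z. F (x, z)))"
    by (intro integral_cong) (simp add: 1)
  also have "\<dots> = integral {0..R} (\<lambda>z. integral {0..R} (\<lambda>x. F (x, z)))"
    by (rule rect_fubini(3)[OF F, symmetric])
  also have "\<dots> = integral {0..R} (\<lambda>x. integral {0..x} a * q x)"
    by (intro integral_cong) (simp add: 2)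
  finally show ?thesis .
qed

lemma rect_bounded_primitive:
  assumes F: "F \<in> borel_measurable borel" and B: "\<And>p. \<bar>F p\<bar> \<le> B"
  shows "rect_bounded R T (\<lambda>p. integral {0..fst p} (\<lambda>z. F (z, snd p)))"
    and "rect_bounded R T (\<lambda>p. integral {0..snd p} (\<lambda>z. F (fst p, z)))"
proof -
  have Fm2 [measurable]: "F \<in> borel_measurable (borel \<Otimes>\<^sub>M borel)" using F by (simp only: borel_prod)
  have "(\<lambda>p. integral {0..fst p} (\<lambda>z. F (z, snd p))) = (\<lambda>p. \<integral>z. indicator {0..fst p} z * F (z, snd p) \<partial>lborel)"
    by (intro ext HK_integral_eq_lborel[OF borel_slice(1)[OF F] B])
  also have "(\<lambda>(p, z). indicator {0..fst p} z * F (z, snd p)) \<in> borel_measurable ((borel \<Otimes>\<^sub>M borel) \<Otimes>\<^sub>M lborel)"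
    unfolding indicator_def atLeastAtMost_iff by measurable
  then have "(\<lambda>p. \<integral>z. indicator {0..fst p} z * F (z, snd p) \<partial>lborel) \<in> borel_measurable (borel \<Otimes>\<^sub>M borel)"
    by (rule lborel.borel_measurable_lebesgue_integral)
  finally have 1: "(\<lambda>p. integral {0..fst p} (\<lambda>z. F (z, snd p))) \<in> borel_measurable borel" by (simp only: borel_prod)
  have "(\<lambda>p. integral {0..snd p} (\<lambda>z. F (fst p, z))) = (\<lambda>p. \<integral>z. indicator {0..snd p} z * F (fst p, z) \<partial>lborel)"
    by (intro ext HK_integral_eq_lborel[OF borel_slice(2)[OF F] B])
  also have "(\<lambda>(p, z). indicator {0..snd p} z * F (fst p, z)) \<in> borel_measurable ((borel \<Otimes>\<^sub>M borel) \<Otimes>\<^sub>M lborel)"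
    unfolding indicator_def atLeastAtMost_iff by measurable
  then have "(\<lambda>p. \<integral>z. indicator {0..snd p} z * F (fst p, z) \<partial>lborel) \<in> borel_measurable (borel \<Otimes>\<^sub>M borel)"
    by (rule lborel.borel_measurable_lebesgue_integral)
  finally have 2: "(\<lambda>p. integral {0..snd p} (\<lambda>z. F (fst p, z))) \<in> borel_measurable borel" by (simp only: borel_prod)
  have B0: "B \<ge> 0" using B[of "(0,0)"] by linarith
  have "\<bar>integral {0..x} (\<lambda>z. F (z, t))\<bar> \<le> B * R" if "x \<in> {0..R}" for x t
  proof -
    have "\<bar>integral {0..x} (\<lambda>z. F (z, t))\<bar> \<le> B * (x - 0)"
      using that B by (intro abs_integral_bound bounded_borel_integrable_on[OF borel_slice(1)[OF F] B]) auto
    also have "\<dots> \<le> B * R" using that B0 by (intro mult_left_mono) auto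
    finally show ?thesis .
  qed
  with 1 show "rect_bounded R T (\<lambda>p. integral {0..fst p} (\<lambda>z. F (z, snd p)))"
    by (intro rect_boundedI[where B = "B * R"]) simp_all
  have "\<bar>integral {0..t} (\<lambda>z. F (x, z))\<bar> \<le> B * T" if "t \<in> {0..T}" for x t
  proof -
    have "\<bar>integral {0..t} (\<lambda>z. F (x, z))\<bar> \<le> B * (t - 0)"
      using that B by (intro abs_integral_bound bounded_borel_integrable_on[OF borel_slice(2)[OF F] B]) auto
    also have "\<dots> \<le> B * T" using that B0 by (intro mult_left_mono) auto
    finally show ?thesis .
  qed
  with 2 show "rect_bounded R T (\<lambda>p. integral {0..snd p} (\<lambda>z. F (fst p, z)))"
    by (intro rect_boundedI[where B = "B * T"]) simp_all
qed

text \<open>\<open>a\<close> is a density with flux \<open>b\<close>; the last hypothesis measures the defect in the conservation law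
  integrated over \<open>[0, x] \<times> [0, t]\<close>, with initial datum \<open>c\<close> and total inflow \<open>H t\<close> at \<open>0\<close> up to time \<open>t\<close>.\<close>

lemma weak_form_defect:
  fixes a b \<psi> \<psi>x \<psi>t \<psi>xt :: "real \<times> real \<Rightarrow> real" and c H :: "real \<Rightarrow> real"
  assumes RT: "R \<ge> 0" "T \<ge> 0"
    and a: "a \<in> borel_measurable borel" "\<And>p. \<bar>a p\<bar> \<le> B"
    and b: "b \<in> borel_measurable borel" "\<And>p. \<bar>b p\<bar> \<le> B"
    and c: "c \<in> borel_measurable borel" "\<And>x. \<bar>c x\<bar> \<le> B"
    and H: "H \<in> borel_measurable borel" "\<And>t. t \<in> {0..T} \<Longrightarrow> \<bar>H t\<bar> \<le> B'"
    and \<psi>m: "\<psi>x \<in> borel_measurable borel" "\<psi>t \<in> borel_measurable borel" "\<psi>xt \<in> borel_measurable borel"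
    and \<psi>b: "\<And>p. \<bar>\<psi>x p\<bar> \<le> D" "\<And>p. \<bar>\<psi>t p\<bar> \<le> D" "\<And>p. \<bar>\<psi>xt p\<bar> \<le> D"
    and d1: "\<And>x t. x \<in> {0..R} \<Longrightarrow> t \<in> {0..T} \<Longrightarrow>
      ((\<lambda>x. \<psi>t (x, t)) has_real_derivative \<psi>xt (x, t)) (at x within {0..R})"
    and d2: "\<And>x t. x \<in> {0..R} \<Longrightarrow> t \<in> {0..T} \<Longrightarrow>
      ((\<lambda>t. \<psi>x (x, t)) has_real_derivative \<psi>xt (x, t)) (at t within {0..T})"
    and d3: "\<And>x. x \<in> {0..R} \<Longrightarrow> ((\<lambda>x. \<psi> (x, 0)) has_real_derivative \<psi>x (x, 0)) (at x within {0..R})"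
    and z: "\<And>t. t \<in> {0..T} \<Longrightarrow> \<psi>t (R, t) = 0" "\<And>x. x \<in> {0..R} \<Longrightarrow> \<psi>x (x, T) = 0" "\<psi> (R, 0) = 0"
    and defect: "\<And>t. t \<in> {0..T} \<Longrightarrow> integral {0..R} (\<lambda>x. \<bar>integral {0..x} (\<lambda>y. a (y, t))
      + integral {0..t} (\<lambda>s. b (x, s)) - integral {0..x} c - H t\<bar>) \<le> \<epsilon>"
  shows "\<bar>integral {0..T} (\<lambda>t. integral {0..R} (\<lambda>x. a (x, t) * \<psi>t (x, t) + b (x, t) * \<psi>x (x, t)))
    + integral {0..R} (\<lambda>x. c x * \<psi> (x, 0)) - integral {0..T} (\<lambda>t. H t * \<psi>t (0, t))\<bar> \<le> T * (D * \<epsilon>)"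
proof -
  define A where "A = (\<lambda>p. integral {0..fst p} (\<lambda>y. a (y, snd p)))"
  define Bb where "Bb = (\<lambda>p. integral {0..snd p} (\<lambda>s. b (fst p, s)))"
  define C where "C = (\<lambda>p :: real \<times> real. integral {0..fst p} (\<lambda>y. (c \<circ> fst) (y, snd p)))"
  define Hh where "Hh = (\<lambda>p :: real \<times> real. H (snd p))"
  have fstm: "fst \<in> borel_measurable (borel :: (real \<times> real) measure)"
    and sndm: "snd \<in> borel_measurable (borel :: (real \<times> real) measure)"
    by (intro borel_measurable_continuous_onI continuous_intros)+
  have g\<psi>: "rect_bounded R T \<psi>x" "rect_bounded R T \<psi>t" "rect_bounded R T \<psi>xt"
    using \<psi>m \<psi>b unfolding rect_bounded_def by blast+
  have ga: "rect_bounded R T a" "rect_bounded R T b" using a b unfolding rect_bounded_def by blast+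
  have gA: "rect_bounded R T A" unfolding A_def by (rule rect_bounded_primitive(1)[OF a])
  have gB: "rect_bounded R T Bb" unfolding Bb_def by (rule rect_bounded_primitive(2)[OF b])
  have gC: "rect_bounded R T C" unfolding C_def
    by (rule rect_bounded_primitive(1)[where B = B, OF measurable_comp[OF fstm c(1)]]) (use c in simp)
  have gH: "rect_bounded R T Hh" unfolding Hh_def
    by (rule rect_boundedI[where B = B', OF measurable_compose[OF sndm H(1)]]) (use H(2) in simp)
  have C_eq: "C (x, t) = integral {0..x} c" for x t by (simp add: C_def)
  define II where "II = (\<lambda>F :: real \<times> real \<Rightarrow> real. integral {0..T} (\<lambda>t. integral {0..R} (\<lambda>x. F (x, t))))"
  have II_add: "II (\<lambda>p. F p + G p) = II F + II G" if "rect_bounded R T F" "rect_bounded R T G" for F G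
  proof -
    have "II (\<lambda>p. F p + G p) = integral {0..T} (\<lambda>t. integral {0..R} (\<lambda>x. F (x, t)) + integral {0..R} (\<lambda>x. G (x, t)))"
      unfolding II_def
      by (intro integral_cong Henstock_Kurzweil_Integration.integral_add rect_bounded_slice) (use that in auto)
    also have "\<dots> = II F + II G"
      unfolding II_def by (intro Henstock_Kurzweil_Integration.integral_add rect_fubini) (use that in auto)
    finally show ?thesis .
  qed
  have II_minus: "II (\<lambda>p. - F p) = - II F" for F by (simp add: II_def)
  \<comment> \<open>All four terms are turned into double integrals against the mixed derivative
    \<open>\<psi>xt\<close>: the density by parts in \<open>x\<close>, the flux by parts in
    \<open>t\<close>, the initial datum and the boundary flow by writing \<open>\<psi>x\<close> and
    \<open>\<psi>t\<close> as integrals of \<open>\<psi>xt\<close>. The common factor is then the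
    defect of the conservation law.\<close>
  have X1: "II (\<lambda>p. a p * \<psi>t p) = II (\<lambda>p. - (A p * \<psi>xt p))"
    unfolding II_def
  proof (rule integral_cong)
    fix t assume t: "t \<in> {0..T}"
    have "integral {0..R} (\<lambda>x. a (x, t) * \<psi>t (x, t)) = - integral {0..R} (\<lambda>x. integral {0..x} (\<lambda>x. a (x, t)) * \<psi>xt (x, t))"
      by (rule integration_by_parts_bounded[OF borel_slice(1)[OF a(1)] a(2) borel_slice(1)[OF \<psi>m(3)] \<psi>b(3)])
        (use d1 z t in auto)
    then show "integral {0..R} (\<lambda>x. a (x, t) * \<psi>t (x, t)) = integral {0..R} (\<lambda>x. - (A (x, t) * \<psi>xt (x, t)))"
      by (simp add: A_def)
  qed
  have X2: "II (\<lambda>p. b p * \<psi>x p) = II (\<lambda>p. - (Bb p * \<psi>xt p))"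
  proof -
    have "II (\<lambda>p. b p * \<psi>x p) = integral {0..R} (\<lambda>x. integral {0..T} (\<lambda>t. b (x, t) * \<psi>x (x, t)))"
      unfolding II_def by (rule rect_fubini(3)[OF rect_bounded_mult[OF ga(2) g\<psi>(1)]])
    also have "\<dots> = integral {0..R} (\<lambda>x. integral {0..T} (\<lambda>t. - (Bb (x, t) * \<psi>xt (x, t))))"
    proof (rule integral_cong)
      fix x assume x: "x \<in> {0..R}"
      have "integral {0..T} (\<lambda>t. b (x, t) * \<psi>x (x, t)) = - integral {0..T} (\<lambda>t. integral {0..t} (\<lambda>t. b (x, t)) * \<psi>xt (x, t))"
        by (rule integration_by_parts_bounded[OF borel_slice(2)[OF b(1)] b(2) borel_slice(2)[OF \<psi>m(3)] \<psi>b(3)])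
          (use d2 z x in auto)
      then show "integral {0..T} (\<lambda>t. b (x, t) * \<psi>x (x, t)) = integral {0..T} (\<lambda>t. - (Bb (x, t) * \<psi>xt (x, t)))"
        by (simp add: Bb_def)
    qed
    also have "\<dots> = II (\<lambda>p. - (Bb p * \<psi>xt p))"
      unfolding II_def by (rule rect_fubini(3)[OF rect_bounded_minus[OF rect_bounded_mult[OF gB g\<psi>(3)]], symmetric])
    finally show ?thesis .
  qed
  have X3: "integral {0..R} (\<lambda>x. c x * \<psi> (x, 0)) = II (\<lambda>p. C p * \<psi>xt p)"
  proof -
    have "integral {0..R} (\<lambda>x. c x * \<psi> (x, 0)) = - integral {0..R} (\<lambda>x. integral {0..x} c * \<psi>x (x, 0))"
      by (rule integration_by_parts_bounded[OF c borel_slice(1)[OF \<psi>m(1)] \<psi>b(1)]) (use d3 z in auto)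
    also have "\<dots> = integral {0..R} (\<lambda>x. - (integral {0..x} c * \<psi>x (x, 0)))" by simp
    also have "\<dots> = integral {0..R} (\<lambda>x. integral {0..T} (\<lambda>t. C (x, t) * \<psi>xt (x, t)))"
    proof (rule integral_cong)
      fix x assume x: "x \<in> {0..R}"
      have "((\<lambda>t. \<psi>xt (x, t)) has_integral \<psi>x (x, T) - \<psi>x (x, 0)) {0..T}"
        using d2[OF x] RT by (intro fundamental_theorem_of_calculus)
          (auto simp: has_real_derivative_iff_has_vector_derivative[symmetric])
      then have "integral {0..T} (\<lambda>t. \<psi>xt (x, t)) = - \<psi>x (x, 0)" using z(2)[OF x] by (simp add: integral_unique)
      then show "- (integral {0..x} c * \<psi>x (x, 0)) = integral {0..T} (\<lambda>t. C (x, t) * \<psi>xt (x, t))"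
        by (simp add: C_eq)
    qed
    also have "\<dots> = II (\<lambda>p. C p * \<psi>xt p)"
      unfolding II_def by (rule rect_fubini(3)[OF rect_bounded_mult[OF gC g\<psi>(3)], symmetric])
    finally show ?thesis .
  qed
  have X4: "integral {0..T} (\<lambda>t. H t * \<psi>t (0, t)) = II (\<lambda>p. - (Hh p * \<psi>xt p))"
    unfolding II_def
  proof (rule integral_cong)
    fix t assume t: "t \<in> {0..T}"
    have "((\<lambda>x. \<psi>xt (x, t)) has_integral \<psi>t (R, t) - \<psi>t (0, t)) {0..R}"
      using d1[OF _ t] RT by (intro fundamental_theorem_of_calculus)
        (auto simp: has_real_derivative_iff_has_vector_derivative[symmetric])
    then have "integral {0..R} (\<lambda>x. \<psi>xt (x, t)) = - \<psi>t (0, t)" using z(1)[OF t] by (simp add: integral_unique)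
    then show "H t * \<psi>t (0, t) = integral {0..R} (\<lambda>x. - (Hh (x, t) * \<psi>xt (x, t)))"
      by (simp add: Hh_def)
  qed
  define E where "E = (\<lambda>p. A p + Bb p - C p - Hh p)"
  have gE: "rect_bounded R T E" unfolding E_def by (intro rect_bounded_diff rect_bounded_add gA gB gC gH)
  have gm: "rect_bounded R T (\<lambda>p. A p * \<psi>xt p)" "rect_bounded R T (\<lambda>p. Bb p * \<psi>xt p)"
    "rect_bounded R T (\<lambda>p. C p * \<psi>xt p)" "rect_bounded R T (\<lambda>p. Hh p * \<psi>xt p)"
    by (intro rect_bounded_mult gA gB gC gH g\<psi>)+
  have sum: "II (\<lambda>p. a p * \<psi>t p + b p * \<psi>x p) + integral {0..R} (\<lambda>x. c x * \<psi> (x, 0))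
      - integral {0..T} (\<lambda>t. H t * \<psi>t (0, t)) = - II (\<lambda>p. E p * \<psi>xt p)"
  proof -
    have "II (\<lambda>p. E p * \<psi>xt p) = II (\<lambda>p. (A p * \<psi>xt p + Bb p * \<psi>xt p) + (- (C p * \<psi>xt p) + - (Hh p * \<psi>xt p)))"
      by (rule arg_cong[where f = II]) (simp add: E_def fun_eq_iff algebra_simps)
    also have "\<dots> = (II (\<lambda>p. A p * \<psi>xt p) + II (\<lambda>p. Bb p * \<psi>xt p)) + (- II (\<lambda>p. C p * \<psi>xt p) + - II (\<lambda>p. Hh p * \<psi>xt p))"
      unfolding II_add[OF rect_bounded_add[OF gm(1,2)] rect_bounded_add[OF gm(3,4)[THEN rect_bounded_minus]]]
        II_add[OF gm(1,2)] II_add[OF gm(3,4)[THEN rect_bounded_minus]] II_minus ..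
    finally show ?thesis
      using II_add[OF rect_bounded_mult[OF ga(1) g\<psi>(2)] rect_bounded_mult[OF ga(2) g\<psi>(1)]] X1 X2 X3 X4
      unfolding II_minus by linarith
  qed
  have "\<bar>II (\<lambda>p. E p * \<psi>xt p)\<bar> \<le> D * \<epsilon> * (T - 0)"
    unfolding II_def
  proof (rule abs_integral_bound)
    fix t assume t: "t \<in> {0..T}"
    have Ei: "(\<lambda>x. E (x, t)) integrable_on {0..R}" using gE t by (rule rect_bounded_slice)
    have absE: "rect_bounded R T (\<lambda>p. \<bar>E p\<bar>)" using gE unfolding rect_bounded_def by auto
    have D0: "D \<ge> 0" using \<psi>b(1)[of "(0,0)"] by linarith
    have "norm (integral {0..R} (\<lambda>x. E (x, t) * \<psi>xt (x, t))) \<le> integral {0..R} (\<lambda>x. D * \<bar>E (x, t)\<bar>)"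
    proof (rule integral_norm_bound_integral)
      show "(\<lambda>x. E (x, t) * \<psi>xt (x, t)) integrable_on {0..R}"
        using rect_bounded_slice(1)[OF rect_bounded_mult[OF gE g\<psi>(3)] t] .
      show "(\<lambda>x. D * \<bar>E (x, t)\<bar>) integrable_on {0..R}"
        using rect_bounded_slice(1)[OF absE t] by (rule integrable_on_mult_right)
      show "norm (E (x, t) * \<psi>xt (x, t)) \<le> D * \<bar>E (x, t)\<bar>" for x
        using mult_left_mono[OF \<psi>b(3)[of "(x, t)"] abs_ge_zero[of "E (x, t)"]]
        by (simp add: abs_mult mult.commute)
    qed
    also have "\<dots> = D * integral {0..R} (\<lambda>x. \<bar>E (x, t)\<bar>)" by simp
    also have "\<dots> \<le> D * \<epsilon>"
      using defect[OF t] D0 by (intro mult_left_mono) (auto simp: E_def A_def Bb_def C_eq Hh_def)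
    finally show "\<bar>integral {0..R} (\<lambda>x. E (x, t) * \<psi>xt (x, t))\<bar> \<le> D * \<epsilon>" by simp
  qed (use RT rect_fubini(1)[OF rect_bounded_mult[OF gE g\<psi>(3)]] in auto)
  then show ?thesis using sum unfolding II_def by (simp add: algebra_simps)
qed

section \<open>Reflection of the edges\<close>

lemma AE_lborel_affine:
  fixes c t :: real
  assumes "AE x in lborel. P x" "c \<noteq> 0"
  shows "AE x in lborel. P (t + c * x)"
proof -
  obtain N where N: "{x. \<not> P x} \<subseteq> N" "emeasure lborel N = 0" "N \<in> sets borel"
    using assms(1) by (rule AE_E) auto
  define N' where "N' = (\<lambda>x. t + c * x) -` N"
  have m: "(\<lambda>x. t + c * x) \<in> borel_measurable (borel :: real measure)" by measurable
  have N': "N' \<in> sets borel" unfolding N'_def using measurable_sets[OF m N(3)] by simp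
  have ind: "indicator N (t + c * x) = (indicator N' x :: ennreal)" for x by (simp add: N'_def indicator_def)
  have "0 = (\<integral>\<^sup>+x. indicator N x \<partial>lborel)" using N by simp
  also have "\<dots> = ennreal \<bar>c\<bar> * (\<integral>\<^sup>+x. indicator N (t + c * x) \<partial>lborel)"
    using N(3) by (intro nn_integral_real_affine assms(2)) auto
  also have "(\<integral>\<^sup>+x. indicator N (t + c * x) \<partial>lborel) = emeasure lborel N'"
    unfolding ind using N' by simp
  finally have "emeasure lborel N' = 0" using assms(2) by simp
  with N' show ?thesis using N(1) by (intro AE_I[where N = N']) (auto simp: N'_def)
qed

definition dir :: "int \<Rightarrow> real" where
  "dir k = (if k < 0 then -1 else 1)"

lemma dir_simps [simp]: "dir k * dir k = 1" "dir k * (dir k * a) = a" "dir k \<noteq> 0" "\<bar>dir k\<bar> = 1" "\<bar>dir k * a\<bar> = \<bar>a\<bar>"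
  by (auto simp: dir_def)

lemma edge_iff_dir: "x \<in> edge k \<longleftrightarrow> 0 < dir k * x"
  by (auto simp: edge_def dir_def)

lemma edge_lebesgue [simp]: "edge k \<in> sets lebesgue" "edge k \<in> sets borel"
  by (auto simp: edge_def)

lemma edge_ivl_lebesgue [simp]: "edge k \<inter> {a..b} \<in> sets lebesgue"
  by (auto simp: edge_def)

text \<open>The bridge between the Lebesgue integrals over subsets of an edge in the statement and
  the Henstock--Kurzweil integrals over reflected intervals in the estimates. Open or closed ends do
  not matter: the reflected points \<open>a\<close> and \<open>b\<close> form a null set.\<close>

lemma LINT_edge:
  fixes g w :: "real \<Rightarrow> real"
  assumes S: "S \<in> sets lebesgue" and w: "w \<in> borel_measurable borel" "\<And>x. x \<in> {a..b} \<Longrightarrow> \<bar>w x\<bar> \<le> B"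
    and inside: "\<And>x. a < x \<Longrightarrow> x < b \<Longrightarrow> dir k * x \<in> S"
    and eq: "AE x in lborel. x \<in> S \<longrightarrow> g x = indicator {a..b} (dir k * x) * w (dir k * x)"
    and g: "g \<in> borel_measurable (lebesgue_on S)"
  shows "integrable (lebesgue_on S) g" "integral\<^sup>L (lebesgue_on S) g = integral {a..b} w"
proof -
  have Sp: "S \<inter> space lebesgue \<in> sets lebesgue" using S by simp
  define w1 where "w1 = (\<lambda>x. indicator {a..b} x * w x)"
  define g1 where "g1 = (\<lambda>x. indicator S x *\<^sub>R g x)"
  have g1m: "g1 \<in> borel_measurable lebesgue"
    unfolding g1_def using g by (simp only: borel_measurable_restrict_space_iff[OF Sp])
  have w1m: "w1 \<in> borel_measurable borel"
    unfolding w1_def by (intro borel_measurable_times borel_measurable_indicator w) simp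
  have w1i: "integrable lborel w1"
    using integrableI_bounded_set_indicator[of "{a..b}" lborel w B] w
    by (simp add: w1_def emeasure_lborel_Icc_eq)
  have dm: "(\<lambda>x. 0 + dir k * x) \<in> borel_measurable (borel :: real measure)" by measurable
  have w2m: "(\<lambda>x. w1 (0 + dir k * x)) \<in> borel_measurable borel" using w1m by (rule measurable_compose[OF dm])
  have ends: "AE x in lborel. 0 + dir k * x \<notin> {a, b}"
    using AE_lborel_affine[where P = "\<lambda>x. x \<notin> {a, b}" and c = "dir k" and t = 0]
      AE_lborel_singleton[of a] AE_lborel_singleton[of b] by (simp add: AE_conj_iff)
  have "AE x in lborel. g1 x = w1 (0 + dir k * x)"
  proof (rule AE_mp[OF eq], rule AE_mp[OF ends], intro AE_I2 impI)
    fix x assume e: "0 + dir k * x \<notin> {a, b}"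
      and "x \<in> S \<longrightarrow> g x = indicator {a..b} (dir k * x) * w (dir k * x)"
    moreover have "x \<in> S" if "dir k * x \<in> {a..b}"
      using inside[of "dir k * x"] that e by (auto simp: less_le)
    ultimately show "g1 x = w1 (0 + dir k * x)" by (auto simp: g1_def w1_def indicator_def)
  qed
  then have ae: "AE x in lebesgue. g1 x = w1 (0 + dir k * x)" by (rule AE_completion)
  have w2l: "(\<lambda>x. w1 (0 + dir k * x)) \<in> borel_measurable lebesgue"
    using w2m by (intro measurable_completion) simp
  have w1l: "integrable lebesgue w1" using w1i w1m by (simp add: integrable_completion)
  then have w2i: "integrable lebesgue (\<lambda>x. w1 (0 + dir k * x))"
    by (subst lebesgue_integrable_real_affine_iff) auto
  have g1i: "integrable lebesgue g1"
    using w2i integrable_cong_AE[OF g1m w2l ae] by simp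
  then show "integrable (lebesgue_on S) g"
    unfolding integrable_restrict_space[OF Sp] g1_def .
  have "integral\<^sup>L (lebesgue_on S) g = integral\<^sup>L lebesgue g1"
    unfolding integral_restrict_space[OF Sp] g1_def ..
  also have "\<dots> = integral\<^sup>L lebesgue (\<lambda>x. w1 (0 + dir k * x))"
    by (rule integral_cong_AE[OF g1m w2l ae])
  also have "\<dots> = integral\<^sup>L lebesgue w1"
    using lebesgue_integral_real_affine[of "dir k" w1 0] by simp
  also have "\<dots> = integral\<^sup>L lborel w1" using w1m by (intro integral_completion) simp
  also have "\<dots> = integral {a..b} w"
    unfolding w1_def by (rule HK_integral_eq_lborel[OF w, symmetric])
  finally show "integral\<^sup>L (lebesgue_on S) g = integral {a..b} w" .
qed

text \<open>The initial datum is only Lebesgue measurable and bounded almost everywhere, whereas the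
  integrals above ask for Borel functions bounded everywhere. Clamping a Borel representative to
  \<open>[c, d]\<close> changes it on a null set of the edge at most.\<close>

lemma borel_representative:
  fixes g :: "real \<Rightarrow> real"
  assumes g: "g \<in> borel_measurable (lebesgue_on (edge k))"
    and bnd: "AE x in lebesgue_on (edge k). c \<le> g x \<and> g x \<le> d" and cd: "c \<le> d"
  obtains b where "b \<in> borel_measurable borel" "\<And>\<rho>. b \<rho> \<in> {c..d}"
    "AE x in lborel. x \<in> edge k \<longrightarrow> g x = b (dir k * x)"
proof -
  have "(\<lambda>x. if x \<in> edge k then g x else 0) \<in> borel_measurable lebesgue"
    using g by (rule borel_measurable_if_I) simp
  then obtain g' where g': "g' \<in> borel_measurable lborel" "AE x in lborel. (if x \<in> edge k then g x else 0) = g' x"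
    using completion_ex_borel_measurable_real by blast
  define b where "b = (\<lambda>\<rho>. max c (min d (g' (dir k * \<rho>))))"
  have "(\<lambda>\<rho>. dir k * \<rho>) \<in> borel_measurable (borel :: real measure)" by measurable
  then have "(\<lambda>\<rho>. g' (dir k * \<rho>)) \<in> borel_measurable borel"
    using g'(1) by (simp add: measurable_compose)
  then have bm: "b \<in> borel_measurable borel" unfolding b_def by measurable
  have "AE x in lebesgue. x \<in> edge k \<longrightarrow> c \<le> g x \<and> g x \<le> d"
    using bnd by (subst (asm) AE_restrict_space_iff) auto
  then have bnd': "AE x in lborel. x \<in> edge k \<longrightarrow> c \<le> g x \<and> g x \<le> d"
    by (simp only: AE_completion_iff)
  have "AE x in lborel. x \<in> edge k \<longrightarrow> g x = b (dir k * x)"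
  proof (rule AE_mp[OF bnd'], rule AE_mp[OF g'(2)], intro AE_I2 impI)
    fix x assume "(if x \<in> edge k then g x else 0) = g' x" "x \<in> edge k \<longrightarrow> c \<le> g x \<and> g x \<le> d" "x \<in> edge k"
    then show "g x = b (dir k * x)" by (simp add: b_def)
  qed
  moreover have "b \<rho> \<in> {c..d}" for \<rho> using cd by (auto simp: b_def)
  ultimately show thesis using bm that by blast
qed

lemma pointwise_variation_ge:
  assumes "mono p" "range p \<subseteq> A"
  shows "(\<Sum>i<n. ennreal \<bar>v (p (Suc i)) - v (p i)\<bar>) \<le> pointwise_variation A v"
  unfolding pointwise_variation_def using assms by (intro SUP_upper2[of "(n, p)"]) auto

lemma edge_variation_ge:
  assumes p: "\<And>i. p i > 0" "mono p"
  shows "(\<Sum>i<n. ennreal \<bar>w (dir k * p (Suc i)) - w (dir k * p i)\<bar>) \<le> pointwise_variation (edge k) w"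
proof (cases "k < 0")
  case False
  then have "dir k = 1" "edge k = {0<..}" by (auto simp: dir_def edge_def)
  then show ?thesis using pointwise_variation_ge[of p "edge k" w n] p by auto
next
  case True
  then have d: "dir k = -1" "edge k = {..<0}" by (auto simp: dir_def edge_def)
  \<comment> \<open>Reflection reverses the order, so the points are run through backwards.
    Truncated subtraction makes \<open>q\<close> constant beyond \<open>n\<close>, which keeps it
    monotone and inside the edge.\<close>
  define q where "q = (\<lambda>i. - p (n - i))"
  have "mono q" using p(2) by (auto simp: q_def mono_def intro!: diff_le_mono2)
  moreover have "range q \<subseteq> edge k" using p(1) by (auto simp: q_def d)
  ultimately have "(\<Sum>i<n. ennreal \<bar>w (q (Suc i)) - w (q i)\<bar>) \<le> pointwise_variation (edge k) w"
    by (rule pointwise_variation_ge)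
  also have "(\<Sum>i<n. ennreal \<bar>w (q (Suc i)) - w (q i)\<bar>) = (\<Sum>i<n. ennreal \<bar>w (- p (Suc (n - Suc i))) - w (- p (n - Suc i))\<bar>)"
    by (intro sum.cong) (auto simp: q_def Suc_diff_Suc abs_minus_commute)
  also have "\<dots> = (\<Sum>i<n. ennreal \<bar>w (- p (Suc i)) - w (- p i)\<bar>)"
    by (rule sum.nat_diff_reindex[of "\<lambda>i. ennreal \<bar>w (- p (Suc i)) - w (- p i)\<bar>"])
  finally show ?thesis by (simp add: d)
qed

text \<open>The variation of the cell averages is an average of variations along translated grids.\<close>

lemma variation_cell_averages:
  fixes b g :: "real \<Rightarrow> real"
  assumes b: "b \<in> borel_measurable borel" "\<And>\<rho>. \<bar>b \<rho>\<bar> \<le> B"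
    and ae: "AE x in lborel. x \<in> edge k \<longrightarrow> g x = b (dir k * x)"
    and TV: "total_variation (edge k) g < \<infinity>"
  obtains V where "\<And>h J. h > 0 \<Longrightarrow>
    (\<Sum>l<J. \<bar>integral {(real l + 3/2) * h..(real l + 5/2) * h} b - integral {(real l + 1/2) * h..(real l + 3/2) * h} b\<bar>) \<le> h * V"
proof -
  obtain w where w: "AE x in lebesgue_on (edge k). w x = g x" "pointwise_variation (edge k) w < \<infinity>"
    using TV unfolding total_variation_def by (auto simp: INF_less_iff)
  define V where "V = enn2real (pointwise_variation (edge k) w)"
  have V: "pointwise_variation (edge k) w = ennreal V" using w(2) by (simp add: V_def)
  have V0: "V \<ge> 0" by (simp add: V_def)
  have "AE x in lebesgue. x \<in> edge k \<longrightarrow> w x = g x"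
    using w(1) by (subst (asm) AE_restrict_space_iff) auto
  then have "AE x in lborel. x \<in> edge k \<longrightarrow> w x = g x" by (simp only: AE_completion_iff)
  with ae have "AE x in lborel. x \<in> edge k \<longrightarrow> w x = b (dir k * x)" by eventually_elim auto
  from AE_lborel_affine[OF this, of "dir k" 0]
  have wb: "AE \<rho> in lborel. \<rho> > 0 \<longrightarrow> b \<rho> = w (dir k * \<rho>)" by (auto simp: edge_iff_dir elim!: eventually_mono)
  show thesis
  proof (rule that)
    fix h :: real and J :: nat assume h: "h > 0"
    \<comment> \<open>The first full cell; cell \<open>l\<close> is its translate by
      \<open>l * h\<close>, so all cell integrals become integrals over \<open>I\<close> of
      translates \<open>s l\<close>.\<close>
    define I where "I = {h/2..3/2*h}"
    define s where "s = (\<lambda>l \<theta>. b (real l * h + 1 * \<theta>))"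
    have sm: "s l \<in> borel_measurable borel" for l unfolding s_def using b(1) by measurable
    have sb: "\<bar>s l \<theta>\<bar> \<le> B" for l \<theta> unfolding s_def by (rule b)
    have int: "integral {(real l + 1/2) * h..(real l + 3/2) * h} b = (\<integral>\<theta>. indicator I \<theta> * s l \<theta> \<partial>lborel)" for l
    proof -
      have "integral {(real l + 1/2) * h..(real l + 3/2) * h} b
          = (\<integral>x. indicator {(real l + 1/2) * h..(real l + 3/2) * h} x * b x \<partial>lborel)"
        by (rule HK_integral_eq_lborel[OF b])
      also have "\<dots> = (\<integral>x. indicator {(real l + 1/2) * h..(real l + 3/2) * h} (real l * h + 1 * x) * b (real l * h + 1 * x) \<partial>lborel)"
        by (subst lborel_integral_real_affine[of 1 _ "real l * h"]) auto
      also have "\<dots> = (\<integral>\<theta>. indicator I \<theta> * s l \<theta> \<partial>lborel)"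
        by (intro Bochner_Integration.integral_cong) (auto simp: indicator_def I_def s_def algebra_simps)
      finally show ?thesis .
    qed
    have si: "integrable lborel (\<lambda>\<theta>. indicator I \<theta> * f \<theta>)"
      if "f \<in> borel_measurable borel" "\<And>\<theta>. \<bar>f \<theta>\<bar> \<le> C" for f :: "real \<Rightarrow> real" and C
      using bounded_borel_set_integrable[OF that, of "h/2" "3/2*h"] by (simp add: set_integrable_def I_def)
    define D where "D = (\<lambda>l \<theta>. \<bar>s (Suc l) \<theta> - s l \<theta>\<bar>)"
    have Dm: "D l \<in> borel_measurable borel" for l unfolding D_def using sm[of l] sm[of "Suc l"] by measurable
    have Db: "\<bar>D l \<theta>\<bar> \<le> 2 * B" for l \<theta> using sb[of l \<theta>] sb[of "Suc l" \<theta>] by (simp add: D_def)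
    have each: "\<bar>integral {(real l + 3/2) * h..(real l + 5/2) * h} b - integral {(real l + 1/2) * h..(real l + 3/2) * h} b\<bar>
        \<le> (\<integral>\<theta>. indicator I \<theta> * D l \<theta> \<partial>lborel)" for l
    proof -
      have e1: "integral {(real l + 3/2) * h..(real l + 5/2) * h} b = (\<integral>\<theta>. indicator I \<theta> * s (Suc l) \<theta> \<partial>lborel)"
        using int[of "Suc l"] by (simp add: algebra_simps)
      have "(\<integral>\<theta>. indicator I \<theta> * s (Suc l) \<theta> \<partial>lborel) - (\<integral>\<theta>. indicator I \<theta> * s l \<theta> \<partial>lborel)
          = (\<integral>\<theta>. indicator I \<theta> * s (Suc l) \<theta> - indicator I \<theta> * s l \<theta> \<partial>lborel)"
        by (rule Bochner_Integration.integral_diff[symmetric]; rule si[OF sm sb])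
      also have "\<bar>\<dots>\<bar> \<le> (\<integral>\<theta>. \<bar>indicator I \<theta> * s (Suc l) \<theta> - indicator I \<theta> * s l \<theta>\<bar> \<partial>lborel)"
        by (rule integral_abs_bound)
      also have "\<dots> = (\<integral>\<theta>. indicator I \<theta> * D l \<theta> \<partial>lborel)"
        by (intro Bochner_Integration.integral_cong) (auto simp: D_def indicator_def)
      finally show ?thesis unfolding e1 int[of l] .
    qed
    have "(\<Sum>l<J. \<bar>integral {(real l + 3/2) * h..(real l + 5/2) * h} b - integral {(real l + 1/2) * h..(real l + 3/2) * h} b\<bar>)
        \<le> (\<Sum>l<J. \<integral>\<theta>. indicator I \<theta> * D l \<theta> \<partial>lborel)"
      by (rule sum_mono[OF each])
    also have "\<dots> = (\<integral>\<theta>. (\<Sum>l<J. indicator I \<theta> * D l \<theta>) \<partial>lborel)"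
      by (rule Bochner_Integration.integral_sum[symmetric]) (rule si[OF Dm Db])
    also have "\<dots> \<le> (\<integral>\<theta>. indicator I \<theta> * V \<partial>lborel)"
    proof (rule integral_mono_AE)
      show "integrable lborel (\<lambda>\<theta>. \<Sum>l<J. indicator I \<theta> * D l \<theta>)"
        by (rule Bochner_Integration.integrable_sum) (rule si[OF Dm Db])
      show "integrable lborel (\<lambda>\<theta>. indicator I \<theta> * V)" by (rule si[of _ V]) (use V0 in auto)
      \<comment> \<open>There are countably many translates, so almost every offset
        \<open>\<theta>\<close> is good for all of them at once. For such an offset the points
        \<open>l * h + \<theta>\<close> form an admissible chain for the pointwise variation. The
        factor \<open>1\<close> fits the affine form of \<open>AE_lborel_affine\<close>.\<close>
      have "AE \<theta> in lborel. \<forall>l::nat. real l * h + 1 * \<theta> > 0 \<longrightarrow> b (real l * h + 1 * \<theta>) = w (dir k * (real l * h + 1 * \<theta>))"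
        unfolding AE_all_countable by (intro allI AE_lborel_affine[OF wb]) simp
      then show "AE \<theta> in lborel. (\<Sum>l<J. indicator I \<theta> * D l \<theta>) \<le> indicator I \<theta> * V"
      proof (rule AE_mp, intro AE_I2 impI)
        fix \<theta> assume A: "\<forall>l::nat. real l * h + 1 * \<theta> > 0 \<longrightarrow> b (real l * h + 1 * \<theta>) = w (dir k * (real l * h + 1 * \<theta>))"
        show "(\<Sum>l<J. indicator I \<theta> * D l \<theta>) \<le> indicator I \<theta> * V"
        proof (cases "\<theta> \<in> I")
          case True
          then have "\<theta> > 0" using h by (auto simp: I_def)
          define p where "p = (\<lambda>l. real l * h + \<theta>)"
          have p: "p l > 0" for l using \<open>\<theta> > 0\<close> h by (simp add: p_def add_nonneg_pos)
          have "mono p" using h by (auto simp: p_def mono_def)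
          have "D l \<theta> = \<bar>w (dir k * p (Suc l)) - w (dir k * p l)\<bar>" for l
            using A[rule_format, of l] A[rule_format, of "Suc l"] p[of l] p[of "Suc l"]
            unfolding D_def s_def p_def by simp
          then have "ennreal (\<Sum>l<J. D l \<theta>) = (\<Sum>l<J. ennreal \<bar>w (dir k * p (Suc l)) - w (dir k * p l)\<bar>)"
            by (simp add: sum_ennreal)
          also have "\<dots> \<le> ennreal V" unfolding V[symmetric] by (rule edge_variation_ge[OF p \<open>mono p\<close>])
          finally show ?thesis using True V0 by (simp add: ennreal_le_iff)
        qed simp
      qed
    qed
    also have "\<dots> = h * V" using h by (simp add: I_def)
    finally show "(\<Sum>l<J. \<bar>integral {(real l + 3/2) * h..(real l + 5/2) * h} b - integral {(real l + 1/2) * h..(real l + 3/2) * h} b\<bar>) \<le> h * V" .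
  qed
qed

lemma dir_slice_borel:
  fixes w :: "real \<times> real \<Rightarrow> real"
  assumes "w \<in> borel_measurable borel"
  shows "(\<lambda>x. w (dir k * x, t)) \<in> borel_measurable borel"
    and "(\<lambda>p. w (dir k * fst p, snd p)) \<in> borel_measurable borel"
proof -
  have 1: "(\<lambda>x. (dir k * x, t)) \<in> borel_measurable (borel :: real measure)"
    by (intro borel_measurable_continuous_onI continuous_intros)
  have 2: "(\<lambda>p. (dir k * fst p, snd p)) \<in> borel_measurable (borel :: (real \<times> real) measure)"
    by (intro borel_measurable_continuous_onI continuous_intros)
  show "(\<lambda>x. w (dir k * x, t)) \<in> borel_measurable borel"
    by (rule measurable_compose[OF 1 assms])
  show "(\<lambda>p. w (dir k * fst p, snd p)) \<in> borel_measurable borel"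
    by (rule measurable_compose[OF 2 assms])
qed

lemma borel_lebesgue_on:
  fixes g :: "'b::euclidean_space \<Rightarrow> real"
  shows "g \<in> borel_measurable borel \<Longrightarrow> g \<in> borel_measurable (lebesgue_on S)"
  by (intro measurable_restrict_space1 measurable_completion) simp

lemma edge_interval_integral:
  fixes g w :: "real \<Rightarrow> real"
  assumes R: "R \<ge> 0" and w: "w \<in> borel_measurable borel" "\<And>x. \<bar>w x\<bar> \<le> B"
    and g: "g \<in> borel_measurable borel" and eq: "AE x in lborel. x \<in> edge k \<longrightarrow> g x = w (dir k * x)"
  shows "integrable (lebesgue_on (edge k \<inter> {-R..R})) g"
    "integral\<^sup>L (lebesgue_on (edge k \<inter> {-R..R})) g = integral {0..R} w"
proof -
  have ae: "AE x in lborel. x \<in> edge k \<inter> {-R..R} \<longrightarrow> g x = indicator {0..R} (dir k * x) * w (dir k * x)"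
    using eq by eventually_elim (auto simp: edge_iff_dir dir_def split: if_splits)
  have ins: "dir k * x \<in> edge k \<inter> {-R..R}" if "0 < x" "x < R" for x
    using that by (auto simp: edge_iff_dir dir_def)
  note * = LINT_edge[OF edge_ivl_lebesgue w(1) w(2) ins ae borel_lebesgue_on[OF g]]
  show "integrable (lebesgue_on (edge k \<inter> {-R..R})) g" by (rule *(1))
  show "integral\<^sup>L (lebesgue_on (edge k \<inter> {-R..R})) g = integral {0..R} w" by (rule *(2))
qed

section \<open>Passage to the limit on the star\<close>

text \<open>The derivatives are requested within the rectangle only, while the bounds are global;
  functions cut off outside the rectangle satisfy both. The vanishing conditions remove every
  boundary term except those at \<open>x = 0\<close> and \<open>t = 0\<close>.\<close>

definition test_data :: "real \<Rightarrow> real \<Rightarrow> real \<Rightarrow> (real \<times> real \<Rightarrow> real) \<Rightarrow> (real \<times> real \<Rightarrow> real) \<Rightarrow>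
    (real \<times> real \<Rightarrow> real) \<Rightarrow> (real \<times> real \<Rightarrow> real) \<Rightarrow> bool" where
  "test_data R T D \<psi> \<psi>x \<psi>t \<psi>xt \<longleftrightarrow>
     \<psi>x \<in> borel_measurable borel \<and> \<psi>t \<in> borel_measurable borel \<and> \<psi>xt \<in> borel_measurable borel \<and>
     (\<forall>p. \<bar>\<psi>x p\<bar> \<le> D) \<and> (\<forall>p. \<bar>\<psi>t p\<bar> \<le> D) \<and> (\<forall>p. \<bar>\<psi>xt p\<bar> \<le> D) \<and>
     (\<forall>x\<in>{0..R}. \<forall>t\<in>{0..T}. ((\<lambda>x. \<psi>t (x, t)) has_real_derivative \<psi>xt (x, t)) (at x within {0..R})) \<and>
     (\<forall>x\<in>{0..R}. \<forall>t\<in>{0..T}. ((\<lambda>t. \<psi>x (x, t)) has_real_derivative \<psi>xt (x, t)) (at t within {0..T})) \<and>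
     (\<forall>x\<in>{0..R}. ((\<lambda>x. \<psi> (x, 0)) has_real_derivative \<psi>x (x, 0)) (at x within {0..R})) \<and>
     (\<forall>t\<in>{0..T}. \<psi>t (R, t) = 0) \<and> (\<forall>x\<in>{0..R}. \<psi>x (x, T) = 0) \<and> \<psi> (R, 0) = 0"

lemma test_dataD:
  assumes "test_data R T D \<psi> \<psi>x \<psi>t \<psi>xt"
  shows "\<psi>x \<in> borel_measurable borel" "\<psi>t \<in> borel_measurable borel" "\<psi>xt \<in> borel_measurable borel"
    "\<bar>\<psi>x p\<bar> \<le> D" "\<bar>\<psi>t p\<bar> \<le> D" "\<bar>\<psi>xt p\<bar> \<le> D"
  using assms unfolding test_data_def by blast+

lemma grid_function_borel:
  fixes a :: "nat \<Rightarrow> nat \<Rightarrow> real" and h \<delta> :: real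
  shows "(\<lambda>(x, t). a (nat \<lfloor>t / \<delta>\<rfloor>) (nat (round (x / h)))) \<in> borel_measurable borel"
proof -
  have [measurable]: "(\<lambda>t::real. nat \<lfloor>t / \<delta>\<rfloor>) \<in> borel \<rightarrow>\<^sub>M count_space UNIV"
    "(\<lambda>x::real. nat (round (x / h))) \<in> borel \<rightarrow>\<^sub>M count_space UNIV"
    unfolding round_def by measurable
  have "(\<lambda>p::real \<times> real. a (nat \<lfloor>snd p / \<delta>\<rfloor>) (nat (round (fst p / h)))) \<in> borel_measurable (borel \<Otimes>\<^sub>M borel)"
    by measurable
  then show ?thesis by (simp add: borel_prod split_beta')
qed

locale upwind_star_data = upwind_star +
  fixes b :: "'a \<Rightarrow> real \<Rightarrow> real"
  assumes b_borel: "\<And>k. k \<in> K \<Longrightarrow> b k \<in> borel_measurable borel"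
    and b_bound: "\<And>k x. k \<in> K \<Longrightarrow> \<bar>b k x\<bar> \<le> M"
    and P_eq: "\<And>k x. k \<in> K \<Longrightarrow> 0 \<le> x \<Longrightarrow> P k x = integral {0..x} (b k)"
begin

lemma sol_borel: "sol h k \<in> borel_measurable borel"
  unfolding sol_def by (rule grid_function_borel)

lemma sol_range: "k \<in> K \<Longrightarrow> h > 0 \<Longrightarrow> sol h k p \<in> {lo k..hi k}"
  unfolding sol_def split_beta by (rule upwind_edge.scheme_range[OF edge sch])

lemma flux_sol_borel: "(\<lambda>p. \<phi> k (sol h k p)) \<in> borel_measurable borel"
  using grid_function_borel[of "\<lambda>n l. \<phi> k (u h k n l)"] by (simp add: sol_def split_beta')

lemma range_bounds:
  assumes "k \<in> K" "z \<in> {lo k..hi k}"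
  shows "\<bar>z\<bar> \<le> M" "\<bar>\<phi> k z\<bar> \<le> M"
  using upwind_edge.M_bound[OF edge[OF assms(1)] assms(2)] .

lemma flux_borel:
  assumes k: "k \<in> K" and w: "w \<in> borel_measurable borel" "\<And>p. w p \<in> {lo k..hi k}"
  shows "(\<lambda>p. \<phi> k (w p)) \<in> borel_measurable borel"
proof -
  interpret e: upwind_edge "\<phi> k" "\<sigma> k" "lo k" "hi k" L \<mu> M "P k" by (rule edge[OF k])
  have "L-lipschitz_on UNIV e.clamp_flux"
    using e.clamp_flux_lip e.L_nonneg by (intro lipschitz_onI) (auto simp: dist_real_def)
  then have "e.clamp_flux \<in> borel_measurable borel"
    by (intro borel_measurable_continuous_onI lipschitz_on_continuous_on)
  with w(1) have "(\<lambda>p. e.clamp_flux (w p)) \<in> borel_measurable borel" by (rule measurable_compose)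
  then show ?thesis by (simp only: e.clamp_flux_eq[OF w(2)])
qed

text \<open>The accumulated numerical flux from the vertex into the edge; it serves as the
  \<open>H\<close> of \<open>weak_form_defect\<close>.\<close>

definition vertex_flow :: "real \<Rightarrow> 'a \<Rightarrow> real \<Rightarrow> real" where
  "vertex_flow h k t = \<mu> * h * (\<Sum>m<nat \<lfloor>t / (\<mu> * h)\<rfloor>. fl k (u h k m 0) (u h k m (Suc 0)))"

lemma vertex_flow_props:
  assumes k: "k \<in> K" and h: "h > 0"
  shows "vertex_flow h k \<in> borel_measurable borel" "t \<ge> 0 \<Longrightarrow> \<bar>vertex_flow h k t\<bar> \<le> M * t"
proof -
  have mh: "\<mu> * h > 0" using h params by simp
  show "vertex_flow h k \<in> borel_measurable borel"
    unfolding vertex_flow_def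
    using step_borel_measurable(2)[of "\<lambda>n. \<mu> * h * (\<Sum>m<n. fl k (u h k m 0) (u h k m (Suc 0)))" "\<mu> * h"] by simp
  assume t: "t \<ge> 0"
  define n where "n = nat \<lfloor>t / (\<mu> * h)\<rfloor>"
  have "\<bar>\<Sum>m<n. fl k (u h k m 0) (u h k m (Suc 0))\<bar> \<le> (\<Sum>m<n. M)"
    by (intro order_trans[OF sum_abs sum_mono] upwind_edge.scheme_flux_bound[OF edge[OF k] sch[OF k h]])
  then have "\<mu> * h * \<bar>\<Sum>m<n. fl k (u h k m 0) (u h k m (Suc 0))\<bar> \<le> \<mu> * h * (\<Sum>m<n. M)"
    using mh by (intro mult_left_mono) auto
  also have "\<dots> = M * (real n * (\<mu> * h))" by simp
  also have "\<dots> \<le> M * t"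
    unfolding n_def using nat_floor_bounds(1)[OF mh t] params by (intro mult_left_mono) auto
  finally show "\<bar>vertex_flow h k t\<bar> \<le> M * t"
    using mh unfolding vertex_flow_def n_def[symmetric] abs_mult[of "\<mu> * h"] by simp
qed

text \<open>For \<open>x \<ge> h / 2\<close> the defect is at most
  \<open>(5 + \<mu>) * M * h\<close> by \<open>conservation_defect\<close>. Inside the vertex cell
  the trivial bound \<open>M * h + 2 * M * T\<close> is good enough, as that region has length
  \<open>h / 2\<close>.\<close>

lemma sol_weak_defect:
  assumes k: "k \<in> K" and h: "h > 0" "h / 2 \<le> R" and T1: "0 \<le> T1" "T1 \<le> T"
    and td: "test_data R T1 D \<psi> \<psi>x \<psi>t \<psi>xt"
  shows "\<bar>integral {0..T1} (\<lambda>t. integral {0..R} (\<lambda>x. sol h k (x, t) * \<psi>t (x, t) + \<phi> k (sol h k (x, t)) * \<psi>x (x, t)))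
    + integral {0..R} (\<lambda>x. b k x * \<psi> (x, 0)) - integral {0..T1} (\<lambda>t. vertex_flow h k t * \<psi>t (0, t))\<bar>
    \<le> T1 * (D * (R * ((5 + \<mu>) * M * h) + h / 2 * (M * h + 2 * M * T)))"
proof (rule weak_form_defect[where B = M and B' = "M * T" and \<psi>xt = \<psi>xt])
  have R: "R \<ge> 0" using h by linarith
  show "R \<ge> 0" "T1 \<ge> 0" using R T1 by auto
  show "sol h k \<in> borel_measurable borel" by (rule sol_borel)
  show bs: "\<bar>sol h k p\<bar> \<le> M" "\<bar>\<phi> k (sol h k p)\<bar> \<le> M" for p using range_bounds[OF k sol_range[OF k h(1)]] by auto
  show "(\<lambda>p. \<phi> k (sol h k p)) \<in> borel_measurable borel" by (rule flux_sol_borel)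
  show "b k \<in> borel_measurable borel" "\<bar>b k x\<bar> \<le> M" for x using b_borel[OF k] b_bound[OF k] by auto
  show "vertex_flow h k \<in> borel_measurable borel" by (rule vertex_flow_props[OF k h(1)])
  show "\<bar>vertex_flow h k t\<bar> \<le> M * T" if "t \<in> {0..T1}" for t
  proof -
    have "M * t \<le> M * T" using that T1 params by (intro mult_left_mono) auto
    then show ?thesis using vertex_flow_props(2)[OF k h(1), of t] that by auto
  qed
  show "\<psi>x \<in> borel_measurable borel" "\<psi>t \<in> borel_measurable borel" "\<psi>xt \<in> borel_measurable borel"
    "\<bar>\<psi>x p\<bar> \<le> D" "\<bar>\<psi>t p\<bar> \<le> D" "\<bar>\<psi>xt p\<bar> \<le> D" for p
    by (rule test_dataD[OF td])+
  show "((\<lambda>x. \<psi>t (x, t)) has_real_derivative \<psi>xt (x, t)) (at x within {0..R})"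
    "((\<lambda>t. \<psi>x (x, t)) has_real_derivative \<psi>xt (x, t)) (at t within {0..T1})"
    if "x \<in> {0..R}" "t \<in> {0..T1}" for x t
    using td that unfolding test_data_def by blast+
  show "((\<lambda>x. \<psi> (x, 0)) has_real_derivative \<psi>x (x, 0)) (at x within {0..R})" if "x \<in> {0..R}" for x
    using td that unfolding test_data_def by blast
  show "\<psi>t (R, t) = 0" if "t \<in> {0..T1}" for t using td that unfolding test_data_def by blast
  show "\<psi>x (x, T1) = 0" if "x \<in> {0..R}" for x using td that unfolding test_data_def by blast
  show "\<psi> (R, 0) = 0" using td unfolding test_data_def by blast
  fix t assume t: "t \<in> {0..T1}"
  define E where "E = (\<lambda>p. integral {0..fst p} (\<lambda>y. sol h k (y, snd p)) + integral {0..snd p} (\<lambda>s. \<phi> k (sol h k (fst p, s)))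
      - integral {0..fst p} (\<lambda>y. (b k \<circ> fst) (y, snd p)) - (\<lambda>p. vertex_flow h k t) p)"
  have fstm: "fst \<in> borel_measurable (borel :: (real \<times> real) measure)"
    by (intro borel_measurable_continuous_onI continuous_intros)
  have "rect_bounded R T1 E"
    unfolding E_def
  proof (intro rect_bounded_diff rect_bounded_add rect_bounded_primitive)
    show "sol h k \<in> borel_measurable borel" by (rule sol_borel)
    show "\<bar>sol h k p\<bar> \<le> M" "\<bar>\<phi> k (sol h k p)\<bar> \<le> M" for p by (rule bs)+
    show "(\<lambda>p. \<phi> k (sol h k p)) \<in> borel_measurable borel" by (rule flux_sol_borel)
    show "(b k \<circ> fst) \<in> borel_measurable (borel :: (real \<times> real) measure)"
      by (rule measurable_comp[OF fstm b_borel[OF k]])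
    show "\<bar>(b k \<circ> fst) p\<bar> \<le> M" for p using b_bound[OF k] by simp
    show "rect_bounded R T1 (\<lambda>p. vertex_flow h k t)" by (auto simp: rect_bounded_def)
  qed
  then have "rect_bounded R T1 (\<lambda>p. \<bar>E p\<bar>)" unfolding rect_bounded_def by auto
  from rect_bounded_slice(1)[OF this t]
  have Ei: "(\<lambda>x. \<bar>integral {0..x} (\<lambda>y. sol h k (y, t)) + integral {0..t} (\<lambda>s. \<phi> k (sol h k (x, s)))
      - integral {0..x} (b k) - vertex_flow h k t\<bar>) integrable_on {0..R}"
    by (simp add: E_def)
  define F where "F = (\<lambda>x. (5 + \<mu>) * M * h + (if x \<in> {..h/2} then M * h + 2 * M * T else 0))"
  have cut: "{..h/2} \<inter> {0..R} = {0..h/2}" "{0..R} \<inter> {..h/2} = {0..h/2}" using h by auto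
  have ri: "(\<lambda>x. if x \<in> {..h/2} then M * h + 2 * M * T else 0) integrable_on {0..R}"
    by (simp only: integrable_restrict_Int cut integrable_const_ivl)
  have Fi: "F integrable_on {0..R}" unfolding F_def by (intro integrable_add ri integrable_const_ivl)
  have "integral {0..R} F = R * ((5 + \<mu>) * M * h) + h / 2 * (M * h + 2 * M * T)"
    unfolding F_def
    by (subst Henstock_Kurzweil_Integration.integral_add[OF _ ri])
      (use R h in \<open>auto simp only: integral_restrict_Int cut integral_const_real integrable_const_ivl\<close>, simp)
  moreover have "integral {0..R} (\<lambda>x. \<bar>integral {0..x} (\<lambda>y. sol h k (y, t)) + integral {0..t} (\<lambda>s. \<phi> k (sol h k (x, s)))
      - integral {0..x} (b k) - vertex_flow h k t\<bar>) \<le> integral {0..R} F"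
  proof (rule integral_le[OF Ei Fi])
    fix x assume x: "x \<in> {0..R}"
    show "\<bar>integral {0..x} (\<lambda>y. sol h k (y, t)) + integral {0..t} (\<lambda>s. \<phi> k (sol h k (x, s)))
      - integral {0..x} (b k) - vertex_flow h k t\<bar> \<le> F x"
    proof (cases "h / 2 \<le> x")
      case True
      have "0 \<le> M * h + 2 * M * T" using params h T_pos by (simp add: add_nonneg_nonneg)
      then have "(5 + \<mu>) * M * h \<le> F x" by (simp add: F_def)
      moreover have "\<bar>integral {0..x} (\<lambda>y. sol h k (y, t)) + integral {0..t} (\<lambda>s. \<phi> k (sol h k (x, s)))
        - integral {0..x} (b k) - vertex_flow h k t\<bar> \<le> (5 + \<mu>) * M * h"
        using upwind_edge.conservation_defect[OF edge[OF k] sch[OF k h(1)] True, of t] t P_eq[OF k, of x] x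
        by (simp add: sol_def vertex_flow_def)
      ultimately show ?thesis by linarith
    next
      case False
      have nn: "0 \<le> (5 + \<mu>) * M * h" using params h by simp
      have "\<bar>integral {0..x} (\<lambda>y. sol h k (y, t))\<bar> \<le> M * (x - 0)"
        using x bs by (intro abs_integral_bound bounded_borel_integrable_on[OF borel_slice(1)[OF sol_borel]]) auto
      moreover have "\<bar>integral {0..x} (b k)\<bar> \<le> M * (x - 0)"
        using x b_bound[OF k] by (intro abs_integral_bound bounded_borel_integrable_on[OF b_borel[OF k]]) auto
      moreover have "\<bar>integral {0..t} (\<lambda>s. \<phi> k (sol h k (x, s)))\<bar> \<le> M * (t - 0)"
        using t bs by (intro abs_integral_bound bounded_borel_integrable_on[OF borel_slice(2)[OF flux_sol_borel]]) auto
      moreover have "\<bar>vertex_flow h k t\<bar> \<le> M * t" using t by (intro vertex_flow_props(2)[OF k h(1)]) auto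
      moreover have "M * x \<le> M * (h / 2)" using False params by (intro mult_left_mono) auto
      moreover have "M * t \<le> M * T" using t T1 params by (intro mult_left_mono) auto
      ultimately have "\<bar>integral {0..x} (\<lambda>y. sol h k (y, t)) + integral {0..t} (\<lambda>s. \<phi> k (sol h k (x, s)))
        - integral {0..x} (b k) - vertex_flow h k t\<bar> \<le> M * h + 2 * (M * T)" by simp
      with False nn show ?thesis by (simp add: F_def)
    qed
  qed
  ultimately show "integral {0..R} (\<lambda>x. \<bar>integral {0..x} (\<lambda>y. sol h k (y, t)) + integral {0..t} (\<lambda>s. \<phi> k (sol h k (x, s)))
      - integral {0..x} (b k) - vertex_flow h k t\<bar>) \<le> R * ((5 + \<mu>) * M * h) + h / 2 * (M * h + 2 * M * T)"
    by linarith
qed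

lemma sol_limit:
  assumes k: "k \<in> K"
  obtains w where "w \<in> borel_measurable borel" "\<And>p. w p \<in> {lo k..hi k}"
    "\<And>R \<epsilon>. R \<ge> 0 \<Longrightarrow> \<epsilon> > 0 \<Longrightarrow> \<forall>\<^sub>F h in at_right 0. \<forall>t\<in>{0..T}.
      integral {0..R} (\<lambda>x. \<bar>sol h k (x, t) - w (x, t)\<bar>) \<le> \<epsilon>"
  using L1_limit_exists[of "\<lambda>h. sol h k" "lo k" "hi k" T, OF sol_borel sol_range[OF k] sol_cauchy[OF k]] by blast

definition lim_of :: "'a \<Rightarrow> (real \<times> real \<Rightarrow> real) \<Rightarrow> bool" where
  "lim_of k w \<longleftrightarrow> w \<in> borel_measurable borel \<and> (\<forall>p. w p \<in> {lo k..hi k}) \<and>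
    (\<forall>R\<ge>0. \<forall>\<epsilon>>0. \<forall>\<^sub>F h in at_right 0. \<forall>t\<in>{0..T}.
      integral {0..R} (\<lambda>x. \<bar>sol h k (x, t) - w (x, t)\<bar>) \<le> \<epsilon>)"

lemma lim_ofD:
  assumes "lim_of k w"
  shows "w \<in> borel_measurable borel" "w p \<in> {lo k..hi k}"
    "R \<ge> 0 \<Longrightarrow> \<epsilon> > 0 \<Longrightarrow> \<forall>\<^sub>F h in at_right 0. \<forall>t\<in>{0..T}.
      integral {0..R} (\<lambda>x. \<bar>sol h k (x, t) - w (x, t)\<bar>) \<le> \<epsilon>"
  using assms unfolding lim_of_def by blast+

lemma lim_exists: "k \<in> K \<Longrightarrow> \<exists>w. lim_of k w"
  unfolding lim_of_def by (rule sol_limit) blast+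

lemma abs_diff_integrable:
  assumes k: "k \<in> K" and f: "f \<in> borel_measurable borel" "\<And>x. f x \<in> {lo k..hi k}"
    and f': "f' \<in> borel_measurable borel" "\<And>x. f' x \<in> {lo k..hi k}"
  shows "(\<lambda>x. \<bar>f x - f' x\<bar>) integrable_on {a..c :: real}"
proof (rule bounded_borel_integrable_on)
  show "(\<lambda>x. \<bar>f x - f' x\<bar>) \<in> borel_measurable borel" using f(1) f'(1) by measurable
  show "\<bar>\<bar>f x - f' x\<bar>\<bar> \<le> 2 * M" for x
    using range_bounds(1)[OF k f(2)[of x]] range_bounds(1)[OF k f'(2)[of x]] by linarith
qed

lemma lim_time_continuity:
  assumes k: "k \<in> K" and w: "lim_of k w" and R: "R \<ge> 0" and \<epsilon>: "\<epsilon> > 0"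
  shows "\<exists>\<delta>>0. \<forall>s\<in>{0..T}. \<forall>t\<in>{0..T}. \<bar>t - s\<bar> \<le> \<delta> \<longrightarrow>
    integral {0..R} (\<lambda>x. \<bar>w (x, t) - w (x, s)\<bar>) \<le> \<epsilon>"
proof -
  obtain \<delta> where \<delta>: "\<delta> > 0" "\<forall>\<^sub>F h in at_right 0. \<forall>s\<in>{0..T}. \<forall>t\<in>{0..T}. \<bar>t - s\<bar> \<le> \<delta> \<longrightarrow>
      integral {0..R} (\<lambda>x. \<bar>sol h k (x, t) - sol h k (x, s)\<bar>) \<le> \<epsilon> / 3"
    using sol_time_continuity[OF k R, of "\<epsilon> / 3"] \<epsilon> by auto
  have wm: "w \<in> borel_measurable borel" "\<And>p. w p \<in> {lo k..hi k}" by (rule lim_ofD[OF w])+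
  have "\<forall>\<^sub>F h in at_right 0. \<forall>t\<in>{0..T}. integral {0..R} (\<lambda>x. \<bar>sol h k (x, t) - w (x, t)\<bar>) \<le> \<epsilon> / 3"
    by (rule lim_ofD(3)[OF w R]) (use \<epsilon> in simp)
  from eventually_happens'[OF trivial_limit_at_right_real
      eventually_conj[OF eventually_at_right_less[of 0] eventually_conj[OF \<delta>(2) this]]]
  obtain h where h: "h > 0" "\<forall>s\<in>{0..T}. \<forall>t\<in>{0..T}. \<bar>t - s\<bar> \<le> \<delta> \<longrightarrow>
      integral {0..R} (\<lambda>x. \<bar>sol h k (x, t) - sol h k (x, s)\<bar>) \<le> \<epsilon> / 3"
    "\<forall>t\<in>{0..T}. integral {0..R} (\<lambda>x. \<bar>sol h k (x, t) - w (x, t)\<bar>) \<le> \<epsilon> / 3"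
    by blast
  have sb: "(\<lambda>x. sol h k (x, t)) \<in> borel_measurable borel" "(\<lambda>x. w (x, t)) \<in> borel_measurable borel" for t
    by (rule borel_slice(1)[OF sol_borel], rule borel_slice(1)[OF wm(1)])
  note ints = abs_diff_integrable[OF k sb(1) sol_range[OF k h(1)] sb(1) sol_range[OF k h(1)]]
    abs_diff_integrable[OF k sb(1) sol_range[OF k h(1)] sb(2) wm(2)]
    abs_diff_integrable[OF k sb(2) wm(2) sb(2) wm(2)]
  have "integral {0..R} (\<lambda>x. \<bar>w (x, t) - w (x, s)\<bar>) \<le> \<epsilon>"
    if st: "s \<in> {0..T}" "t \<in> {0..T}" "\<bar>t - s\<bar> \<le> \<delta>" for s t
  proof -
    have "integral {0..R} (\<lambda>x. \<bar>w (x, t) - w (x, s)\<bar>) \<le> integral {0..R} (\<lambda>x. \<bar>sol h k (x, t) - w (x, t)\<bar>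
        + (\<bar>sol h k (x, t) - sol h k (x, s)\<bar> + \<bar>sol h k (x, s) - w (x, s)\<bar>))"
      by (intro integral_le integrable_add ints) linarith
    also have "\<dots> = integral {0..R} (\<lambda>x. \<bar>sol h k (x, t) - w (x, t)\<bar>)
        + (integral {0..R} (\<lambda>x. \<bar>sol h k (x, t) - sol h k (x, s)\<bar>) + integral {0..R} (\<lambda>x. \<bar>sol h k (x, s) - w (x, s)\<bar>))"
      by (simp only: Henstock_Kurzweil_Integration.integral_add integrable_add ints)
    also have "\<dots> \<le> \<epsilon>"
      using h(2)[rule_format, OF st] h(3)[rule_format, OF st(1)] h(3)[rule_format, OF st(2)] by linarith
    finally show ?thesis .
  qed
  with \<delta>(1) show ?thesis by blast
qed

lemma lim_double_integral:
  assumes k: "k \<in> K" and w: "lim_of k w" and h: "h > 0" and R: "R \<ge> 0" and T1: "0 \<le> T1" "T1 \<le> T"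
    and close: "\<forall>t\<in>{0..T}. integral {0..R} (\<lambda>x. \<bar>sol h k (x, t) - w (x, t)\<bar>) \<le> \<eta>"
    and td: "test_data R T1 D \<psi> \<psi>x \<psi>t \<psi>xt"
  shows "\<bar>integral {0..T1} (\<lambda>t. integral {0..R} (\<lambda>x. sol h k (x, t) * \<psi>t (x, t) + \<phi> k (sol h k (x, t)) * \<psi>x (x, t)))
    - integral {0..T1} (\<lambda>t. integral {0..R} (\<lambda>x. w (x, t) * \<psi>t (x, t) + \<phi> k (w (x, t)) * \<psi>x (x, t)))\<bar>
    \<le> T1 * (D * (1 + L) * \<eta>)"
proof -
  have wm: "w \<in> borel_measurable borel" "\<And>p. w p \<in> {lo k..hi k}" by (rule lim_ofD[OF w])+
  have sr: "sol h k p \<in> {lo k..hi k}" for p by (rule sol_range[OF k h])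
  have \<psi>: "rect_bounded R T1 \<psi>t" "rect_bounded R T1 \<psi>x"
    by (rule rect_boundedI[OF test_dataD(2)[OF td] test_dataD(5)[OF td]],
      rule rect_boundedI[OF test_dataD(1)[OF td] test_dataD(4)[OF td]])
  have D: "\<bar>\<psi>t p\<bar> \<le> D" "\<bar>\<psi>x p\<bar> \<le> D" for p by (rule test_dataD[OF td])+
  have D0: "D \<ge> 0" using D(1)[of "(0,0)"] by linarith
  have good: "rect_bounded R T1 (\<lambda>p. s p * \<psi>t p + \<phi> k (s p) * \<psi>x p)"
    if "s \<in> borel_measurable borel" "\<And>p. s p \<in> {lo k..hi k}" for s
  proof (intro rect_bounded_add rect_bounded_mult \<psi>)
    show "rect_bounded R T1 s" using range_bounds(1)[OF k that(2)] by (intro rect_boundedI[OF that(1)])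
    show "rect_bounded R T1 (\<lambda>p. \<phi> k (s p))"
      using range_bounds(2)[OF k that(2)] by (intro rect_boundedI[OF flux_borel[OF k that]])
  qed
  define F where "F = (\<lambda>p. sol h k p * \<psi>t p + \<phi> k (sol h k p) * \<psi>x p)"
  define G where "G = (\<lambda>p. w p * \<psi>t p + \<phi> k (w p) * \<psi>x p)"
  have FG: "rect_bounded R T1 F" "rect_bounded R T1 G"
    unfolding F_def G_def by (rule good[OF sol_borel sr], rule good[OF wm])
  have pt: "\<bar>F p - G p\<bar> \<le> D * (1 + L) * \<bar>sol h k p - w p\<bar>" for p
  proof -
    have "F p - G p = (sol h k p - w p) * \<psi>t p + (\<phi> k (sol h k p) - \<phi> k (w p)) * \<psi>x p"
      by (simp add: F_def G_def algebra_simps)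
    then have "\<bar>F p - G p\<bar> \<le> \<bar>sol h k p - w p\<bar> * \<bar>\<psi>t p\<bar> + \<bar>\<phi> k (sol h k p) - \<phi> k (w p)\<bar> * \<bar>\<psi>x p\<bar>"
      by (metis abs_mult abs_triangle_ineq)
    also have "\<dots> \<le> \<bar>sol h k p - w p\<bar> * D + (L * \<bar>sol h k p - w p\<bar>) * D"
      using D params upwind_edge.lip[OF edge[OF k] sr wm(2), of p p]
      by (intro add_mono mult_mono mult_left_mono) (auto simp: mult_nonneg_nonneg)
    finally show ?thesis by (simp add: algebra_simps)
  qed
  have "integral {0..T1} (\<lambda>t. integral {0..R} (\<lambda>x. F (x, t))) - integral {0..T1} (\<lambda>t. integral {0..R} (\<lambda>x. G (x, t)))
      = integral {0..T1} (\<lambda>t. integral {0..R} (\<lambda>x. F (x, t)) - integral {0..R} (\<lambda>x. G (x, t)))"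
    by (rule Henstock_Kurzweil_Integration.integral_diff[symmetric]; rule rect_fubini(1); rule FG)
  also have "\<bar>\<dots>\<bar> \<le> D * (1 + L) * \<eta> * (T1 - 0)"
  proof (rule abs_integral_bound[OF T1(1)])
    show "(\<lambda>t. integral {0..R} (\<lambda>x. F (x, t)) - integral {0..R} (\<lambda>x. G (x, t))) integrable_on {0..T1}"
      by (intro integrable_diff rect_fubini(1) FG)
    fix t assume t: "t \<in> {0..T1}"
    have ds: "(\<lambda>x. \<bar>sol h k (x, t) - w (x, t)\<bar>) integrable_on {0..R}"
      by (rule abs_diff_integrable[OF k borel_slice(1)[OF sol_borel] sr borel_slice(1)[OF wm(1)] wm(2)])
    have "integral {0..R} (\<lambda>x. F (x, t)) - integral {0..R} (\<lambda>x. G (x, t)) = integral {0..R} (\<lambda>x. F (x, t) - G (x, t))"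
      by (rule Henstock_Kurzweil_Integration.integral_diff[symmetric]; rule rect_bounded_slice(1)[OF _ t]; rule FG)
    also have "norm \<dots> \<le> integral {0..R} (\<lambda>x. D * (1 + L) * \<bar>sol h k (x, t) - w (x, t)\<bar>)"
    proof (rule integral_norm_bound_integral)
      show "(\<lambda>x. F (x, t) - G (x, t)) integrable_on {0..R}" by (intro integrable_diff rect_bounded_slice(1)[OF _ t] FG)
      show "(\<lambda>x. D * (1 + L) * \<bar>sol h k (x, t) - w (x, t)\<bar>) integrable_on {0..R}"
        by (rule integrable_on_mult_right[OF ds])
      show "norm (F (x, t) - G (x, t)) \<le> D * (1 + L) * \<bar>sol h k (x, t) - w (x, t)\<bar>" for x
        unfolding real_norm_def by (rule pt)
    qed
    also have "\<dots> = D * (1 + L) * integral {0..R} (\<lambda>x. \<bar>sol h k (x, t) - w (x, t)\<bar>)"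
      by (rule Henstock_Kurzweil_Integration.integral_mult_right)
    also have "\<dots> \<le> D * (1 + L) * \<eta>" using close t T1 D0 params by (intro mult_left_mono) auto
    finally show "\<bar>integral {0..R} (\<lambda>x. F (x, t)) - integral {0..R} (\<lambda>x. G (x, t))\<bar> \<le> D * (1 + L) * \<eta>" by simp
  qed
  finally show ?thesis by (simp add: F_def G_def mult.commute)
qed

text \<open>The vertex terms of the edges share the factor \<open>q t\<close>, so only the sum of
  the vertex flows matters, and this is \<open>O(h)\<close> by \<open>flux_balance\<close>. Mesh
  errors vanish first, for a fixed distance \<open>\<eta>\<close> to the limit; afterwards
  \<open>\<eta>\<close> is sent to \<open>0\<close>.\<close>

lemma lim_weak_solution:
  assumes w: "\<And>k. k \<in> K \<Longrightarrow> lim_of k (w k)" and R: "R > 0" and T1: "0 \<le> T1" "T1 \<le> T"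
    and td: "\<And>k. k \<in> K \<Longrightarrow> test_data R T1 D (\<psi> k) (\<psi>x k) (\<psi>t k) (\<psi>xt k)"
    and q: "\<And>k t. k \<in> K \<Longrightarrow> t \<in> {0..T1} \<Longrightarrow> \<psi>t k (0, t) = q t"
  shows "(\<Sum>k\<in>K. integral {0..T1} (\<lambda>t. integral {0..R} (\<lambda>x. w k (x, t) * \<psi>t k (x, t) + \<phi> k (w k (x, t)) * \<psi>x k (x, t)))
    + integral {0..R} (\<lambda>x. b k x * \<psi> k (x, 0))) = 0"
proof -
  define X where "X = (\<lambda>k. integral {0..T1} (\<lambda>t. integral {0..R} (\<lambda>x. w k (x, t) * \<psi>t k (x, t) + \<phi> k (w k (x, t)) * \<psi>x k (x, t)))
    + integral {0..R} (\<lambda>x. b k x * \<psi> k (x, 0)))"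
  obtain k0 where k0: "k0 \<in> K" by (rule some_edge)
  have D: "\<bar>\<psi>t k p\<bar> \<le> D" if "k \<in> K" for k p by (rule test_dataD[OF td[OF that]])
  have D0: "D \<ge> 0" using D[OF k0, of "(0,0)"] by linarith
  define e where "e = (\<lambda>h. N * (T1 * (D * (R * ((5 + \<mu>) * M * h) + h / 2 * (M * h + 2 * M * T)))) + N * M * h * D * T1)"
  have bound: "\<forall>\<^sub>F h in at_right 0. \<bar>\<Sum>k\<in>K. X k\<bar> \<le> N * (T1 * (D * (1 + L) * \<eta>)) + e h" if \<eta>: "\<eta> > 0" for \<eta>
  proof -
    have R2: "0 < 2 * R" using R by simp
    have ev1: "\<forall>\<^sub>F h in at_right 0. \<forall>k\<in>K. \<forall>t\<in>{0..T}. integral {0..R} (\<lambda>x. \<bar>sol h k (x, t) - w k (x, t)\<bar>) \<le> \<eta>"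
      by (intro eventually_ball_finite[OF fin] ballI lim_ofD(3)[OF w]) (use R \<eta> in auto)
    have ev2: "\<forall>\<^sub>F h in at_right (0::real). h > 0 \<and> h < 2 * R"
      using eventually_at_right_less[of 0] order_tendstoD(2)[OF tendsto_ident_at R2] by (auto intro: eventually_conj)
    show ?thesis
    proof (rule eventually_mono[OF eventually_conj[OF ev1 ev2]])
      fix h assume A: "(\<forall>k\<in>K. \<forall>t\<in>{0..T}. integral {0..R} (\<lambda>x. \<bar>sol h k (x, t) - w k (x, t)\<bar>) \<le> \<eta>) \<and> h > 0 \<and> h < 2 * R"
      then have h: "h > 0" "h / 2 \<le> R" by auto
      define Y where "Y = (\<lambda>k. integral {0..T1} (\<lambda>t. vertex_flow h k t * \<psi>t k (0, t)))"
      have each: "\<bar>X k - Y k\<bar> \<le> T1 * (D * (1 + L) * \<eta>) + T1 * (D * (R * ((5 + \<mu>) * M * h) + h / 2 * (M * h + 2 * M * T)))"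
        if k: "k \<in> K" for k
      proof -
        have "\<forall>t\<in>{0..T}. integral {0..R} (\<lambda>x. \<bar>sol h k (x, t) - w k (x, t)\<bar>) \<le> \<eta>" using A k by blast
        from lim_double_integral[OF k w[OF k] h(1) _ T1 this td[OF k]] sol_weak_defect[OF k h T1 td[OF k]] R
        show ?thesis unfolding X_def Y_def by linarith
      qed
      have "\<bar>\<Sum>k\<in>K. Y k\<bar> \<le> N * M * h * D * T1"
      proof -
        have vi: "(\<lambda>t. vertex_flow h k t * \<psi>t k (0, t)) integrable_on {0..T1}" if k: "k \<in> K" for k
        proof (rule borel_bounded_on_integrable_on)
          have "\<psi>t k \<in> borel_measurable borel" by (rule test_dataD[OF td[OF k]])
          then show "(\<lambda>t. vertex_flow h k t * \<psi>t k (0, t)) \<in> borel_measurable borel"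
            by (intro borel_measurable_times vertex_flow_props(1)[OF k h(1)] borel_slice(2))
          fix t assume t: "t \<in> {0..T1}"
          have "\<bar>vertex_flow h k t\<bar> \<le> M * t" using t by (intro vertex_flow_props(2)[OF k h(1)]) auto
          also have "\<dots> \<le> M * T" using t T1 params by (intro mult_left_mono) auto
          finally show "\<bar>vertex_flow h k t * \<psi>t k (0, t)\<bar> \<le> M * T * D"
            unfolding abs_mult using D[OF k] T_pos params by (intro mult_mono) auto
        qed
        have "(\<Sum>k\<in>K. Y k) = integral {0..T1} (\<lambda>t. \<Sum>k\<in>K. vertex_flow h k t * \<psi>t k (0, t))"
          unfolding Y_def by (rule integral_sum[OF fin vi, symmetric])
        also have "\<bar>\<dots>\<bar> \<le> N * M * h * D * (T1 - 0)"
        proof (rule abs_integral_bound[OF T1(1)])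
          show "(\<lambda>t. \<Sum>k\<in>K. vertex_flow h k t * \<psi>t k (0, t)) integrable_on {0..T1}"
            by (rule integrable_sum[OF fin vi])
          fix t assume t: "t \<in> {0..T1}"
          have "(\<Sum>k\<in>K. vertex_flow h k t * \<psi>t k (0, t)) = (\<Sum>k\<in>K. vertex_flow h k t) * \<psi>t k0 (0, t)"
            unfolding sum_distrib_right using q[OF _ t] k0 by (intro sum.cong) auto
          also have "\<bar>\<dots>\<bar> \<le> N * M * h * D"
            unfolding abs_mult using D[OF k0] flux_balance[OF h(1)] N_pos params h
            by (intro mult_mono) (auto simp: vertex_flow_def)
          finally show "\<bar>\<Sum>k\<in>K. vertex_flow h k t * \<psi>t k (0, t)\<bar> \<le> N * M * h * D" .
        qed
        finally show ?thesis by simp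
      qed
      moreover have "\<bar>(\<Sum>k\<in>K. X k) - (\<Sum>k\<in>K. Y k)\<bar> \<le> N * (T1 * (D * (1 + L) * \<eta>)
          + T1 * (D * (R * ((5 + \<mu>) * M * h) + h / 2 * (M * h + 2 * M * T))))"
      proof -
        have "\<bar>(\<Sum>k\<in>K. X k) - (\<Sum>k\<in>K. Y k)\<bar> \<le> (\<Sum>k\<in>K. \<bar>X k - Y k\<bar>)"
          unfolding sum_subtractf[symmetric] by (rule sum_abs)
        also have "\<dots> \<le> (\<Sum>k\<in>K. T1 * (D * (1 + L) * \<eta>)
          + T1 * (D * (R * ((5 + \<mu>) * M * h) + h / 2 * (M * h + 2 * M * T))))" by (rule sum_mono[OF each])
        finally show ?thesis by simp
      qed
      ultimately show "\<bar>\<Sum>k\<in>K. X k\<bar> \<le> N * (T1 * (D * (1 + L) * \<eta>)) + e h"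
        unfolding e_def by (simp add: distrib_left)
    qed
  qed
  have e0: "(e \<longlongrightarrow> 0) (at_right 0)"
  proof -
    have "(e \<longlongrightarrow> N * (T1 * (D * (R * ((5 + \<mu>) * M * 0) + 0 / 2 * (M * 0 + 2 * M * T)))) + N * M * 0 * D * T1) (at_right 0)"
      unfolding e_def by (intro tendsto_intros) auto
    then show ?thesis by simp
  qed
  define C where "C = N * (T1 * (D * (1 + L)))"
  have C0: "C \<ge> 0" using N_pos T1 D0 params by (simp add: C_def)
  have le: "\<bar>\<Sum>k\<in>K. X k\<bar> \<le> C * \<eta>" if "\<eta> > 0" for \<eta>
  proof -
    have "((\<lambda>h. N * (T1 * (D * (1 + L) * \<eta>)) + e h) \<longlongrightarrow> N * (T1 * (D * (1 + L) * \<eta>)) + 0) (at_right 0)"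
      by (intro tendsto_add tendsto_const e0)
    from tendsto_lowerbound[OF this bound[OF that] trivial_limit_at_right_real]
    show ?thesis by (simp add: C_def mult.assoc)
  qed
  have "(\<Sum>k\<in>K. X k) = 0"
  proof (rule ccontr)
    assume "(\<Sum>k\<in>K. X k) \<noteq> 0"
    then have pos: "\<bar>\<Sum>k\<in>K. X k\<bar> > 0" by simp
    have "\<bar>\<Sum>k\<in>K. X k\<bar> \<le> C * (\<bar>\<Sum>k\<in>K. X k\<bar> / (C + 1))" using pos C0 by (intro le) simp
    then have "\<bar>\<Sum>k\<in>K. X k\<bar> * (C + 1) \<le> C * \<bar>\<Sum>k\<in>K. X k\<bar>" using C0 by (simp add: pos_le_divide_eq)
    with pos show False by (simp add: algebra_simps)
  qed
  then show ?thesis by (simp add: X_def)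
qed

end

section \<open>Test functions\<close>

lemma closure_edge: "closure (edge k) = {x. 0 \<le> dir k * x}"
  by (auto simp: edge_def dir_def)

text \<open>A second point in the convex set makes \<open>x\<close> a limit point of it, and only
  then is a derivative within the set unique.\<close>

lemma has_real_derivative_zero_within:
  assumes "(f has_real_derivative D) (at x within A)" "\<And>y. y \<in> A \<Longrightarrow> f y = 0"
    and "convex A" "x \<in> A" "y \<in> A" "x \<noteq> y"
  shows "D = 0"
proof -
  have "x islimpt A"
    using assms(3-6) by (intro connected_imp_perfect convex_connected) auto
  then have nb: "at x within A \<noteq> bot" by (simp add: trivial_limit_within)
  have "(f has_vector_derivative D) (at x within A)"
    using assms(1) by (simp add: has_real_derivative_iff_has_vector_derivative)
  moreover have "(f has_vector_derivative 0) (at x within A)"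
    by (rule has_vector_derivative_transform[OF assms(4) _ has_vector_derivative_const[of 0]]) (use assms(2) in auto)
  ultimately show ?thesis using vector_derivative_unique_within[OF nb] by blast
qed

lemma has_real_derivative_unique_within:
  fixes f :: "real \<Rightarrow> real"
  assumes "(f has_real_derivative D) (at x within A)" "(f has_real_derivative D') (at x within A)"
    and "convex A" "x \<in> A" "y \<in> A" "x \<noteq> y"
  shows "D = D'"
proof -
  have "((\<lambda>z. f z - f z) has_real_derivative D - D') (at x within A)"
    using assms by (intro DERIV_diff)
  from has_real_derivative_zero_within[OF this _ assms(3-6)] show ?thesis by simp
qed

lemma test_function_support:
  assumes tf: "test_function_on (X \<times> {0..<T}) \<psi>" and T: "T > 0"
  obtains R0 T0 where "0 < R0" "0 \<le> T0" "T0 < T"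
    "\<And>x t. x \<in> X \<Longrightarrow> t \<in> {0..<T} \<Longrightarrow> R0 \<le> \<bar>x\<bar> \<or> T0 \<le> t \<Longrightarrow> \<psi> (x, t) = 0"
proof -
  obtain C where C: "compact C" "C \<subseteq> X \<times> {0..<T}" "\<And>p. p \<in> X \<times> {0..<T} - C \<Longrightarrow> \<psi> p = 0"
    using tf by (auto simp: test_function_on_def)
  have c1: "compact (fst ` C)" "compact (snd ` C)"
    using C(1) by (auto intro!: compact_continuous_image continuous_intros)
  obtain B where B: "\<And>x. x \<in> fst ` C \<Longrightarrow> \<bar>x\<bar> \<le> B"
    using compact_imp_bounded[OF c1(1)] by (auto simp: bounded_iff)
  have "\<exists>m\<ge>0. m < T \<and> (\<forall>t\<in>snd ` C. t \<le> m)"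
  proof (cases "C = {}")
    case False
    then obtain m where "m \<in> snd ` C" "\<forall>t\<in>snd ` C. t \<le> m"
      using compact_attains_sup[OF c1(2)] by auto
    moreover have "m \<in> {0..<T}" using \<open>m \<in> snd ` C\<close> C(2) by auto
    ultimately show ?thesis by auto
  qed (use T in auto)
  then obtain m where m: "0 \<le> m" "m < T" "\<And>t. t \<in> snd ` C \<Longrightarrow> t \<le> m" by blast
  \<comment> \<open>Both values lie strictly beyond the support, so the function vanishes from them
    on, ends included; the midpoint of \<open>m\<close> and \<open>T\<close> is still below
    \<open>T\<close>.\<close>
  show thesis
  proof (rule that[of "\<bar>B\<bar> + 1" "(m + T) / 2"])
    show "\<psi> (x, t) = 0" if "x \<in> X" "t \<in> {0..<T}" "\<bar>B\<bar> + 1 \<le> \<bar>x\<bar> \<or> (m + T) / 2 \<le> t" for x t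
    proof (rule C(3))
      have "(x, t) \<notin> C"
      proof
        assume "(x, t) \<in> C"
        then have "\<bar>x\<bar> \<le> B" "t \<le> m" using B m(3) by force+
        moreover have "m < (m + T) / 2" using m(2) by simp
        ultimately show False using that(3) by auto
      qed
      with that show "(x, t) \<in> X \<times> {0..<T} - C" by auto
    qed
  qed (use m in auto)
qed

lemma test_data_mono: "test_data R T D \<psi> \<psi>x \<psi>t \<psi>xt \<Longrightarrow> D \<le> D' \<Longrightarrow> test_data R T D' \<psi> \<psi>x \<psi>t \<psi>xt"
  unfolding test_data_def by (meson order_trans)

lemma continuous_cutoff_borel:
  fixes G :: "real \<times> real \<Rightarrow> real"
  assumes "continuous_on ({0..R} \<times> {0..T}) G"
  shows "(\<lambda>p. indicator ({0..R} \<times> {0..T}) p * G p) \<in> borel_measurable borel"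
    and "\<exists>B. \<forall>p. \<bar>indicator ({0..R} \<times> {0..T}) p * G p\<bar> \<le> B"
proof -
  have cl: "closed ({0..R} \<times> {0..T} :: (real \<times> real) set)" by (intro closed_Times) auto
  show "(\<lambda>p. indicator ({0..R} \<times> {0..T}) p * G p) \<in> borel_measurable borel"
    using borel_measurable_continuous_on_indicator[OF borel_closed[OF cl] assms] by simp
  have "compact (G ` ({0..R} \<times> {0..T}))"
    by (intro compact_continuous_image assms compact_Times) auto
  then obtain B where B: "\<And>p. p \<in> {0..R} \<times> {0..T} \<Longrightarrow> \<bar>G p\<bar> \<le> B"
    using compact_imp_bounded by (fastforce simp: bounded_iff)
  have "\<bar>indicator ({0..R} \<times> {0..T}) p * G p\<bar> \<le> max 0 B" for p
    using B[of p] by (cases "p \<in> {0..R} \<times> {0..T}") auto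
  then show "\<exists>B. \<forall>p. \<bar>indicator ({0..R} \<times> {0..T}) p * G p\<bar> \<le> B" by blast
qed

text \<open>The derivatives supplied by \<open>smooth_within\<close> are restricted to coordinate
  lines in two ways: one-sided on the closed rectangle for the integrations by parts, and two-sided
  at interior points, where they equal the \<open>deriv\<close> of the weak formulation.\<close>

lemma test_function_data:
  assumes tf: "test_function_on (closure (edge k) \<times> {0..<T}) \<psi>"
    and RT: "R > 0" "0 \<le> T1" "T1 < T"
    and van: "\<And>x t. x \<in> closure (edge k) \<Longrightarrow> t \<in> {0..<T} \<Longrightarrow> R \<le> \<bar>x\<bar> \<or> T1 \<le> t \<Longrightarrow> \<psi> (x, t) = 0"
  obtains D \<psi>x \<psi>t \<psi>xt where
    "test_data R T1 D (\<lambda>p. \<psi> (dir k * fst p, snd p)) \<psi>x \<psi>t \<psi>xt"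
    "\<And>x t. x \<in> edge k \<Longrightarrow> t \<in> {0<..<T} \<Longrightarrow> deriv (\<lambda>s. \<psi> (x, s)) t = \<psi>t (dir k * x, t)"
    "\<And>x t. x \<in> edge k \<Longrightarrow> t \<in> {0<..<T} \<Longrightarrow> deriv (\<lambda>y. \<psi> (y, t)) x = dir k * \<psi>x (dir k * x, t)"
    "\<And>p. p \<notin> {0..R} \<times> {0..T1} \<Longrightarrow> \<psi>t p = 0 \<and> \<psi>x p = 0"
    "\<And>t. t \<in> {0..T1} \<Longrightarrow> ((\<lambda>s. \<psi> (0, s)) has_real_derivative \<psi>t (0, t)) (at t within {0..<T})"
proof -
  define S where "S = closure (edge k) \<times> {0..<T}"
  obtain Df :: "nat \<Rightarrow> nat \<Rightarrow> real \<times> real \<Rightarrow> real" where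
    D0: "\<And>p. p \<in> S \<Longrightarrow> Df 0 0 p = \<psi> p" and
    Df: "\<And>i j p. p \<in> S \<Longrightarrow> (Df i j has_derivative (\<lambda>h. fst h * Df (Suc i) j p + snd h * Df i (Suc j) p)) (at p within S)"
    using tf unfolding test_function_on_def smooth_within_def S_def by blast
  have S: "(dir k * \<rho>, t) \<in> S" if "0 \<le> \<rho>" "t \<in> {0..<T}" for \<rho> t
    using that by (simp add: S_def closure_edge)
  have S': "(x, t) \<in> S" if "x \<in> closure (edge k)" "t \<in> {0..<T}" for x t
    using that by (simp add: S_def)
  have line_x: "((\<lambda>\<rho>. Df i j (dir k * \<rho>, t)) has_real_derivative dir k * Df (Suc i) j (dir k * \<rho>, t)) (at \<rho> within {0..})"
    if "0 \<le> \<rho>" "t \<in> {0..<T}" for i j \<rho> t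
  proof -
    have "((\<lambda>\<rho>. (dir k * \<rho>, t)) has_derivative (\<lambda>h. (dir k * h, 0))) (at \<rho> within {0..})"
      by (auto intro!: derivative_eq_intros)
    moreover have "(Df i j has_derivative (\<lambda>h. fst h * Df (Suc i) j (dir k * \<rho>, t) + snd h * Df i (Suc j) (dir k * \<rho>, t)))
        (at (dir k * \<rho>, t) within (\<lambda>\<rho>. (dir k * \<rho>, t)) ` {0..})"
      by (rule has_derivative_subset[OF Df[OF S[OF that]]]) (use S that in auto)
    ultimately have "((\<lambda>\<rho>. Df i j (dir k * \<rho>, t)) has_derivative
        (\<lambda>h. fst (dir k * h, 0::real) * Df (Suc i) j (dir k * \<rho>, t) + snd (dir k * h, 0::real) * Df i (Suc j) (dir k * \<rho>, t)))
        (at \<rho> within {0..})"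
      by (rule has_derivative_in_compose)
    then show ?thesis unfolding has_field_derivative_def by (rule has_derivative_eq_rhs) (simp add: fun_eq_iff)
  qed
  have line_t: "((\<lambda>s. Df i j (x, s)) has_real_derivative Df i (Suc j) (x, t)) (at t within {0..<T})"
    if "x \<in> closure (edge k)" "t \<in> {0..<T}" for i j x t
  proof -
    have "((\<lambda>s. (x, s)) has_derivative (\<lambda>h. (0, h))) (at t within {0..<T})"
      by (auto intro!: derivative_eq_intros)
    moreover have "(Df i j has_derivative (\<lambda>h. fst h * Df (Suc i) j (x, t) + snd h * Df i (Suc j) (x, t)))
        (at (x, t) within (\<lambda>s. (x, s)) ` {0..<T})"
      by (rule has_derivative_subset[OF Df[OF S'[OF that]]]) (use that S' in auto)
    ultimately have "((\<lambda>s. Df i j (x, s)) has_derivative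
        (\<lambda>h. fst (0::real, h) * Df (Suc i) j (x, t) + snd (0::real, h) * Df i (Suc j) (x, t)))
        (at t within {0..<T})"
      by (rule has_derivative_in_compose)
    then show ?thesis unfolding has_field_derivative_def by (rule has_derivative_eq_rhs) (simp add: fun_eq_iff)
  qed
  have cl: "dir k * \<rho> \<in> closure (edge k)" if "0 \<le> \<rho>" for \<rho> using that by (simp add: closure_edge)
  have z00: "Df 0 0 (dir k * \<rho>, t) = 0" if "0 \<le> \<rho>" "t \<in> {0..<T}" "R \<le> \<rho> \<or> T1 \<le> t" for \<rho> t
    using D0[OF S[OF that(1,2)]] van[OF cl[OF that(1)] that(2)] that by auto
  have z10: "Df (Suc 0) 0 (dir k * \<rho>, t) = 0" if "0 \<le> \<rho>" "t \<in> {0..<T}" "R \<le> \<rho> \<or> T1 \<le> t" for \<rho> t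
  proof -
    \<comment> \<open>A convex set containing \<open>\<rho>\<close> on which the function vanishes:
      beyond \<open>R\<close> if \<open>\<rho>\<close> is there, otherwise the whole half line,
      since then \<open>T1 \<le> t\<close>. At \<open>\<rho> = R\<close> the derivative from the
      right determines the derivative within \<open>{0..}\<close>.\<close>
    define A where "A = (if R \<le> \<rho> then {R..} else {0..})"
    have A: "A \<subseteq> {0..}" "convex A" "\<rho> \<in> A" "\<rho> + 1 \<in> A" using that RT by (auto simp: A_def)
    have "dir k * Df (Suc 0) 0 (dir k * \<rho>, t) = 0"
    proof (rule has_real_derivative_zero_within[OF DERIV_subset[OF line_x[OF that(1,2)] A(1)] _ A(2-4)])
      show "Df 0 0 (dir k * y, t) = 0" if "y \<in> A" for y
        using that \<open>t \<in> {0..<T}\<close> \<open>R \<le> \<rho> \<or> T1 \<le> t\<close> RT by (intro z00) (auto simp: A_def split: if_splits)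
    qed simp
    then show ?thesis by simp
  qed
  have z01: "Df 0 (Suc 0) (dir k * \<rho>, t) = 0" if "0 \<le> \<rho>" "t \<in> {0..<T}" "R \<le> \<rho> \<or> T1 \<le> t" for \<rho> t
  proof -
    define A where "A = (if R \<le> \<rho> then {0..<T} else {T1..<T})"
    have A: "A \<subseteq> {0..<T}" "convex A" "t \<in> A" "(t + T) / 2 \<in> A" "t \<noteq> (t + T) / 2" using that RT by (auto simp: A_def)
    show ?thesis
    proof (rule has_real_derivative_zero_within[OF DERIV_subset[OF line_t[OF cl[OF that(1)] that(2)] A(1)] _ A(2-5)])
      show "Df 0 0 (dir k * \<rho>, s) = 0" if "s \<in> A" for s
        using that \<open>0 \<le> \<rho>\<close> RT A(1) by (intro z00) (auto simp: A_def split: if_splits)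
    qed
  qed
  \<comment> \<open>Cutting off with the indicator of the closed rectangle makes the derivatives
    Borel and bounded on the whole plane without changing them within the rectangle.\<close>
  define Q where "Q = {0..R} \<times> {0..T1}"
  define \<psi>t where "\<psi>t = (\<lambda>p. indicator Q p * Df 0 (Suc 0) (dir k * fst p, snd p))"
  define \<psi>x where "\<psi>x = (\<lambda>p. indicator Q p * (dir k * Df (Suc 0) 0 (dir k * fst p, snd p)))"
  define \<psi>xt where "\<psi>xt = (\<lambda>p. indicator Q p * (dir k * Df (Suc 0) (Suc 0) (dir k * fst p, snd p)))"
  have contD: "continuous_on Q (\<lambda>p. Df i j (dir k * fst p, snd p))" for i j
  proof (rule continuous_on_compose2[of S "Df i j"])
    show "continuous_on S (Df i j)" using Df by (rule has_derivative_continuous_on)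
    show "continuous_on Q (\<lambda>p. (dir k * fst p, snd p))" by (intro continuous_intros)
    show "(\<lambda>p. (dir k * fst p, snd p)) ` Q \<subseteq> S" using S RT by (auto simp: Q_def)
  qed
  have contE: "continuous_on Q (\<lambda>p. dir k * Df i j (dir k * fst p, snd p))" for i j
    by (intro continuous_on_mult contD continuous_on_const)
  obtain B1 B2 B3 where B: "\<And>p. \<bar>\<psi>x p\<bar> \<le> B1" "\<And>p. \<bar>\<psi>t p\<bar> \<le> B2" "\<And>p. \<bar>\<psi>xt p\<bar> \<le> B3"
    using continuous_cutoff_borel(2)[OF contE[unfolded Q_def], of "Suc 0" 0]
      continuous_cutoff_borel(2)[OF contD[unfolded Q_def], of 0 "Suc 0"]
      continuous_cutoff_borel(2)[OF contE[unfolded Q_def], of "Suc 0" "Suc 0"]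
    unfolding \<psi>x_def \<psi>t_def \<psi>xt_def Q_def by blast
  define D where "D = max B1 (max B2 B3)"
  have in_T: "t \<in> {0..<T}" if "t \<in> {0..T1}" for t using that RT by auto
  have td: "test_data R T1 D (\<lambda>p. \<psi> (dir k * fst p, snd p)) \<psi>x \<psi>t \<psi>xt"
    unfolding test_data_def
  proof (intro conjI ballI allI)
    show "\<psi>x \<in> borel_measurable borel" "\<psi>xt \<in> borel_measurable borel"
      unfolding \<psi>x_def \<psi>xt_def Q_def by (rule continuous_cutoff_borel(1)[OF contE[unfolded Q_def]])+
    show "\<psi>t \<in> borel_measurable borel"
      unfolding \<psi>t_def Q_def by (rule continuous_cutoff_borel(1)[OF contD[unfolded Q_def]])
    show "\<bar>\<psi>x p\<bar> \<le> D" "\<bar>\<psi>t p\<bar> \<le> D" "\<bar>\<psi>xt p\<bar> \<le> D" for p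
      using B[of p] by (auto simp: D_def le_max_iff_disj)
    have T1: "0 \<in> {0..T1}" "T1 \<in> {0..T1}" using RT by auto
    show "\<psi>t (R, t) = 0" if "t \<in> {0..T1}" for t using z01[of R t] in_T[OF that] RT by (simp add: \<psi>t_def)
    show "\<psi> (dir k * fst (R, 0::real), snd (R, 0::real)) = 0"
      using van[OF cl[of R], of 0] RT by simp
    fix x assume x: "x \<in> {0..R}"
    have x0: "0 \<le> x" using x by simp
    show "\<psi>x (x, T1) = 0" using z10[of x T1] in_T[OF T1(2)] x0 by (simp add: \<psi>x_def)
    show "((\<lambda>x. \<psi> (dir k * fst (x, 0::real), snd (x, 0::real))) has_real_derivative \<psi>x (x, 0)) (at x within {0..R})"
    proof -
      have "((\<lambda>\<rho>. Df 0 0 (dir k * \<rho>, 0)) has_real_derivative \<psi>x (x, 0)) (at x within {0..R})"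
        using DERIV_subset[OF line_x[OF x0 in_T[OF T1(1)]], of "{0..R}" 0 0] x RT by (simp add: \<psi>x_def Q_def)
      then show ?thesis unfolding has_field_derivative_def
        by (rule has_derivative_transform[OF x, rotated]) (use D0 S in_T[OF T1(1)] in auto)
    qed
    fix t assume t: "t \<in> {0..T1}"
    show "((\<lambda>x. \<psi>t (x, t)) has_real_derivative \<psi>xt (x, t)) (at x within {0..R})"
    proof -
      have "((\<lambda>\<rho>. Df 0 (Suc 0) (dir k * \<rho>, t)) has_real_derivative \<psi>xt (x, t)) (at x within {0..R})"
        using DERIV_subset[OF line_x[OF x0 in_T[OF t]], of "{0..R}" 0 "Suc 0"] x t by (simp add: \<psi>xt_def Q_def)
      then show ?thesis unfolding has_field_derivative_def
        by (rule has_derivative_transform[OF x, rotated]) (use t in \<open>simp add: \<psi>t_def Q_def\<close>)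
    qed
    show "((\<lambda>t. \<psi>x (x, t)) has_real_derivative \<psi>xt (x, t)) (at t within {0..T1})"
    proof -
      have "((\<lambda>s. Df (Suc 0) 0 (dir k * x, s)) has_real_derivative Df (Suc 0) (Suc 0) (dir k * x, t)) (at t within {0..T1})"
        using line_t[OF cl[OF x0] in_T[OF t]] by (rule DERIV_subset) (use in_T in auto)
      from DERIV_cmult[OF this, of "dir k"]
      have "((\<lambda>s. dir k * Df (Suc 0) 0 (dir k * x, s)) has_real_derivative \<psi>xt (x, t)) (at t within {0..T1})"
        using x t by (simp add: \<psi>xt_def Q_def)
      then show ?thesis unfolding has_field_derivative_def
        by (rule has_derivative_transform[OF t, rotated]) (use x in \<open>simp add: \<psi>x_def Q_def\<close>)
    qed
  qed
  have edge_cl: "x \<in> closure (edge k)" if "x \<in> edge k" for x using that closure_subset by blast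
  have td1: "deriv (\<lambda>s. \<psi> (x, s)) t = \<psi>t (dir k * x, t)" if x: "x \<in> edge k" and t: "t \<in> {0<..<T}" for x t
  proof -
    have xx: "0 \<le> dir k * x" "x = dir k * (dir k * x)" using x by (auto simp: edge_iff_dir)
    have tt: "t \<in> {0..<T}" using t by auto
    have "((\<lambda>s. Df 0 0 (x, s)) has_real_derivative Df 0 (Suc 0) (x, t)) (at t within {0<..<T})"
      using line_t[OF edge_cl[OF x] tt] by (rule DERIV_subset) auto
    then have "((\<lambda>s. \<psi> (x, s)) has_real_derivative Df 0 (Suc 0) (x, t)) (at t within {0<..<T})"
      unfolding has_field_derivative_def
      by (rule has_derivative_transform[OF t, rotated]) (use D0 S' edge_cl[OF x] in auto)
    then have "((\<lambda>s. \<psi> (x, s)) has_real_derivative Df 0 (Suc 0) (x, t)) (at t)"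
      using at_within_open[OF t] by simp
    then have "deriv (\<lambda>s. \<psi> (x, s)) t = Df 0 (Suc 0) (x, t)" by (rule DERIV_imp_deriv)
    also have "\<dots> = \<psi>t (dir k * x, t)"
      using z01[OF xx(1) tt] xx tt by (cases "R \<le> dir k * x \<or> T1 \<le> t") (auto simp: \<psi>t_def Q_def)
    finally show ?thesis .
  qed
  have td2: "deriv (\<lambda>y. \<psi> (y, t)) x = dir k * \<psi>x (dir k * x, t)" if x: "x \<in> edge k" and t: "t \<in> {0<..<T}" for x t
  proof -
    have xx: "0 \<le> dir k * x" "x = dir k * (dir k * x)" using x by (auto simp: edge_iff_dir)
    have tt: "t \<in> {0..<T}" using t by auto
    have op: "open (edge k)" by (auto simp: edge_def)
    have "((\<lambda>y. (y, t)) has_derivative (\<lambda>h. (h, 0))) (at x within edge k)"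
      by (auto intro!: derivative_eq_intros)
    moreover have "(Df 0 0 has_derivative (\<lambda>h. fst h * Df (Suc 0) 0 (x, t) + snd h * Df 0 (Suc 0) (x, t)))
        (at (x, t) within (\<lambda>y. (y, t)) ` edge k)"
      by (rule has_derivative_subset[OF Df[OF S'[OF edge_cl[OF x] tt]]]) (use S' edge_cl tt in auto)
    ultimately have "((\<lambda>y. Df 0 0 (y, t)) has_derivative
        (\<lambda>h. fst (h, 0::real) * Df (Suc 0) 0 (x, t) + snd (h, 0::real) * Df 0 (Suc 0) (x, t))) (at x within edge k)"
      by (rule has_derivative_in_compose)
    then have "((\<lambda>y. \<psi> (y, t)) has_derivative
        (\<lambda>h. fst (h, 0::real) * Df (Suc 0) 0 (x, t) + snd (h, 0::real) * Df 0 (Suc 0) (x, t))) (at x within edge k)"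
      by (rule has_derivative_transform[OF x, rotated]) (use D0 S' edge_cl tt in auto)
    then have "((\<lambda>y. \<psi> (y, t)) has_real_derivative Df (Suc 0) 0 (x, t)) (at x within edge k)"
      unfolding has_field_derivative_def by (rule has_derivative_eq_rhs) (simp add: fun_eq_iff)
    then have "((\<lambda>y. \<psi> (y, t)) has_real_derivative Df (Suc 0) 0 (x, t)) (at x)"
      using at_within_open[OF x op] by simp
    then have "deriv (\<lambda>y. \<psi> (y, t)) x = Df (Suc 0) 0 (x, t)" by (rule DERIV_imp_deriv)
    also have "\<dots> = dir k * \<psi>x (dir k * x, t)"
      using z10[OF xx(1) tt] xx tt by (cases "R \<le> dir k * x \<or> T1 \<le> t") (auto simp: \<psi>x_def Q_def)
    finally show ?thesis .
  qed
  have td3: "\<psi>t p = 0 \<and> \<psi>x p = 0" if "p \<notin> {0..R} \<times> {0..T1}" for p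
    using that by (simp add: \<psi>t_def \<psi>x_def Q_def)
  have td4: "((\<lambda>s. \<psi> (0, s)) has_real_derivative \<psi>t (0, t)) (at t within {0..<T})" if t: "t \<in> {0..T1}" for t
  proof -
    have c0: "0 \<in> closure (edge k)" by (simp add: closure_edge)
    have "((\<lambda>s. Df 0 0 (0, s)) has_real_derivative \<psi>t (0, t)) (at t within {0..<T})"
      using line_t[OF c0 in_T[OF t], of 0 0] t RT by (simp add: \<psi>t_def Q_def)
    then show ?thesis unfolding has_field_derivative_def
      by (rule has_derivative_transform[OF in_T[OF t], rotated]) (use D0 S' c0 in auto)
  qed
  show thesis by (rule that[OF td td1 td2 td3 td4])
qed

section \<open>The network as a star\<close>

lemma edges_cases: "k \<in> edges Nin Nout \<longleftrightarrow> (if k < 0 then k \<in> I_in Nin else k \<in> I_out Nout)"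
  by (auto simp: edges_def I_in_def I_out_def)

lemma edges_card: "finite (edges Nin Nout)" "card (edges Nin Nout) = Nin + Nout"
proof -
  have "I_in Nin \<inter> I_out Nout = {}" by (auto simp: I_in_def I_out_def)
  moreover have "card (I_in Nin) = Nin" "card (I_out Nout) = Nout" "finite (I_in Nin)" "finite (I_out Nout)"
    by (simp_all add: I_in_def I_out_def)
  ultimately show "finite (edges Nin Nout)" "card (edges Nin Nout) = Nin + Nout"
    by (simp_all add: edges_def card_Un_disjoint)
qed

lemma sum_edges: "(\<Sum>k\<in>edges Nin Nout. a k) = (\<Sum>k\<in>I_in Nin. a k) + (\<Sum>k\<in>I_out Nout. a k)" for a :: "int \<Rightarrow> real"
  unfolding edges_def by (rule sum.union_disjoint) (auto simp: I_in_def I_out_def)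

lemma I_in_neg: "k \<in> I_in Nin \<Longrightarrow> k < 0" and I_out_pos: "k \<in> I_out Nout \<Longrightarrow> \<not> k < 0"
  by (auto simp: I_in_def I_out_def)

definition cell_index :: "int \<Rightarrow> nat \<Rightarrow> int" where
  "cell_index k l = (if k < 0 then - int l else int l)"

text \<open>\<open>b\<close> stands for the initial datum, reflected to the positive half line and
  modified on a null set. Finite total variation enters through \<open>V\<close> only, the CFL
  condition through \<open>L\<close>.\<close>

locale upwind_network =
  fixes Nin Nout :: nat and T \<mu> L V :: real and f ubar :: "int \<Rightarrow> real \<Rightarrow> real" and c d :: "int \<Rightarrow> real"
    and b :: "int \<Rightarrow> real \<Rightarrow> real"
  assumes Nin: "Nin \<ge> 1" and Nout: "Nout \<ge> 1" and T0: "T > 0"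
    and strict: "\<And>k. k \<in> edges Nin Nout \<Longrightarrow> strict_mono (f k) \<or> strict_antimono_on UNIV (f k)"
    and stat_c: "discrete_stationary Nin Nout f (upwind_flux f) c"
    and stat_d: "discrete_stationary Nin Nout f (upwind_flux f) d"
    and c0d0: "c 0 \<le> d 0" and cd: "\<And>k. k \<in> edges Nin Nout \<Longrightarrow> c k \<le> d k"
    and mu0: "\<mu> > 0" and cflL: "\<mu> * L \<le> 1 / 2"
    and cflk: "\<And>k. k \<in> edges Nin Nout \<Longrightarrow> let S = {min (c k) (c 0)..max (d k) (d 0)} in
      (\<forall>v\<in>S. L-lipschitz_on S (\<lambda>u. upwind_flux f k u v)) \<and> (\<forall>u\<in>S. L-lipschitz_on S (\<lambda>v. upwind_flux f k u v))"
    and ubar_meas: "\<And>k. k \<in> edges Nin Nout \<Longrightarrow> ubar k \<in> borel_measurable (lebesgue_on (edge k))"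
    and bB: "\<And>k. k \<in> edges Nin Nout \<Longrightarrow> b k \<in> borel_measurable borel"
    and brange: "\<And>k x. k \<in> edges Nin Nout \<Longrightarrow> b k x \<in> {c k..d k}"
    and brep: "\<And>k. k \<in> edges Nin Nout \<Longrightarrow> AE x in lborel. x \<in> edge k \<longrightarrow> ubar k x = b k (dir k * x)"
    and bV: "\<And>k h J. k \<in> edges Nin Nout \<Longrightarrow> h > 0 \<Longrightarrow>
      (\<Sum>l<J. \<bar>integral {(real l + 3/2) * h..(real l + 5/2) * h} (b k) - integral {(real l + 1/2) * h..(real l + 3/2) * h} (b k)\<bar>) \<le> h * V"
begin

abbreviation "E \<equiv> edges Nin Nout"
abbreviation "F \<equiv> upwind_flux f"

definition ori :: "int \<Rightarrow> real" where "ori k = (if mono (f k) then 1 else -1)"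
text \<open>Reflecting the space variable of an edge on the negative half line changes the sign of
  the flux. After that, \<open>\<sigma> k = 1\<close> says that the reflected flux increases, so
  that information leaves the vertex.\<close>

definition \<phi> :: "int \<Rightarrow> real \<Rightarrow> real" where "\<phi> k a = dir k * f k a"
definition \<sigma> :: "int \<Rightarrow> real" where "\<sigma> k = dir k * ori k"
definition lo :: "int \<Rightarrow> real" where "lo k = min (c k) (c 0)"
definition hi :: "int \<Rightarrow> real" where "hi k = max (d k) (d 0)"
text \<open>A monotone flux attains its extremes at the ends of the interval, so this sum bounds all
  values and all fluxes on all edges.\<close>

definition M :: real where "M = (\<Sum>k\<in>E. \<bar>lo k\<bar> + \<bar>hi k\<bar> + \<bar>f k (lo k)\<bar> + \<bar>f k (hi k)\<bar>)"
definition P :: "int \<Rightarrow> real \<Rightarrow> real" where "P k x = integral {0..x} (b k)"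
definition grid :: "real \<Rightarrow> nat \<Rightarrow> int \<Rightarrow> int \<Rightarrow> real" where
  "grid h = fv_grid Nin Nout F ubar (c 0) (\<mu> * h) h"
definition u :: "real \<Rightarrow> int \<Rightarrow> nat \<Rightarrow> nat \<Rightarrow> real" where "u h k n l = grid h n k (cell_index k l)"
definition v :: "real \<Rightarrow> nat \<Rightarrow> real" where "v h n = grid h n 1 0"

lemma ori_simps: "ori k * ori k = 1" "ori k * (ori k * a) = a" "ori k = 1 \<or> ori k = -1"
  by (auto simp: ori_def)

lemma sigma_phi: "\<sigma> k * \<phi> k a = ori k * f k a"
  by (simp add: \<sigma>_def \<phi>_def dir_def)

lemma one_edge: "1 \<in> E"
  using Nout by (simp add: edges_def I_out_def)

lemma ori_strict:
  assumes "k \<in> E" "x < y"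
  shows "ori k * f k x < ori k * f k y"
proof (cases "strict_mono (f k)")
  case True
  then have "mono (f k)" by (rule strict_mono_mono)
  with True assms show ?thesis by (simp add: ori_def strict_mono_def)
next
  case False
  with strict[OF assms(1)] have sa: "strict_antimono_on UNIV (f k)" by blast
  then have "f k y < f k x" "f k 1 < f k 0" using assms(2) by (auto simp: monotone_on_def)
  moreover from this(2) have "\<not> mono (f k)" using monoD[of "f k" 0 1] by (auto simp: not_le[symmetric])
  ultimately show ?thesis by (simp add: ori_def)
qed

lemma ori_mono: "k \<in> E \<Longrightarrow> x \<le> y \<Longrightarrow> ori k * f k x \<le> ori k * f k y"
  using ori_strict[of k x y] by (cases "x = y") auto

lemma lohi: "k \<in> E \<Longrightarrow> lo k \<le> c k \<and> lo k \<le> c 0 \<and> d k \<le> hi k \<and> d 0 \<le> hi k \<and> lo k \<le> hi k"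
  using cd c0d0 by (auto simp: lo_def hi_def)

lemma f_lipschitz:
  assumes "k \<in> E"
  shows "L-lipschitz_on {lo k..hi k} (f k)"
proof -
  have "lo k \<in> {lo k..hi k}" using lohi[OF assms] by auto
  then have "L-lipschitz_on {lo k..hi k} (\<lambda>a. F k a (lo k))" "L-lipschitz_on {lo k..hi k} (\<lambda>a. F k (lo k) a)"
    using cflk[OF assms] unfolding Let_def lo_def[symmetric] hi_def[symmetric] by blast+
  then show ?thesis by (cases "mono (f k)") (simp_all add: upwind_flux_def)
qed

lemma M_ge: "k \<in> E \<Longrightarrow> \<bar>lo k\<bar> + \<bar>hi k\<bar> + \<bar>f k (lo k)\<bar> + \<bar>f k (hi k)\<bar> \<le> M"
  unfolding M_def by (rule member_le_sum) (use edges_card in auto)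

lemma bnd:
  assumes "k \<in> E" "x \<in> {lo k..hi k}"
  shows "\<bar>x\<bar> \<le> M" "\<bar>f k x\<bar> \<le> M"
proof -
  show "\<bar>x\<bar> \<le> M" using M_ge[OF assms(1)] assms(2) by auto
  have "ori k * f k (lo k) \<le> ori k * f k x" "ori k * f k x \<le> ori k * f k (hi k)"
    using ori_mono[OF assms(1)] assms(2) by auto
  then show "\<bar>f k x\<bar> \<le> M" using M_ge[OF assms(1)] ori_simps(3)[of k] by auto
qed

lemma b_bnd: "k \<in> E \<Longrightarrow> \<bar>b k x\<bar> \<le> M"
proof (rule bnd(1))
  assume "k \<in> E"
  then show "b k x \<in> {lo k..hi k}" using brange[of k x] lohi[of k] by auto
qed

lemma b_int: "k \<in> E \<Longrightarrow> b k integrable_on {x..y}"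
  by (rule bounded_borel_integrable_on[OF bB b_bnd])

lemma P_diff:
  assumes "k \<in> E" "0 \<le> x" "x \<le> y"
  shows "P k y - P k x = integral {x..y} (b k)"
proof -
  have "integral {0..x} (b k) + integral {x..y} (b k) = integral {0..y} (b k)"
    using assms b_int by (intro Henstock_Kurzweil_Integration.integral_combine) auto
  then show ?thesis by (simp add: P_def)
qed

lemma edge_locale: 
  assumes k: "k \<in> E"
  shows "upwind_edge (\<phi> k) (\<sigma> k) (lo k) (hi k) L \<mu> M (P k)"
proof
  show "\<sigma> k = 1 \<or> \<sigma> k = -1" by (auto simp: \<sigma>_def dir_def ori_def)
  show "lo k \<le> hi k" using lohi[OF k] by simp
  show "\<sigma> k * \<phi> k x < \<sigma> k * \<phi> k y" if "x < y" for x y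
    unfolding sigma_phi by (rule ori_strict[OF k that])
  have "dist (f k x) (f k y) \<le> L * dist x y" if "x \<in> {lo k..hi k}" "y \<in> {lo k..hi k}" for x y
    by (rule lipschitz_onD[OF f_lipschitz[OF k] that])
  then show "\<bar>\<phi> k x - \<phi> k y\<bar> \<le> L * \<bar>x - y\<bar>" if "x \<in> {lo k..hi k}" "y \<in> {lo k..hi k}" for x y
    using that by (simp add: \<phi>_def dist_real_def right_diff_distrib[symmetric])
  show "0 \<le> L" using f_lipschitz[OF k] by (rule lipschitz_on_nonneg)
  show "\<mu> > 0" "\<mu> * L \<le> 1" using mu0 cflL by auto
  show "\<bar>x\<bar> \<le> M" "\<bar>\<phi> k x\<bar> \<le> M" if "x \<in> {lo k..hi k}" for x
    using bnd[OF k that] by (simp_all add: \<phi>_def)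
  have *: "\<bar>P k y - P k x\<bar> \<le> M * (y - x)" if "0 \<le> x" "x \<le> y" for x y
    unfolding P_diff[OF k that] using that b_bnd[OF k] by (intro abs_integral_bound b_int k) auto
  show "\<bar>P k x - P k y\<bar> \<le> M * \<bar>x - y\<bar>" if "0 \<le> x" "0 \<le> y" for x y
    using *[of x y] *[of y x] that by (cases "x \<le> y") (auto simp: abs_minus_commute)
  show "P k 0 = 0" by (simp add: P_def)
qed

lemma flux_eq:
  assumes k: "k \<in> E"
  shows "upwind_edge.flux (\<phi> k) (\<sigma> k) x y = (if k < 0 then - F k y x else F k x y)"
  unfolding upwind_edge.flux_def[OF edge_locale[OF k]]
  by (auto simp: \<sigma>_def \<phi>_def dir_def ori_def upwind_flux_def)

lemma cell_index_simps [simp]: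
  "cell_index k (Suc l) \<in> edge_disc k" "cell_index k 0 = 0" "0 \<notin> edge_disc k"
  by (auto simp: cell_index_def edge_disc_def)

lemma grid_Suc: "grid h (Suc n) = fv_step Nin Nout F (\<mu> * h) h (grid h n)"
  by (simp add: grid_def fv_grid_def)

lemma grid_vertex: "grid h n k 0 = v h n"
  by (induction n) (simp_all add: v_def grid_Suc fv_step_def, simp add: grid_def fv_grid_def fv_init_def)

lemma u_vertex: "u h k n 0 = v h n"
  by (simp add: u_def grid_vertex)

lemma u_step:
  assumes k: "k \<in> E" and h: "h > 0"
  shows "u h k (Suc n) (Suc l) = u h k n (Suc l) - \<mu> * (upwind_edge.flux (\<phi> k) (\<sigma> k) (u h k n (Suc l)) (u h k n (Suc (Suc l)))
    - upwind_edge.flux (\<phi> k) (\<sigma> k) (u h k n l) (u h k n (Suc l)))"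
proof (cases "k < 0")
  case True
  have i: "cell_index k (Suc l) + 1 = cell_index k l" "cell_index k (Suc l) - 1 = cell_index k (Suc (Suc l))"
    using True by (auto simp: cell_index_def)
  have "u h k (Suc n) (Suc l) = u h k n (Suc l) - \<mu> * h / h * (F k (u h k n (Suc l)) (u h k n l) - F k (u h k n (Suc (Suc l))) (u h k n (Suc l)))"
    unfolding u_def grid_Suc by (simp add: fv_step_def i)
  then show ?thesis using h True by (simp add: flux_eq[OF k])
next
  case False
  have i: "cell_index k (Suc l) - 1 = cell_index k l" "cell_index k (Suc l) + 1 = cell_index k (Suc (Suc l))"
    using False by (auto simp: cell_index_def)
  have "u h k (Suc n) (Suc l) = u h k n (Suc l) - \<mu> * h / h * (F k (u h k n (Suc l)) (u h k n (Suc (Suc l))) - F k (u h k n l) (u h k n (Suc l)))"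
    unfolding u_def grid_Suc by (simp add: fv_step_def i)
  then show ?thesis using h False by (simp add: flux_eq[OF k])
qed

lemma v_step:
  assumes h: "h > 0"
  shows "v h (Suc n) = v h n - 2 * \<mu> / real (card E) *
    (\<Sum>k\<in>E. upwind_edge.flux (\<phi> k) (\<sigma> k) (u h k n 0) (u h k n (Suc 0)))"
proof -
  have o: "upwind_edge.flux (\<phi> k) (\<sigma> k) (u h k n 0) (u h k n (Suc 0)) = F k (grid h n k 0) (grid h n k 1)"
    if "k \<in> I_out Nout" for k
  proof -
    have "k \<in> E" "\<not> k < 0" using that I_out_pos[OF that] by (auto simp: edges_def)
    then show ?thesis by (simp add: flux_eq u_def cell_index_def)
  qed
  have i: "upwind_edge.flux (\<phi> k) (\<sigma> k) (u h k n 0) (u h k n (Suc 0)) = - F k (grid h n k (-1)) (grid h n k 0)"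
    if "k \<in> I_in Nin" for k
  proof -
    have "k \<in> E" "k < 0" using that I_in_neg[OF that] by (auto simp: edges_def)
    then show ?thesis by (simp add: flux_eq u_def cell_index_def)
  qed
  have "(\<Sum>k\<in>E. upwind_edge.flux (\<phi> k) (\<sigma> k) (u h k n 0) (u h k n (Suc 0)))
      = (\<Sum>k\<in>I_out Nout. F k (grid h n k 0) (grid h n k 1)) - (\<Sum>k\<in>I_in Nin. F k (grid h n k (-1)) (grid h n k 0))"
    unfolding sum_edges by (simp add: o i sum_negf)
  moreover have "v h (Suc n) = v h n - \<mu> * h / (real (Nin + Nout) * h / 2) *
      ((\<Sum>k\<in>I_out Nout. F k (grid h n k 0) (grid h n k 1)) - (\<Sum>k\<in>I_in Nin. F k (grid h n k (-1)) (grid h n k 0)))"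
    unfolding v_def grid_Suc fv_step_def by simp
  moreover have "\<mu> * h / (real (Nin + Nout) * h / 2) = 2 * \<mu> / real (card E)"
    using h by (simp add: edges_card)
  ultimately show ?thesis by simp
qed

lemma init_average:
  assumes k: "k \<in> E" and h: "h > 0"
  shows "h * u h k 0 (Suc l) = integral {(real l + 1/2) * h..(real l + 3/2) * h} (b k)"
proof -
  define S where "S = cell h k (cell_index k (Suc l))"
  have S: "S \<subseteq> edge k" "S \<in> sets lebesgue" by (auto simp: S_def cell_def)
  have mem: "dir k * x \<in> S \<longleftrightarrow> (real l + 1/2) * h < x \<and> x < (real l + 3/2) * h" for x
  proof -
    have "0 < (real l + 1/2) * h" using h by simp
    then show ?thesis by (auto simp: S_def cell_def cell_index_def edge_def dir_def algebra_simps)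
  qed
  have "integral\<^sup>L (lebesgue_on S) (ubar k) = integral {(real l + 1/2) * h..(real l + 3/2) * h} (b k)"
  proof (rule LINT_edge(2)[OF S(2) bB[OF k] b_bnd[OF k], where k = k])
    show "dir k * x \<in> S" if "(real l + 1/2) * h < x" "x < (real l + 3/2) * h" for x
      using that by (simp add: mem)
    show "AE x in lborel. x \<in> S \<longrightarrow> ubar k x = indicator {(real l + 1/2) * h..(real l + 3/2) * h} (dir k * x) * b k (dir k * x)"
    proof (rule AE_mp[OF brep[OF k]], intro AE_I2 impI)
      fix x assume "x \<in> edge k \<longrightarrow> ubar k x = b k (dir k * x)" "x \<in> S"
      then show "ubar k x = indicator {(real l + 1/2) * h..(real l + 3/2) * h} (dir k * x) * b k (dir k * x)"
        using S(1) mem[of "dir k * x"] by auto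
    qed
    show "ubar k \<in> borel_measurable (lebesgue_on S)"
      using ubar_meas[OF k] S(1) by (rule measurable_restrict_mono)
  qed
  moreover have "u h k 0 (Suc l) = 1 / h * integral\<^sup>L (lebesgue_on S) (ubar k)"
    by (simp add: u_def grid_def fv_grid_def fv_init_def S_def)
  ultimately show ?thesis using h by simp
qed

lemma init_range:
  assumes k: "k \<in> E" and h: "h > 0"
  shows "u h k 0 (Suc l) \<in> {c k..d k}"
proof -
  define I where "I = {(real l + 1/2) * h..(real l + 3/2) * h}"
  have len: "(real l + 3/2) * h - (real l + 1/2) * h = h" by (simp add: algebra_simps)
  have le: "(real l + 1/2) * h \<le> (real l + 3/2) * h" using h by simp
  have "integral I (\<lambda>x. c k) \<le> integral I (b k)" "integral I (b k) \<le> integral I (\<lambda>x. d k)"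
    unfolding I_def
    by (intro integral_le b_int[OF k] integrable_const_ivl; use brange[OF k] in auto)+
  then have "h * c k \<le> h * u h k 0 (Suc l)" "h * u h k 0 (Suc l) \<le> h * d k"
    unfolding init_average[OF k h] I_def using le len by simp_all
  then show ?thesis using h by simp
qed

text \<open>With fluxes counted away from the vertex, the balance of a stationary solution reads as
  a vanishing sum. Where information leaves the vertex, the upwind flux uses the vertex value, and
  injectivity of the flux then makes the edge value equal to it.\<close>

lemma stationary_sum:
  assumes "discrete_stationary Nin Nout f F e"
  shows "(\<Sum>k\<in>E. upwind_edge.flux (\<phi> k) (\<sigma> k) (e 0) (e k)) = 0"
    and "k \<in> E \<Longrightarrow> \<sigma> k = 1 \<Longrightarrow> e k = e 0"
proof -
  have o: "upwind_edge.flux (\<phi> k) (\<sigma> k) (e 0) (e k) = f k (e k)" if "k \<in> I_out Nout" for k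
  proof -
    have "k \<in> E" "\<not> k < 0" using that I_out_pos[OF that] by (auto simp: edges_def)
    then show ?thesis using assms that by (simp add: flux_eq discrete_stationary_def)
  qed
  have i: "upwind_edge.flux (\<phi> k) (\<sigma> k) (e 0) (e k) = - f k (e k)" if "k \<in> I_in Nin" for k
  proof -
    have "k \<in> E" "k < 0" using that I_in_neg[OF that] by (auto simp: edges_def)
    then show ?thesis using assms that by (simp add: flux_eq discrete_stationary_def)
  qed
  show "(\<Sum>k\<in>E. upwind_edge.flux (\<phi> k) (\<sigma> k) (e 0) (e k)) = 0"
    unfolding sum_edges using assms by (simp add: o i sum_negf discrete_stationary_def)
  assume k: "k \<in> E" "\<sigma> k = 1"
  have "upwind_edge.flux (\<phi> k) (\<sigma> k) (e 0) (e k) = \<phi> k (e k)"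
    using o[of k] i[of k] k(1) unfolding edges_cases[of k] \<phi>_def dir_def by (auto split: if_splits)
  then have eq: "\<phi> k (e 0) = \<phi> k (e k)"
    unfolding upwind_edge.flux_out[OF edge_locale[OF k(1)] k(2)] .
  then have "ori k * f k (e 0) = ori k * f k (e k)" unfolding sigma_phi[symmetric] by simp
  then show "e k = e 0"
    using ori_strict[OF k(1), of "e k" "e 0"] ori_strict[OF k(1), of "e 0" "e k"] by (cases "e k" "e 0" rule: linorder_cases) auto
qed

text \<open>Among the admissible \<open>a'\<close>, the ends \<open>c k\<close> and
  \<open>d k\<close> give the extreme updates. Against an end, the flux difference times
  \<open>\<mu>\<close> does not exceed the distance of \<open>a\<close> from that end.\<close>

lemma monotone_update:
  assumes k: "k \<in> E" and a: "a \<in> {c k..d k}" "a' \<in> {c k..d k}"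
  shows "a - \<mu> * (\<sigma> k * \<phi> k a - \<sigma> k * \<phi> k a') \<in> {c k..d k}"
proof -
  interpret e: upwind_edge "\<phi> k" "\<sigma> k" "lo k" "hi k" L \<mu> M "P k" by (rule edge_locale[OF k])
  have sub: "{c k..d k} \<subseteq> {lo k..hi k}" using lohi[OF k] by auto
  have lip: "\<mu> * \<bar>\<sigma> k * \<phi> k x - \<sigma> k * \<phi> k y\<bar> \<le> \<bar>x - y\<bar>" if "x \<in> {c k..d k}" "y \<in> {c k..d k}" for x y
  proof -
    have "\<bar>\<sigma> k * \<phi> k x - \<sigma> k * \<phi> k y\<bar> = \<bar>\<phi> k x - \<phi> k y\<bar>" using e.sig by auto
    also have "\<dots> \<le> L * \<bar>x - y\<bar>" using e.lip sub that by blast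
    finally have "\<mu> * \<bar>\<sigma> k * \<phi> k x - \<sigma> k * \<phi> k y\<bar> \<le> \<mu> * (L * \<bar>x - y\<bar>)" using mu0 by simp
    also have "\<dots> = (\<mu> * L) * \<bar>x - y\<bar>" by simp
    also have "\<dots> \<le> 1 * \<bar>x - y\<bar>" using cflL by (intro mult_right_mono) auto
    finally show ?thesis by simp
  qed
  have cd': "c k \<in> {c k..d k}" "d k \<in> {c k..d k}" using a by auto
  have m: "\<sigma> k * \<phi> k (c k) \<le> \<sigma> k * \<phi> k a'" "\<sigma> k * \<phi> k a' \<le> \<sigma> k * \<phi> k (d k)"
    unfolding sigma_phi using ori_mono[OF k] a(2) by auto
  have lc: "\<mu> * (\<sigma> k * \<phi> k a - \<sigma> k * \<phi> k (c k)) \<le> a - c k"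
  proof -
    have "\<mu> * (\<sigma> k * \<phi> k a - \<sigma> k * \<phi> k (c k)) \<le> \<mu> * \<bar>\<sigma> k * \<phi> k a - \<sigma> k * \<phi> k (c k)\<bar>"
      using mu0 by (intro mult_left_mono) auto
    with lip[OF a(1) cd'(1)] a(1) show ?thesis by auto
  qed
  have ld: "\<mu> * (\<sigma> k * \<phi> k (d k) - \<sigma> k * \<phi> k a) \<le> d k - a"
  proof -
    have "\<mu> * (\<sigma> k * \<phi> k (d k) - \<sigma> k * \<phi> k a) \<le> \<mu> * \<bar>\<sigma> k * \<phi> k (d k) - \<sigma> k * \<phi> k a\<bar>"
      using mu0 by (intro mult_left_mono) auto
    with lip[OF cd'(2) a(1)] a(1) show ?thesis by auto
  qed
  have "\<mu> * (\<sigma> k * \<phi> k a - \<sigma> k * \<phi> k a') \<le> \<mu> * (\<sigma> k * \<phi> k a - \<sigma> k * \<phi> k (c k))"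
    "\<mu> * (\<sigma> k * \<phi> k a' - \<sigma> k * \<phi> k a) \<le> \<mu> * (\<sigma> k * \<phi> k (d k) - \<sigma> k * \<phi> k a)"
    using m mu0 by (auto intro!: mult_left_mono)
  with lc ld show ?thesis by (simp add: right_diff_distrib)
qed

text \<open>The stationary solutions \<open>c\<close> and \<open>d\<close> are discrete sub- and supersolutions.\<close>

lemma grid_range:
  assumes h: "h > 0"
  shows "v h n \<in> {c 0..d 0} \<and> (\<forall>k\<in>E. \<forall>l. u h k n (Suc l) \<in> {c k..d k})"
proof (induction n)
  case 0
  have "v h 0 = c 0" by (simp add: v_def grid_def fv_grid_def fv_init_def)
  then show ?case using c0d0 init_range[OF _ h] by auto
next
  case (Suc n)
  then have vr: "v h n \<in> {c 0..d 0}" and ur: "\<And>k l. k \<in> E \<Longrightarrow> u h k n (Suc l) \<in> {c k..d k}" by auto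
  have "u h k (Suc n) (Suc l) \<in> {c k..d k}" if k: "k \<in> E" for k l
  proof (cases "\<sigma> k = 1")
    case True
    note fo = upwind_edge.flux_out[OF edge_locale[OF k] True]
    \<comment> \<open>For \<open>l = 0\<close> this is the vertex value, which lies in
      \<open>[c 0, d 0]\<close>; on such an edge this is the interval
      \<open>[c k, d k]\<close>.\<close>
    have a': "u h k n l \<in> {c k..d k}"
      using ur[OF k] vr stationary_sum(2)[OF stat_c k True] stationary_sum(2)[OF stat_d k True] u_vertex
      by (cases l) auto
    show ?thesis unfolding u_step[OF k h] fo
      using monotone_update[OF k ur[OF k, of l] a'] True by simp
  next
    case False
    note fi = upwind_edge.flux_in[OF edge_locale[OF k] False]
    have "\<sigma> k = -1" using False upwind_edge.sig[OF edge_locale[OF k]] by blast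
    then show ?thesis unfolding u_step[OF k h] fi
      using monotone_update[OF k ur[OF k, of l] ur[OF k, of "Suc l"]] by (simp add: algebra_simps)
  qed
  moreover have "v h (Suc n) \<in> {c 0..d 0}"
  proof -
    define N where "N = real (card E)"
    have N: "N > 0" using Nin by (simp add: N_def edges_card)
    define S where "S = (\<Sum>k\<in>E. upwind_edge.flux (\<phi> k) (\<sigma> k) (u h k n 0) (u h k n (Suc 0)))"
    have L0: "L \<ge> 0" by (rule upwind_edge.L_nonneg[OF edge_locale[OF one_edge]])
    \<comment> \<open>Each flux is compared with the flux of the stationary solutions
      \<open>c\<close> and \<open>d\<close>: by the Lipschitz bound if it depends on the vertex
      value, by monotonicity if it depends on the first cell. The stationary fluxes sum to zero, so
      only the Lipschitz terms survive the summation, and \<open>2 * \<mu> * L \<le> 1\<close> keeps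
      the vertex value between \<open>c 0\<close> and \<open>d 0\<close>.\<close>
    have cmp: "upwind_edge.flux (\<phi> k) (\<sigma> k) (v h n) (u h k n (Suc 0)) \<le> upwind_edge.flux (\<phi> k) (\<sigma> k) (c 0) (c k) + L * (v h n - c 0)
      \<and> upwind_edge.flux (\<phi> k) (\<sigma> k) (d 0) (d k) - L * (d 0 - v h n) \<le> upwind_edge.flux (\<phi> k) (\<sigma> k) (v h n) (u h k n (Suc 0))"
      if k: "k \<in> E" for k
    proof (cases "\<sigma> k = 1")
      case True
      have "v h n \<in> {lo k..hi k}" "c 0 \<in> {lo k..hi k}" "d 0 \<in> {lo k..hi k}" using vr lohi[OF k] c0d0 by auto
      then have "\<bar>\<phi> k (v h n) - \<phi> k (c 0)\<bar> \<le> L * \<bar>v h n - c 0\<bar>" "\<bar>\<phi> k (d 0) - \<phi> k (v h n)\<bar> \<le> L * \<bar>d 0 - v h n\<bar>"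
        using upwind_edge.lip[OF edge_locale[OF k]] by blast+
      then show ?thesis unfolding upwind_edge.flux_out[OF edge_locale[OF k] True] using vr by auto
    next
      case False
      have s: "\<sigma> k = -1" using False upwind_edge.sig[OF edge_locale[OF k]] by blast
      have "\<sigma> k * \<phi> k (c k) \<le> \<sigma> k * \<phi> k (u h k n (Suc 0))" "\<sigma> k * \<phi> k (u h k n (Suc 0)) \<le> \<sigma> k * \<phi> k (d k)"
        unfolding sigma_phi using ori_mono[OF k] ur[OF k, of 0] by auto
      moreover have "0 \<le> L * (v h n - c 0)" "0 \<le> L * (d 0 - v h n)" using L0 vr by auto
      ultimately show ?thesis unfolding upwind_edge.flux_in[OF edge_locale[OF k] False] using s by simp
    qed
    have "S \<le> (\<Sum>k\<in>E. upwind_edge.flux (\<phi> k) (\<sigma> k) (c 0) (c k) + L * (v h n - c 0))"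
      unfolding S_def u_vertex using cmp by (intro sum_mono) auto
    then have Su: "S \<le> N * (L * (v h n - c 0))"
      by (simp add: sum.distrib stationary_sum(1)[OF stat_c] N_def)
    have "(\<Sum>k\<in>E. upwind_edge.flux (\<phi> k) (\<sigma> k) (d 0) (d k) - L * (d 0 - v h n)) \<le> S"
      unfolding S_def u_vertex using cmp by (intro sum_mono) auto
    then have Sl: "- (N * (L * (d 0 - v h n))) \<le> S"
      by (simp add: sum_subtractf stationary_sum(1)[OF stat_d] N_def)
    have r: "2 * \<mu> / N > 0" using mu0 N by simp
    have contr: "2 * \<mu> / N * (N * (L * z)) \<le> z" if "z \<ge> 0" for z
    proof -
      have "2 * \<mu> / N * (N * (L * z)) = 2 * (\<mu> * L) * z" using N by simp
      also have "\<dots> \<le> 1 * z" using cflL that by (intro mult_right_mono) auto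
      finally show ?thesis by simp
    qed
    have "2 * \<mu> / N * S \<le> 2 * \<mu> / N * (N * (L * (v h n - c 0)))" using Su r by (intro mult_left_mono) auto
    also have "\<dots> \<le> v h n - c 0" using vr by (intro contr) auto
    finally have 1: "2 * \<mu> / N * S \<le> v h n - c 0" .
    have "2 * \<mu> / N * (- (N * (L * (d 0 - v h n)))) \<le> 2 * \<mu> / N * S" using Sl r by (intro mult_left_mono) auto
    moreover have "2 * \<mu> / N * (N * (L * (d 0 - v h n))) \<le> d 0 - v h n" using vr by (intro contr) auto
    ultimately have 2: "- (d 0 - v h n) \<le> 2 * \<mu> / N * S" by linarith
    show ?thesis using 1 2 v_step[OF h, of n] unfolding S_def N_def by auto
  qed
  ultimately show ?case by blast
qed

lemma u_range:
  assumes k: "k \<in> E" and h: "h > 0"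
  shows "u h k n l \<in> {lo k..hi k}"
proof (cases l)
  case 0
  then show ?thesis using grid_range[OF h, of n] lohi[OF k] u_vertex[of h k n] by auto
next
  case (Suc l')
  then have "u h k n l \<in> {c k..d k}" using grid_range[OF h, of n] k by blast
  then show ?thesis using lohi[OF k] by auto
qed

lemma scheme:
  assumes k: "k \<in> E" and h: "h > 0"
  shows "upwind_edge.scheme (\<phi> k) (\<sigma> k) (lo k) (hi k) \<mu> (P k) h (u h k)"
  unfolding upwind_edge.scheme_def[OF edge_locale[OF k]]
proof (intro conjI allI)
  show "h * u h k 0 (Suc l) = P k ((real l + 3/2) * h) - P k ((real l + 1/2) * h)" for l
    unfolding init_average[OF k h] using h by (intro P_diff[OF k, symmetric]) auto
qed (use h u_range[OF k h] u_step[OF k h] in auto)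

lemma init_variation:
  assumes k: "k \<in> E" and h: "h > 0"
  shows "(\<Sum>l<J. \<bar>u h k 0 (Suc (Suc l)) - u h k 0 (Suc l)\<bar>) \<le> V"
proof -
  have "h * \<bar>u h k 0 (Suc (Suc l)) - u h k 0 (Suc l)\<bar>
      = \<bar>integral {(real l + 3/2) * h..(real l + 5/2) * h} (b k) - integral {(real l + 1/2) * h..(real l + 3/2) * h} (b k)\<bar>" for l
  proof -
    have "real (Suc l) + 1/2 = real l + 3/2" "real (Suc l) + 3/2 = real l + 5/2" by simp_all
    then have "h * u h k 0 (Suc (Suc l)) = integral {(real l + 3/2) * h..(real l + 5/2) * h} (b k)"
      using init_average[OF k h, of "Suc l"] by (simp only:)
    moreover have "h * \<bar>u h k 0 (Suc (Suc l)) - u h k 0 (Suc l)\<bar> = \<bar>h * u h k 0 (Suc (Suc l)) - h * u h k 0 (Suc l)\<bar>"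
      using h by (simp add: abs_mult right_diff_distrib[symmetric])
    ultimately show ?thesis unfolding init_average[OF k h, of l] by simp
  qed
  then have "h * (\<Sum>l<J. \<bar>u h k 0 (Suc (Suc l)) - u h k 0 (Suc l)\<bar>) \<le> h * V"
    unfolding sum_distrib_left using bV[OF k h, of J] by simp
  then show ?thesis using h by simp
qed

sublocale star: upwind_star_data E \<phi> \<sigma> lo hi L \<mu> M V T P u v b
proof (intro upwind_star_data.intro upwind_star.intro upwind_star_data_axioms.intro)
  show "finite E" "E \<noteq> {}" using edges_card one_edge by auto
  show "P k x = integral {0..x} (b k)" for k x by (rule P_def)
qed (rule edge_locale scheme u_vertex v_step init_variation bB b_bnd cflL T0; assumption?)+

text \<open>\<open>round\<close> sends half-integers upwards, and reflection does not respect this.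
  The two functions may thus differ at cell interfaces, which form a countable set that is
  independent of \<open>t\<close>.\<close>

lemma fv_solution_star:
  assumes k: "k \<in> E" and h: "h > 0"
  shows "AE x in lborel. x \<in> edge k \<longrightarrow>
    (\<forall>t. fv_solution Nin Nout F ubar (c 0) (\<mu> * h) h k (x, t) = star.sol h k (dir k * x, t))"
proof -
  have "AE x in lborel. \<forall>i::int. x \<noteq> (of_int i + 1/2) * h"
    unfolding AE_all_countable by (intro allI AE_lborel_singleton)
  then show ?thesis
  proof (rule AE_mp, intro AE_I2 impI allI)
    fix x t assume ne: "\<forall>i::int. x \<noteq> (of_int i + 1/2) * h" and x: "x \<in> edge k"
    have "cell_index k (nat (round (dir k * x / h))) = round (x / h)"
    proof (cases "k < 0")
      case False
      then have "0 \<le> round (x / h)" using x h by (simp add: edge_def round_def)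
      then show ?thesis using False by (simp add: cell_index_def dir_def)
    next
      case True
      define r where "r = round (x / h)"
      have r: "x / h - 1/2 < of_int r" "of_int r \<le> x / h + 1/2" unfolding r_def round_def by linarith+
      have "of_int r \<noteq> x / h + 1/2"
      proof
        assume "of_int r = x / h + 1/2"
        then have "x / h = of_int (r - 1) + 1/2" by simp
        then have "x = (of_int (r - 1) + 1/2) * h" using h by (simp add: field_simps)
        with ne show False by blast
      qed
      then have "round (- (x / h)) = - r"
        using r by (intro round_unique) auto
      moreover have "0 \<le> round (- (x / h))"
        using x h True by (simp add: edge_def round_def divide_neg_pos less_imp_le)
      ultimately show ?thesis using True by (simp add: cell_index_def dir_def r_def)
    qed
    then show "fv_solution Nin Nout F ubar (c 0) (\<mu> * h) h k (x, t) = star.sol h k (dir k * x, t)"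
      by (simp add: fv_solution_def star.sol_def u_def grid_def)
  qed
qed

lemma fv_slice_borel: "(\<lambda>x. fv_solution Nin Nout F ubar (c 0) (\<mu> * h) h k (x, t)) \<in> borel_measurable borel"
  unfolding fv_solution_def split_conv round_def by measurable

lemma convergence:
  assumes w: "\<And>k. k \<in> E \<Longrightarrow> star.lim_of k (w k)"
  defines "uu \<equiv> \<lambda>k p. w k (dir k * fst p, snd p)"
  shows "converges_C_L1loc Nin Nout T (\<lambda>dt. fv_solution Nin Nout F ubar (c 0) dt (dt / \<mu>)) uu"
proof -
  have wm: "w k \<in> borel_measurable borel" "w k p \<in> {lo k..hi k}" if "k \<in> E" for k p
    by (rule star.lim_ofD[OF w[OF that]])+
  have wb: "\<bar>w k p\<bar> \<le> M" if "k \<in> E" for k p by (rule bnd(1)[OF that wm(2)[OF that]])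
  have um: "(\<lambda>x. uu k (x, t)) \<in> borel_measurable borel" if "k \<in> E" for k t
    unfolding uu_def using dir_slice_borel(1)[OF wm(1)[OF that]] by simp
  have int: "integrable (lebesgue_on (edge k \<inter> {-R..R})) (\<lambda>x. uu k (x, t))" if "k \<in> E" "R > 0" for k R t
    by (rule edge_interval_integral(1)[OF _ borel_slice(1)[OF wm(1)[OF that(1)]] wb[OF that(1)] um[OF that(1)]])
      (use that in \<open>auto simp: uu_def\<close>)
  have udiff: "integral\<^sup>L (lebesgue_on (edge k \<inter> {-R..R})) (\<lambda>x. \<bar>uu k (x, t) - uu k (x, s)\<bar>)
      = integral {0..R} (\<lambda>x. \<bar>w k (x, t) - w k (x, s)\<bar>)" if k: "k \<in> E" and R: "R > 0" for k R s t
  proof (rule edge_interval_integral(2))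
    show "(\<lambda>x. \<bar>w k (x, t) - w k (x, s)\<bar>) \<in> borel_measurable borel"
      using borel_slice(1)[OF wm(1)[OF k], of t] borel_slice(1)[OF wm(1)[OF k], of s] by measurable
    show "\<bar>\<bar>w k (x, t) - w k (x, s)\<bar>\<bar> \<le> 2 * M" for x
      using wb[OF k, of "(x, t)"] wb[OF k, of "(x, s)"] by linarith
    show "(\<lambda>x. \<bar>uu k (x, t) - uu k (x, s)\<bar>) \<in> borel_measurable borel"
      using um[OF k, of t] um[OF k, of s] by measurable
  qed (use R in \<open>auto simp: uu_def\<close>)
  have C: "C_L1loc Nin Nout T uu"
    unfolding C_L1loc_def
  proof (intro ballI allI impI conjI)
    fix k R assume k: "k \<in> E" and R: "(0::real) < R"
    show "integrable (lebesgue_on (edge k \<inter> {-R..R})) (\<lambda>x. uu k (x, t))" for t by (rule int[OF k R])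
    fix s assume s: "s \<in> {0..T}"
    show "((\<lambda>t. LINT x|lebesgue_on (edge k \<inter> {-R..R}). \<bar>uu k (x, t) - uu k (x, s)\<bar>) \<longlongrightarrow> 0) (at s within {0..T})"
      unfolding udiff[OF k R] Lim_within
    proof (intro allI impI)
      fix \<epsilon> :: real assume \<epsilon>: "\<epsilon> > 0"
      obtain \<delta> where \<delta>: "\<delta> > 0" "\<forall>s\<in>{0..T}. \<forall>t\<in>{0..T}. \<bar>t - s\<bar> \<le> \<delta> \<longrightarrow>
          integral {0..R} (\<lambda>x. \<bar>w k (x, t) - w k (x, s)\<bar>) \<le> \<epsilon> / 2"
        using star.lim_time_continuity[OF k w[OF k], of R "\<epsilon> / 2"] R \<epsilon> by auto
      have nn: "0 \<le> integral {0..R} (\<lambda>x. \<bar>w k (x, t) - w k (x, s)\<bar>)" for t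
        unfolding udiff[OF k R, symmetric] by simp
      show "\<exists>d>0. \<forall>t\<in>{0..T}. 0 < dist t s \<and> dist t s < d \<longrightarrow> dist (integral {0..R} (\<lambda>x. \<bar>w k (x, t) - w k (x, s)\<bar>)) 0 < \<epsilon>"
      proof (intro exI[of _ \<delta>] conjI ballI impI)
        fix t assume "t \<in> {0..T}" "0 < dist t s \<and> dist t s < \<delta>"
        then have "integral {0..R} (\<lambda>x. \<bar>w k (x, t) - w k (x, s)\<bar>) \<le> \<epsilon> / 2"
          using \<delta>(2) s by (auto simp: dist_real_def)
        then show "dist (integral {0..R} (\<lambda>x. \<bar>w k (x, t) - w k (x, s)\<bar>)) 0 < \<epsilon>"
          using nn[of t] \<epsilon> by (simp add: dist_real_def)
      qed (rule \<delta>(1))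
    qed
  qed
  have fdiff: "integral\<^sup>L (lebesgue_on (edge k \<inter> {-R..R})) (\<lambda>x. \<bar>fv_solution Nin Nout F ubar (c 0) (\<mu> * h) h k (x, t) - uu k (x, t)\<bar>)
      = integral {0..R} (\<lambda>x. \<bar>star.sol h k (x, t) - w k (x, t)\<bar>)" if k: "k \<in> E" and R: "R > 0" and h: "h > 0" for k R h t
  proof (rule edge_interval_integral(2))
    show "(\<lambda>x. \<bar>star.sol h k (x, t) - w k (x, t)\<bar>) \<in> borel_measurable borel"
      using borel_slice(1)[OF star.sol_borel, of h k t] borel_slice(1)[OF wm(1)[OF k], of t] by measurable
    show "\<bar>\<bar>star.sol h k (x, t) - w k (x, t)\<bar>\<bar> \<le> 2 * M" for x
      using wb[OF k, of "(x, t)"] bnd(1)[OF k star.sol_range[OF k h], of "(x, t)"] by linarith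
    show "(\<lambda>x. \<bar>fv_solution Nin Nout F ubar (c 0) (\<mu> * h) h k (x, t) - uu k (x, t)\<bar>) \<in> borel_measurable borel"
      using fv_slice_borel[of h k t] um[OF k, of t] by measurable
    show "AE x in lborel. x \<in> edge k \<longrightarrow> \<bar>fv_solution Nin Nout F ubar (c 0) (\<mu> * h) h k (x, t) - uu k (x, t)\<bar>
        = \<bar>star.sol h k (dir k * x, t) - w k (dir k * x, t)\<bar>"
      using fv_solution_star[OF k h] by eventually_elim (auto simp: uu_def)
  qed (use R in auto)
  have "uniform_limit {0..T} (\<lambda>dt t. \<Sum>k\<in>E. LINT x|lebesgue_on (edge k \<inter> {-R..R}).
      \<bar>fv_solution Nin Nout F ubar (c 0) dt (dt / \<mu>) k (x, t) - uu k (x, t)\<bar>) (\<lambda>t. 0) (at_right 0)" if R: "R > 0" for R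
  proof (rule uniform_limitI)
    fix \<epsilon> :: real assume \<epsilon>: "\<epsilon> > 0"
    define \<epsilon>' where "\<epsilon>' = \<epsilon> / (2 * real (card E))"
    have cE: "real (card E) > 0" using Nin by (simp add: edges_card)
    have \<epsilon>': "\<epsilon>' > 0" "real (card E) * \<epsilon>' < \<epsilon>" using \<epsilon> cE by (auto simp: \<epsilon>'_def)
    have "\<forall>\<^sub>F h in at_right 0. \<forall>k\<in>E. \<forall>t\<in>{0..T}. integral {0..R} (\<lambda>x. \<bar>star.sol h k (x, t) - w k (x, t)\<bar>) \<le> \<epsilon>'"
      by (intro eventually_ball_finite ballI star.lim_ofD(3)[OF w]) (use R \<epsilon>' edges_card in auto)
    then obtain h0 where h0: "h0 > 0" "\<And>h k t. 0 < h \<Longrightarrow> h < h0 \<Longrightarrow> k \<in> E \<Longrightarrow> t \<in> {0..T} \<Longrightarrow>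
        integral {0..R} (\<lambda>x. \<bar>star.sol h k (x, t) - w k (x, t)\<bar>) \<le> \<epsilon>'"
      unfolding eventually_at_right_field by auto
    show "\<forall>\<^sub>F dt in at_right 0. \<forall>t\<in>{0..T}. dist (\<Sum>k\<in>E. LINT x|lebesgue_on (edge k \<inter> {-R..R}).
      \<bar>fv_solution Nin Nout F ubar (c 0) dt (dt / \<mu>) k (x, t) - uu k (x, t)\<bar>) 0 < \<epsilon>"
      unfolding eventually_at_right_field
    proof (intro exI[of _ "h0 * \<mu>"] conjI allI impI ballI)
      show "0 < h0 * \<mu>" using h0 mu0 by simp
      fix dt t assume dt: "0 < dt" "dt < h0 * \<mu>" and t: "t \<in> {0..T}"
      define h where "h = dt / \<mu>"
      have h: "0 < h" "h < h0" "dt = \<mu> * h" "dt / \<mu> = h" using dt mu0 by (auto simp: h_def pos_divide_less_eq)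
      have "(\<Sum>k\<in>E. LINT x|lebesgue_on (edge k \<inter> {-R..R}).
          \<bar>fv_solution Nin Nout F ubar (c 0) dt (dt / \<mu>) k (x, t) - uu k (x, t)\<bar>)
          = (\<Sum>k\<in>E. integral {0..R} (\<lambda>x. \<bar>star.sol h k (x, t) - w k (x, t)\<bar>))"
        unfolding h(4) unfolding h(3) by (intro sum.cong fdiff R h) auto
      also have "\<dots> \<le> (\<Sum>k\<in>E. \<epsilon>')" by (intro sum_mono h0 h t)
      also have "\<dots> < \<epsilon>" using \<epsilon>' by simp
      finally have "(\<Sum>k\<in>E. LINT x|lebesgue_on (edge k \<inter> {-R..R}).
          \<bar>fv_solution Nin Nout F ubar (c 0) dt (dt / \<mu>) k (x, t) - uu k (x, t)\<bar>) < \<epsilon>" .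
      moreover have "0 \<le> (\<Sum>k\<in>E. LINT x|lebesgue_on (edge k \<inter> {-R..R}).
          \<bar>fv_solution Nin Nout F ubar (c 0) dt (dt / \<mu>) k (x, t) - uu k (x, t)\<bar>)"
        by (intro sum_nonneg) simp
      ultimately show "dist (\<Sum>k\<in>E. LINT x|lebesgue_on (edge k \<inter> {-R..R}).
          \<bar>fv_solution Nin Nout F ubar (c 0) dt (dt / \<mu>) k (x, t) - uu k (x, t)\<bar>) 0 < \<epsilon>"
        by (simp add: dist_real_def)
    qed
  qed
  with C show ?thesis unfolding converges_C_L1loc_def by blast
qed

end

section \<open>The limit satisfies the weak formulation on the network\<close>

context upwind_network
begin

text \<open>The factor \<open>dir k\<close> that the space derivative of the test function picks up
  under reflection is the one that turns \<open>f k\<close> into \<open>\<phi> k\<close>, so the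
  integrand on the edge is the reflected integrand. Everything outside the rectangle
  vanishes.\<close>

lemma edge_weak_terms:
  assumes k: "k \<in> E" and w: "w \<in> borel_measurable borel" "\<And>p. w p \<in> {lo k..hi k}"
    and RT: "R > 0" "0 \<le> T1" "T1 < T"
    and van: "\<And>x. x \<in> edge k \<Longrightarrow> R \<le> \<bar>x\<bar> \<Longrightarrow> \<psi> (x, 0) = 0"
    and td: "test_data R T1 D (\<lambda>p. \<psi> (dir k * fst p, snd p)) \<psi>x \<psi>t \<psi>xt"
    and dt: "\<And>x t. x \<in> edge k \<Longrightarrow> t \<in> {0<..<T} \<Longrightarrow> deriv (\<lambda>s. \<psi> (x, s)) t = \<psi>t (dir k * x, t)"
    and dx: "\<And>x t. x \<in> edge k \<Longrightarrow> t \<in> {0<..<T} \<Longrightarrow> deriv (\<lambda>y. \<psi> (y, t)) x = dir k * \<psi>x (dir k * x, t)"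
    and off: "\<And>p. p \<notin> {0..R} \<times> {0..T1} \<Longrightarrow> \<psi>t p = 0 \<and> \<psi>x p = 0"
  shows "(LINT t|lebesgue_on {0<..<T}. LINT x|lebesgue_on (edge k).
      w (dir k * x, t) * deriv (\<lambda>s. \<psi> (x, s)) t + f k (w (dir k * x, t)) * deriv (\<lambda>y. \<psi> (y, t)) x)
    = integral {0..T1} (\<lambda>t. integral {0..R} (\<lambda>x. w (x, t) * \<psi>t (x, t) + \<phi> k (w (x, t)) * \<psi>x (x, t)))" (is ?first)
    and "(LINT x|lebesgue_on (edge k). ubar k x * \<psi> (x, 0)) = integral {0..R} (\<lambda>x. b k x * \<psi> (dir k * x, 0))" (is ?second)
proof -
  define Q where "Q = (\<lambda>p. w p * \<psi>t p + \<phi> k (w p) * \<psi>x p)"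
  have pm: "(\<lambda>p. \<phi> k (w p)) \<in> borel_measurable borel" by (rule star.flux_borel[OF k w])
  note tD = test_dataD[OF td]
  have D0: "D \<ge> 0" using tD(4)[of "(0,0)"] by linarith
  have Qm: "Q \<in> borel_measurable borel"
    unfolding Q_def by (intro borel_measurable_add borel_measurable_times w pm tD)
  have Qb: "\<bar>Q p\<bar> \<le> M * D + M * D" for p
  proof -
    have "\<bar>w p\<bar> \<le> M" "\<bar>\<phi> k (w p)\<bar> \<le> M" using star.range_bounds[OF k w(2)] by auto
    then have "\<bar>w p * \<psi>t p\<bar> \<le> M * D" "\<bar>\<phi> k (w p) * \<psi>x p\<bar> \<le> M * D"
      unfolding abs_mult using tD(4,5)[of p] star.params by (auto intro!: mult_mono)
    then show ?thesis unfolding Q_def by linarith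
  qed
  have Qoff: "Q p = 0" if "p \<notin> {0..R} \<times> {0..T1}" for p using off[OF that] by (simp add: Q_def)
  define I where "I = (\<lambda>t. integral {0..R} (\<lambda>x. Q (x, t)))"
  have inner: "(LINT x|lebesgue_on (edge k).
      w (dir k * x, t) * deriv (\<lambda>s. \<psi> (x, s)) t + f k (w (dir k * x, t)) * deriv (\<lambda>y. \<psi> (y, t)) x) = I t"
    if t: "t \<in> {0<..<T}" for t
  proof -
    define q where "q = (\<lambda>x. w (dir k * x, t) * deriv (\<lambda>s. \<psi> (x, s)) t + f k (w (dir k * x, t)) * deriv (\<lambda>y. \<psi> (y, t)) x)"
    have qe: "q x = Q (dir k * x, t)" if "x \<in> edge k" for x
      using dt[OF that t] dx[OF that t] by (simp add: q_def Q_def \<phi>_def)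
    have "integral\<^sup>L (lebesgue_on (edge k)) q = I t"
      unfolding I_def
    proof (rule LINT_edge(2)[OF edge_lebesgue(1) borel_slice(1)[OF Qm] Qb])
      show "dir k * x \<in> edge k" if "0 < x" "x < R" for x using that by (simp add: edge_iff_dir)
      show "AE x in lborel. x \<in> edge k \<longrightarrow> q x = indicator {0..R} (dir k * x) * Q (dir k * x, t)"
      proof (intro AE_I2 impI)
        fix x assume "x \<in> edge k"
        then show "q x = indicator {0..R} (dir k * x) * Q (dir k * x, t)"
          using qe[of x] Qoff[of "(dir k * x, t)"] by (cases "dir k * x \<in> {0..R}") auto
      qed
      have "(\<lambda>x. Q (dir k * x, t)) \<in> borel_measurable (lebesgue_on (edge k))"
        by (rule borel_lebesgue_on[OF dir_slice_borel(1)[OF Qm]])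
      then show "q \<in> borel_measurable (lebesgue_on (edge k))"
        by (rule measurable_cong[THEN iffD1, rotated]) (simp add: qe)
    qed
    then show ?thesis by (simp add: q_def)
  qed
  have rb: "rect_bounded R T1 Q" using Qb by (intro rect_boundedI[OF Qm])
  obtain C where C: "\<And>t. \<bar>indicator {0..T1} t * I t\<bar> \<le> C"
    using rect_fubini(5)[OF rb] unfolding I_def by blast
  \<comment> \<open>\<open>I\<close> vanishes for \<open>t > T1\<close>, so cutting it off changes
    nothing for positive times; the cut-off version is bounded and Borel on the whole line, as
    \<open>LINT_edge\<close> needs.\<close>
  define J where "J = (\<lambda>t. indicator {0..T1} t * I t)"
  have Jm: "J \<in> borel_measurable borel" unfolding J_def I_def by (rule rect_fubini(4)[OF rb])
  have IJ: "I t = J t" if "t > 0" for t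
  proof (cases "t \<le> T1")
    case False
    then have "I t = integral {0..R} (\<lambda>x. 0)" unfolding I_def by (intro integral_cong Qoff) auto
    then show ?thesis using False by (simp add: J_def)
  qed (use that in \<open>simp add: J_def\<close>)
  have "(LINT t|lebesgue_on {0<..<T}. LINT x|lebesgue_on (edge k).
      w (dir k * x, t) * deriv (\<lambda>s. \<psi> (x, s)) t + f k (w (dir k * x, t)) * deriv (\<lambda>y. \<psi> (y, t)) x)
      = (LINT t|lebesgue_on {0<..<T}. J t)"
    by (rule Bochner_Integration.integral_cong) (use inner IJ in auto)
  also have "\<dots> = integral {0..T1} J"
  proof (rule LINT_edge(2)[where k = 1])
    show "J \<in> borel_measurable borel" by (rule Jm)
    show "\<bar>J x\<bar> \<le> C" for x unfolding J_def by (rule C)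
    show "dir 1 * x \<in> {0<..<T}" if "0 < x" "x < T1" for x using that RT by (simp add: dir_def)
    show "AE x in lborel. x \<in> {0<..<T} \<longrightarrow> J x = indicator {0..T1} (dir 1 * x) * J (dir 1 * x)"
      by (intro AE_I2) (simp add: J_def dir_def indicator_def)
    show "J \<in> borel_measurable (lebesgue_on {0<..<T})" by (rule borel_lebesgue_on[OF Jm])
  qed simp
  also have "\<dots> = integral {0..T1} I" by (rule integral_cong) (simp add: J_def)
  finally show ?first by (simp add: I_def Q_def)
  define Z where "Z = (\<lambda>x. indicator {0..R} x * \<psi> (dir k * x, 0))"
  have contZ: "continuous_on {0..R} (\<lambda>x. \<psi> (dir k * x, 0))"
  proof (rule DERIV_continuous_on)
    show "((\<lambda>x. \<psi> (dir k * x, 0)) has_real_derivative \<psi>x (x, 0)) (at x within {0..R})" if "x \<in> {0..R}" for x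
      using td that unfolding test_data_def by simp
  qed
  have Zm: "Z \<in> borel_measurable borel"
    using borel_measurable_continuous_on_indicator[OF _ contZ] by (simp add: Z_def)
  obtain B where B: "\<And>x. x \<in> {0..R} \<Longrightarrow> \<bar>\<psi> (dir k * x, 0)\<bar> \<le> B"
    using compact_imp_bounded[OF compact_continuous_image[OF contZ compact_Icc]] by (fastforce simp: bounded_iff)
  have "(LINT x|lebesgue_on (edge k). ubar k x * \<psi> (x, 0)) = integral {0..R} (\<lambda>x. b k x * Z x)"
  proof (rule LINT_edge(2)[OF edge_lebesgue(1)])
    show bz: "(\<lambda>x. b k x * Z x) \<in> borel_measurable borel" by (intro borel_measurable_times bB[OF k] Zm)
    show "\<bar>b k x * Z x\<bar> \<le> M * B" if "x \<in> {0..R}" for x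
      using that B[OF that] b_bnd[OF k, of x] star.params unfolding abs_mult by (intro mult_mono) (auto simp: Z_def)
    show "dir k * x \<in> edge k" if "0 < x" "x < R" for x using that by (simp add: edge_iff_dir)
    have "AE x in lborel. x \<in> edge k \<longrightarrow> ubar k x * \<psi> (x, 0) = b k (dir k * x) * Z (dir k * x)"
    proof (rule AE_mp[OF brep[OF k]], intro AE_I2 impI)
      fix x assume x: "x \<in> edge k \<longrightarrow> ubar k x = b k (dir k * x)" "x \<in> edge k"
      then have "0 < dir k * x" "dir k * x = \<bar>x\<bar>" "dir k * \<bar>x\<bar> = x"
        by (auto simp: edge_iff_dir dir_def split: if_splits)
      then have "\<psi> (x, 0) = Z (dir k * x)"
        using van[OF x(2)] by (auto simp: Z_def indicator_def)
      then show "ubar k x * \<psi> (x, 0) = b k (dir k * x) * Z (dir k * x)" using x by simp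
    qed
    then show ae: "AE x in lborel. x \<in> edge k \<longrightarrow> ubar k x * \<psi> (x, 0) = indicator {0..R} (dir k * x) * (b k (dir k * x) * Z (dir k * x))"
      by eventually_elim (auto simp: Z_def indicator_def)
    show "(\<lambda>x. ubar k x * \<psi> (x, 0)) \<in> borel_measurable (lebesgue_on (edge k))"
    proof (rule borel_measurable_times[OF ubar_meas[OF k]])
      have "(\<lambda>x. Z (0 + dir k * x)) \<in> borel_measurable borel" using Zm by measurable
      then have "(\<lambda>x. Z (0 + dir k * x)) \<in> borel_measurable (lebesgue_on (edge k))" by (rule borel_lebesgue_on)
      then show "(\<lambda>x. \<psi> (x, 0)) \<in> borel_measurable (lebesgue_on (edge k))"
      proof (rule measurable_cong[THEN iffD1, rotated])
        fix x assume "x \<in> space (lebesgue_on (edge k))"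
        then have x: "x \<in> edge k" by simp
        then have "0 < dir k * x" "dir k * x = \<bar>x\<bar>" "dir k * \<bar>x\<bar> = x"
          by (auto simp: edge_iff_dir dir_def split: if_splits)
        then show "Z (0 + dir k * x) = \<psi> (x, 0)" using van[OF x] by (auto simp: Z_def indicator_def)
      qed
    qed
  qed
  also have "\<dots> = integral {0..R} (\<lambda>x. b k x * \<psi> (dir k * x, 0))" by (rule integral_cong) (simp add: Z_def)
  finally show ?second .
qed

lemma limit_is_weak_solution:
  assumes w: "\<And>k. k \<in> E \<Longrightarrow> star.lim_of k (w k)"
  shows "weak_solution Nin Nout f T ubar (\<lambda>k p. w k (dir k * fst p, snd p))"
  unfolding weak_solution_def
proof (intro conjI allI impI)
  have wm: "w k \<in> borel_measurable borel" "w k p \<in> {lo k..hi k}" if "k \<in> E" for k p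
    by (rule star.lim_ofD[OF w[OF that]])+
  show "Linf_spacetime Nin Nout T (\<lambda>k p. w k (dir k * fst p, snd p))"
    unfolding Linf_spacetime_def
  proof (intro ballI conjI)
    fix k assume k: "k \<in> E"
    show "(\<lambda>p. w k (dir k * fst p, snd p)) \<in> borel_measurable (lebesgue_on (edge k \<times> {0<..<T}))"
      by (rule borel_lebesgue_on[OF dir_slice_borel(2)[OF wm(1)[OF k]]])
    show "\<exists>B. AE p in lebesgue_on (edge k \<times> {0<..<T}). \<bar>w k (dir k * fst p, snd p)\<bar> \<le> B"
      using bnd(1)[OF k wm(2)[OF k]] by (intro exI[of _ M] AE_I2) auto
  qed
  fix \<psi> assume tf: "test_family Nin Nout T \<psi>"
  have tfk: "test_function_on (closure (edge k) \<times> {0..<T}) (\<psi> k)" if "k \<in> E" for k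
    using tf that by (simp add: test_family_def)
  have "\<exists>R0 T0. 0 < R0 \<and> 0 \<le> T0 \<and> T0 < T \<and> (\<forall>x\<in>closure (edge k). \<forall>t\<in>{0..<T}. R0 \<le> \<bar>x\<bar> \<or> T0 \<le> t \<longrightarrow> \<psi> k (x, t) = 0)"
    if k: "k \<in> E" for k
    by (rule test_function_support[OF tfk[OF k] T0]) blast
  then obtain R0 T0 where RT0: "\<And>k. k \<in> E \<Longrightarrow> 0 < R0 k \<and> 0 \<le> T0 k \<and> T0 k < T \<and>
      (\<forall>x\<in>closure (edge k). \<forall>t\<in>{0..<T}. R0 k \<le> \<bar>x\<bar> \<or> T0 k \<le> t \<longrightarrow> \<psi> k (x, t) = 0)"
    by metis
  \<comment> \<open>One rectangle must serve all edges, so the largest supports are taken;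
    \<open>T1\<close> stays below \<open>T\<close> because there are finitely many edges.\<close>
  define R where "R = Max (R0 ` E)"
  define T1 where "T1 = Max (T0 ` E)"
  have ne: "finite E" "E \<noteq> {}" using edges_card one_edge by auto
  have ge: "R0 k \<le> R" "T0 k \<le> T1" if "k \<in> E" for k
    using that ne by (auto simp: R_def T1_def)
  have R: "R > 0" using ge(1)[OF one_edge] RT0[OF one_edge] by linarith
  have T1: "0 \<le> T1" using ge(2)[OF one_edge] RT0[OF one_edge] by linarith
  have T1T: "T1 < T" unfolding T1_def using ne RT0 by (subst Max_less_iff) auto
  have van: "\<psi> k (x, t) = 0" if "k \<in> E" "x \<in> closure (edge k)" "t \<in> {0..<T}" "R \<le> \<bar>x\<bar> \<or> T1 \<le> t" for k x t
  proof -
    have "R0 k \<le> \<bar>x\<bar> \<or> T0 k \<le> t" using ge[OF that(1)] that(4) by linarith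
    then show ?thesis using RT0[OF that(1)] that(2,3) by blast
  qed
  define good where "good = (\<lambda>k D \<psi>x \<psi>t \<psi>xt. test_data R T1 D (\<lambda>p. \<psi> k (dir k * fst p, snd p)) \<psi>x \<psi>t \<psi>xt \<and>
    (\<forall>x\<in>edge k. \<forall>t\<in>{0<..<T}. deriv (\<lambda>s. \<psi> k (x, s)) t = \<psi>t (dir k * x, t)) \<and>
    (\<forall>x\<in>edge k. \<forall>t\<in>{0<..<T}. deriv (\<lambda>y. \<psi> k (y, t)) x = dir k * \<psi>x (dir k * x, t)) \<and>
    (\<forall>p. p \<notin> {0..R} \<times> {0..T1} \<longrightarrow> \<psi>t p = 0 \<and> \<psi>x p = 0) \<and>
    (\<forall>t\<in>{0..T1}. ((\<lambda>s. \<psi> k (0, s)) has_real_derivative \<psi>t (0, t)) (at t within {0..<T})))"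
  have "\<exists>D \<psi>x \<psi>t \<psi>xt. good k D \<psi>x \<psi>t \<psi>xt" if k: "k \<in> E" for k
    unfolding good_def by (rule test_function_data[OF tfk[OF k] R T1 T1T van[OF k]]) blast+
  then obtain D \<psi>x \<psi>t \<psi>xt where good: "\<And>k. k \<in> E \<Longrightarrow> good k (D k) (\<psi>x k) (\<psi>t k) (\<psi>xt k)"
    by metis
  define DD where "DD = Max (D ` E)"
  have DD: "D k \<le> DD" if "k \<in> E" for k using that ne by (auto simp: DD_def)
  have td: "test_data R T1 DD (\<lambda>p. \<psi> k (dir k * fst p, snd p)) (\<psi>x k) (\<psi>t k) (\<psi>xt k)" if k: "k \<in> E" for k
    using good[OF k] DD[OF k] unfolding good_def by (blast intro: test_data_mono)
  \<comment> \<open>The test functions agree at the vertex for all times in \<open>[0, T)\<close>,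
    hence so do their time derivatives there; at \<open>t = 0\<close> this is uniqueness of the
    one-sided derivative.\<close>
  have coupling: "\<psi>t k (0, t) = \<psi>t 1 (0, t)" if k: "k \<in> E" and t: "t \<in> {0..T1}" for k t
  proof -
    have t': "t \<in> {0..<T}" using t T1T by auto
    have d1: "((\<lambda>s. \<psi> 1 (0, s)) has_real_derivative \<psi>t 1 (0, t)) (at t within {0..<T})"
      using good[OF one_edge] t unfolding good_def by blast
    have dk: "((\<lambda>s. \<psi> k (0, s)) has_real_derivative \<psi>t k (0, t)) (at t within {0..<T})"
      using good[OF k] t unfolding good_def by blast
    then have dk: "((\<lambda>s. \<psi> 1 (0, s)) has_real_derivative \<psi>t k (0, t)) (at t within {0..<T})"
      unfolding has_field_derivative_def
      by (rule has_derivative_transform[OF t', rotated]) (use tf k in \<open>simp add: test_family_def\<close>)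
    show ?thesis
      by (rule has_real_derivative_unique_within[OF dk d1 _ t', of "(t + T) / 2"]) (use t' in auto)
  qed
  have "(\<Sum>k\<in>E. integral {0..T1} (\<lambda>t. integral {0..R} (\<lambda>x. w k (x, t) * \<psi>t k (x, t) + \<phi> k (w k (x, t)) * \<psi>x k (x, t)))
    + integral {0..R} (\<lambda>x. b k x * (\<lambda>p. \<psi> k (dir k * fst p, snd p)) (x, 0))) = 0"
    by (rule star.lim_weak_solution[OF w R T1 _ td, where q = "\<lambda>t. \<psi>t 1 (0, t)"]) (use T1T coupling in auto)
  moreover have "(LINT t|lebesgue_on {0<..<T}. LINT x|lebesgue_on (edge k).
      w k (dir k * fst (x, t), snd (x, t)) * deriv (\<lambda>s. \<psi> k (x, s)) t
      + f k (w k (dir k * fst (x, t), snd (x, t))) * deriv (\<lambda>y. \<psi> k (y, t)) x)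
    = integral {0..T1} (\<lambda>t. integral {0..R} (\<lambda>x. w k (x, t) * \<psi>t k (x, t) + \<phi> k (w k (x, t)) * \<psi>x k (x, t)))"
    "(LINT x|lebesgue_on (edge k). ubar k x * \<psi> k (x, 0)) = integral {0..R} (\<lambda>x. b k x * \<psi> k (dir k * x, 0))"
    if k: "k \<in> E" for k
  proof -
    have v0: "\<psi> k (x, 0) = 0" if "x \<in> edge k" "R \<le> \<bar>x\<bar>" for x
      using van[OF k _ _ disjI1[OF that(2)], of 0] that(1) closure_subset T0 by auto
    have dt: "deriv (\<lambda>s. \<psi> k (x, s)) t = \<psi>t k (dir k * x, t)"
      and dx: "deriv (\<lambda>y. \<psi> k (y, t)) x = dir k * \<psi>x k (dir k * x, t)"
      if "x \<in> edge k" "t \<in> {0<..<T}" for x t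
      using good[OF k] that unfolding good_def by blast+
    have off: "\<psi>t k p = 0 \<and> \<psi>x k p = 0" if "p \<notin> {0..R} \<times> {0..T1}" for p
      using good[OF k] that unfolding good_def by blast
    note e = edge_weak_terms[OF k wm[OF k] R T1 T1T v0 td[OF k] dt dx off]
    show "(LINT t|lebesgue_on {0<..<T}. LINT x|lebesgue_on (edge k).
      w k (dir k * fst (x, t), snd (x, t)) * deriv (\<lambda>s. \<psi> k (x, s)) t
      + f k (w k (dir k * fst (x, t), snd (x, t))) * deriv (\<lambda>y. \<psi> k (y, t)) x)
    = integral {0..T1} (\<lambda>t. integral {0..R} (\<lambda>x. w k (x, t) * \<psi>t k (x, t) + \<phi> k (w k (x, t)) * \<psi>x k (x, t)))"
      using e(1) by simp
    show "(LINT x|lebesgue_on (edge k). ubar k x * \<psi> k (x, 0)) = integral {0..R} (\<lambda>x. b k x * \<psi> k (dir k * x, 0))"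
      by (rule e(2))
  qed
  ultimately show "(\<Sum>k\<in>E. LINT t|lebesgue_on {0<..<T}. LINT x|lebesgue_on (edge k).
      w k (dir k * fst (x, t), snd (x, t)) * deriv (\<lambda>s. \<psi> k (x, s)) t
      + f k (w k (dir k * fst (x, t), snd (x, t))) * deriv (\<lambda>y. \<psi> k (y, t)) x)
    + (\<Sum>k\<in>E. LINT x|lebesgue_on (edge k). ubar k x * \<psi> k (x, 0)) = 0"
    by (simp add: sum.distrib)
qed

lemma upwind_convergence:
  "\<exists>u. weak_solution Nin Nout f T ubar u \<and>
    converges_C_L1loc Nin Nout T (\<lambda>dt. fv_solution Nin Nout F ubar (c 0) dt (dt / \<mu>)) u"
proof -
  have "\<forall>k\<in>E. \<exists>w. star.lim_of k w" using star.lim_exists by blast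
  then obtain w where w: "\<And>k. k \<in> E \<Longrightarrow> star.lim_of k (w k)" by metis
  show ?thesis using limit_is_weak_solution[OF w] convergence[OF w] by blast
qed

end

theorem theorem5p3:
  fixes Nin Nout :: nat and T \<mu> :: real
    and f :: "int \<Rightarrow> real \<Rightarrow> real" and G :: "(int \<Rightarrow> real) set"
    and ubar :: "int \<Rightarrow> real \<Rightarrow> real" and c d :: "int \<Rightarrow> real"
  assumes "Nin \<ge> 1" and "Nout \<ge> 1" and "T > 0"
    and "\<And>k. k \<in> edges Nin Nout \<Longrightarrow> local_lipschitz (UNIV :: real set) UNIV (\<lambda>_. f k)"
    and "\<And>k. k \<in> edges Nin Nout \<Longrightarrow> strict_mono (f k) \<or> strict_antimono_on UNIV (f k)"
    and "\<And>e. e \<in> G \<Longrightarrow> discrete_stationary Nin Nout f (upwind_flux f) e"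
    and "ubar \<in> Linf_oco Nin Nout G"
    and "L1_network Nin Nout ubar"
    and "TV_network Nin Nout ubar < \<infinity>"
    and "init_bounds Nin Nout f (upwind_flux f) G ubar c d"
    and "\<mu> > 0" and "CFL Nin Nout (upwind_flux f) c d \<mu>"
  shows "\<exists>u. weak_solution Nin Nout f T ubar u \<and>
    converges_C_L1loc Nin Nout T
      (\<lambda>dt. fv_solution Nin Nout (upwind_flux f) ubar (c 0) dt (dt / \<mu>)) u"
proof -
  let ?E = "edges Nin Nout"
  obtain c' d' where oco: "oco_bounds Nin Nout G ubar c' d'" "\<And>k. k \<in> ?E \<Longrightarrow> c k = c' k \<and> d k = d' k"
    and st: "discrete_stationary Nin Nout f (upwind_flux f) c" "discrete_stationary Nin Nout f (upwind_flux f) d"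
    and c0d0: "c 0 \<le> d 0"
    using assms(10) unfolding init_bounds_def by blast
  have bounds: "c k \<le> d k" "AE x in lebesgue_on (edge k). c k \<le> ubar k x \<and> ubar k x \<le> d k" if "k \<in> ?E" for k
    using oco that unfolding oco_bounds_def by auto
  have meas: "ubar k \<in> borel_measurable (lebesgue_on (edge k))" if "k \<in> ?E" for k
    using assms(7) that unfolding Linf_oco_def Linf_network_def by blast
  have TV: "total_variation (edge k) (ubar k) < \<infinity>" if "k \<in> ?E" for k
  proof -
    have "total_variation (edge k) (ubar k) \<le> TV_network Nin Nout ubar"
      unfolding TV_network_def by (rule member_le_sum) (use that edges_card in auto)
    then show ?thesis using assms(9) by (rule le_less_trans)
  qed
  define good where "good = (\<lambda>k b V. b \<in> borel_measurable borel \<and> (\<forall>x. b x \<in> {c k..d k}) \<and>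
      (AE x in lborel. x \<in> edge k \<longrightarrow> ubar k x = b (dir k * x)) \<and>
      (\<forall>h J. h > 0 \<longrightarrow> (\<Sum>l<J. \<bar>integral {(real l + 3/2) * h..(real l + 5/2) * h} b
        - integral {(real l + 1/2) * h..(real l + 3/2) * h} b\<bar>) \<le> h * V))"
  have "\<exists>b V. good k b V" if k: "k \<in> ?E" for k
  proof -
    have "\<exists>b. b \<in> borel_measurable borel \<and> (\<forall>x. b x \<in> {c k..d k}) \<and>
        (AE x in lborel. x \<in> edge k \<longrightarrow> ubar k x = b (dir k * x))"
      by (rule borel_representative[OF meas[OF k] bounds(2)[OF k] bounds(1)[OF k]]) blast
    then obtain b where b: "b \<in> borel_measurable borel" "\<forall>x. b x \<in> {c k..d k}"
      "AE x in lborel. x \<in> edge k \<longrightarrow> ubar k x = b (dir k * x)" by blast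
    have bb: "\<bar>b x\<bar> \<le> \<bar>c k\<bar> + \<bar>d k\<bar>" for x using b(2)[rule_format, of x] by auto
    have "\<exists>V. \<forall>h J. h > 0 \<longrightarrow> (\<Sum>l<J. \<bar>integral {(real l + 3/2) * h..(real l + 5/2) * h} b
        - integral {(real l + 1/2) * h..(real l + 3/2) * h} b\<bar>) \<le> h * V"
      by (rule variation_cell_averages[OF b(1) bb b(3) TV[OF k]]) blast
    with b show ?thesis unfolding good_def by blast
  qed
  then obtain b V where "\<And>k. k \<in> ?E \<Longrightarrow> good k (b k) (V k)" by metis
  note bV = this[unfolded good_def]
  have Vmax: "V k \<le> Max (V ` ?E)" if "k \<in> ?E" for k using that edges_card by simp
  obtain L where L: "\<mu> * L \<le> 1 / 2" "\<And>k. k \<in> ?E \<Longrightarrow> let S = {min (c k) (c 0)..max (d k) (d 0)} in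
      (\<forall>v\<in>S. L-lipschitz_on S (\<lambda>u. upwind_flux f k u v)) \<and> (\<forall>u\<in>S. L-lipschitz_on S (\<lambda>v. upwind_flux f k u v))"
    using assms(12) unfolding CFL_def by blast
  interpret upwind_network Nin Nout T \<mu> L "Max (V ` ?E)" f ubar c d b
  proof
    fix k h J assume k: "k \<in> ?E" and h: "(0::real) < h"
    have "(\<Sum>l<J. \<bar>integral {(real l + 3/2) * h..(real l + 5/2) * h} (b k)
        - integral {(real l + 1/2) * h..(real l + 3/2) * h} (b k)\<bar>) \<le> h * V k"
      using bV[OF k] h by blast
    also have "\<dots> \<le> h * Max (V ` ?E)" using Vmax[OF k] h by simp
    finally show "(\<Sum>l<J. \<bar>integral {(real l + 3/2) * h..(real l + 5/2) * h} (b k)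
        - integral {(real l + 1/2) * h..(real l + 3/2) * h} (b k)\<bar>) \<le> h * Max (V ` ?E)" .
  qed (use assms(1-3,5,11) st c0d0 bounds L meas bV in blast)+
  show ?thesis by (rule upwind_convergence)
qed

end
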